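(* Let $n\in\mathbb{N}$, $n\ge 1$, $s\in(0,1)$, $\beta>0$ and let $\Omega\subset\mathbb{R}^n$ be an open set. Let $\Lambda\ge\lambda>0$, $M>0$, $\Gamma>0$ be constants and let $K:\mathbb{R}^n\times\mathbb{R}^n\to[0,+\infty]$ be a measurable function such that (i) $K(x,y)=K(y,x)$ for a.a. $x,y\in\mathbb{R}^n$; (ii) $\lambda\le|x-y|^{n+2s}K(x,y)\le\Lambda$ for a.a. $x,y\in\mathbb{R}^n$ with $|x-y|<1$, and $0\le|x-y|^{n+\beta}K(x,y)\le M$ for a.a. $x,y\in\mathbb{R}^n$ with $|x-y|\ge1$; (iii) $|x-y|^{n+2s}\,|K(x+z,y+z)-K(x,y)|\le\Gamma|z|^s$ for a.a. $x,y,z\in\mathbb{R}^n$ with $|x-y|<1$ and $|z|<1$. Let $f\in L^2(\Omega)$ and let $u\in X(\Omega)\cap L^1_\beta(\mathbb{R}^n)$ be a solution of $\mathcal{E}_K(u,\cdot)=f$ in $\Omega$. Then $u\in H^{2s-\varepsilon}_{\mathrm{loc}}(\Omega)$ for every $\varepsilon\in(0,2s)$ and, for any domain $\Omega'\subset\subset\Omega$, $$\|u\|_{H^{2s-\varepsilon}(\Omega')}\le C\left(\|u\|_{L^2(\Omega)}+\|u\|_{L^1_\beta(\mathbb{R}^n)}+\|f\|_{L^2(\Omega)}\right),$$ for some constant $C>0$ depending only on $n,s,\beta,\lambda,\Lambda,M,\Gamma,\Omega,\Omega'$ and $\varepsilon$.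
   Context: Function spaces attached to $K$. For an open set $U\subset\mathbb{R}^n$, let $\mathscr{C}_U:=(\mathbb{R}^n\times\mathbb{R}^n)\setminus\big((\mathbb{R}^n\setminus U)\times(\mathbb{R}^n\setminus U)\big)$. $X(U)$ is the space of measurable functions $u:\mathbb{R}^n\to\mathbb{R}$ such that $u|_U\in L^2(U)$ and the map $(x,y)\mapsto(u(x)-u(y))\sqrt{K(x,y)}$ belongs to $L^2(\mathscr{C}_U)$. $X_0(U)$ is the subspace of functions in $X(U)$ that vanish a.e. outside $U$. Bilinear form and solutions. For $u\in X(\Omega)$ and $\varphi\in X_0(\Omega)$, $$\mathcal{E}_K(u,\varphi):=\int_{\mathbb{R}^n}\int_{\mathbb{R}^n}(u(x)-u(y))(\varphi(x)-\varphi(y))K(x,y)\,dx\,dy.$$ Given $f\in L^2(\Omega)$, a function $u\in X(\Omega)$ is a solution of $\mathcal{E}_K(u,\cdot)=f$ in $\Omega$ if $\mathcal{E}_K(u,\varphi)=\langle f,\varphi\rangle_{L^2(\Omega)}$ for every $\varphi\in X_0(\Omega)$. Weighted space. $L^1_\beta(\mathbb{R}^n)$ is the space of measurable $u:\mathbb{R}^n\to\mathbb{R}$ with $\|u\|_{L^1_\beta(\mathbb{R}^n)}:=\int_{\mathbb{R}^n}\frac{|u(x)|}{1+|x|^{n+\beta}}\,dx<+\infty$. Sobolev spaces. $H^r(U):=W^{r,2}(U)$. For $r=k+\sigma>0$ with $k\in\mathbb{N}\cup\{0\}$ and $\sigma\in(0,1)$, it is the space of $u\in W^{k,2}(U)$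 (with $W^{0,2}=L^2$) such that $[D^\alpha u]_{H^\sigma(U)}<+\infty$ for all multi-indices $|\alpha|=k$, where $[v]_{H^\sigma(U)}^2:=\int_U\int_U\frac{|v(x)-v(y)|^2}{|x-y|^{n+2\sigma}}\,dx\,dy$, with norm $\|u\|_{H^r(U)}:=\|u\|_{W^{k,2}(U)}+\sum_{|\alpha|=k}[D^\alpha u]_{H^\sigma(U)}$; for integer $r$ it is the standard Sobolev space. $u\in H^r_{\mathrm{loc}}(\Omega)$ means $u|_V\in H^r(V)$ for any domain $V\subset\subset\Omega$. $V\subset\subset\Omega$ means that the closure of $V$ is compact and contained in $\Omega$. *)

theory Defs
  imports "HOL-Analysis.Analysis"
begin

text \<open>Throughout, "measurable" means Lebesgue measurable, and the elements of function spaces over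
  a set \<open>U\<close> are total functions of which only the values on \<open>U\<close> matter.\<close>

subsection \<open>Lebesgue spaces\<close>

definition L2 :: "'a::euclidean_space set \<Rightarrow> ('a \<Rightarrow> real) set" where
  "L2 U = {g. g \<in> borel_measurable (lebesgue_on U) \<and> integrable (lebesgue_on U) (\<lambda>x. (g x)\<^sup>2)}"

definition L2_norm :: "'a::euclidean_space set \<Rightarrow> ('a \<Rightarrow> real) \<Rightarrow> real" where
  "L2_norm U g = sqrt (\<integral>x. (g x)\<^sup>2 \<partial>lebesgue_on U)"

definition L2_inner :: "'a::euclidean_space set \<Rightarrow> ('a \<Rightarrow> real) \<Rightarrow> ('a \<Rightarrow> real) \<Rightarrow> real" where
  "L2_inner U f g = (\<integral>x. f x * g x \<partial>lebesgue_on U)"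

definition weighted_L1 :: "real \<Rightarrow> (real^'n \<Rightarrow> real) set" where
  "weighted_L1 \<beta> = {u. u \<in> borel_measurable lebesgue \<and>
     integrable lebesgue (\<lambda>x. \<bar>u x\<bar> / (1 + norm x powr (real CARD('n) + \<beta>)))}"

definition weighted_L1_norm :: "real \<Rightarrow> (real^'n \<Rightarrow> real) \<Rightarrow> real" where
  "weighted_L1_norm \<beta> u = (\<integral>x. \<bar>u x\<bar> / (1 + norm x powr (real CARD('n) + \<beta>)) \<partial>lebesgue)"

subsection \<open>Kernels, the associated function spaces and solutions\<close>

text \<open>\<open>l\<close> and \<open>L\<close> are the ellipticity constants \<open>\<lambda> \<le> \<Lambda>\<close>.  The difference in the last clause is taken in \<^typ>\<open>ereal\<close>, so that the truncated
  subtraction of \<^typ>\<open>ennreal\<close> is avoided.  The second clause makes \<open>K\<close> finite almost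
  everywhere, so the value given to \<open>\<infinity> - \<infinity>\<close> is irrelevant.\<close>

definition admissible_kernel ::
  "real \<Rightarrow> real \<Rightarrow> real \<Rightarrow> real \<Rightarrow> real \<Rightarrow> real \<Rightarrow> ((real^'n) \<times> (real^'n) \<Rightarrow> ennreal) \<Rightarrow> bool" where
  "admissible_kernel s \<beta> l L M \<Gamma> K \<longleftrightarrow>
     K \<in> borel_measurable lebesgue \<and>
     (AE (x, y) in lebesgue. K (x, y) = K (y, x)) \<and>
     (AE (x, y) in lebesgue.
        (norm (x - y) < 1 \<longrightarrow>
           ennreal l \<le> ennreal (norm (x - y) powr (real CARD('n) + 2 * s)) * K (x, y) \<and>
           ennreal (norm (x - y) powr (real CARD('n) + 2 * s)) * K (x, y) \<le> ennreal L) \<and>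
        (norm (x - y) \<ge> 1 \<longrightarrow>
           ennreal (norm (x - y) powr (real CARD('n) + \<beta>)) * K (x, y) \<le> ennreal M)) \<and>
     (AE (x, y, z) in lebesgue. norm (x - y) < 1 \<and> norm z < 1 \<longrightarrow>
        ereal (norm (x - y) powr (real CARD('n) + 2 * s)) *
          \<bar>enn2ereal (K (x + z, y + z)) - enn2ereal (K (x, y))\<bar>
        \<le> ereal (\<Gamma> * norm z powr s))"

definition cross_region :: "'a set \<Rightarrow> ('a \<times> 'a) set" where
  "cross_region U = (UNIV \<times> UNIV) - ((UNIV - U) \<times> (UNIV - U))"

text \<open>The integral below is the squared \<open>L\<^sup>2\<close> norm of \<open>(u(x) - u(y)) K(x,y)\<^sup>1\<^sup>/\<^sup>2\<close>, computed in
  \<open>[0, \<infinity>]\<close> because \<open>K\<close> may take the value \<open>\<infinity>\<close>.\<close>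

definition X_space :: "((real^'n) \<times> (real^'n) \<Rightarrow> ennreal) \<Rightarrow> (real^'n) set \<Rightarrow> (real^'n \<Rightarrow> real) set" where
  "X_space K U = {u. u \<in> borel_measurable lebesgue \<and> u \<in> L2 U \<and>
     (\<integral>\<^sup>+(x, y)\<in>cross_region U. ennreal ((u x - u y)\<^sup>2) * K (x, y) \<partial>lebesgue) < \<infinity>}"

definition X0_space :: "((real^'n) \<times> (real^'n) \<Rightarrow> ennreal) \<Rightarrow> (real^'n) set \<Rightarrow> (real^'n \<Rightarrow> real) set" where
  "X0_space K U = {u \<in> X_space K U. AE x in lebesgue. x \<notin> U \<longrightarrow> u x = 0}"

text \<open>For \<open>u\<close> in \<^const>\<open>X_space\<close> and \<open>\<phi>\<close> in \<^const>\<open>X0_space\<close> the integrand is absolutely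
  integrable, so the integral over the product space agrees with the iterated one; it also vanishes
  almost everywhere on \<open>K = \<infinity>\<close>, where \<^const>\<open>enn2real\<close> replaces \<open>\<infinity>\<close> by \<open>0\<close>.\<close>

definition energy ::
  "((real^'n) \<times> (real^'n) \<Rightarrow> ennreal) \<Rightarrow> (real^'n \<Rightarrow> real) \<Rightarrow> (real^'n \<Rightarrow> real) \<Rightarrow> real" where
  "energy K u \<phi> = (\<integral>(x, y). (u x - u y) * (\<phi> x - \<phi> y) * enn2real (K (x, y)) \<partial>lebesgue)"

definition is_solution ::
  "((real^'n) \<times> (real^'n) \<Rightarrow> ennreal) \<Rightarrow> (real^'n) set \<Rightarrow> (real^'n \<Rightarrow> real) \<Rightarrow> (real^'n \<Rightarrow> real) \<Rightarrow> bool" where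
  "is_solution K \<Omega> f u \<longleftrightarrow> u \<in> X_space K \<Omega> \<and> (\<forall>\<phi>\<in>X0_space K \<Omega>. energy K u \<phi> = L2_inner \<Omega> f \<phi>)"

subsection \<open>Weak derivatives\<close>

definition partial_deriv :: "'n \<Rightarrow> (real^'n \<Rightarrow> real) \<Rightarrow> real^'n \<Rightarrow> real" where
  "partial_deriv i \<phi> x = frechet_derivative \<phi> (at x) (axis i 1)"

text \<open>\<open>C\<^sub>c\<^sup>\<infinity>(U)\<close>: differentiability of all iterated partial derivatives makes them all continuous.\<close>

definition test_functions :: "(real^'n) set \<Rightarrow> (real^'n \<Rightarrow> real) set" where
  "test_functions U = {\<phi>. (\<forall>is x. fold partial_deriv is \<phi> differentiable (at x)) \<and>
     compact (closure {x. \<phi> x \<noteq> 0}) \<and> closure {x. \<phi> x \<noteq> 0} \<subseteq> U}"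

text \<open>Multi-indices are functions \<open>\<alpha> :: 'n \<Rightarrow> nat\<close>.  Derivatives are taken along a fixed but
  arbitrary enumeration of the coordinates; on smooth functions the order does not matter.\<close>

definition multi_order :: "('n::finite \<Rightarrow> nat) \<Rightarrow> nat" where
  "multi_order \<alpha> = (\<Sum>i\<in>UNIV. \<alpha> i)"

definition multi_deriv :: "('n \<Rightarrow> nat) \<Rightarrow> (real^'n \<Rightarrow> real) \<Rightarrow> real^'n \<Rightarrow> real" where
  "multi_deriv \<alpha> \<phi> =
     fold (\<lambda>i. partial_deriv i ^^ \<alpha> i) (SOME is. distinct is \<and> set is = UNIV) \<phi>"

definition has_weak_deriv ::
  "(real^'n) set \<Rightarrow> ('n \<Rightarrow> nat) \<Rightarrow> (real^'n \<Rightarrow> real) \<Rightarrow> (real^'n \<Rightarrow> real) \<Rightarrow> bool" where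
  "has_weak_deriv U \<alpha> u v \<longleftrightarrow>
     (\<forall>C. compact C \<and> C \<subseteq> U \<longrightarrow> set_integrable lebesgue C u \<and> set_integrable lebesgue C v) \<and>
     (\<forall>\<phi>\<in>test_functions U.
        (\<integral>x. u x * multi_deriv \<alpha> \<phi> x \<partial>lebesgue_on U) =
        (-1) ^ multi_order \<alpha> * (\<integral>x. v x * \<phi> x \<partial>lebesgue_on U))"

text \<open>A weak derivative on an open set is unique up to null sets, so the choice is immaterial.\<close>

definition weak_deriv ::
  "(real^'n) set \<Rightarrow> ('n \<Rightarrow> nat) \<Rightarrow> (real^'n \<Rightarrow> real) \<Rightarrow> real^'n \<Rightarrow> real" where
  "weak_deriv U \<alpha> u = (SOME v. has_weak_deriv U \<alpha> u v)"

subsection \<open>Sobolev spaces\<close>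

definition W2 :: "nat \<Rightarrow> (real^'n) set \<Rightarrow> (real^'n \<Rightarrow> real) set" where
  "W2 k U = {u \<in> L2 U. \<forall>\<alpha>. multi_order \<alpha> \<le> k \<longrightarrow>
     (\<exists>v. has_weak_deriv U \<alpha> u v) \<and> weak_deriv U \<alpha> u \<in> L2 U}"

definition W2_norm :: "nat \<Rightarrow> (real^'n) set \<Rightarrow> (real^'n \<Rightarrow> real) \<Rightarrow> real" where
  "W2_norm k U u = sqrt (\<Sum>\<alpha> | multi_order \<alpha> \<le> k. (L2_norm U (weak_deriv U \<alpha> u))\<^sup>2)"

definition gagliardo_integrand :: "real \<Rightarrow> (real^'n \<Rightarrow> real) \<Rightarrow> (real^'n) \<times> (real^'n) \<Rightarrow> real" where
  "gagliardo_integrand \<sigma> v = (\<lambda>(x, y). \<bar>v x - v y\<bar>\<^sup>2 / norm (x - y) powr (real CARD('n) + 2 * \<sigma>))"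

definition gagliardo_finite :: "real \<Rightarrow> (real^'n) set \<Rightarrow> (real^'n \<Rightarrow> real) \<Rightarrow> bool" where
  "gagliardo_finite \<sigma> U v \<longleftrightarrow> integrable (lebesgue_on (U \<times> U)) (gagliardo_integrand \<sigma> v)"

definition gagliardo_seminorm :: "real \<Rightarrow> (real^'n) set \<Rightarrow> (real^'n \<Rightarrow> real) \<Rightarrow> real" where
  "gagliardo_seminorm \<sigma> U v = sqrt (\<integral>p. gagliardo_integrand \<sigma> v p \<partial>lebesgue_on (U \<times> U))"

text \<open>\<open>H\<^sup>r(U)\<close> for \<open>r > 0\<close>, with \<open>r = k + \<sigma>\<close>, \<open>k = \<lfloor>r\<rfloor>\<close> and \<open>\<sigma> = frac r\<close>.\<close>

definition H_space :: "real \<Rightarrow> (real^'n) set \<Rightarrow> (real^'n \<Rightarrow> real) set" where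
  "H_space r U = (let k = nat \<lfloor>r\<rfloor>; \<sigma> = frac r in
     if \<sigma> = 0 then W2 k U
     else {u \<in> W2 k U. \<forall>\<alpha>. multi_order \<alpha> = k \<longrightarrow> gagliardo_finite \<sigma> U (weak_deriv U \<alpha> u)})"

definition H_norm :: "real \<Rightarrow> (real^'n) set \<Rightarrow> (real^'n \<Rightarrow> real) \<Rightarrow> real" where
  "H_norm r U u = (let k = nat \<lfloor>r\<rfloor>; \<sigma> = frac r in
     if \<sigma> = 0 then W2_norm k U u
     else W2_norm k U u + (\<Sum>\<alpha> | multi_order \<alpha> = k. gagliardo_seminorm \<sigma> U (weak_deriv U \<alpha> u)))"

lemma finite_multi_order_le: "finite {\<alpha> :: 'n::finite \<Rightarrow> nat. multi_order \<alpha> \<le> k}"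
proof (rule finite_subset)
  show "{\<alpha> :: 'n \<Rightarrow> nat. multi_order \<alpha> \<le> k} \<subseteq> (\<Pi>\<^sub>E i\<in>UNIV. {..k})"
  proof
    fix \<alpha> :: "'n \<Rightarrow> nat"
    assume "\<alpha> \<in> {\<alpha>. multi_order \<alpha> \<le> k}"
    then have "sum \<alpha> UNIV \<le> k"
      by (simp add: multi_order_def)
    moreover have "\<alpha> i \<le> sum \<alpha> UNIV" for i
      by (rule member_le_sum) simp_all
    ultimately have "\<alpha> i \<le> k" for i
      using le_trans by blast
    then show "\<alpha> \<in> (\<Pi>\<^sub>E i\<in>UNIV. {..k})"
      by (simp add: PiE_UNIV_domain)
  qed
  show "finite (\<Pi>\<^sub>E i\<in>(UNIV::'n set). {..k})"
    by (rule finite_PiE) simp_all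
qed

definition subdomain :: "'a::topological_space set \<Rightarrow> 'a set \<Rightarrow> bool" where
  "subdomain V \<Omega> \<longleftrightarrow> open V \<and> connected V \<and> V \<noteq> {} \<and> compact (closure V) \<and> closure V \<subseteq> \<Omega>"

definition H_loc :: "real \<Rightarrow> (real^'n) set \<Rightarrow> (real^'n \<Rightarrow> real) set" where
  "H_loc r \<Omega> = {u. \<forall>V. subdomain V \<Omega> \<longrightarrow> u \<in> H_space r V}"

end

theory Submission imports Defs begin

text \<open>
  The part of the form with \<open>|x - y| \<ge> d\<close> acts on compactly supported test functions as an \<open>L\<^sup>2\<close>
  right-hand side, so only the kernel near the diagonal matters and \<open>u\<close> may be multiplied by a cutoff.
  Testing with \<open>\<eta>\<^sup>2 u\<close> bounds the local \<open>H\<^sup>s\<close> energy of \<open>u\<close>.  Testing with a difference of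
  \<open>\<eta>\<^sup>2 \<Delta>\<^sub>h u\<close>, where \<open>\<Delta>\<^sub>h u = u(\<cdot> + h) - u\<close>, bounds the \<open>H\<^sup>s\<close> energy of \<open>\<Delta>\<^sub>h u\<close> by \<open>|h|\<^sup>2\<^sup>s\<close>: the translated
  kernel and the \<open>L\<^sup>2\<close> norm of the test function are both of order \<open>|h|\<^sup>s\<close>.  Hence
  \<open>\<parallel>\<Delta>\<^sub>k \<Delta>\<^sub>h u\<parallel> \<le> C |k|\<^sup>s |h|\<^sup>s\<close> locally in \<open>L\<^sup>2\<close>.  For orders below one, halving arguments turn this into a bound on
  \<open>\<Delta>\<^sub>h u\<close>.  If \<open>2 s > 1\<close>, the difference quotients with dyadic increments converge geometrically in \<open>L\<^sup>2\<close> to the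
  weak derivatives, whose differences are of order \<open>|k|\<^sup>2\<^sup>s\<^sup>-\<^sup>1\<close>.
\<close>

subsection \<open>Square-integrable functions\<close>

text \<open>Truncating the kernel at increments shorter than \<open>d\<close> makes the form local
  up to distance \<open>d\<close>: it sees \<open>u\<close> only within \<open>d\<close> of the
  support of the test function. That is why a cutoff of \<open>u\<close> may replace
  \<open>u\<close>, and why the argument consumes a fixed number of layers of width \<open>d\<close>
  around the subdomain. Three obstacles shape the rest. The translation bound on the kernel holds
  for almost every shift only, so an arbitrary shift is split into two at which it holds. The
  hypotheses concern Lebesgue measurable \<open>K\<close> and \<open>u\<close>, while Fubini and
  translation invariance are wanted for product measures; Borel representatives are therefore fixed
  early and the results are carried back at the end. A bound |k|^\<tau> on differences in the mean
  yields a finite Gagliardo integral only for orders strictly below \<tau>; this is where \<epsilon>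
  is spent. Constants must not depend on \<open>K\<close>, \<open>f\<close> or \<open>u\<close>, so
  they are obtained before these are fixed, and one number \<open>A\<close> dominates both the norm
  of \<open>u\<close> and its form, which keeps every estimate homogeneous.\<close>

definition sqint :: "'a measure \<Rightarrow> ('a \<Rightarrow> real) \<Rightarrow> bool" where
  "sqint M f \<longleftrightarrow> f \<in> borel_measurable M \<and> integrable M (\<lambda>x. (f x)\<^sup>2)"

text \<open>The Bochner integral of a non-integrable function is 0, so a bound on \<open>l2\<close>
  alone says nothing; results therefore come in pairs, \<open>sqint\<close> together with the
  bound.\<close>

definition l2 :: "'a measure \<Rightarrow> ('a \<Rightarrow> real) \<Rightarrow> real" where
  "l2 M f = sqrt (\<integral>x. (f x)\<^sup>2 \<partial>M)"

lemma l2_nonneg [simp]: "0 \<le> l2 M f"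
  by (simp add: l2_def)

lemma l2_square: "(l2 M f)\<^sup>2 = (\<integral>x. (f x)\<^sup>2 \<partial>M)"
  by (simp add: l2_def)

lemma sqint_measurable [measurable_dest]: "sqint M f \<Longrightarrow> f \<in> borel_measurable M"
  by (simp add: sqint_def)

lemma nn_integral_square:
  assumes "sqint M f"
  shows "(\<integral>\<^sup>+x. ennreal ((f x)\<^sup>2) \<partial>M) = ennreal ((l2 M f)\<^sup>2)"
  using assms by (simp add: sqint_def l2_square nn_integral_eq_integral)

lemma sqintI:
  assumes "f \<in> borel_measurable M" "(\<integral>\<^sup>+x. ennreal ((f x)\<^sup>2) \<partial>M) < \<infinity>"
  shows "sqint M f"
  using assms by (auto simp: sqint_def integrable_iff_bounded)

text \<open>Estimates are made with the nonnegative integral, which asks for no integrability in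
  advance; a finite bound there yields membership and norm at once.\<close>

lemma l2_leI:
  assumes "f \<in> borel_measurable M" "(\<integral>\<^sup>+x. ennreal ((f x)\<^sup>2) \<partial>M) \<le> ennreal (c\<^sup>2)" "0 \<le> c"
  shows "sqint M f" "l2 M f \<le> c"
proof -
  show *: "sqint M f"
    using assms(2) ennreal_less_top le_less_trans by (intro sqintI assms(1)) fastforce
  show "l2 M f \<le> c"
    using assms(2,3) nn_integral_square[OF *] by (auto simp: ennreal_le_iff power2_le_iff_abs_le)
qed

lemma l2_mono_AE:
  assumes "sqint M g" "f \<in> borel_measurable M" "AE x in M. \<bar>f x\<bar> \<le> c * \<bar>g x\<bar>" "0 \<le> c"
  shows "sqint M f" "l2 M f \<le> c * l2 M g"
proof -
  have "(\<integral>\<^sup>+x. ennreal ((f x)\<^sup>2) \<partial>M) \<le> (\<integral>\<^sup>+x. ennreal (c\<^sup>2) * ennreal ((g x)\<^sup>2) \<partial>M)"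
  proof (rule nn_integral_mono_AE, use assms(3) in eventually_elim)
    fix x assume "\<bar>f x\<bar> \<le> c * \<bar>g x\<bar>"
    then have "(f x)\<^sup>2 \<le> (c * g x)\<^sup>2"
      using assms(4) by (simp add: abs_le_square_iff[symmetric] abs_mult)
    then show "ennreal ((f x)\<^sup>2) \<le> ennreal (c\<^sup>2) * ennreal ((g x)\<^sup>2)"
      by (simp add: power_mult_distrib ennreal_mult[symmetric] ennreal_leI)
  qed
  also have "\<dots> = ennreal ((c * l2 M g)\<^sup>2)"
    using assms(1) by (subst nn_integral_cmult) (auto simp: nn_integral_square power_mult_distrib ennreal_mult sqint_def)
  finally have *: "(\<integral>\<^sup>+x. ennreal ((f x)\<^sup>2) \<partial>M) \<le> ennreal ((c * l2 M g)\<^sup>2)" .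
  show "sqint M f" "l2 M f \<le> c * l2 M g"
    using l2_leI[OF assms(2) *] assms(4) by auto
qed

lemma l2_mono:
  assumes "sqint M g" "f \<in> borel_measurable M" "\<And>x. x \<in> space M \<Longrightarrow> \<bar>f x\<bar> \<le> c * \<bar>g x\<bar>" "0 \<le> c"
  shows "sqint M f" "l2 M f \<le> c * l2 M g"
  using l2_mono_AE[of M g f c] assms by auto

lemma l2_cong_AE:
  assumes "AE x in M. f x = g x" "f \<in> borel_measurable M" "g \<in> borel_measurable M"
  shows "l2 M f = l2 M g" "sqint M f \<longleftrightarrow> sqint M g"
proof -
  show "l2 M f = l2 M g"
    unfolding l2_def using assms by (intro arg_cong[where f=sqrt] integral_cong_AE) auto
  have "integrable M (\<lambda>x. (f x)\<^sup>2) \<longleftrightarrow> integrable M (\<lambda>x. (g x)\<^sup>2)"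
    using assms by (intro integrable_cong_AE) auto
  then show "sqint M f \<longleftrightarrow> sqint M g" using assms by (simp add: sqint_def)
qed

lemma sqint_cmult [intro]: "sqint M f \<Longrightarrow> sqint M (\<lambda>x. c * f x)"
  by (auto simp: sqint_def power_mult_distrib)

lemma l2_cmult [simp]: "l2 M (\<lambda>x. c * f x) = \<bar>c\<bar> * l2 M f"
  by (simp add: l2_def power_mult_distrib real_sqrt_mult)

lemma sqint_uminus [simp]: "sqint M (\<lambda>x. - f x) \<longleftrightarrow> sqint M f"
  by (simp add: sqint_def)

lemma l2_uminus [simp]: "l2 M (\<lambda>x. - f x) = l2 M f"
  by (simp add: l2_def)

lemma sqint_mult_integrable:
  assumes "sqint M f" "sqint M g"
  shows "integrable M (\<lambda>x. f x * g x)"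
proof (rule Bochner_Integration.integrable_bound)
  show "integrable M (\<lambda>x. (f x)\<^sup>2 + (g x)\<^sup>2)"
    using assms by (simp add: sqint_def)
  show "(\<lambda>x. f x * g x) \<in> borel_measurable M"
    using assms by (intro borel_measurable_times) (simp_all add: sqint_def)
  have "\<bar>a * b\<bar> \<le> a\<^sup>2 + b\<^sup>2" for a b :: real
  proof -
    have "2 * (\<bar>a\<bar> * \<bar>b\<bar>) \<le> a\<^sup>2 + b\<^sup>2"
      using sum_squares_bound[of "\<bar>a\<bar>" "\<bar>b\<bar>"] by simp
    moreover have "0 \<le> \<bar>a\<bar> * \<bar>b\<bar>" by simp
    ultimately show ?thesis unfolding abs_mult by linarith
  qed
  then show "AE x in M. norm (f x * g x) \<le> norm ((f x)\<^sup>2 + (g x)\<^sup>2)"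
    by auto
qed

lemma Cauchy_Schwarz_l2:
  assumes "sqint M f" "sqint M g"
  shows "(\<integral>x. \<bar>f x * g x\<bar> \<partial>M) \<le> l2 M f * l2 M g" "\<bar>\<integral>x. f x * g x \<partial>M\<bar> \<le> l2 M f * l2 M g"
proof -
  have [measurable]: "f \<in> borel_measurable M" "g \<in> borel_measurable M"
    using assms by (auto simp: sqint_def)
  have int: "integrable M (\<lambda>x. f x * g x)" by (rule sqint_mult_integrable) fact+
  have "(\<integral>\<^sup>+x. ennreal \<bar>f x * g x\<bar> \<partial>M)\<^sup>2 \<le> (\<integral>\<^sup>+x. (ennreal \<bar>f x\<bar>)\<^sup>2 \<partial>M) * (\<integral>\<^sup>+x. (ennreal \<bar>g x\<bar>)\<^sup>2 \<partial>M)"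
    unfolding abs_mult ennreal_mult[OF abs_ge_zero abs_ge_zero]
    by (rule Cauchy_Schwarz_nn_integral) auto
  also have "\<dots> = ennreal ((l2 M f * l2 M g)\<^sup>2)"
    using assms by (simp add: ennreal_power nn_integral_square ennreal_mult power_mult_distrib)
  finally have "ennreal ((\<integral>x. \<bar>f x * g x\<bar> \<partial>M)\<^sup>2) \<le> ennreal ((l2 M f * l2 M g)\<^sup>2)"
    using int by (subst (asm) nn_integral_eq_integral) (auto simp: ennreal_power)
  then have "(\<integral>x. \<bar>f x * g x\<bar> \<partial>M)\<^sup>2 \<le> (l2 M f * l2 M g)\<^sup>2" by (simp add: ennreal_le_iff)
  then show *: "(\<integral>x. \<bar>f x * g x\<bar> \<partial>M) \<le> l2 M f * l2 M g"
    by (rule power2_le_imp_le) simp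
  show "\<bar>\<integral>x. f x * g x \<partial>M\<bar> \<le> l2 M f * l2 M g"
    using integral_abs_bound[of M "\<lambda>x. f x * g x"] * by linarith
qed

lemma sqint_add:
  assumes "sqint M f" "sqint M g"
  shows "sqint M (\<lambda>x. f x + g x)" "l2 M (\<lambda>x. f x + g x) \<le> l2 M f + l2 M g"
proof -
  have eq: "(f x + g x)\<^sup>2 = (f x)\<^sup>2 + (g x)\<^sup>2 + 2 * (f x * g x)" for x
    by (simp add: power2_sum)
  note int = sqint_mult_integrable[OF assms]
  show *: "sqint M (\<lambda>x. f x + g x)"
    using assms int by (auto simp: sqint_def eq)
  have "(l2 M (\<lambda>x. f x + g x))\<^sup>2 = (l2 M f)\<^sup>2 + (l2 M g)\<^sup>2 + 2 * (\<integral>x. f x * g x \<partial>M)"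
    using assms int by (simp add: l2_square eq sqint_def)
  also have "\<dots> \<le> (l2 M f + l2 M g)\<^sup>2"
    using Cauchy_Schwarz_l2(2)[OF assms] by (simp add: power2_sum)
  finally show "l2 M (\<lambda>x. f x + g x) \<le> l2 M f + l2 M g"
    by (rule power2_le_imp_le) (simp add: add_nonneg_nonneg)
qed

lemma sqint_diff:
  assumes "sqint M f" "sqint M g"
  shows "sqint M (\<lambda>x. f x - g x)" "l2 M (\<lambda>x. f x - g x) \<le> l2 M f + l2 M g"
  using sqint_add[of M f "\<lambda>x. - g x"] assms by auto

lemma sqint_zero [simp]: "sqint M (\<lambda>x. 0)" "l2 M (\<lambda>x. 0) = 0"
  by (auto simp: sqint_def l2_def)

lemma sqint_bounded_mult:
  assumes "sqint M f" "e \<in> borel_measurable M" "AE x in M. \<bar>e x\<bar> \<le> c" "0 \<le> c"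
  shows "sqint M (\<lambda>x. e x * f x)" "l2 M (\<lambda>x. e x * f x) \<le> c * l2 M f"
proof -
  have [measurable]: "f \<in> borel_measurable M" "e \<in> borel_measurable M"
    using assms by (auto simp: sqint_def)
  have *: "AE x in M. \<bar>e x * f x\<bar> \<le> c * \<bar>f x\<bar>"
    using assms(3) by eventually_elim (auto simp: abs_mult intro: mult_right_mono)
  show "sqint M (\<lambda>x. e x * f x)" "l2 M (\<lambda>x. e x * f x) \<le> c * l2 M f"
    using l2_mono_AE[OF assms(1) _ * assms(4)] by auto
qed

lemma l2_restrict_mono:
  assumes "sqint M f" "A \<in> sets M"
  shows "sqint M (\<lambda>x. indicator A x * f x)" "l2 M (\<lambda>x. indicator A x * f x) \<le> l2 M f"
  using sqint_bounded_mult[OF assms(1), of "indicator A" 1] assms(2) by (auto simp: indicator_def)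

subsection \<open>Radial integrals\<close>

declare borel_open[OF open_ball, measurable] borel_closed[OF closed_cball, measurable]

lemma nn_integral_lborel_translate:
  fixes f :: "'a::euclidean_space \<Rightarrow> ennreal"
  assumes [measurable]: "f \<in> borel_measurable borel"
  shows "(\<integral>\<^sup>+x. f (x + h) \<partial>lborel) = (\<integral>\<^sup>+x. f x \<partial>lborel)"
proof -
  have "(\<integral>\<^sup>+x. f x \<partial>lborel) = (\<integral>\<^sup>+x. f x \<partial>distr lborel borel ((+) h))"
    by (simp add: lborel_distr_plus)
  also have "\<dots> = (\<integral>\<^sup>+x. f (h + x) \<partial>lborel)"
    by (subst nn_integral_distr) auto
  finally show ?thesis by (simp add: add.commute)
qed

lemma nn_integral_lborel_reflect:
  fixes f :: "'a::euclidean_space \<Rightarrow> ennreal"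
  assumes [measurable]: "f \<in> borel_measurable borel"
  shows "(\<integral>\<^sup>+x. f (h - x) \<partial>lborel) = (\<integral>\<^sup>+x. f x \<partial>lborel)"
proof -
  have "(\<integral>\<^sup>+x. f x \<partial>lborel) = (\<integral>\<^sup>+x. f x \<partial>density (distr lborel borel (\<lambda>x. h + (-1) *\<^sub>R x)) (\<lambda>_. ennreal (\<bar>-1\<bar> ^ DIM('a))))"
    using lborel_affine[of "-1" h] by simp
  also have "\<dots> = (\<integral>\<^sup>+x. f (h - x) \<partial>lborel)"
    by (subst nn_integral_density) (auto simp: nn_integral_distr)
  finally show ?thesis by simp
qed

lemma dyadic_scale:
  fixes x R :: real
  assumes "0 < x" "x < R"
  obtains j :: nat where "R / 2 ^ j / 2 \<le> x" "x < R / 2 ^ j"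
proof -
  obtain j0 where "R / x < 2 ^ j0" using real_arch_pow[of 2 "R / x"] by auto
  then have j0: "R / 2 ^ j0 \<le> x" using assms(1) by (simp add: field_simps)
  \<comment> \<open>The least such \<open>j\<close> is positive because \<open>x < R\<close>; its
    predecessor is the scale wanted.\<close>
  define j where "j = (LEAST j. R / 2 ^ j \<le> x)"
  have j: "R / 2 ^ j \<le> x" unfolding j_def using j0 by (rule LeastI)
  have "j \<noteq> 0" using j assms(2) by (cases j) auto
  then obtain i where i: "j = Suc i" by (cases j) auto
  have "\<not> R / 2 ^ i \<le> x" using not_less_Least[of i "\<lambda>j. R / 2 ^ j \<le> x"] i by (simp add: j_def)
  then show thesis using j i that[of i] by (simp add: field_simps)
qed

text \<open>This replaces polar coordinates. On the shell between r j / 2 and r j the power of |k|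
  is comparable to that of r j, up to 2^|p| for either sign of \<open>p\<close>, and the shell lies
  in a ball whose volume is a multiple of (r j)^n; summability of the products is then enough. The
  origin needs no shell since \<open>0 powr p\<close> is 0.\<close>

lemma radial_dyadic:
  fixes S :: "'a::euclidean_space set" and p :: real
  assumes [measurable]: "S \<in> sets borel"
    and r: "\<And>j. 0 < r j" and S: "\<And>k. k \<in> S \<Longrightarrow> k \<noteq> 0 \<Longrightarrow> \<exists>j. r j / 2 \<le> norm k \<and> norm k < r j"
    and sum: "summable (\<lambda>j::nat. r j powr (p + DIM('a)))"
  shows "(\<integral>\<^sup>+k. ennreal (indicator S k * norm k powr p) \<partial>lborel) < \<infinity>"
proof -
  define c where "c = 2 powr \<bar>p\<bar> * unit_ball_vol (real DIM('a))"
  have c: "c \<ge> 0" by (simp add: c_def)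
  have "ennreal (indicator S k * norm k powr p)
      \<le> (\<Sum>j. ennreal (2 powr \<bar>p\<bar> * r j powr p) * indicator (ball 0 (r j)) k)" for k :: 'a
  proof (cases "k \<in> S \<and> k \<noteq> 0")
    case True
    then obtain j where j: "r j / 2 \<le> norm k" "norm k < r j" using S by blast
    have "norm k powr p \<le> 2 powr \<bar>p\<bar> * r j powr p"
    proof (cases "p \<ge> 0")
      case True
      have "norm k powr p \<le> r j powr p" using j True by (intro powr_mono2) auto
      also have "\<dots> \<le> 2 powr \<bar>p\<bar> * r j powr p"
        using mult_right_mono[OF ge_one_powr_ge_zero[of 2 "\<bar>p\<bar>"], of "r j powr p"] by simp
      finally show ?thesis .
    next
      case False
      have "norm k powr p \<le> (r j / 2) powr p" using j False r[of j] by (intro powr_mono2') auto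
      also have "\<dots> = 2 powr \<bar>p\<bar> * r j powr p"
        using r[of j] False by (simp add: powr_divide powr_minus_divide)
      finally show ?thesis .
    qed
    then have "ennreal (indicator S k * norm k powr p) \<le> ennreal (2 powr \<bar>p\<bar> * r j powr p) * indicator (ball 0 (r j)) k"
      using j True by (simp add: ennreal_leI)
    also have "\<dots> = (\<Sum>i\<in>{j}. ennreal (2 powr \<bar>p\<bar> * r i powr p) * indicator (ball 0 (r i)) k)"
      by (simp only: sum.insert sum.empty finite.emptyI empty_iff not_False_eq_True add_0_right)
    also have "\<dots> \<le> (\<Sum>j. ennreal (2 powr \<bar>p\<bar> * r j powr p) * indicator (ball 0 (r j)) k)"
      by (rule sum_le_suminf) auto
    finally show ?thesis .
  qed auto
  then have "(\<integral>\<^sup>+k. ennreal (indicator S k * norm k powr p) \<partial>(lborel::'a measure))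
     \<le> (\<integral>\<^sup>+k. (\<Sum>j. ennreal (2 powr \<bar>p\<bar> * r j powr p) * indicator (ball 0 (r j)) k) \<partial>(lborel::'a measure))"
    by (intro nn_integral_mono) auto
  also have "\<dots> = (\<Sum>j. \<integral>\<^sup>+k. ennreal (2 powr \<bar>p\<bar> * r j powr p) * indicator (ball 0 (r j)) k \<partial>(lborel::'a measure))"
    by (intro nn_integral_suminf borel_measurable_times_ennreal borel_measurable_const borel_measurable_indicator) simp
  also have "\<dots> = (\<Sum>j. ennreal (2 powr \<bar>p\<bar> * r j powr p) * emeasure lborel (ball 0 (r j) :: 'a set))"
    by (intro arg_cong[where f=suminf] ext nn_integral_cmult_indicator) simp
  also have "\<dots> = (\<Sum>j. ennreal (c * r j powr (p + DIM('a))))"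
  proof (intro arg_cong[where f=suminf] ext)
    fix j
    have "ennreal (2 powr \<bar>p\<bar> * r j powr p) * emeasure lborel (ball 0 (r j) :: 'a set)
      = ennreal ((2 powr \<bar>p\<bar> * r j powr p) * (unit_ball_vol (real DIM('a)) * r j ^ DIM('a)))"
      using r[of j] by (subst ennreal_mult) (simp_all add: emeasure_ball)
    also have "(2 powr \<bar>p\<bar> * r j powr p) * (unit_ball_vol (real DIM('a)) * r j ^ DIM('a)) = c * r j powr (p + DIM('a))"
      using r[of j] by (simp add: c_def powr_add powr_realpow)
    finally show "ennreal (2 powr \<bar>p\<bar> * r j powr p) * emeasure lborel (ball 0 (r j) :: 'a set) = ennreal (c * r j powr (p + DIM('a)))" .
  qed
  also have "\<dots> < \<infinity>"
    unfolding infinity_ennreal_def top.not_eq_extremum[symmetric]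
    by (rule ennreal_suminf_neq_top[OF summable_mult[OF sum, of c]]) (intro mult_nonneg_nonneg c powr_ge_zero)
  finally show ?thesis .
qed

lemma radial_near:
  fixes t R :: real
  assumes "0 < t" "0 < R"
  shows "(\<integral>\<^sup>+k. ennreal (indicator (ball 0 R) k * norm k powr (t - real DIM('a))) \<partial>(lborel::'a::euclidean_space measure)) < \<infinity>"
proof (rule radial_dyadic[where r = "\<lambda>j. R / 2 ^ j"])
  fix k :: 'a assume "k \<in> ball 0 R" "k \<noteq> 0"
  then show "\<exists>j. R / 2 ^ j / 2 \<le> norm k \<and> norm k < R / 2 ^ j"
    using dyadic_scale[of "norm k" R] by (metis mem_ball_0 zero_less_norm_iff)
next
  have "(R / 2 ^ j) powr t = R powr t * ((1/2) powr t) ^ j" for j :: nat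
    using assms by (simp add: powr_divide powr_power powr_powr powr_realpow[symmetric] mult.commute)
  moreover have "(1/2::real) powr t < 1" using assms powr_less_mono2[of t "1/2" 1] by simp
  ultimately show "summable (\<lambda>j. (R / 2 ^ j) powr (t - real DIM('a) + real DIM('a)))"
    by (auto intro!: summable_mult summable_geometric)
qed (use assms in auto)

lemma radial_far:
  fixes t R :: real
  assumes "0 < t" "0 < R"
  shows "(\<integral>\<^sup>+k. ennreal (indicator (- ball 0 R) k * norm k powr (- real DIM('a) - t)) \<partial>(lborel::'a::euclidean_space measure)) < \<infinity>"
\<comment> \<open>Half of the first radius has to reach down to \<open>R\<close>, hence
  \<open>Suc j\<close>.\<close>
proof (rule radial_dyadic[where r = "\<lambda>j. R * 2 ^ Suc j"])
  fix k :: 'a assume k: "k \<in> - ball 0 R"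
  obtain j0 where "norm k / R < 2 ^ j0"
    using real_arch_pow[of 2 "norm k / R"] by auto
  then have j0: "norm k < R * 2 ^ j0" using assms by (simp add: field_simps)
  define j where "j = (LEAST j. norm k < R * 2 ^ j)"
  have j: "norm k < R * 2 ^ j" unfolding j_def using j0 by (rule LeastI)
  have "j \<noteq> 0" using j k by (cases j) auto
  then obtain i where i: "j = Suc i" by (cases j) auto
  have "\<not> norm k < R * 2 ^ i" using not_less_Least[of i "\<lambda>j. norm k < R * 2 ^ j"] i by (simp add: j_def)
  then show "\<exists>j. R * 2 ^ Suc j / 2 \<le> norm k \<and> norm k < R * 2 ^ Suc j"
    using j i by (intro exI[of _ i]) (auto simp: field_simps)
next
  have "(R * 2 ^ Suc j) powr (- t) = (R * 2) powr - t * (2 powr - t) ^ j" for j :: nat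
    using assms by (simp add: powr_mult powr_power powr_powr powr_realpow[symmetric] powr_add[symmetric] field_simps)
  moreover have "(2::real) powr - t < 1" using assms using powr_less_mono[of "-t" 0 2] by simp
  ultimately show "summable (\<lambda>j. (R * 2 ^ Suc j) powr (- real DIM('a) - t + real DIM('a)))"
    by (auto intro!: summable_mult summable_geometric)
qed (use assms in auto)

subsection \<open>Fractional energies in difference coordinates\<close>

text \<open>The model kernel of order 2s, cut off at radius \<open>\<rho>\<close>. Since
  \<open>0 powr a\<close> is 0, it vanishes at the origin, so the diagonal carries no mass whatever
  the exponent.\<close>

definition wgt :: "real \<Rightarrow> real \<Rightarrow> 'a::euclidean_space \<Rightarrow> real" where
  "wgt s \<rho> k = indicator (ball 0 \<rho>) k * norm k powr (- (real DIM('a) + 2 * s))"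

text \<open>A pair \<open>(k, x)\<close> stands for the pair of points \<open>x + k\<close> and \<open>x\<close>, so that translations act on \<open>x\<close> only.\<close>

definition kmeas :: "real \<Rightarrow> real \<Rightarrow> ('a::euclidean_space \<times> 'a) measure" where
  "kmeas s \<rho> = density (lborel \<Otimes>\<^sub>M lborel) (\<lambda>(k, x). ennreal (wgt s \<rho> k))"

definition dif :: "'a::plus \<Rightarrow> ('a \<Rightarrow> real) \<Rightarrow> 'a \<Rightarrow> real" where
  "dif k \<phi> x = \<phi> (x + k) - \<phi> x"

definition difs :: "('a::plus \<Rightarrow> real) \<Rightarrow> 'a \<times> 'a \<Rightarrow> real" where
  "difs \<phi> = (\<lambda>(k, x). dif k \<phi> x)"

text \<open>This is H^s on the whole space, with the Gagliardo double integral restricted to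
  increments shorter than \<open>\<rho>\<close>. The functions are global; localisation is left to
  cutoffs and to supports.\<close>

definition frac_sobolev :: "real \<Rightarrow> real \<Rightarrow> ('a::euclidean_space \<Rightarrow> real) \<Rightarrow> bool" where
  "frac_sobolev s \<rho> \<phi> \<longleftrightarrow> \<phi> \<in> borel_measurable borel \<and> sqint lborel \<phi> \<and> sqint (kmeas s \<rho>) (difs \<phi>)"

lemma ennreal_power2_sum_le:
  fixes a b :: real
  shows "ennreal ((a + b)\<^sup>2) \<le> 2 * ennreal (a\<^sup>2) + 2 * ennreal (b\<^sup>2)"
proof -
  have "(a + b)\<^sup>2 \<le> 2 * a\<^sup>2 + 2 * b\<^sup>2"
    using sum_squares_bound[of a b] by (simp add: power2_sum)
  then have "ennreal ((a + b)\<^sup>2) \<le> ennreal (2 * a\<^sup>2 + 2 * b\<^sup>2)" by (rule ennreal_leI)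
  also have "\<dots> = 2 * ennreal (a\<^sup>2) + 2 * ennreal (b\<^sup>2)"
    by (subst ennreal_plus) (auto simp: ennreal_mult)
  finally show ?thesis .
qed

lemma wgt_nonneg [simp]: "0 \<le> wgt s \<rho> k"
  by (simp add: wgt_def)

lemma wgt_measurable [measurable]: "wgt s \<rho> \<in> borel_measurable borel"
  unfolding wgt_def by measurable

lemma dif_measurable [measurable]:
  fixes \<phi> :: "'a::euclidean_space \<Rightarrow> real"
  assumes [measurable]: "\<phi> \<in> borel_measurable borel"
  shows "dif k \<phi> \<in> borel_measurable borel"
  unfolding dif_def by measurable

lemma sets_kmeas [measurable_cong]: "sets (kmeas s \<rho>) = sets (borel \<Otimes>\<^sub>M borel)"
  unfolding kmeas_def sets_density by (rule sets_pair_measure_cong) simp_all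

lemma space_kmeas [simp]: "space (kmeas s \<rho>) = UNIV"
  by (simp add: kmeas_def space_pair_measure)

lemma difs_measurable [measurable]:
  fixes \<phi> :: "'a::euclidean_space \<Rightarrow> real"
  assumes [measurable]: "\<phi> \<in> borel_measurable borel"
  shows "difs \<phi> \<in> borel_measurable (borel \<Otimes>\<^sub>M borel)"
  unfolding difs_def dif_def by measurable

lemma dif_measurable2 [measurable]:
  fixes \<phi> :: "'a::euclidean_space \<Rightarrow> real"
  assumes [measurable]: "\<phi> \<in> borel_measurable borel"
    and [measurable]: "f \<in> borel_measurable M" "g \<in> borel_measurable M"
  shows "(\<lambda>p. dif (f p) \<phi> (g p)) \<in> borel_measurable M"
  unfolding dif_def by measurable

lemma difs_measurable' [measurable]:
  fixes \<phi> :: "'a::euclidean_space \<Rightarrow> real"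
  assumes [measurable]: "\<phi> \<in> borel_measurable borel"
  shows "difs \<phi> \<in> borel_measurable (kmeas s \<rho>)"
  by measurable

lemma nn_integral_kmeas:
  assumes [measurable]: "F \<in> borel_measurable (borel \<Otimes>\<^sub>M borel)"
  shows "(\<integral>\<^sup>+p. F p \<partial>kmeas s \<rho>) = (\<integral>\<^sup>+k. ennreal (wgt s \<rho> k) * (\<integral>\<^sup>+x. F (k, x) \<partial>lborel) \<partial>lborel)"
proof -
  have "(\<integral>\<^sup>+p. F p \<partial>kmeas s \<rho>) = (\<integral>\<^sup>+p. ennreal (wgt s \<rho> (fst p)) * F p \<partial>(lborel \<Otimes>\<^sub>M lborel))"
    unfolding kmeas_def by (subst nn_integral_density) (auto simp: case_prod_beta)
  also have "\<dots> = (\<integral>\<^sup>+k. \<integral>\<^sup>+x. ennreal (wgt s \<rho> k) * F (k, x) \<partial>lborel \<partial>lborel)"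
    by (subst lborel.nn_integral_fst[symmetric]) auto
  also have "\<dots> = (\<integral>\<^sup>+k. ennreal (wgt s \<rho> k) * (\<integral>\<^sup>+x. F (k, x) \<partial>lborel) \<partial>lborel)"
    by (intro nn_integral_cong nn_integral_cmult) measurable
  finally show ?thesis .
qed

text \<open>The density depends on \<open>k\<close> alone, so translation invariance of Lebesgue
  measure in \<open>x\<close> carries over. This invariance is what later moves a translation from
  one argument of the form to the other argument and to the kernel.\<close>

lemma kmeas_shift:
  fixes h :: "'a::euclidean_space"
  shows "distr (kmeas s \<rho>) (kmeas s \<rho>) (\<lambda>(k, x). (k, x + h)) = kmeas s \<rho>"
proof (rule measure_eqI)
  fix A assume "A \<in> sets (distr (kmeas s \<rho>) (kmeas s \<rho>) (\<lambda>(k, x). (k, x + h)))"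
  then have [measurable]: "A \<in> sets (borel \<Otimes>\<^sub>M borel)" by (simp add: sets_kmeas)
  have [measurable]: "(\<lambda>(k, x). (k, x + h)) \<in> (kmeas s \<rho> :: ('a \<times> 'a) measure) \<rightarrow>\<^sub>M kmeas s \<rho>"
    by measurable
  have "emeasure (distr (kmeas s \<rho>) (kmeas s \<rho>) (\<lambda>(k, x). (k, x + h))) A
     = (\<integral>\<^sup>+p. indicator A p \<partial>distr (kmeas s \<rho>) (kmeas s \<rho>) (\<lambda>(k, x). (k, x + h)))"
    by (simp add: sets_kmeas)
  also have "\<dots> = (\<integral>\<^sup>+p. indicator A (fst p, snd p + h) \<partial>kmeas s \<rho>)"
    by (subst nn_integral_distr) (auto simp: case_prod_beta)
  also have "\<dots> = (\<integral>\<^sup>+k. ennreal (wgt s \<rho> k) * (\<integral>\<^sup>+x. indicator A (k, x + h) \<partial>lborel) \<partial>lborel)"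
    by (subst nn_integral_kmeas) auto
  also have "\<dots> = (\<integral>\<^sup>+k. ennreal (wgt s \<rho> k) * (\<integral>\<^sup>+x. indicator A (k, x) \<partial>lborel) \<partial>lborel)"
    by (subst nn_integral_lborel_translate) auto
  also have "\<dots> = (\<integral>\<^sup>+p. indicator A p \<partial>kmeas s \<rho>)"
    by (subst nn_integral_kmeas) auto
  finally show "emeasure (distr (kmeas s \<rho>) (kmeas s \<rho>) (\<lambda>(k, x). (k, x + h))) A = emeasure (kmeas s \<rho>) A"
    by (simp add: sets_kmeas)
qed simp

lemma kmeas_shift_measurable [measurable]:
  fixes h :: "'a::euclidean_space"
  shows "(\<lambda>(k, x). (k, x + h)) \<in> (kmeas s \<rho> :: ('a \<times> 'a) measure) \<rightarrow>\<^sub>M kmeas s \<rho>"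
  by measurable

lemma integral_kmeas_shift:
  fixes F :: "'a::euclidean_space \<times> 'a \<Rightarrow> real"
  assumes [measurable]: "F \<in> borel_measurable (borel \<Otimes>\<^sub>M borel)"
  shows "(\<integral>p. F (fst p, snd p + h) \<partial>kmeas s \<rho>) = (\<integral>p. F p \<partial>kmeas s \<rho>)"
    and "integrable (kmeas s \<rho>) (\<lambda>p. F (fst p, snd p + h)) \<longleftrightarrow> integrable (kmeas s \<rho>) F"
proof -
  have "(\<integral>p. F p \<partial>distr (kmeas s \<rho>) (kmeas s \<rho>) (\<lambda>(k, x). (k, x + h))) = (\<integral>p. F (fst p, snd p + h) \<partial>kmeas s \<rho>)"
    by (subst integral_distr) (auto simp: case_prod_beta)
  then show "(\<integral>p. F (fst p, snd p + h) \<partial>kmeas s \<rho>) = (\<integral>p. F p \<partial>kmeas s \<rho>)"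
    by (simp add: kmeas_shift)
  have "integrable (distr (kmeas s \<rho>) (kmeas s \<rho>) (\<lambda>(k, x). (k, x + h))) F \<longleftrightarrow> integrable (kmeas s \<rho>) (\<lambda>p. F (fst p, snd p + h))"
    by (subst integrable_distr_eq) (auto simp: case_prod_beta)
  then show "integrable (kmeas s \<rho>) (\<lambda>p. F (fst p, snd p + h)) \<longleftrightarrow> integrable (kmeas s \<rho>) F"
    by (simp add: kmeas_shift)
qed

lemma AE_kmeas_shift:
  fixes h :: "'a::euclidean_space"
  assumes "AE p in kmeas s \<rho>. P p"
  shows "AE p in kmeas s \<rho>. P (fst p, snd p + h)"
proof -
  have "AE p in distr (kmeas s \<rho>) (kmeas s \<rho>) (\<lambda>(k, x). (k, x + h)). P p"
    by (subst kmeas_shift) (rule assms)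
  from AE_distrD[OF kmeas_shift_measurable this] show ?thesis by (simp add: case_prod_beta)
qed

lemma l2_translate:
  fixes \<phi> :: "'a::euclidean_space \<Rightarrow> real"
  assumes "sqint lborel \<phi>"
  shows "sqint lborel (\<lambda>x. \<phi> (x + h))" "l2 lborel (\<lambda>x. \<phi> (x + h)) = l2 lborel \<phi>"
proof -
  have *: "distr lborel lborel (\<lambda>x::'a. x + h) = lborel"
    using lborel_distr_plus[of h] by (metis (no_types, lifting) ext add.commute distr_cong sets_lborel)
  have [measurable]: "\<phi> \<in> borel_measurable borel" using assms by (simp add: sqint_def)
  have "integrable (distr lborel lborel (\<lambda>x::'a. x + h)) (\<lambda>x. (\<phi> x)\<^sup>2)"
    using assms * by (simp add: sqint_def)
  then show "sqint lborel (\<lambda>x. \<phi> (x + h))"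
    by (subst (asm) integrable_distr_eq) (auto simp: sqint_def)
  have "(\<integral>x. (\<phi> x)\<^sup>2 \<partial>distr lborel lborel (\<lambda>x::'a. x + h)) = (\<integral>x. (\<phi> (x + h))\<^sup>2 \<partial>lborel)"
    by (subst integral_distr) auto
  then show "l2 lborel (\<lambda>x. \<phi> (x + h)) = l2 lborel \<phi>"
    by (simp add: * l2_def)
qed

lemma l2_dif:
  fixes \<phi> :: "'a::euclidean_space \<Rightarrow> real"
  assumes "sqint lborel \<phi>"
  shows "sqint lborel (dif h \<phi>)" "l2 lborel (dif h \<phi>) \<le> 2 * l2 lborel \<phi>"
  using sqint_diff[OF l2_translate(1)[OF assms] assms, of h] l2_translate(2)[OF assms, of h]
  unfolding dif_def[abs_def] by auto

lemma frac_sobolevD: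
  assumes "frac_sobolev s \<rho> \<phi>"
  shows "\<phi> \<in> borel_measurable borel" "sqint lborel \<phi>" "sqint (kmeas s \<rho>) (difs \<phi>)"
  using assms by (auto simp: frac_sobolev_def)

lemma frac_sobolev_translate:
  fixes \<phi> :: "'a::euclidean_space \<Rightarrow> real"
  assumes "frac_sobolev s \<rho> \<phi>"
  shows "frac_sobolev s \<rho> (\<lambda>x. \<phi> (x + h))"
    "l2 (kmeas s \<rho>) (difs (\<lambda>x. \<phi> (x + h))) = l2 (kmeas s \<rho>) (difs \<phi>)"
proof -
  note [measurable] = frac_sobolevD(1)[OF assms]
  have eq: "difs (\<lambda>x. \<phi> (x + h)) = (\<lambda>p. difs \<phi> (fst p, snd p + h))"
    by (auto simp: difs_def dif_def fun_eq_iff ac_simps)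
  show "l2 (kmeas s \<rho>) (difs (\<lambda>x. \<phi> (x + h))) = l2 (kmeas s \<rho>) (difs \<phi>)"
    unfolding l2_def eq using integral_kmeas_shift(1)[of "\<lambda>p. (difs \<phi> p)\<^sup>2"] by simp
  have "integrable (kmeas s \<rho>) (\<lambda>p. (difs \<phi> (fst p, snd p + h))\<^sup>2)"
    using integral_kmeas_shift(2)[of "\<lambda>p. (difs \<phi> p)\<^sup>2" s \<rho> h] assms by (simp add: frac_sobolev_def sqint_def)
  then show "frac_sobolev s \<rho> (\<lambda>x. \<phi> (x + h))"
    using frac_sobolevD[OF assms] l2_translate(1)[OF frac_sobolevD(2)[OF assms]]
    by (auto simp: frac_sobolev_def sqint_def eq)
qed

lemma frac_sobolev_diff:
  fixes \<phi> \<psi> :: "'a::euclidean_space \<Rightarrow> real"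
  assumes "frac_sobolev s \<rho> \<phi>" "frac_sobolev s \<rho> \<psi>"
  shows "frac_sobolev s \<rho> (\<lambda>x. \<phi> x - \<psi> x)"
proof -
  have eq: "difs (\<lambda>x. \<phi> x - \<psi> x) = (\<lambda>p. difs \<phi> p - difs \<psi> p)"
    by (auto simp: difs_def dif_def fun_eq_iff)
  show ?thesis using assms by (auto simp: frac_sobolev_def eq intro!: sqint_diff)
qed

lemma frac_sobolev_dif:
  fixes \<phi> :: "'a::euclidean_space \<Rightarrow> real"
  assumes "frac_sobolev s \<rho> \<phi>"
  shows "frac_sobolev s \<rho> (dif h \<phi>)"
  using frac_sobolev_diff[OF frac_sobolev_translate(1)[OF assms] assms] by (simp add: dif_def[abs_def])

section \<open>Lipschitz multipliers and the second moment of the weight\<close>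

definition second_moment :: "'a::euclidean_space itself \<Rightarrow> real \<Rightarrow> real \<Rightarrow> real" where
  "second_moment _ s \<rho> = enn2real (\<integral>\<^sup>+k. ennreal (wgt s \<rho> k * (norm k)\<^sup>2) \<partial>(lborel :: 'a measure))"

lemma second_moment_nonneg [simp]: "0 \<le> second_moment T s \<rho>"
  by (simp add: second_moment_def)

text \<open>The integrand is |k|^(2 (1 - s) - n), which is integrable at 0 exactly because
  \<open>s < 1\<close>. The moment is the price of a Lipschitz multiplier: its increments are at
  most a multiple of |k|, and their square is integrated against the weight.\<close>

lemma second_moment_eq:
  assumes "s < 1" "0 < \<rho>"
  shows "(\<integral>\<^sup>+k. ennreal (wgt s \<rho> k * (norm k)\<^sup>2) \<partial>(lborel :: 'a::euclidean_space measure))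
    = ennreal (second_moment TYPE('a) s \<rho>)"
proof -
  have "wgt s \<rho> k * (norm k)\<^sup>2 = indicator (ball 0 \<rho>) k * norm k powr (2 * (1 - s) - real DIM('a))" for k :: 'a
  proof (cases "k = 0")
    case False
    have "norm k powr (- (real DIM('a) + 2 * s)) * norm k powr 2 = norm k powr (2 * (1 - s) - real DIM('a))"
      unfolding powr_add[symmetric] by (simp add: algebra_simps)
    then show ?thesis using False by (simp add: wgt_def)
  qed (auto simp: wgt_def)
  then have "(\<integral>\<^sup>+k. ennreal (wgt s \<rho> k * (norm k)\<^sup>2) \<partial>(lborel :: 'a measure)) < \<infinity>"
    using radial_near[of "2 * (1 - s)" \<rho>, where 'a = 'a] assms by simp
  then show ?thesis by (simp add: second_moment_def)
qed

lemma l2_moment: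
  fixes G :: "'a::euclidean_space \<times> 'a \<Rightarrow> real"
  assumes "s < 1" "0 < \<rho>" and [measurable]: "G \<in> borel_measurable (borel \<Otimes>\<^sub>M borel)"
    and "\<And>k. (\<integral>\<^sup>+x. ennreal ((G (k, x))\<^sup>2) \<partial>lborel) \<le> ennreal (c\<^sup>2)" "0 \<le> c"
  shows "sqint (kmeas s \<rho>) (\<lambda>p. norm (fst p) * G p)"
    "l2 (kmeas s \<rho>) (\<lambda>p. norm (fst p) * G p) \<le> sqrt (second_moment TYPE('a) s \<rho>) * c"
proof -
  have "(\<integral>\<^sup>+p. ennreal ((norm (fst p) * G p)\<^sup>2) \<partial>kmeas s \<rho>)
    = (\<integral>\<^sup>+k. ennreal (wgt s \<rho> k) * (\<integral>\<^sup>+x. ennreal ((norm k * G (k, x))\<^sup>2) \<partial>lborel) \<partial>(lborel :: 'a measure))"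
    by (subst nn_integral_kmeas) auto
  also have "\<dots> \<le> (\<integral>\<^sup>+k. ennreal (wgt s \<rho> k * (norm k)\<^sup>2) * ennreal (c\<^sup>2) \<partial>(lborel :: 'a measure))"
  proof (rule nn_integral_mono)
    fix k :: 'a
    have "(\<integral>\<^sup>+x. ennreal ((norm k * G (k, x))\<^sup>2) \<partial>lborel) = ennreal ((norm k)\<^sup>2) * (\<integral>\<^sup>+x. ennreal ((G (k, x))\<^sup>2) \<partial>lborel)"
      by (simp add: power_mult_distrib ennreal_mult nn_integral_cmult)
    also have "\<dots> \<le> ennreal ((norm k)\<^sup>2) * ennreal (c\<^sup>2)"
      by (intro mult_left_mono assms(4)) simp
    finally have "ennreal (wgt s \<rho> k) * (\<integral>\<^sup>+x. ennreal ((norm k * G (k, x))\<^sup>2) \<partial>lborel)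
      \<le> ennreal (wgt s \<rho> k) * (ennreal ((norm k)\<^sup>2) * ennreal (c\<^sup>2))"
      by (rule mult_left_mono) simp
    then show "ennreal (wgt s \<rho> k) * (\<integral>\<^sup>+x. ennreal ((norm k * G (k, x))\<^sup>2) \<partial>lborel)
      \<le> ennreal (wgt s \<rho> k * (norm k)\<^sup>2) * ennreal (c\<^sup>2)"
      by (simp add: ennreal_mult mult.assoc)
  qed
  also have "\<dots> = ennreal (second_moment TYPE('a) s \<rho>) * ennreal (c\<^sup>2)"
    using assms by (simp add: nn_integral_multc second_moment_eq)
  also have "\<dots> = ennreal ((sqrt (second_moment TYPE('a) s \<rho>) * c)\<^sup>2)"
    by (simp add: power_mult_distrib ennreal_mult)
  finally have *: "(\<integral>\<^sup>+p. ennreal ((norm (fst p) * G p)\<^sup>2) \<partial>kmeas s \<rho>)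
    \<le> ennreal ((sqrt (second_moment TYPE('a) s \<rho>) * c)\<^sup>2)" .
  show "sqint (kmeas s \<rho>) (\<lambda>p. norm (fst p) * G p)"
    "l2 (kmeas s \<rho>) (\<lambda>p. norm (fst p) * G p) \<le> sqrt (second_moment TYPE('a) s \<rho>) * c"
    using l2_leI[OF _ *] assms(5) by auto
qed

lemma l2_moment_slice:
  fixes \<phi> :: "'a::euclidean_space \<Rightarrow> real"
  assumes "s < 1" "0 < \<rho>" "sqint lborel \<phi>"
  shows "sqint (kmeas s \<rho>) (\<lambda>p. norm (fst p) * \<phi> (snd p))"
    "l2 (kmeas s \<rho>) (\<lambda>p. norm (fst p) * \<phi> (snd p)) \<le> sqrt (second_moment TYPE('a) s \<rho>) * l2 lborel \<phi>"
    "sqint (kmeas s \<rho>) (\<lambda>p. norm (fst p) * \<phi> (snd p + fst p))"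
    "l2 (kmeas s \<rho>) (\<lambda>p. norm (fst p) * \<phi> (snd p + fst p)) \<le> sqrt (second_moment TYPE('a) s \<rho>) * l2 lborel \<phi>"
proof -
  have [measurable]: "\<phi> \<in> borel_measurable borel" using assms by (simp add: sqint_def)
  show "sqint (kmeas s \<rho>) (\<lambda>p. norm (fst p) * \<phi> (snd p))"
    "l2 (kmeas s \<rho>) (\<lambda>p. norm (fst p) * \<phi> (snd p)) \<le> sqrt (second_moment TYPE('a) s \<rho>) * l2 lborel \<phi>"
    using assms l2_moment[where G = "\<lambda>p. \<phi> (snd p)" and c = "l2 lborel \<phi>"] by (simp_all add: nn_integral_square)
  have "(\<integral>\<^sup>+x. ennreal ((\<phi> (x + k))\<^sup>2) \<partial>lborel) = ennreal ((l2 lborel \<phi>)\<^sup>2)" for k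
    using nn_integral_lborel_translate[of "\<lambda>x. ennreal ((\<phi> x)\<^sup>2)" k] assms by (simp add: nn_integral_square)
  then show "sqint (kmeas s \<rho>) (\<lambda>p. norm (fst p) * \<phi> (snd p + fst p))"
    "l2 (kmeas s \<rho>) (\<lambda>p. norm (fst p) * \<phi> (snd p + fst p)) \<le> sqrt (second_moment TYPE('a) s \<rho>) * l2 lborel \<phi>"
    using assms l2_moment[where G = "\<lambda>p. \<phi> (snd p + fst p)" and c = "l2 lborel \<phi>"] by simp_all
qed

text \<open>Leibniz rule for differences: the increment of the product is \<open>\<eta>\<close> at
  the shifted point times the increment of \<open>\<phi>\<close>, plus the increment of
  \<open>\<eta>\<close> times \<open>\<phi>\<close>. The second term is at most \<open>B\<close> |k|
  |\<open>\<phi>\<close>| and is paid for by the second moment.\<close>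

lemma frac_sobolev_mult:
  fixes \<phi> \<eta> :: "'a::euclidean_space \<Rightarrow> real"
  assumes "s < 1" "0 < \<rho>" "frac_sobolev s \<rho> \<phi>"
    and "\<eta> \<in> borel_measurable borel" "\<And>x. \<bar>\<eta> x\<bar> \<le> 1" "\<And>x y. \<bar>\<eta> x - \<eta> y\<bar> \<le> B * norm (x - y)" "0 \<le> B"
  shows "frac_sobolev s \<rho> (\<lambda>x. \<eta> x * \<phi> x)"
    "l2 (kmeas s \<rho>) (difs (\<lambda>x. \<eta> x * \<phi> x))
      \<le> l2 (kmeas s \<rho>) (difs \<phi>) + B * sqrt (second_moment TYPE('a) s \<rho>) * l2 lborel \<phi>"
proof -
  note [measurable] = frac_sobolevD(1)[OF assms(3)] assms(4)
  note m = l2_moment_slice(1,2)[OF assms(1,2) frac_sobolevD(2)[OF assms(3)]]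
  have 1: "sqint (kmeas s \<rho>) (\<lambda>p. \<eta> (snd p + fst p) * difs \<phi> p)"
      "l2 (kmeas s \<rho>) (\<lambda>p. \<eta> (snd p + fst p) * difs \<phi> p) \<le> 1 * l2 (kmeas s \<rho>) (difs \<phi>)"
    using sqint_bounded_mult[OF frac_sobolevD(3)[OF assms(3)], where c = 1 and e = "\<lambda>p. \<eta> (snd p + fst p)"] assms(5)
    by simp_all
  have 2: "sqint (kmeas s \<rho>) (\<lambda>p. difs \<eta> p * \<phi> (snd p))"
      "l2 (kmeas s \<rho>) (\<lambda>p. difs \<eta> p * \<phi> (snd p)) \<le> B * l2 (kmeas s \<rho>) (\<lambda>p. norm (fst p) * \<phi> (snd p))"
  proof -
    have "\<bar>difs \<eta> p * \<phi> (snd p)\<bar> \<le> B * \<bar>norm (fst p) * \<phi> (snd p)\<bar>" for p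
    proof -
      have "\<bar>difs \<eta> p\<bar> \<le> B * norm (fst p)"
        using assms(6)[of "snd p + fst p" "snd p"] by (simp add: difs_def dif_def case_prod_beta)
      then have "\<bar>difs \<eta> p\<bar> * \<bar>\<phi> (snd p)\<bar> \<le> (B * norm (fst p)) * \<bar>\<phi> (snd p)\<bar>"
        by (rule mult_right_mono) simp
      then show ?thesis by (simp add: case_prod_beta abs_mult mult.assoc)
    qed
    then show "sqint (kmeas s \<rho>) (\<lambda>p. difs \<eta> p * \<phi> (snd p))"
      "l2 (kmeas s \<rho>) (\<lambda>p. difs \<eta> p * \<phi> (snd p)) \<le> B * l2 (kmeas s \<rho>) (\<lambda>p. norm (fst p) * \<phi> (snd p))"
      using l2_mono[OF m(1), of "\<lambda>p. difs \<eta> p * \<phi> (snd p)" B] assms(7) by simp_all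
  qed
  have eq: "difs (\<lambda>x. \<eta> x * \<phi> x) = (\<lambda>p. \<eta> (snd p + fst p) * difs \<phi> p + difs \<eta> p * \<phi> (snd p))"
    by (auto simp: difs_def dif_def fun_eq_iff algebra_simps)
  have "sqint lborel (\<lambda>x. \<eta> x * \<phi> x)"
    using assms by (intro sqint_bounded_mult(1)[where c=1] frac_sobolevD(2)) auto
  then show "frac_sobolev s \<rho> (\<lambda>x. \<eta> x * \<phi> x)"
    using sqint_add(1)[OF 1(1) 2(1)] by (simp add: frac_sobolev_def eq)
  have "l2 (kmeas s \<rho>) (difs (\<lambda>x. \<eta> x * \<phi> x)) \<le> 1 * l2 (kmeas s \<rho>) (difs \<phi>) + B * l2 (kmeas s \<rho>) (\<lambda>p. norm (fst p) * \<phi> (snd p))"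
    using sqint_add(2)[OF 1(1) 2(1)] 1(2) 2(2) unfolding eq by linarith
  also have "\<dots> \<le> l2 (kmeas s \<rho>) (difs \<phi>) + B * (sqrt (second_moment TYPE('a) s \<rho>) * l2 lborel \<phi>)"
    using mult_left_mono[OF m(2) assms(7)] by simp
  finally show "l2 (kmeas s \<rho>) (difs (\<lambda>x. \<eta> x * \<phi> x))
      \<le> l2 (kmeas s \<rho>) (difs \<phi>) + B * sqrt (second_moment TYPE('a) s \<rho>) * l2 lborel \<phi>"
    by (simp add: mult.assoc)
qed

text \<open>Averaging \<open>\<Delta>\<^sub>h \<phi> = \<Delta>\<^sub>h\<^sub>-\<^sub>k \<phi>(\<cdot> + k) + \<Delta>\<^sub>k \<phi>\<close> over \<open>k\<close> in the ball with diameter \<open>[0, h]\<close>.\<close>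

lemma l2_dif_le_energy:
  fixes s \<rho> :: real
  assumes "0 \<le> s"
  obtains C where "0 < C" "\<And>(\<phi> :: 'a::euclidean_space \<Rightarrow> real) h. frac_sobolev s \<rho> \<phi> \<Longrightarrow> norm h \<le> \<rho> \<Longrightarrow>
     l2 lborel (dif h \<phi>) \<le> C * norm h powr s * l2 (kmeas s \<rho>) (difs \<phi>)"
proof -
  define n where "n = real DIM('a)"
  \<comment> \<open>The ball with diameter from 0 to \<open>h\<close> has radius |h| / 2, hence
    volume \<open>V\<close> times |h|^n.\<close>
  define V where "V = unit_ball_vol n / 2 ^ DIM('a)"
  have V: "V > 0" by (simp add: V_def n_def unit_ball_vol_pos)
  show thesis
  proof (rule that[of "2 / sqrt V"])
    show "2 / sqrt V > 0" using V by simp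
  next
    fix \<phi> :: "'a \<Rightarrow> real" and h :: 'a
    assume fs: "frac_sobolev s \<rho> \<phi>" and h: "norm h \<le> \<rho>"
    note [measurable] = frac_sobolevD(1)[OF fs]
    note sq = l2_dif(1)[OF frac_sobolevD(2)[OF fs]]
    define N where "N k = (\<integral>\<^sup>+x. ennreal ((dif k \<phi> x)\<^sup>2) \<partial>lborel)" for k
    have [measurable]: "N \<in> borel_measurable borel"
      unfolding N_def dif_def by measurable
    let ?B = "ball (h /\<^sub>R 2) (norm h / 2)"
    have en: "(\<integral>\<^sup>+k. ennreal (wgt s \<rho> k) * N k \<partial>lborel) = ennreal ((l2 (kmeas s \<rho>) (difs \<phi>))\<^sup>2)"
      using nn_integral_square[OF frac_sobolevD(3)[OF fs]]
      by (subst (asm) nn_integral_kmeas) (auto simp: N_def difs_def[abs_def] intro: difs_measurable[unfolded difs_def])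
    show "l2 lborel (dif h \<phi>) \<le> 2 / sqrt V * norm h powr s * l2 (kmeas s \<rho>) (difs \<phi>)"
    proof (cases "h = 0")
      case True
      then show ?thesis by (simp add: dif_def[abs_def])
    next
      case False
      have tri: "N h \<le> 2 * N (h - k) + 2 * N k" for k
      proof -
        have "N h \<le> (\<integral>\<^sup>+x. 2 * ennreal ((dif (h - k) \<phi> (x + k))\<^sup>2) + 2 * ennreal ((dif k \<phi> x)\<^sup>2) \<partial>lborel)"
          unfolding N_def
        proof (rule nn_integral_mono)
          fix x
          have "dif h \<phi> x = dif (h - k) \<phi> (x + k) + dif k \<phi> x" by (simp add: dif_def)
          then show "ennreal ((dif h \<phi> x)\<^sup>2) \<le> 2 * ennreal ((dif (h - k) \<phi> (x + k))\<^sup>2) + 2 * ennreal ((dif k \<phi> x)\<^sup>2)"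
            by (simp add: ennreal_power2_sum_le)
        qed
        also have "\<dots> = 2 * (\<integral>\<^sup>+x. ennreal ((dif (h - k) \<phi> (x + k))\<^sup>2) \<partial>lborel) + 2 * N k"
          unfolding N_def dif_def by (subst nn_integral_add) (auto simp: nn_integral_cmult)
        also have "(\<integral>\<^sup>+x. ennreal ((dif (h - k) \<phi> (x + k))\<^sup>2) \<partial>lborel) = N (h - k)"
          unfolding N_def by (rule nn_integral_lborel_translate) measurable
        finally show ?thesis .
      qed
      have inB: "norm k < norm h" "norm (h - k) < norm h" if "k \<in> ?B" for k
      proof -
        have d: "norm (h /\<^sub>R 2 - k) < norm h / 2" using that by (simp add: dist_norm)
        have "norm k \<le> norm (h /\<^sub>R 2) + norm (k - h /\<^sub>R 2)" by (metis add.commute diff_add_cancel norm_triangle_ineq)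
        then show "norm k < norm h" using d by (simp add: norm_minus_commute)
        have "h /\<^sub>R 2 + h /\<^sub>R 2 = (inverse 2 + inverse 2) *\<^sub>R h" by (rule scaleR_left_distrib[symmetric])
        then have "h - k = h /\<^sub>R 2 + (h /\<^sub>R 2 - k)" by (simp add: add_diff_eq)
        then have "norm (h - k) \<le> norm (h /\<^sub>R 2) + norm (h /\<^sub>R 2 - k)" by (metis norm_triangle_ineq)
        then show "norm (h - k) < norm h" using d by simp
      qed
      have "ennreal (V * norm h powr n) * N h = emeasure lborel ?B * N h"
        using False by (simp add: emeasure_ball V_def n_def powr_realpow power_divide)
      also have "\<dots> = (\<integral>\<^sup>+k. indicator ?B k * N h \<partial>lborel)"
        by (simp add: nn_integral_multc)
      also have "\<dots> \<le> (\<integral>\<^sup>+k. 2 * (indicator (ball 0 (norm h)) (h - k) * N (h - k)) + 2 * (indicator (ball 0 (norm h)) k * N k) \<partial>lborel)"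
      proof (rule nn_integral_mono)
        fix k
        show "indicator ?B k * N h \<le> 2 * (indicator (ball 0 (norm h)) (h - k) * N (h - k)) + 2 * (indicator (ball 0 (norm h)) k * N k)"
          using tri[of k] inB[of k] by (cases "k \<in> ?B") auto
      qed
      also have "\<dots> = 2 * (\<integral>\<^sup>+k. indicator (ball 0 (norm h)) (h - k) * N (h - k) \<partial>lborel) + 2 * (\<integral>\<^sup>+k. indicator (ball 0 (norm h)) k * N k \<partial>lborel)"
        by (subst nn_integral_add) (auto simp: nn_integral_cmult)
      also have "(\<integral>\<^sup>+k. indicator (ball 0 (norm h)) (h - k) * N (h - k) \<partial>lborel) = (\<integral>\<^sup>+k. indicator (ball 0 (norm h)) k * N k \<partial>lborel)"
        by (rule nn_integral_lborel_reflect) measurable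
      \<comment> \<open>Here |h| \<le> \<open>\<rho>\<close> keeps the ball of radius |h| inside the
        region where the weight is not truncated; in it the weight is at least |h|^(-n-2s).\<close>
      also have "(\<integral>\<^sup>+k. indicator (ball 0 (norm h)) k * N k \<partial>lborel) \<le> (\<integral>\<^sup>+k. ennreal (norm h powr (n + 2 * s)) * (ennreal (wgt s \<rho> k) * N k) \<partial>lborel)"
      proof (rule nn_integral_mono)
        fix k :: 'a
        consider "k = 0" | "k \<noteq> 0" "k \<in> ball 0 (norm h)" | "k \<notin> ball 0 (norm h)" by blast
        then show "indicator (ball 0 (norm h)) k * N k \<le> ennreal (norm h powr (n + 2 * s)) * (ennreal (wgt s \<rho> k) * N k)"
        proof cases
          \<comment> \<open>At \<open>k = 0\<close> the weight is 0 and gives no lower bound, but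
            the increment vanishes as well.\<close>
          case 1
          then show ?thesis by (simp add: N_def dif_def)
        next
          case 2
          have "norm k powr (n + 2 * s) \<le> norm h powr (n + 2 * s)"
            using 2 assms by (intro powr_mono2) (auto simp: n_def)
          moreover have "wgt s \<rho> k = 1 / norm k powr (n + 2 * s)"
            using 2 h by (simp add: wgt_def n_def powr_minus_divide[symmetric])
          ultimately have "1 \<le> norm h powr (n + 2 * s) * wgt s \<rho> k"
            using 2 by simp
          then have "ennreal 1 * N k \<le> ennreal (norm h powr (n + 2 * s) * wgt s \<rho> k) * N k"
            by (intro mult_right_mono ennreal_leI) auto
          then show ?thesis using 2 by (simp add: ennreal_mult mult.assoc)
        qed auto
      qed
      also have "\<dots> = ennreal (norm h powr (n + 2 * s)) * ennreal ((l2 (kmeas s \<rho>) (difs \<phi>))\<^sup>2)"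
        by (simp add: nn_integral_cmult en)
      also have "2 * (ennreal (norm h powr (n + 2 * s)) * ennreal ((l2 (kmeas s \<rho>) (difs \<phi>))\<^sup>2)) + 2 * (ennreal (norm h powr (n + 2 * s)) * ennreal ((l2 (kmeas s \<rho>) (difs \<phi>))\<^sup>2))
         = ennreal (4 * norm h powr (n + 2 * s) * (l2 (kmeas s \<rho>) (difs \<phi>))\<^sup>2)"
      proof -
        have "2 * x + 2 * x = 4 * x" for x :: ennreal
          by (simp flip: distrib_right)
        then show ?thesis by (simp add: ennreal_mult mult.assoc)
      qed
      finally have "ennreal (V * norm h powr n) * N h \<le> ennreal (4 * norm h powr (n + 2 * s) * (l2 (kmeas s \<rho>) (difs \<phi>))\<^sup>2)"
        by (simp add: add_mono mult_left_mono)
      moreover have "N h = ennreal ((l2 lborel (dif h \<phi>))\<^sup>2)"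
        unfolding N_def by (rule nn_integral_square[OF sq])
      ultimately have "V * norm h powr n * (l2 lborel (dif h \<phi>))\<^sup>2 \<le> 4 * norm h powr (n + 2 * s) * (l2 (kmeas s \<rho>) (difs \<phi>))\<^sup>2"
        using V by (simp add: ennreal_mult[symmetric] ennreal_le_iff)
      then have "norm h powr n * (V * (l2 lborel (dif h \<phi>))\<^sup>2) \<le> norm h powr n * (4 * norm h powr (2 * s) * (l2 (kmeas s \<rho>) (difs \<phi>))\<^sup>2)"
        by (simp add: powr_add mult_ac)
      then have "V * (l2 lborel (dif h \<phi>))\<^sup>2 \<le> 4 * norm h powr (2 * s) * (l2 (kmeas s \<rho>) (difs \<phi>))\<^sup>2"
        using False by (subst (asm) mult_le_cancel_left_pos) auto
      then have "(l2 lborel (dif h \<phi>))\<^sup>2 \<le> 4 * norm h powr (2 * s) * (l2 (kmeas s \<rho>) (difs \<phi>))\<^sup>2 / V"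
        using V by (simp add: field_simps)
      also have "\<dots> = (2 / sqrt V * norm h powr s * l2 (kmeas s \<rho>) (difs \<phi>))\<^sup>2"
      proof -
        have "norm h powr (2 * s) = (norm h powr s)\<^sup>2"
          by (simp add: power2_eq_square flip: powr_add)
        then show ?thesis using V by (simp add: power_mult_distrib power_divide)
      qed
      finally show ?thesis
        by (rule power2_le_imp_le) (use V in auto)
    qed
  qed
qed

subsection \<open>Energy estimates\<close>

definition nbh :: "'a::metric_space set \<Rightarrow> real \<Rightarrow> 'a set" where
  "nbh S t = {x. infdist x S \<le> t}"

text \<open>The parameter \<open>a\<close> counts layers of width \<open>d\<close>: the value is 1
  up to distance \<open>a * d\<close> from \<open>S\<close> and falls linearly to 0 within the next
  layer, so the Lipschitz constant is 1 / d whatever the layer.\<close>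

definition cutoff :: "'a::metric_space set \<Rightarrow> real \<Rightarrow> real \<Rightarrow> 'a \<Rightarrow> real" where
  "cutoff S d a x = max 0 (min 1 (a + 1 - infdist x S / d))"

lemma cutoff_bounds: "0 \<le> cutoff S d a x" "cutoff S d a x \<le> 1" "\<bar>cutoff S d a x\<bar> \<le> 1"
  by (auto simp: cutoff_def)

lemma cutoff_eq_1: "0 < d \<Longrightarrow> x \<in> nbh S (a * d) \<Longrightarrow> cutoff S d a x = 1"
  by (simp add: cutoff_def nbh_def field_simps)

lemma cutoff_eq_0: "0 < d \<Longrightarrow> x \<notin> nbh S ((a + 1) * d) \<Longrightarrow> cutoff S d a x = 0"
  by (simp add: cutoff_def nbh_def field_simps)

lemma cutoff_lipschitz:
  fixes x y :: "'a::real_normed_vector"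
  assumes "0 < d"
  shows "\<bar>cutoff S d a x - cutoff S d a y\<bar> \<le> 1 / d * norm (x - y)"
proof -
  have "\<bar>infdist x S / d - infdist y S / d\<bar> \<le> norm (x - y) / d"
    using infdist_triangle_abs[of x S y] assms
    by (simp add: dist_norm divide_right_mono flip: diff_divide_distrib)
  moreover have "\<bar>max 0 (min 1 (c - p)) - max 0 (min 1 (c - q))\<bar> \<le> \<bar>p - q\<bar>" for c p q :: real
    by (simp add: max_def min_def abs_if)
  ultimately show ?thesis unfolding cutoff_def by (metis order_trans times_divide_eq_left mult_1)
qed

lemma cutoff_measurable [measurable]: "cutoff S d a \<in> borel_measurable borel"
  unfolding cutoff_def divide_inverse by (intro borel_measurable_continuous_onI continuous_intros)

lemma nbh_mono: "x \<in> nbh S t \<Longrightarrow> t \<le> t' \<Longrightarrow> x \<in> nbh S t'"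
  by (simp add: nbh_def)

lemma nbh_add:
  fixes x k :: "'a::real_normed_vector"
  assumes "x \<in> nbh S t" "norm k \<le> e"
  shows "x + k \<in> nbh S (t + e)"
  using assms infdist_triangle[of "x + k" S x] by (simp add: nbh_def dist_norm)

lemma nbh_self: "x \<in> S \<Longrightarrow> 0 \<le> t \<Longrightarrow> x \<in> nbh S t"
  by (simp add: nbh_def)

lemma AE_kmeas_ball: "AE p in kmeas s \<rho>. norm (fst p) < \<rho>"
  unfolding kmeas_def
  by (subst AE_density) (auto simp: wgt_def indicator_def case_prod_beta split: if_splits)

section \<open>The truncated form and the first energy bound\<close>

definition bil :: "real \<Rightarrow> real \<Rightarrow> ('a::euclidean_space \<times> 'a \<Rightarrow> real) \<Rightarrow> ('a \<Rightarrow> real) \<Rightarrow> ('a \<Rightarrow> real) \<Rightarrow> real" where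
  "bil s \<rho> a u \<phi> = (\<integral>p. difs u p * difs \<phi> p * a p \<partial>kmeas s \<rho>)"

text \<open>The form of \<open>u\<close>, tested on functions supported in \<open>W\<close>, acts
  like an L2 function of norm at most \<open>A\<close>. Only the L2 norm of the test function
  enters, never its energy; this single condition stands for the equation, its right-hand side and
  the far part of the kernel.\<close>

definition form_bounded ::
  "real \<Rightarrow> real \<Rightarrow> ('a::euclidean_space \<times> 'a \<Rightarrow> real) \<Rightarrow> 'a set \<Rightarrow> real \<Rightarrow> ('a \<Rightarrow> real) \<Rightarrow> bool" where
  "form_bounded s \<rho> a W A u \<longleftrightarrow>
    (\<forall>\<phi>. frac_sobolev s \<rho> \<phi> \<longrightarrow> (\<forall>x. x \<notin> W \<longrightarrow> \<phi> x = 0) \<longrightarrow> \<bar>bil s \<rho> a u \<phi>\<bar> \<le> A * l2 lborel \<phi>)"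

lemma form_boundedD:
  assumes "form_bounded s \<rho> a W A u" "frac_sobolev s \<rho> \<phi>" "\<And>x. x \<notin> W \<Longrightarrow> \<phi> x = 0"
  shows "\<bar>bil s \<rho> a u \<phi>\<bar> \<le> A * l2 lborel \<phi>"
  using assms by (auto simp: form_bounded_def)

lemma triple_integral_bound:
  assumes "sqint M f" "sqint M g" "a \<in> borel_measurable M" "AE p in M. \<bar>a p\<bar> \<le> c" "0 \<le> c"
  shows "integrable M (\<lambda>p. f p * g p * a p)" "\<bar>\<integral>p. f p * g p * a p \<partial>M\<bar> \<le> c * (l2 M f * l2 M g)"
proof -
  note ag = sqint_bounded_mult[OF assms(2-5)]
  have eq: "(\<lambda>p. f p * g p * a p) = (\<lambda>p. f p * (a p * g p))" by (simp add: mult_ac)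
  show "integrable M (\<lambda>p. f p * g p * a p)"
    unfolding eq by (rule sqint_mult_integrable[OF assms(1) ag(1)])
  have "\<bar>\<integral>p. f p * g p * a p \<partial>M\<bar> \<le> l2 M f * l2 M (\<lambda>p. a p * g p)"
    unfolding eq by (rule Cauchy_Schwarz_l2(2)[OF assms(1) ag(1)])
  also have "\<dots> \<le> l2 M f * (c * l2 M g)"
    by (rule mult_left_mono[OF ag(2)]) simp
  finally show "\<bar>\<integral>p. f p * g p * a p \<partial>M\<bar> \<le> c * (l2 M f * l2 M g)" by (simp add: mult_ac)
qed

text \<open>Pairs farther apart than \<open>\<rho>\<close> carry no weight, and a pair at which
  \<open>\<phi>\<close> vanishes twice contributes nothing, so \<open>u\<close> matters only within
  \<open>\<rho>\<close> of the support of \<open>\<phi>\<close>.\<close>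

lemma bil_cong:
  fixes u :: "'a::euclidean_space \<Rightarrow> real"
  assumes "u \<in> borel_measurable borel" "v \<in> borel_measurable borel" "\<phi> \<in> borel_measurable borel"
    and "a \<in> borel_measurable (borel \<Otimes>\<^sub>M borel)"
    and "\<And>k x. norm k < \<rho> \<Longrightarrow> \<phi> x \<noteq> 0 \<or> \<phi> (x + k) \<noteq> 0 \<Longrightarrow> u x = v x \<and> u (x + k) = v (x + k)"
  shows "bil s \<rho> a u \<phi> = bil s \<rho> a v \<phi>"
proof -
  note [measurable] = assms(1-4)
  have [measurable]: "a \<in> borel_measurable (kmeas s \<rho>)" by measurable
  show ?thesis
    unfolding bil_def
  proof (rule integral_cong_AE)
    show "AE p in kmeas s \<rho>. difs u p * difs \<phi> p * a p = difs v p * difs \<phi> p * a p"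
      using AE_kmeas_ball
    proof eventually_elim
      case (elim p)
      show ?case using assms(5)[OF elim, of "snd p"]
        by (cases "\<phi> (snd p) \<noteq> 0 \<or> \<phi> (snd p + fst p) \<noteq> 0") (auto simp: difs_def dif_def case_prod_beta)
    qed
  qed measurable
qed

text \<open>The pointwise identity
  \<open>(p - q) (a\<^sup>2 p - b\<^sup>2 q) = (a p - b q)\<^sup>2 - p q (a - b)\<^sup>2\<close> avoids any absorption of gradient terms.\<close>

lemma caccioppoli:
  fixes u \<eta> :: "'a::euclidean_space \<Rightarrow> real"
  assumes "s < 1" "0 < \<rho>" and u: "frac_sobolev s \<rho> u"
    and \<eta>: "\<eta> \<in> borel_measurable borel" "\<And>x. \<bar>\<eta> x\<bar> \<le> 1" "\<And>x y. \<bar>\<eta> x - \<eta> y\<bar> \<le> B * norm (x - y)" "0 \<le> B"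
    and a: "a \<in> borel_measurable (borel \<Otimes>\<^sub>M borel)" "AE p in kmeas s \<rho>. l \<le> a p \<and> a p \<le> L" "0 < l" "l \<le> L"
  shows "l * (l2 (kmeas s \<rho>) (difs (\<lambda>x. \<eta> x * u x)))\<^sup>2
    \<le> bil s \<rho> a u (\<lambda>x. \<eta> x * (\<eta> x * u x)) + L * (B\<^sup>2 * second_moment TYPE('a) s \<rho>) * (l2 lborel u)\<^sup>2"
proof -
  let ?M = "kmeas s \<rho>"
  note [measurable] = frac_sobolevD(1)[OF u] \<eta>(1) a(1)
  have am [measurable]: "a \<in> borel_measurable ?M" by measurable
  have aL: "AE p in ?M. \<bar>a p\<bar> \<le> \<bar>L\<bar>" using a(2) by eventually_elim (use a(3) in auto)
  note \<eta>u = frac_sobolev_mult(1)[OF assms(1,2) u \<eta>]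
  note \<eta>\<eta>u = frac_sobolev_mult(1)[OF assms(1,2) \<eta>u \<eta>]
  note i1 = triple_integral_bound(1)[OF frac_sobolevD(3)[OF u] frac_sobolevD(3)[OF \<eta>\<eta>u] am aL abs_ge_zero]
  note i2 = triple_integral_bound(1)[OF frac_sobolevD(3)[OF \<eta>u] frac_sobolevD(3)[OF \<eta>u] am aL abs_ge_zero]
  note m = l2_moment_slice[OF assms(1,2) frac_sobolevD(2)[OF u]]
  have i3: "integrable ?M (\<lambda>p. (norm (fst p) * u (snd p + fst p)) * (norm (fst p) * u (snd p)))"
    by (rule sqint_mult_integrable[OF m(3,1)])
  have pt: "l * (difs (\<lambda>x. \<eta> x * u x) p * difs (\<lambda>x. \<eta> x * u x) p)
     \<le> difs u p * difs (\<lambda>x. \<eta> x * (\<eta> x * u x)) p * a p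
       + L * B\<^sup>2 * \<bar>(norm (fst p) * u (snd p + fst p)) * (norm (fst p) * u (snd p))\<bar>"
    if ap: "l \<le> a p \<and> a p \<le> L" for p
  proof -
    obtain k x where p: "p = (k, x)" by force
    define P where "P = u (x + k)"
    define Q where "Q = u x"
    define e where "e = \<eta> (x + k)"
    define f where "f = \<eta> x"
    have id: "(P - Q) * (e * (e * P) - f * (f * Q)) = (e * P - f * Q) * (e * P - f * Q) - (P * Q) * (e - f)\<^sup>2"
      by (simp add: power2_eq_square algebra_simps)
    have "l * ((e * P - f * Q) * (e * P - f * Q)) \<le> a p * ((e * P - f * Q) * (e * P - f * Q))"
      using ap by (intro mult_right_mono) auto
    \<comment> \<open>The sign of \<open>P * Q\<close> is unknown, so this term takes the upper
      bound on the kernel, while the square above takes the lower one. The increment of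
      \<open>\<eta>\<close> supplies |k| twice, once for each of the factors \<open>P\<close> and
      \<open>Q\<close>; both are then square integrable by the second moment.\<close>
    moreover have "(a p * (P * Q)) * (e - f)\<^sup>2 \<le> L * B\<^sup>2 * \<bar>(norm k * P) * (norm k * Q)\<bar>"
    proof -
      have "\<bar>e - f\<bar> \<le> B * norm k" using \<eta>(3)[of "x + k" x] by (simp add: e_def f_def)
      then have "(e - f)\<^sup>2 \<le> (B * norm k)\<^sup>2"
        by (metis abs_ge_zero power2_abs power_mono)
      moreover have "a p * (P * Q) \<le> L * \<bar>P * Q\<bar>"
        by (rule order_trans[of _ "a p * \<bar>P * Q\<bar>"]) (use ap a(3) in \<open>auto intro!: mult_left_mono mult_right_mono\<close>)
      ultimately have "(a p * (P * Q)) * (e - f)\<^sup>2 \<le> (L * \<bar>P * Q\<bar>) * (e - f)\<^sup>2"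
        by (intro mult_right_mono) auto
      also have "\<dots> \<le> (L * \<bar>P * Q\<bar>) * (B * norm k)\<^sup>2"
        using \<open>(e - f)\<^sup>2 \<le> (B * norm k)\<^sup>2\<close> a(3,4) by (intro mult_left_mono) auto
      also have "\<dots> = L * B\<^sup>2 * \<bar>(norm k * P) * (norm k * Q)\<bar>"
        by (simp add: abs_mult power2_eq_square)
      finally show ?thesis .
    qed
    moreover have "(P - Q) * (e * (e * P) - f * (f * Q)) * a p
       = a p * ((e * P - f * Q) * (e * P - f * Q)) - (a p * (P * Q)) * (e - f)\<^sup>2"
      unfolding id by (simp add: algebra_simps)
    ultimately show ?thesis
      by (simp add: p difs_def dif_def P_def Q_def e_def f_def)
  qed
  have "l * (l2 ?M (difs (\<lambda>x. \<eta> x * u x)))\<^sup>2 = (\<integral>p. l * (difs (\<lambda>x. \<eta> x * u x) p * difs (\<lambda>x. \<eta> x * u x) p) \<partial>?M)"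
    by (subst l2_square) (simp add: power2_eq_square)
  also have "\<dots> \<le> (\<integral>p. difs u p * difs (\<lambda>x. \<eta> x * (\<eta> x * u x)) p * a p
       + L * B\<^sup>2 * \<bar>(norm (fst p) * u (snd p + fst p)) * (norm (fst p) * u (snd p))\<bar> \<partial>?M)"
  proof (rule integral_mono_AE)
    show "integrable ?M (\<lambda>p. l * (difs (\<lambda>x. \<eta> x * u x) p * difs (\<lambda>x. \<eta> x * u x) p))"
      using sqint_mult_integrable[OF frac_sobolevD(3)[OF \<eta>u] frac_sobolevD(3)[OF \<eta>u]] by simp
    show "integrable ?M (\<lambda>p. difs u p * difs (\<lambda>x. \<eta> x * (\<eta> x * u x)) p * a p
       + L * B\<^sup>2 * \<bar>(norm (fst p) * u (snd p + fst p)) * (norm (fst p) * u (snd p))\<bar>)"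
      using i1 i3 by (intro Bochner_Integration.integrable_add integrable_mult_right integrable_abs) auto
    show "AE p in ?M. l * (difs (\<lambda>x. \<eta> x * u x) p * difs (\<lambda>x. \<eta> x * u x) p)
       \<le> difs u p * difs (\<lambda>x. \<eta> x * (\<eta> x * u x)) p * a p
         + L * B\<^sup>2 * \<bar>(norm (fst p) * u (snd p + fst p)) * (norm (fst p) * u (snd p))\<bar>"
      using a(2) by eventually_elim (rule pt)
  qed
  also have "\<dots> = bil s \<rho> a u (\<lambda>x. \<eta> x * (\<eta> x * u x))
      + L * B\<^sup>2 * (\<integral>p. \<bar>(norm (fst p) * u (snd p + fst p)) * (norm (fst p) * u (snd p))\<bar> \<partial>?M)"
    unfolding bil_def by (subst Bochner_Integration.integral_add[OF i1]) (use i3 in auto)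
  also have "\<dots> \<le> bil s \<rho> a u (\<lambda>x. \<eta> x * (\<eta> x * u x))
      + L * B\<^sup>2 * (second_moment TYPE('a) s \<rho> * (l2 lborel u)\<^sup>2)"
  proof -
    have "(\<integral>p. \<bar>(norm (fst p) * u (snd p + fst p)) * (norm (fst p) * u (snd p))\<bar> \<partial>?M)
      \<le> l2 ?M (\<lambda>p. norm (fst p) * u (snd p + fst p)) * l2 ?M (\<lambda>p. norm (fst p) * u (snd p))"
      by (rule Cauchy_Schwarz_l2(1)[OF m(3,1)])
    also have "\<dots> \<le> (sqrt (second_moment TYPE('a) s \<rho>) * l2 lborel u) * (sqrt (second_moment TYPE('a) s \<rho>) * l2 lborel u)"
      by (intro mult_mono m) auto
    also have "\<dots> = second_moment TYPE('a) s \<rho> * (l2 lborel u)\<^sup>2"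
    proof -
      have "(sqrt M * c) * (sqrt M * c) = M * c\<^sup>2" if "0 \<le> M" for M c :: real
        using that by (simp add: power2_eq_square mult_ac flip: mult.assoc[of "sqrt M" "sqrt M"])
      then show ?thesis by simp
    qed
    finally show ?thesis using a(3,4) by (intro add_left_mono mult_left_mono) auto
  qed
  finally show ?thesis by (simp add: mult_ac)
qed

text \<open>If \<open>E\<close> exceeds \<open>X\<close>, then the square of \<open>X\<close> is at
  most \<open>X * E\<close> and the inequality can be divided by \<open>E\<close>; otherwise the
  claim holds because the factor is at least 1.\<close>

lemma quadratic_absorb:
  fixes l p q X E :: real
  assumes "0 < l" "0 \<le> p" "0 \<le> q" "0 \<le> X" "l * E\<^sup>2 \<le> p * X * E + q * X\<^sup>2"
  shows "E \<le> ((p + q) / l + 1) * X"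
proof (cases "E \<le> X")
  case True
  have "0 \<le> (p + q) / l * X" using assms by simp
  then show ?thesis using True by (simp add: algebra_simps)
next
  case False
  then have E: "0 < E" using assms(4) by simp
  have "q * X\<^sup>2 \<le> q * X * E"
    using False assms by (simp add: power2_eq_square mult.assoc mult_left_mono)
  then have "(l * E) * E \<le> ((p + q) * X) * E"
    using assms(5) by (simp add: power2_eq_square algebra_simps)
  then have "l * E \<le> (p + q) * X" using E by simp
  then have "E \<le> (p + q) / l * X" using assms(1) by (simp add: field_simps)
  also have "\<dots> \<le> ((p + q) / l + 1) * X" using assms(4) by (simp add: algebra_simps)
  finally show ?thesis .
qed

text \<open>Testing with \<open>\<eta> * (\<eta> * u)\<close>, whose L2 norm is at most that of
  \<open>u\<close>: since \<open>A\<close> dominates both the form and the norm, the form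
  contributes A^2 and the error term of the Caccioppoli inequality \<open>m\<close> times
  A^2.\<close>

lemma local_energy_estimate:
  fixes u \<eta> :: "'a::euclidean_space \<Rightarrow> real"
  assumes "s < 1" "0 < \<rho>" and u: "frac_sobolev s \<rho> u" "l2 lborel u \<le> A"
    and \<eta>: "\<eta> \<in> borel_measurable borel" "\<And>x. \<bar>\<eta> x\<bar> \<le> 1" "\<And>x y. \<bar>\<eta> x - \<eta> y\<bar> \<le> B * norm (x - y)" "0 \<le> B"
    and a: "a \<in> borel_measurable (borel \<Otimes>\<^sub>M borel)" "AE p in kmeas s \<rho>. l \<le> a p \<and> a p \<le> L" "0 < l" "l \<le> L"
    and H: "form_bounded s \<rho> a W A u"
    and W: "\<And>x. x \<notin> W \<Longrightarrow> \<eta> x = 0"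
  shows "l2 (kmeas s \<rho>) (difs (\<lambda>x. \<eta> x * u x)) \<le> sqrt ((1 + L * (B\<^sup>2 * second_moment TYPE('a) s \<rho>)) / l) * A"
proof -
  define m where "m = L * (B\<^sup>2 * second_moment TYPE('a) s \<rho>)"
  have m0: "0 \<le> m" using a by (simp add: m_def)
  have A0: "0 \<le> A" using u(2) l2_nonneg order_trans by blast
  note \<eta>u = frac_sobolev_mult(1)[OF assms(1,2) u(1) \<eta>]
  note \<eta>\<eta>u = frac_sobolev_mult(1)[OF assms(1,2) \<eta>u \<eta>]
  have le: "l2 lborel (\<lambda>x. \<eta> x * v x) \<le> l2 lborel v" if "sqint lborel v" for v
    using sqint_bounded_mult(2)[OF that, of \<eta> 1] \<eta>(1,2) by simp
  have "l2 lborel (\<lambda>x. \<eta> x * (\<eta> x * u x)) \<le> A"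
    using le[OF frac_sobolevD(2)[OF \<eta>u]] le[OF frac_sobolevD(2)[OF u(1)]] u(2) by linarith
  then have "A * l2 lborel (\<lambda>x. \<eta> x * (\<eta> x * u x)) \<le> A * A" using A0 by (rule mult_left_mono)
  moreover have "\<bar>bil s \<rho> a u (\<lambda>x. \<eta> x * (\<eta> x * u x))\<bar> \<le> A * l2 lborel (\<lambda>x. \<eta> x * (\<eta> x * u x))"
    by (rule form_boundedD[OF H \<eta>\<eta>u]) (simp add: W)
  moreover have "m * (l2 lborel u)\<^sup>2 \<le> m * A\<^sup>2"
    using m0 u(2) by (intro mult_left_mono power_mono) auto
  ultimately have "l * (l2 (kmeas s \<rho>) (difs (\<lambda>x. \<eta> x * u x)))\<^sup>2 \<le> (1 + m) * A\<^sup>2"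
    using caccioppoli[OF assms(1,2) u(1) \<eta> a] unfolding m_def[symmetric]
    by (simp add: algebra_simps power2_eq_square)
  then have "(l2 (kmeas s \<rho>) (difs (\<lambda>x. \<eta> x * u x)))\<^sup>2 \<le> (1 + m) * A\<^sup>2 / l"
    using a(3) by (simp add: field_simps)
  also have "\<dots> = (sqrt ((1 + m) / l) * A)\<^sup>2"
    using m0 a(3) by (simp add: power_mult_distrib)
  finally show ?thesis
    unfolding m_def by (rule power2_le_imp_le) (use A0 m0 a(3) in \<open>simp add: m_def\<close>)
qed

text \<open>Testing with the difference \<open>\<psi>(\<cdot> - h) - \<psi>\<close>, \<open>\<psi> = \<eta>\<^sup>2 \<Delta>\<^sub>h w\<close>, transfers the translation to the kernel; both the
  regularity of the kernel and the \<open>L\<^sup>2\<close> bound of the test function contribute one factor \<open>|h|\<^sup>s\<close>.\<close>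

lemma difference_energy_estimate:
  fixes w \<eta> :: "'a::euclidean_space \<Rightarrow> real"
  assumes "s < 1" "0 < \<rho>" and w: "frac_sobolev s \<rho> w" "l2 (kmeas s \<rho>) (difs w) \<le> C1 * A" "0 \<le> A" "0 \<le> C1"
    and \<eta>: "\<eta> \<in> borel_measurable borel" "\<And>x. \<bar>\<eta> x\<bar> \<le> 1" "\<And>x y. \<bar>\<eta> x - \<eta> y\<bar> \<le> B * norm (x - y)" "0 \<le> B"
    and a: "a \<in> borel_measurable (borel \<Otimes>\<^sub>M borel)" "AE p in kmeas s \<rho>. l \<le> a p \<and> a p \<le> L" "0 < l" "l \<le> L"
    and fb: "form_bounded s \<rho> a W A w"
    and h: "norm h \<le> \<rho>" "AE p in kmeas s \<rho>. \<bar>a (fst p, snd p + - h) - a p\<bar> \<le> \<Gamma> * norm h powr s" "0 \<le> \<Gamma>"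
    and W: "\<And>x. \<eta> x \<noteq> 0 \<Longrightarrow> x \<in> W \<and> x + h \<in> W"
    and C3: "0 \<le> C3" "\<And>(\<phi> :: 'a \<Rightarrow> real) h. frac_sobolev s \<rho> \<phi> \<Longrightarrow> norm h \<le> \<rho> \<Longrightarrow>
     l2 lborel (dif h \<phi>) \<le> C3 * norm h powr s * l2 (kmeas s \<rho>) (difs \<phi>)"
  shows "l2 (kmeas s \<rho>) (difs (\<lambda>x. \<eta> x * dif h w x))
    \<le> (((C3 + \<Gamma> * C1) + ((C3 + \<Gamma> * C1) * (B * sqrt (second_moment TYPE('a) s \<rho>) * (C3 * C1))
         + L * (B\<^sup>2 * second_moment TYPE('a) s \<rho>) * (C3 * C1)\<^sup>2)) / l + 1) * (norm h powr s * A)"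
proof -
  let ?M = "kmeas s \<rho>"
  define m where "m = second_moment TYPE('a) s \<rho>"
  have m0: "0 \<le> m" by (simp add: m_def)
  define H where "H = norm h powr s"
  have H0: "0 \<le> H" by (simp add: H_def)
  define v where "v = dif h w"
  define \<psi> where "\<psi> = (\<lambda>x. \<eta> x * (\<eta> x * v x))"
  define E where "E = l2 ?M (difs (\<lambda>x. \<eta> x * v x))"
  have fv: "frac_sobolev s \<rho> v" unfolding v_def by (rule frac_sobolev_dif[OF w(1)])
  note \<eta>v = frac_sobolev_mult(1)[OF assms(1,2) fv \<eta>]
  have f\<psi>: "frac_sobolev s \<rho> \<psi>" unfolding \<psi>_def by (rule frac_sobolev_mult(1)[OF assms(1,2) \<eta>v \<eta>])
  define \<psi>' where "\<psi>' = (\<lambda>x. \<psi> (x + - h))"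
  have f\<psi>': "frac_sobolev s \<rho> \<psi>'" unfolding \<psi>'_def by (rule frac_sobolev_translate(1)[OF f\<psi>])
  have e\<psi>': "l2 ?M (difs \<psi>') = l2 ?M (difs \<psi>)" unfolding \<psi>'_def by (rule frac_sobolev_translate(2)[OF f\<psi>])
  note [measurable] = frac_sobolevD(1)[OF w(1)] frac_sobolevD(1)[OF f\<psi>] frac_sobolevD(1)[OF f\<psi>'] a(1) \<eta>(1)
  have am [measurable]: "a \<in> borel_measurable ?M" by measurable
  have aL: "AE p in ?M. \<bar>a p\<bar> \<le> L" using a(2) by eventually_elim (use a(3) in auto)
  have L0: "0 \<le> L" using a(3,4) by simp
  \<comment> \<open>A first difference gains only |h|^s from the energy of \<open>w\<close>; this
    serves for the lower-order terms.\<close>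
  have vle: "l2 lborel v \<le> C3 * C1 * (H * A)"
  proof -
    have "l2 lborel v \<le> C3 * H * l2 ?M (difs w)" unfolding v_def H_def by (rule C3(2)[OF w(1) h(1)])
    also have "\<dots> \<le> C3 * H * (C1 * A)" by (intro mult_left_mono w(2)) (use C3(1) H0 in auto)
    finally show ?thesis by (simp add: mult_ac)
  qed
  have \<psi>le: "l2 ?M (difs \<psi>) \<le> E + B * sqrt m * (C3 * C1) * (H * A)"
  proof -
    have "l2 lborel (\<lambda>x. \<eta> x * v x) \<le> l2 lborel v"
      using sqint_bounded_mult(2)[OF frac_sobolevD(2)[OF fv], of \<eta> 1] \<eta>(1,2) by simp
    then have "B * sqrt m * l2 lborel (\<lambda>x. \<eta> x * v x) \<le> B * sqrt m * (C3 * C1 * (H * A))"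
      using vle \<eta>(4) m0 by (intro mult_left_mono) auto
    then show ?thesis
      using frac_sobolev_mult(2)[OF assms(1,2) \<eta>v \<eta>] unfolding \<psi>_def E_def m_def by (simp add: mult_ac)
  qed
  \<comment> \<open>In the term with \<open>w (x + h)\<close> the substitution of
    \<open>x - h\<close> for \<open>x\<close> puts the translation on \<open>\<psi>\<close> and on
    the kernel. Replacing the translated kernel by the original one leaves the error
    \<open>R\<close>.\<close>
  define R where "R = (\<integral>p. difs w p * difs \<psi>' p * (a (fst p, snd p + - h) - a p) \<partial>?M)"
  have shifted: "bil s \<rho> a v \<psi> = bil s \<rho> a w (\<lambda>x. \<psi>' x - \<psi> x) + R"
    and R: "\<bar>R\<bar> \<le> \<Gamma> * H * (l2 ?M (difs w) * l2 ?M (difs \<psi>'))"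
  proof -
    have am' [measurable]: "(\<lambda>p. a (fst p, snd p + - h)) \<in> borel_measurable ?M" by measurable
    have aL': "AE p in ?M. \<bar>a (fst p, snd p + - h)\<bar> \<le> L" by (rule AE_kmeas_shift[OF aL])
    have ad: "(\<lambda>p. a (fst p, snd p + - h) - a p) \<in> borel_measurable ?M" by measurable
    have G0: "0 \<le> \<Gamma> * H" using h(3) H0 by simp
    note w3 = frac_sobolevD(3)[OF w(1)] and p3 = frac_sobolevD(3)[OF f\<psi>] and p3' = frac_sobolevD(3)[OF f\<psi>']
    note w3' = frac_sobolevD(3)[OF frac_sobolev_translate(1)[OF w(1), of h]]
    note ib = triple_integral_bound(1)[OF _ _ am aL L0]
    show "\<bar>R\<bar> \<le> \<Gamma> * H * (l2 ?M (difs w) * l2 ?M (difs \<psi>'))"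
      using triple_integral_bound(2)[OF w3 p3' ad _ G0] h(2) unfolding H_def R_def by simp
    have "bil s \<rho> a v \<psi> = (\<integral>p. difs (\<lambda>x. w (x + h)) p * difs \<psi> p * a p - difs w p * difs \<psi> p * a p \<partial>?M)"
      unfolding bil_def
      by (intro Bochner_Integration.integral_cong) (auto simp: v_def difs_def dif_def algebra_simps)
    also have "\<dots> = (\<integral>p. difs (\<lambda>x. w (x + h)) p * difs \<psi> p * a p \<partial>?M) - bil s \<rho> a w \<psi>"
      unfolding bil_def by (rule Bochner_Integration.integral_diff[OF ib[OF w3' p3] ib[OF w3 p3]])
    also have "(\<integral>p. difs (\<lambda>x. w (x + h)) p * difs \<psi> p * a p \<partial>?M)
       = (\<integral>p. (\<lambda>p. difs w p * difs \<psi>' p * a (fst p, snd p + - h)) (fst p, snd p + h) \<partial>?M)"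
      by (intro Bochner_Integration.integral_cong) (auto simp: \<psi>'_def difs_def dif_def algebra_simps)
    also have "\<dots> = (\<integral>p. difs w p * difs \<psi>' p * a (fst p, snd p + - h) \<partial>?M)"
      by (rule integral_kmeas_shift(1)) measurable
    also have "\<dots> = (\<integral>p. difs w p * difs \<psi>' p * a p + difs w p * difs \<psi>' p * (a (fst p, snd p + - h) - a p) \<partial>?M)"
      by (intro Bochner_Integration.integral_cong) (auto simp: algebra_simps)
    also have "\<dots> = bil s \<rho> a w \<psi>' + R"
      unfolding bil_def R_def using triple_integral_bound(1)[OF w3 p3' ad _ G0] h(2) unfolding H_def
      by (intro Bochner_Integration.integral_add ib[OF w3 p3']) simp
    also have "bil s \<rho> a w \<psi>' + R - bil s \<rho> a w \<psi> = (bil s \<rho> a w \<psi>' - bil s \<rho> a w \<psi>) + R" by simp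
    also have "bil s \<rho> a w \<psi>' - bil s \<rho> a w \<psi> = bil s \<rho> a w (\<lambda>x. \<psi>' x - \<psi> x)"
      unfolding bil_def
      by (subst Bochner_Integration.integral_diff[OF ib[OF w3 p3'] ib[OF w3 p3], symmetric],
          intro Bochner_Integration.integral_cong) (auto simp: difs_def dif_def algebra_simps)
    finally show "bil s \<rho> a v \<psi> = bil s \<rho> a w (\<lambda>x. \<psi>' x - \<psi> x) + R" .
  qed
  have "\<bar>bil s \<rho> a w (\<lambda>x. \<psi>' x - \<psi> x)\<bar> \<le> A * l2 lborel (\<lambda>x. \<psi>' x - \<psi> x)"
  proof (rule form_boundedD[OF fb frac_sobolev_diff[OF f\<psi>' f\<psi>]])
    fix x assume "x \<notin> W"
    then have "\<eta> x = 0" "\<eta> (x + - h) = 0" using W[of x] W[of "x + - h"] by auto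
    then show "\<psi>' x - \<psi> x = 0" by (simp add: \<psi>_def \<psi>'_def)
  qed
  also have "(\<lambda>x. \<psi>' x - \<psi> x) = dif (- h) \<psi>" by (simp add: dif_def[abs_def] \<psi>'_def)
  also have "A * l2 lborel (dif (- h) \<psi>) \<le> A * (C3 * H * l2 ?M (difs \<psi>))"
    using C3(2)[OF f\<psi>, of "- h"] h(1) w(3) by (intro mult_left_mono) (simp_all add: H_def)
  finally have T1: "\<bar>bil s \<rho> a w (\<lambda>x. \<psi>' x - \<psi> x)\<bar> \<le> A * (C3 * H * l2 ?M (difs \<psi>))"
    by (simp add: dif_def[abs_def] \<psi>'_def)
  have "\<Gamma> * H * (l2 ?M (difs w) * l2 ?M (difs \<psi>')) \<le> \<Gamma> * H * ((C1 * A) * l2 ?M (difs \<psi>))"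
    unfolding e\<psi>' using h(3) H0 w by (intro mult_left_mono mult_right_mono) auto
  then have "bil s \<rho> a v \<psi> \<le> (C3 + \<Gamma> * C1) * (H * A) * l2 ?M (difs \<psi>)"
    using shifted R T1 by (simp add: algebra_simps)
  also have "\<dots> \<le> (C3 + \<Gamma> * C1) * (H * A) * (E + B * sqrt m * (C3 * C1) * (H * A))"
    using C3(1) h(3) w H0 by (intro mult_left_mono \<psi>le) auto
  finally have b: "bil s \<rho> a v \<psi> \<le> (C3 + \<Gamma> * C1) * (H * A) * (E + B * sqrt m * (C3 * C1) * (H * A))" .
  have "(l2 lborel v)\<^sup>2 \<le> (C3 * C1 * (H * A))\<^sup>2" by (intro power_mono vle) simp
  then have "L * (B\<^sup>2 * m) * (l2 lborel v)\<^sup>2 \<le> L * (B\<^sup>2 * m) * (C3 * C1 * (H * A))\<^sup>2"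
    using L0 m0 by (intro mult_left_mono) auto
  then have "l * E\<^sup>2 \<le> (C3 + \<Gamma> * C1) * (H * A) * (E + B * sqrt m * (C3 * C1) * (H * A)) + L * (B\<^sup>2 * m) * (C3 * C1 * (H * A))\<^sup>2"
    using caccioppoli[OF assms(1,2) fv \<eta> a] b unfolding E_def \<psi>_def m_def by linarith
  also have "\<dots> = (C3 + \<Gamma> * C1) * (H * A) * E + ((C3 + \<Gamma> * C1) * (B * sqrt m * (C3 * C1)) + L * (B\<^sup>2 * m) * (C3 * C1)\<^sup>2) * (H * A)\<^sup>2"
    by (simp add: algebra_simps power2_eq_square)
  \<comment> \<open>The test function \<open>\<eta> * (\<eta> * v)\<close> has energy at most
    \<open>E\<close> plus a multiple of \<open>H * A\<close>, so \<open>E\<close> occurs linearly on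
    the right and \<open>quadratic_absorb\<close> applies with \<open>X = H * A\<close>.\<close>
  finally have "E \<le> (((C3 + \<Gamma> * C1) + ((C3 + \<Gamma> * C1) * (B * sqrt m * (C3 * C1)) + L * (B\<^sup>2 * m) * (C3 * C1)\<^sup>2)) / l + 1) * (H * A)"
    using a(3) C3(1) h(3) w(3,4) H0 m0 L0 \<eta>(4)
    by (intro quadratic_absorb) (auto intro!: add_nonneg_nonneg mult_nonneg_nonneg)
  then show ?thesis by (simp add: E_def v_def m_def H_def)
qed

section \<open>Good shifts and mixed second differences\<close>

lemma AE_lborel_reflect:
  fixes h :: "'a::euclidean_space"
  assumes "AE x in lborel. P x"
  shows "AE x in lborel. P (h - x)"
proof -
  have eq: "distr lborel borel (\<lambda>x. h - x) = (lborel :: 'a measure)"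
    using lborel_affine[of "-1" h] by (simp add: density_1)
  have "AE x in distr lborel borel (\<lambda>x::'a. h - x). P x"
    by (subst eq) (rule assms)
  from AE_distrD[OF _ this] show ?thesis by simp
qed

text \<open>The good shifts and their reflections \<open>h - x\<close> both have full measure, so
  some point of the ball with diameter from 0 to \<open>h\<close> is good together with its
  reflection. Every nonzero shift is thus a sum of two good ones that are no longer than
  itself.\<close>

lemma AE_split_shift:
  fixes h :: "'a::euclidean_space"
  assumes "AE x in lborel. P x" "h \<noteq> 0"
  obtains h' where "P h'" "P (h - h')" "norm h' \<le> norm h" "norm (h - h') \<le> norm h"
proof -
  have "AE x in lborel. P (h - x)" by (rule AE_lborel_reflect[OF assms(1)])
  with assms(1) have *: "AE x in lborel. P x \<and> P (h - x)" by eventually_elim simp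
  let ?B = "ball (h /\<^sub>R 2) (norm h / 2)"
  have "\<exists>x\<in>?B. P x \<and> P (h - x)"
  proof (rule ccontr)
    assume "\<not> ?thesis"
    then have "AE x in lborel. x \<notin> ?B" using * by (auto elim: AE_mp)
    then have "emeasure lborel ?B = 0" by (subst (asm) AE_iff_measurable[of ?B]) auto
    then show False using assms(2) emeasure_ball[of "norm h / 2" "h /\<^sub>R 2"]
      unit_ball_vol_pos[of "real DIM('a)"] by (simp add: less_le)
  qed
  then obtain x where x: "x \<in> ?B" "P x" "P (h - x)" by blast
  have d: "norm (h /\<^sub>R 2 - x) < norm h / 2" using x(1) by (simp add: dist_norm)
  have "norm x \<le> norm (h /\<^sub>R 2) + norm (x - h /\<^sub>R 2)" by (metis add.commute diff_add_cancel norm_triangle_ineq)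
  then have 1: "norm x \<le> norm h" using d by (simp add: norm_minus_commute)
  have "h /\<^sub>R 2 + h /\<^sub>R 2 = (inverse 2 + inverse 2) *\<^sub>R h" by (rule scaleR_left_distrib[symmetric])
  then have "h - x = h /\<^sub>R 2 + (h /\<^sub>R 2 - x)" by (simp add: add_diff_eq)
  then have "norm (h - x) \<le> norm (h /\<^sub>R 2) + norm (h /\<^sub>R 2 - x)" by (metis norm_triangle_ineq)
  then have 2: "norm (h - x) \<le> norm h" using d by simp
  show thesis by (rule that[OF x(2,3) 1 2])
qed

text \<open>The translation bound is asked for almost every shift, with an exceptional null set of
  pairs that may depend on the shift: this is what Fubini extracts from a condition holding for
  almost all triples.\<close>

definition kernel_regular ::
  "real \<Rightarrow> real \<Rightarrow> real \<Rightarrow> real \<Rightarrow> real \<Rightarrow> ('a::euclidean_space \<times> 'a \<Rightarrow> real) \<Rightarrow> bool" where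
  "kernel_regular s d l L \<Gamma> a \<longleftrightarrow> a \<in> borel_measurable (borel \<Otimes>\<^sub>M borel) \<and>
    (AE p in kmeas s d. l \<le> a p \<and> a p \<le> L) \<and>
    (AE h in lborel. norm h \<le> d \<longrightarrow>
      (AE p in kmeas s d. \<bar>a (fst p, snd p + h) - a p\<bar> \<le> \<Gamma> * norm h powr s))"

text \<open>The interface between the equation and the function spaces: the Sobolev estimates
  further on use nothing else about the solution. \<open>w\<close> is defined on the whole space, so
  translates of it make sense even where they leave \<open>S\<close>.\<close>

definition difference_regular ::
  "real \<Rightarrow> real \<Rightarrow> 'a::euclidean_space set \<Rightarrow> real \<Rightarrow> ('a \<Rightarrow> real) \<Rightarrow> bool" where
  "difference_regular s d S A w \<longleftrightarrow> w \<in> borel_measurable borel \<and> sqint lborel w \<and> l2 lborel w \<le> A \<and>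
    (\<forall>h k. norm h \<le> d \<longrightarrow> norm k \<le> d \<longrightarrow>
      l2 lborel (\<lambda>x. indicator S x * dif k (dif h w) x) \<le> norm h powr s * norm k powr s * A)"

lemma difference_regularD:
  assumes "difference_regular s d S A w"
  shows "w \<in> borel_measurable borel" "sqint lborel w" "l2 lborel w \<le> A" "0 \<le> A"
    "norm h \<le> d \<Longrightarrow> norm k \<le> d \<Longrightarrow>
      l2 lborel (\<lambda>x. indicator S x * dif k (dif h w) x) \<le> norm h powr s * norm k powr s * A"
  using assms order_trans[OF l2_nonneg[of lborel w], of A] by (auto simp: difference_regular_def)

text \<open>The layers, from outside in: \<open>u\<close> is cut off between 5 d and 6 d, so the
  first energy bound uses test functions in \<open>nbh S (6 * d)\<close>. The form of the resulting
  \<open>w\<close> is bounded for test functions in \<open>nbh S (4 * d)\<close>, whose interactions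
  reach at most 5 d, where \<open>w\<close> is \<open>u\<close>. Differences of \<open>w\<close> are
  cut off between 2 d and 3 d, and the shift \<open>h\<close> takes one more layer. On
  \<open>S\<close> two shifts stay within 2 d, where this last cutoff is 1.\<close>

theorem mixed_difference_estimate:
  fixes S :: "'a::euclidean_space set"
  assumes "0 < s" "s < 1" "0 < d" "0 < l" "l \<le> L" "0 \<le> \<Gamma>" and S [measurable]: "S \<in> sets borel"
  obtains C where "0 < C" "\<And>u a A. frac_sobolev s d u \<Longrightarrow> l2 lborel u \<le> A \<Longrightarrow> kernel_regular s d l L \<Gamma> a \<Longrightarrow>
    form_bounded s d a (nbh S (6 * d)) A u \<Longrightarrow> \<exists>w. difference_regular s d S (C * A) w \<and> (\<forall>x\<in>nbh S (5 * d). w x = u x)"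
proof -
  define m where "m = second_moment TYPE('a) s d"
  define B where "B = 1 / d"
  have B0: "0 \<le> B" using assms by (simp add: B_def)
  define C1 where "C1 = sqrt ((1 + L * (B\<^sup>2 * m)) / l)"
  have C10: "0 \<le> C1" using assms by (simp add: C1_def m_def)
  obtain C3 where C3: "0 < C3" "\<And>(\<phi> :: 'a \<Rightarrow> real) h. frac_sobolev s d \<phi> \<Longrightarrow> norm h \<le> d \<Longrightarrow>
     l2 lborel (dif h \<phi>) \<le> C3 * norm h powr s * l2 (kmeas s d) (difs \<phi>)"
    using l2_dif_le_energy[of s, where \<rho> = d and 'a = 'a] assms(1) by (metis less_imp_le)
  define C2 where "C2 = ((C3 + \<Gamma> * C1) + ((C3 + \<Gamma> * C1) * (B * sqrt m * (C3 * C1))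
         + L * (B\<^sup>2 * m) * (C3 * C1)\<^sup>2)) / l + 1"
  have C2: "0 < C2"
    unfolding C2_def using assms C3(1) C10 B0
    by (intro add_nonneg_pos divide_nonneg_pos add_nonneg_nonneg mult_nonneg_nonneg) (auto simp: m_def)
  show thesis
  \<comment> \<open>The factor 2 comes from splitting \<open>h\<close> into two good shifts; the
    summand 1 lets the same constant bound the L2 norm of \<open>w\<close>.\<close>
  proof (rule that[of "2 * (C3 * C2) + 1"])
    show "0 < 2 * (C3 * C2) + 1" using mult_pos_pos[OF C3(1) C2] by simp
  next
    fix u :: "'a \<Rightarrow> real" and a A
    assume u: "frac_sobolev s d u" "l2 lborel u \<le> A"
      and reg: "kernel_regular s d l L \<Gamma> a" and H: "form_bounded s d a (nbh S (6 * d)) A u"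
    have a: "a \<in> borel_measurable (borel \<Otimes>\<^sub>M borel)" "AE p in kmeas s d. l \<le> a p \<and> a p \<le> L"
      and ah: "AE h in lborel. norm h \<le> d \<longrightarrow> (AE p in kmeas s d. \<bar>a (fst p, snd p + h) - a p\<bar> \<le> \<Gamma> * norm h powr s)"
      using reg by (auto simp: kernel_regular_def)
    have A0: "0 \<le> A" using u(2) l2_nonneg order_trans by blast
    define w where "w = (\<lambda>x. cutoff S d 5 x * u x)"
    note cut = cutoff_measurable cutoff_bounds(3) cutoff_lipschitz[OF assms(3), folded B_def] B0
    have fw: "frac_sobolev s d w"
      unfolding w_def by (rule frac_sobolev_mult(1)[OF assms(2,3) u(1) cut])
    have wE: "l2 (kmeas s d) (difs w) \<le> C1 * A"
      unfolding w_def C1_def m_def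
      by (rule local_energy_estimate[OF assms(2,3) u cut a assms(4,5) H])
        (use cutoff_eq_0[OF assms(3), of _ S 5] in auto)
    have weq: "w x = u x" if "x \<in> nbh S (5 * d)" for x
      using cutoff_eq_1[OF assms(3) that] by (simp add: w_def)
    have wA: "l2 lborel w \<le> A"
      using sqint_bounded_mult(2)[OF frac_sobolevD(2)[OF u(1)], of "cutoff S d 5" 1] u(2)
      by (simp add: w_def cutoff_bounds(3))
    have Hw: "form_bounded s d a (nbh S (4 * d)) A w"
      unfolding form_bounded_def
    proof (intro allI impI)
      fix \<phi> assume \<phi>: "frac_sobolev s d \<phi>" and "\<forall>x. x \<notin> nbh S (4 * d) \<longrightarrow> \<phi> x = 0"
      then have \<phi>0: "\<And>x. x \<notin> nbh S (4 * d) \<Longrightarrow> \<phi> x = 0" by blast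
      have "bil s d a w \<phi> = bil s d a u \<phi>"
      proof (rule bil_cong[OF frac_sobolevD(1)[OF fw] frac_sobolevD(1)[OF u(1)] frac_sobolevD(1)[OF \<phi>] a(1)])
        fix k x :: 'a assume k: "norm k < d" and nz: "\<phi> x \<noteq> 0 \<or> \<phi> (x + k) \<noteq> 0"
        have "x \<in> nbh S (5 * d) \<and> x + k \<in> nbh S (5 * d)"
        proof (cases "x \<in> nbh S (4 * d)")
          case True
          then show ?thesis using nbh_add[OF True, of k d] nbh_mono[OF True, of "5 * d"] k assms(3) by (simp add: algebra_simps)
        next
          case False
          then have *: "x + k \<in> nbh S (4 * d)" using nz \<phi>0 by blast
          then show ?thesis using nbh_add[OF *, of "- k" d] nbh_mono[OF *, of "5 * d"] k assms(3) by (simp add: algebra_simps)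
        qed
        then show "w x = u x \<and> w (x + k) = u (x + k)" by (simp add: weq)
      qed
      moreover have "x \<notin> nbh S (6 * d) \<Longrightarrow> \<phi> x = 0" for x using \<phi>0 nbh_mono[of x S "4 * d" "6 * d"] assms(3) by auto
      ultimately show "\<bar>bil s d a w \<phi>\<bar> \<le> A * l2 lborel \<phi>" using form_boundedD[OF H \<phi>] by simp
    qed
    define \<eta> where "\<eta> = cutoff S d (2 :: real)"
    note \<eta> = cutoff_measurable[of S d 2, folded \<eta>_def] cutoff_bounds(3)[of S d 2, folded \<eta>_def]
      cutoff_lipschitz[OF assms(3), where S = S and a = 2, folded B_def \<eta>_def] B0
    define G where "G h = (\<lambda>x. \<eta> x * dif h w x)" for h
    have fG: "frac_sobolev s d (G h)" for h
      unfolding G_def by (rule frac_sobolev_mult(1)[OF assms(2,3) frac_sobolev_dif[OF fw] \<eta>])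
    \<comment> \<open>The energy estimate uses the kernel translated by \<open>- h\<close>;
      reflection preserves null sets, so almost every \<open>h\<close> is still good.\<close>
    define good where "good h \<longleftrightarrow> norm h \<le> d \<longrightarrow> (AE p in kmeas s d. \<bar>a (fst p, snd p + - h) - a p\<bar> \<le> \<Gamma> * norm h powr s)" for h
    have good: "AE h in lborel. good h"
      using AE_lborel_reflect[OF ah, of 0] by (simp add: good_def[abs_def])
    have EG: "l2 lborel (dif k (G h)) \<le> C3 * C2 * norm k powr s * (norm h powr s * A)"
      if "good h" "norm h \<le> d" "norm k \<le> d" for h k
    proof -
      have "l2 (kmeas s d) (difs (G h)) \<le> C2 * (norm h powr s * A)"
        unfolding G_def C2_def m_def
      proof (rule difference_energy_estimate[OF assms(2,3) fw wE A0 C10 \<eta> a assms(4,5) Hw that(2) _ assms(6) _ less_imp_le[OF C3(1)] C3(2)])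
        show "AE p in kmeas s d. \<bar>a (fst p, snd p + - h) - a p\<bar> \<le> \<Gamma> * norm h powr s"
          using that by (simp add: good_def)
        fix x assume "\<eta> x \<noteq> 0"
        then have *: "x \<in> nbh S (3 * d)" using cutoff_eq_0[OF assms(3), of x S 2] by (auto simp: \<eta>_def)
        show "x \<in> nbh S (4 * d) \<and> x + h \<in> nbh S (4 * d)"
          using nbh_add[OF * that(2)] nbh_mono[OF *, of "4 * d"] assms(3) by (simp add: algebra_simps)
      qed auto
      then have "C3 * norm k powr s * l2 (kmeas s d) (difs (G h)) \<le> C3 * norm k powr s * (C2 * (norm h powr s * A))"
        using C3(1) by (intro mult_left_mono) auto
      then show ?thesis using C3(2)[OF fG that(3), of h] by (simp add: mult_ac)
    qed
    have bd: "l2 lborel (\<lambda>x. indicator S x * dif k (dif h w) x) \<le> 2 * (C3 * C2) * norm h powr s * norm k powr s * A"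
      if hk: "norm h \<le> d" "norm k \<le> d" for h k
    proof (cases "h = 0")
      case True
      then show ?thesis using A0 C3(1) C2 by (simp add: dif_def[abs_def])
    next
      case False
      obtain h' where h': "good h'" "good (h - h')" "norm h' \<le> norm h" "norm (h - h') \<le> norm h"
        using AE_split_shift[OF good False] by blast
      \<comment> \<open>The increment of \<open>w\<close> by \<open>h\<close> is its increment by
        \<open>h - h'\<close> plus its increment by \<open>h'\<close> taken at the point displaced
        by \<open>h - h'\<close>.\<close>
      let ?f1 = "\<lambda>x. dif k (G h') (x + (h - h'))" and ?f2 = "dif k (G (h - h'))"
      have sq: "sqint lborel (dif k (G h'))" "sqint lborel ?f2"
        using l2_dif(1)[OF frac_sobolevD(2)[OF fG]] by auto
      note tr = l2_translate[OF sq(1), of "h - h'"]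
      note ad = sqint_add[OF tr(1) sq(2)]
      have eq: "indicator S x * dif k (dif h w) x = indicator S x * (?f1 x + ?f2 x)" for x
      proof (cases "x \<in> S")
        case True
        have n0: "x \<in> nbh S 0" using True by (simp add: nbh_def)
        have n1: "x + (h - h') \<in> nbh S d" using nbh_add[OF n0, of "h - h'" d] h' hk by simp
        have n2: "x + (h - h') + k \<in> nbh S (2 * d)" using nbh_add[OF n1 hk(2)] by (simp add: algebra_simps)
        have n3: "x + k \<in> nbh S d" using nbh_add[OF n0 hk(2)] by simp
        have one: "\<eta> y = 1" if "y \<in> nbh S t" "t \<le> 2 * d" for y t
          unfolding \<eta>_def by (rule cutoff_eq_1[OF assms(3)]) (use nbh_mono[OF that] in simp)
        have e: "\<eta> x = 1" "\<eta> (x + (h - h')) = 1" "\<eta> (x + (h - h') + k) = 1" "\<eta> (x + k) = 1"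
          using one[OF n0] one[OF n1] one[OF n2] one[OF n3] assms(3) by auto
        show ?thesis using True e by (simp add: G_def dif_def algebra_simps)
      qed simp
      have "l2 lborel (\<lambda>x. indicator S x * dif k (dif h w) x) = l2 lborel (\<lambda>x. indicator S x * (?f1 x + ?f2 x))"
        by (simp only: eq)
      also have "\<dots> \<le> l2 lborel (\<lambda>x. ?f1 x + ?f2 x)" by (rule l2_restrict_mono(2)[OF ad(1)]) simp
      also have "\<dots> \<le> l2 lborel (dif k (G h')) + l2 lborel ?f2" using ad(2) tr(2) by simp
      also have "\<dots> \<le> C3 * C2 * norm k powr s * (norm h' powr s * A) + C3 * C2 * norm k powr s * (norm (h - h') powr s * A)"
        using h' hk by (intro add_mono EG) auto
      also have "\<dots> \<le> C3 * C2 * norm k powr s * (norm h powr s * A) + C3 * C2 * norm k powr s * (norm h powr s * A)"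
        using h' assms(1) C3(1) C2 A0 by (intro add_mono mult_left_mono mult_right_mono powr_mono2) auto
      finally show ?thesis by (simp add: mult_ac)
    qed
    have "2 * (C3 * C2) * norm h powr s * norm k powr s * A \<le> norm h powr s * norm k powr s * ((2 * (C3 * C2) + 1) * A)" for h k :: 'a
      using A0 by (simp add: algebra_simps)
    note order_trans[OF bd this]
    moreover have "l2 lborel w \<le> (2 * (C3 * C2) + 1) * A"
    proof -
      have "0 \<le> C3 * C2 * A" using C3(1) C2 A0 by simp
      then show ?thesis using wA by (simp add: distrib_right)
    qed
    ultimately show "\<exists>w. difference_regular s d S ((2 * (C3 * C2) + 1) * A) w \<and> (\<forall>x\<in>nbh S (5 * d). w x = u x)"
      unfolding difference_regular_def using frac_sobolevD[OF fw] weq by blast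
  qed
qed

subsection \<open>Reduction to a truncated kernel\<close>

lemma L2_iff_sqint: "g \<in> L2 U \<longleftrightarrow> sqint (lebesgue_on U) g"
  by (simp add: L2_def sqint_def)

lemma L2_norm_eq_l2: "L2_norm U g = l2 (lebesgue_on U) g"
  by (simp add: L2_norm_def l2_def)

lemma sqint_lebesgue_on_iff:
  fixes g :: "'a::euclidean_space \<Rightarrow> real"
  assumes [measurable]: "U \<in> sets borel" "g \<in> borel_measurable borel"
  shows "sqint (lebesgue_on U) g \<longleftrightarrow> sqint lborel (\<lambda>x. indicator U x * g x)"
    "l2 (lebesgue_on U) g = l2 lborel (\<lambda>x. indicator U x * g x)"
proof -
  have U: "U \<inter> space lebesgue \<in> sets lebesgue" using assms(1) by simp
  have eq: "indicator U x *\<^sub>R (g x)\<^sup>2 = (indicator U x * g x)\<^sup>2" for x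
    by (simp add: indicator_def)
  have gm: "g \<in> borel_measurable (lebesgue_on U)"
    by (rule measurable_restrict_space1) (rule measurable_completion, simp)
  have "integrable (lebesgue_on U) (\<lambda>x. (g x)\<^sup>2) \<longleftrightarrow> integrable lborel (\<lambda>x. (indicator U x * g x)\<^sup>2)"
    unfolding integrable_restrict_space[OF U] eq by (rule integrable_completion) measurable
  then show "sqint (lebesgue_on U) g \<longleftrightarrow> sqint lborel (\<lambda>x. indicator U x * g x)"
    using gm by (simp add: sqint_def)
  have "(\<integral>x. (g x)\<^sup>2 \<partial>lebesgue_on U) = (\<integral>x. (indicator U x * g x)\<^sup>2 \<partial>lborel)"
    unfolding integral_restrict_space[OF U] eq by (rule integral_completion) measurable
  then show "l2 (lebesgue_on U) g = l2 lborel (\<lambda>x. indicator U x * g x)"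
    by (simp add: l2_def)
qed

lemma AE_lebesgue_on_iff:
  assumes "U \<in> sets borel"
  shows "(AE x in lebesgue_on U. P x) \<longleftrightarrow> (AE x in lborel. x \<in> U \<longrightarrow> P x)"
  using assms by (subst AE_restrict_space_iff) (auto simp: AE_completion_iff)

text \<open>The exceptional points \<open>q\<close> are recovered from exceptional points
  \<open>g q\<close> by the linear left inverse \<open>g'\<close>, and a linear map into a space of
  at least the same dimension sends negligible sets to negligible sets.\<close>

lemma AE_lebesgue_linear:
  fixes g :: "'b::euclidean_space \<Rightarrow> 'a::euclidean_space"
  assumes "linear g'" "DIM('a) \<le> DIM('b)" "\<And>q. g' (g q) = q" "AE p in lebesgue. P p"
  shows "AE q in lebesgue. P (g q)"
proof -
  obtain N where N: "negligible N" "{p. \<not> P p} \<subseteq> N"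
    using assms(4) by (auto simp: eventually_ae_filter_negligible)
  have "negligible (g' ` N)"
    using assms(1,2) N(1)
    by (intro negligible_differentiable_image_negligible linear_imp_differentiable_on) auto
  moreover have "{q. \<not> P (g q)} \<subseteq> g' ` N"
  proof
    fix q assume "q \<in> {q. \<not> P (g q)}"
    then have "g q \<in> N" using N(2) by blast
    then show "q \<in> g' ` N" using assms(3)[of q] by (metis imageI)
  qed
  ultimately show ?thesis by (auto simp: eventually_ae_filter_negligible)
qed

lemma AE_lborel_pair_fst:
  assumes "AE x in (lborel :: 'a::euclidean_space measure). P x"
  shows "AE p in (lborel :: 'a measure) \<Otimes>\<^sub>M (lborel :: 'b::euclidean_space measure). P (fst p)"
proof -
  obtain N where N: "N \<in> null_sets (lborel :: 'a measure)" "{x. \<not> P x} \<subseteq> N"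
    using assms by (auto simp: eventually_ae_filter)
  have "N \<times> UNIV \<in> null_sets ((lborel :: 'a measure) \<Otimes>\<^sub>M (lborel :: 'b measure))"
    using N(1) by (auto simp: null_sets_def lborel.emeasure_pair_measure_Times)
  then show ?thesis by (rule AE_I') (use N(2) in \<open>auto simp: space_pair_measure\<close>)
qed

lemma AE_lborel_pair_snd:
  assumes "AE x in (lborel :: 'b::euclidean_space measure). P x"
  shows "AE p in (lborel :: 'a::euclidean_space measure) \<Otimes>\<^sub>M (lborel :: 'b measure). P (snd p)"
proof -
  obtain N where N: "N \<in> null_sets (lborel :: 'b measure)" "{x. \<not> P x} \<subseteq> N"
    using assms by (auto simp: eventually_ae_filter)
  have "UNIV \<times> N \<in> null_sets ((lborel :: 'a measure) \<Otimes>\<^sub>M (lborel :: 'b measure))"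
    using N(1) by (auto simp: null_sets_def lborel.emeasure_pair_measure_Times)
  then show ?thesis by (rule AE_I') (use N(2) in \<open>auto simp: space_pair_measure\<close>)
qed

section \<open>Passage to difference coordinates\<close>

definition shear :: "'a::plus \<times> 'a \<Rightarrow> 'a \<times> 'a" where
  "shear p = (snd p + fst p, snd p)"

lemma shear_measurable [measurable]:
  "shear \<in> (borel :: 'a::euclidean_space measure) \<Otimes>\<^sub>M borel \<rightarrow>\<^sub>M borel \<Otimes>\<^sub>M borel"
  unfolding shear_def by measurable

text \<open>For fixed \<open>x\<close> the map only translates \<open>k\<close>, so it is enough to
  integrate over \<open>k\<close> first.\<close>

lemma nn_integral_shear:
  fixes F :: "'a::euclidean_space \<times> 'a \<Rightarrow> ennreal"
  assumes [measurable]: "F \<in> borel_measurable (borel \<Otimes>\<^sub>M borel)"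
  shows "(\<integral>\<^sup>+p. F (shear p) \<partial>(lborel \<Otimes>\<^sub>M lborel)) = (\<integral>\<^sup>+p. F p \<partial>(lborel \<Otimes>\<^sub>M lborel))"
proof -
  have "(\<integral>\<^sup>+p. F (shear p) \<partial>(lborel \<Otimes>\<^sub>M lborel)) = (\<integral>\<^sup>+x. \<integral>\<^sup>+k. F (shear (k, x)) \<partial>lborel \<partial>lborel)"
    by (rule lborel_pair.nn_integral_snd[symmetric]) measurable
  also have "\<dots> = (\<integral>\<^sup>+x. \<integral>\<^sup>+k. F (k, x) \<partial>lborel \<partial>lborel)"
  proof (rule nn_integral_cong)
    fix x :: 'a
    show "(\<integral>\<^sup>+k. F (shear (k, x)) \<partial>lborel) = (\<integral>\<^sup>+k. F (k, x) \<partial>lborel)"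
      using nn_integral_lborel_translate[of "\<lambda>k. F (k, x)" x] by (simp add: shear_def add.commute)
  qed
  also have "\<dots> = (\<integral>\<^sup>+p. F p \<partial>(lborel \<Otimes>\<^sub>M lborel))"
    by (rule lborel_pair.nn_integral_snd) measurable
  finally show ?thesis .
qed

lemma distr_shear:
  "distr (lborel \<Otimes>\<^sub>M lborel) (lborel \<Otimes>\<^sub>M lborel) shear = (lborel \<Otimes>\<^sub>M lborel :: ('a::euclidean_space \<times> 'a) measure)"
proof (rule measure_eqI)
  fix A :: "('a \<times> 'a) set" assume "A \<in> sets (distr (lborel \<Otimes>\<^sub>M lborel) (lborel \<Otimes>\<^sub>M lborel) shear)"
  then have A: "A \<in> sets (lborel \<Otimes>\<^sub>M lborel)" by simp
  then have [measurable]: "A \<in> sets (borel \<Otimes>\<^sub>M borel)" by simp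
  have m: "shear \<in> (lborel :: 'a measure) \<Otimes>\<^sub>M lborel \<rightarrow>\<^sub>M lborel \<Otimes>\<^sub>M lborel"
    by measurable
  have "emeasure (distr (lborel \<Otimes>\<^sub>M lborel) (lborel \<Otimes>\<^sub>M lborel) shear) A = (\<integral>\<^sup>+p. indicator A p \<partial>distr (lborel \<Otimes>\<^sub>M lborel) (lborel \<Otimes>\<^sub>M lborel) shear)"
    using A by simp
  also have "\<dots> = (\<integral>\<^sup>+p. indicator A (shear p) \<partial>(lborel \<Otimes>\<^sub>M lborel))"
    by (rule nn_integral_distr[OF m]) simp
  also have "\<dots> = (\<integral>\<^sup>+p. indicator A p \<partial>(lborel \<Otimes>\<^sub>M lborel))"
    by (rule nn_integral_shear) measurable
  finally show "emeasure (distr (lborel \<Otimes>\<^sub>M lborel) (lborel \<Otimes>\<^sub>M lborel) shear) A = emeasure (lborel \<Otimes>\<^sub>M lborel) A"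
    using A by simp
qed simp

lemma integral_shear:
  fixes F :: "'a::euclidean_space \<times> 'a \<Rightarrow> real"
  assumes [measurable]: "F \<in> borel_measurable (borel \<Otimes>\<^sub>M borel)"
  shows "(\<integral>p. F p \<partial>lborel) = (\<integral>p. F (shear p) \<partial>(lborel \<Otimes>\<^sub>M lborel))"
proof -
  have m: "shear \<in> (lborel :: 'a measure) \<Otimes>\<^sub>M lborel \<rightarrow>\<^sub>M lborel \<Otimes>\<^sub>M lborel" by measurable
  have F: "F \<in> borel_measurable (lborel \<Otimes>\<^sub>M lborel)" by measurable
  have "(\<integral>p. F p \<partial>lborel) = (\<integral>p. F p \<partial>distr (lborel \<Otimes>\<^sub>M lborel) (lborel \<Otimes>\<^sub>M lborel) shear)"
    by (subst distr_shear) (simp only: lborel_prod)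
  also have "\<dots> = (\<integral>p. F (shear p) \<partial>(lborel \<Otimes>\<^sub>M lborel))" by (rule integral_distr[OF m F])
  finally show ?thesis .
qed

lemma AE_shear:
  fixes P :: "'a::euclidean_space \<times> 'a \<Rightarrow> bool"
  assumes "AE p in lebesgue. P p"
  shows "AE p in lborel \<Otimes>\<^sub>M lborel. P (shear p)"
proof -
  have "AE p in lborel \<Otimes>\<^sub>M lborel. P p" using assms unfolding lborel_prod AE_completion_iff .
  then have "AE p in distr (lborel \<Otimes>\<^sub>M lborel) (lborel \<Otimes>\<^sub>M lborel) shear. P p" by (simp only: distr_shear)
  then show ?thesis by (rule AE_distrD[rotated]) measurable
qed

text \<open>Zero increments and increments of length at least \<open>\<rho>\<close> have weight 0.
  Excluding \<open>fst p = 0\<close> matters because kernel bounds multiplied by a power of |k|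
  carry no information there.\<close>

lemma AE_kmeasI:
  assumes "AE p in lborel \<Otimes>\<^sub>M lborel. norm (fst p) < \<rho> \<longrightarrow> fst p \<noteq> 0 \<longrightarrow> P p"
  shows "AE p in kmeas s \<rho>. P p"
  unfolding kmeas_def
proof (subst AE_density)
  show "AE p in lborel \<Otimes>\<^sub>M lborel. 0 < (case p of (k, x) \<Rightarrow> ennreal (wgt s \<rho> k)) \<longrightarrow> P p"
    using assms by eventually_elim (auto simp: wgt_def indicator_def split: if_splits)
qed measurable

section \<open>The kernel near the diagonal and in the tail\<close>

lemma kernel_near_bounds:
  fixes \<kappa> :: ennreal
  assumes "0 < r" "ennreal l \<le> ennreal r * \<kappa>" "ennreal r * \<kappa> \<le> ennreal L" "0 < l"
  shows "\<kappa> = ennreal (enn2real \<kappa>)" "l \<le> r * enn2real \<kappa>" "r * enn2real \<kappa> \<le> L"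
proof -
  have fin: "\<kappa> \<noteq> top"
  proof
    assume "\<kappa> = top"
    then have "ennreal r * \<kappa> = top" using assms(1) by (simp add: ennreal_mult_top)
    then show False using assms(3) by (simp add: top_unique)
  qed
  then show \<kappa>: "\<kappa> = ennreal (enn2real \<kappa>)" by (simp add: ennreal_enn2real_if)
  have p: "ennreal r * \<kappa> = ennreal (r * enn2real \<kappa>)"
    using assms(1) by (subst \<kappa>) (simp add: ennreal_mult)
  have 0: "0 \<le> r * enn2real \<kappa>" using assms(1) by simp
  show 1: "l \<le> r * enn2real \<kappa>" using assms(2) 0 unfolding p by (simp add: ennreal_le_iff)
  show "r * enn2real \<kappa> \<le> L" using assms(3) 0 1 assms(4) unfolding p by (simp add: ennreal_le_iff2)
qed

text \<open>The kernel divided by the model kernel, in difference coordinates. Near the diagonal the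
  ellipticity condition says that it lies between \<open>l\<close> and \<open>L\<close>, which is
  the form in which the energy estimates use it.\<close>

definition wkern :: "real \<Rightarrow> ('a::euclidean_space \<times> 'a \<Rightarrow> ennreal) \<Rightarrow> 'a \<times> 'a \<Rightarrow> real" where
  "wkern s K p = norm (fst p) powr (real DIM('a) + 2 * s) * enn2real (K (shear p))"

lemma wkern_measurable [measurable]:
  assumes [measurable]: "K \<in> borel_measurable (borel \<Otimes>\<^sub>M borel)"
  shows "wkern s K \<in> borel_measurable (borel \<Otimes>\<^sub>M borel)"
  unfolding wkern_def by measurable

definition far_bound :: "real \<Rightarrow> real \<Rightarrow> real \<Rightarrow> 'a::euclidean_space \<Rightarrow> real" where
  "far_bound \<beta> d B k = B * (indicator (- ball 0 d) k * norm k powr (- real DIM('a) - \<beta>))"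

lemma far_bound_measurable [measurable]: "far_bound \<beta> d B \<in> borel_measurable borel"
  unfolding far_bound_def by measurable

text \<open>The first conjunct says that \<open>enn2real\<close> loses no infinity at this point.
  Near the diagonal the lower bound recovers the model weight from \<open>K\<close> and the
  factorisation turns \<open>K\<close> into the coefficient of \<open>bil\<close>; away from it only
  an integrable majorant is kept.\<close>

definition kernel_bounds_at ::
  "real \<Rightarrow> real \<Rightarrow> real \<Rightarrow> real \<Rightarrow> real \<Rightarrow> real \<Rightarrow> ('a::euclidean_space \<times> 'a \<Rightarrow> ennreal) \<Rightarrow> 'a \<times> 'a \<Rightarrow> bool" where
  "kernel_bounds_at s \<beta> d l L B K p \<longleftrightarrow> K (shear p) = ennreal (enn2real (K (shear p))) \<and>
    (if norm (fst p) < d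
     then l * wgt s d (fst p) \<le> enn2real (K (shear p)) \<and>
       enn2real (K (shear p)) = wgt s d (fst p) * wkern s K p \<and> wkern s K p \<le> L
     else enn2real (K (shear p)) \<le> far_bound \<beta> d B (fst p))"

text \<open>Since \<open>d < 1\<close>, the shell between \<open>d\<close> and 1 is counted as far
  although only the ellipticity bound holds there. On it \<open>K\<close> is at most
  \<open>L\<close> times d^(-n-2s), and |k|^(-n-\<beta>) is at least 1, so the maximum of that
  number and \<open>M\<close> serves as the constant of the tail on both ranges.\<close>

lemma admissible_kernel_reduce:
  fixes K :: "(real^'n) \<times> (real^'n) \<Rightarrow> ennreal"
  assumes K: "admissible_kernel s \<beta> l L M \<Gamma> K" and "0 < s" "0 < \<beta>" "0 < l" "0 < d" "d < 1" "0 < M" "0 \<le> \<Gamma>"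
  obtains K' where "K' \<in> borel_measurable (borel \<Otimes>\<^sub>M borel)" "AE p in lebesgue. K p = K' p"
    "kernel_regular s d l L \<Gamma> (wkern s K')"
    "AE p in lborel \<Otimes>\<^sub>M lborel. fst p \<noteq> 0 \<longrightarrow> kernel_bounds_at s \<beta> d l L (max M (L * d powr (- (real CARD('n) + 2 * s)))) K' p"
proof -
  define e where "e = real CARD('n) + 2 * s"
  have e0: "0 < e" using assms(2) by (simp add: e_def add_pos_pos)
  obtain K' where K'm: "K' \<in> borel_measurable lborel" and K': "AE p in lborel. K p = K' p"
    using K completion_ex_borel_measurable[of K lborel] by (auto simp: admissible_kernel_def)
  have mK[measurable]: "K' \<in> borel_measurable (borel \<Otimes>\<^sub>M borel)" using K'm by (simp add: borel_prod)
  have KK: "AE p in lebesgue. K p = K' p" using K' by (simp add: AE_completion_iff)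
  have KKs: "AE p in lborel \<Otimes>\<^sub>M lborel. K (shear p) = K' (shear p)" by (rule AE_shear[OF KK])
  have b: "AE p in lebesgue. (norm (fst p - snd p) < 1 \<longrightarrow>
           ennreal l \<le> ennreal (norm (fst p - snd p) powr e) * K p \<and>
           ennreal (norm (fst p - snd p) powr e) * K p \<le> ennreal L) \<and>
        (norm (fst p - snd p) \<ge> 1 \<longrightarrow> ennreal (norm (fst p - snd p) powr (real CARD('n) + \<beta>)) * K p \<le> ennreal M)"
    using K unfolding admissible_kernel_def e_def by (simp add: case_prod_beta)
  have bs: "AE p in lborel \<Otimes>\<^sub>M lborel. (norm (fst p) < 1 \<longrightarrow>
           ennreal l \<le> ennreal (norm (fst p) powr e) * K' (shear p) \<and>
           ennreal (norm (fst p) powr e) * K' (shear p) \<le> ennreal L) \<and>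
        (norm (fst p) \<ge> 1 \<longrightarrow> ennreal (norm (fst p) powr (real CARD('n) + \<beta>)) * K' (shear p) \<le> ennreal M)"
    using AE_shear[OF b] KKs by eventually_elim (simp add: shear_def)
  have near: "AE p in lborel \<Otimes>\<^sub>M lborel. norm (fst p) < 1 \<longrightarrow> fst p \<noteq> 0 \<longrightarrow>
      K' (shear p) = ennreal (enn2real (K' (shear p))) \<and> l \<le> wkern s K' p \<and> wkern s K' p \<le> L"
    using bs
  proof eventually_elim
    case (elim p)
    show ?case
    proof (intro impI)
      assume "norm (fst p) < 1" "fst p \<noteq> 0"
      then show "K' (shear p) = ennreal (enn2real (K' (shear p))) \<and> l \<le> wkern s K' p \<and> wkern s K' p \<le> L"
        using kernel_near_bounds[of "norm (fst p) powr e" l "K' (shear p)" L] elim assms(4)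
        by (auto simp: wkern_def e_def)
    qed
  qed
  have 1: "AE p in kmeas s d. l \<le> wkern s K' p \<and> wkern s K' p \<le> L"
    by (rule AE_kmeasI) (use near in eventually_elim, use assms in auto)
  have K2: "AE p in kmeas s d. norm (fst p) < d \<and> fst p \<noteq> 0 \<and> K (shear p) = K' (shear p) \<and> K' (shear p) = ennreal (enn2real (K' (shear p)))"
    by (rule AE_kmeasI) (use near KKs in eventually_elim, use assms in auto)
  have 2: "AE h in lborel. norm h \<le> d \<longrightarrow> (AE p in kmeas s d. \<bar>wkern s K' (fst p, snd p + h) - wkern s K' p\<bar> \<le> \<Gamma> * norm h powr s)"
  proof -
    have t: "AE t in lebesgue. norm (fst t - fst (snd t)) < 1 \<and> norm (snd (snd t)) < 1 \<longrightarrow>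
        ereal (norm (fst t - fst (snd t)) powr e) * \<bar>enn2ereal (K (fst t + snd (snd t), fst (snd t) + snd (snd t))) - enn2ereal (K (fst t, fst (snd t)))\<bar>
        \<le> ereal (\<Gamma> * norm (snd (snd t)) powr s)"
      using K unfolding admissible_kernel_def e_def by (simp add: case_prod_beta)
    \<comment> \<open>The triple (shift, increment, point) is sent to two points and the shift, so
      that the difference of the points is the increment; after this linear substitution Fubini
      separates the shift from the pair.\<close>
    let ?g = "\<lambda>q::(real^'n) \<times> (real^'n) \<times> (real^'n). (snd (snd q) + fst (snd q), snd (snd q), fst q)"
    let ?g' = "\<lambda>t::(real^'n) \<times> (real^'n) \<times> (real^'n). (snd (snd t), fst t - fst (snd t), fst (snd t))"
    have "linear ?g'" by (auto intro!: linearI simp: algebra_simps)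
    from AE_lebesgue_linear[OF this _ _ t, of ?g]
    have "AE q in lebesgue. norm (fst (snd q)) < 1 \<and> norm (fst q) < 1 \<longrightarrow>
        ereal (norm (fst (snd q)) powr e) * \<bar>enn2ereal (K (shear (fst (snd q), snd (snd q) + fst q))) - enn2ereal (K (shear (snd q)))\<bar>
        \<le> ereal (\<Gamma> * norm (fst q) powr s)"
      by (simp add: shear_def add_ac)
    then have "AE q in (lborel :: (real^'n) measure) \<Otimes>\<^sub>M (lborel :: ((real^'n) \<times> (real^'n)) measure). norm (fst (snd q)) < 1 \<and> norm (fst q) < 1 \<longrightarrow>
        ereal (norm (fst (snd q)) powr e) * \<bar>enn2ereal (K (shear (fst (snd q), snd (snd q) + fst q))) - enn2ereal (K (shear (snd q)))\<bar>
        \<le> ereal (\<Gamma> * norm (fst q) powr s)"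
      unfolding lborel_prod AE_completion_iff .
    from lborel_pair.AE_pair[OF this]
    have "AE h in lborel. AE p in (lborel :: ((real^'n) \<times> (real^'n)) measure). norm (fst p) < 1 \<and> norm h < 1 \<longrightarrow>
        ereal (norm (fst p) powr e) * \<bar>enn2ereal (K (shear (fst p, snd p + h))) - enn2ereal (K (shear p))\<bar> \<le> ereal (\<Gamma> * norm h powr s)"
      by simp
    then show ?thesis
    proof eventually_elim
      case (elim h)
      show ?case
      proof
        assume h: "norm h \<le> d"
        have "AE p in lborel \<Otimes>\<^sub>M lborel. norm (fst p) < 1 \<and> norm h < 1 \<longrightarrow>
          ereal (norm (fst p) powr e) * \<bar>enn2ereal (K (shear (fst p, snd p + h))) - enn2ereal (K (shear p))\<bar> \<le> ereal (\<Gamma> * norm h powr s)"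
          using elim unfolding lborel_prod .
        then have "AE p in kmeas s d. norm (fst p) < 1 \<and> norm h < 1 \<longrightarrow>
          ereal (norm (fst p) powr e) * \<bar>enn2ereal (K (shear (fst p, snd p + h))) - enn2ereal (K (shear p))\<bar> \<le> ereal (\<Gamma> * norm h powr s)"
          by (intro AE_kmeasI) (auto elim: AE_mp)
        \<comment> \<open>Agreement of \<open>K\<close> with its Borel version and finiteness are
          needed at the pair and at its translate; the latter holds almost everywhere because the
          measure is shift invariant.\<close>
        with K2 AE_kmeas_shift[OF K2, of h]
        show "AE p in kmeas s d. \<bar>wkern s K' (fst p, snd p + h) - wkern s K' p\<bar> \<le> \<Gamma> * norm h powr s"
        proof eventually_elim
          case (elim p)
          define c where "c = enn2real (K' (shear (fst p, snd p + h)))"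
          define c' where "c' = enn2real (K' (shear p))"
          have "K (shear (fst p, snd p + h)) = ennreal c" "K (shear p) = ennreal c'" "0 \<le> c" "0 \<le> c'"
            using elim(1,2) by (simp_all add: c_def c'_def)
          moreover have "norm (fst p) < 1" "norm h < 1" using elim(1) h assms by auto
          ultimately have "ereal (norm (fst p) powr e) * \<bar>ereal c - ereal c'\<bar> \<le> ereal (\<Gamma> * norm h powr s)"
            using elim(3) by (simp add: enn2ereal_ennreal)
          then have "norm (fst p) powr e * \<bar>c - c'\<bar> \<le> \<Gamma> * norm h powr s" by simp
          moreover have "wkern s K' (fst p, snd p + h) - wkern s K' p = norm (fst p) powr e * (c - c')"
            by (simp add: wkern_def e_def c_def c'_def algebra_simps)
          ultimately show ?case by (simp add: abs_mult)
        qed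
      qed
    qed
  qed
  have 3: "AE p in lborel \<Otimes>\<^sub>M lborel. fst p \<noteq> 0 \<longrightarrow> K' (shear p) = ennreal (enn2real (K' (shear p))) \<and>
      (if norm (fst p) < d then l * wgt s d (fst p) \<le> enn2real (K' (shear p)) \<and> enn2real (K' (shear p)) = wgt s d (fst p) * wkern s K' p \<and> wkern s K' p \<le> L
       else enn2real (K' (shear p)) \<le> far_bound \<beta> d (max M (L * d powr - e)) (fst p))"
    using near bs
  proof eventually_elim
    case (elim p)
    show ?case
    proof
      assume nz: "fst p \<noteq> 0"
      define r where "r = norm (fst p)"
      define c where "c = enn2real (K' (shear p))"
      have r0: "0 < r" using nz by (simp add: r_def)
      have c0: "0 \<le> c" by (simp add: c_def)
      show "K' (shear p) = ennreal (enn2real (K' (shear p))) \<and>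
      (if norm (fst p) < d then l * wgt s d (fst p) \<le> enn2real (K' (shear p)) \<and> enn2real (K' (shear p)) = wgt s d (fst p) * wkern s K' p \<and> wkern s K' p \<le> L
       else enn2real (K' (shear p)) \<le> far_bound \<beta> d (max M (L * d powr - e)) (fst p))"
      proof (cases "r < 1")
        case True
        then have n: "K' (shear p) = ennreal c" "l \<le> r powr e * c" "r powr e * c \<le> L"
          using elim(1) nz by (auto simp: r_def c_def wkern_def e_def)
        have cr: "c = r powr - e * (r powr e * c)" using r0 by (simp add: powr_minus field_simps)
        show ?thesis
        proof (cases "r < d")
          case True
          have w: "wgt s d (fst p) = r powr - e" using True by (simp add: wgt_def r_def e_def)
          have k: "wkern s K' p = r powr e * c" by (simp add: wkern_def r_def e_def c_def)
          have "l * r powr - e \<le> (r powr e * c) * r powr - e" using n by (intro mult_right_mono) auto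
          also have "(r powr e * c) * r powr - e = c" using r0 by (simp add: powr_minus)
          finally have a1: "l * wgt s d (fst p) \<le> c" unfolding w .
          have a2: "c = wgt s d (fst p) * wkern s K' p" unfolding w k by (rule cr)
          have a3: "wkern s K' p \<le> L" unfolding k by (rule n(3))
          show ?thesis unfolding if_P[OF True[unfolded r_def]] c_def[symmetric]
            by (rule conjI[OF n(1) conjI[OF a1 conjI[OF a2 a3]]])
        next
          case False
          have "c \<le> r powr - e * L" by (subst cr) (intro mult_left_mono n, simp)
          also have "\<dots> \<le> d powr - e * L"
            using False assms e0 n by (intro mult_right_mono powr_mono2') auto
          also have "\<dots> \<le> max M (L * d powr - e)" by (simp add: mult.commute)
          also have "\<dots> \<le> max M (L * d powr - e) * r powr (- real CARD('n) - \<beta>)"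
          proof -
            have "1 \<le> r powr (- real CARD('n) - \<beta>)"
              using r0 True assms(3) powr_mono2'[of "- real CARD('n) - \<beta>" r 1] by simp
            then show ?thesis using assms(7) mult_left_mono[of 1 "r powr (- real CARD('n) - \<beta>)" "max M (L * d powr - e)"] by simp
          qed
          finally have "c \<le> far_bound \<beta> d (max M (L * d powr - e)) (fst p)"
            using False by (simp add: r_def far_bound_def)
          then show ?thesis unfolding if_not_P[OF False[unfolded r_def]] c_def[symmetric]
            by (rule conjI[OF n(1)])
        qed
      next
        case False
        then have m: "ennreal (r powr (real CARD('n) + \<beta>)) * K' (shear p) \<le> ennreal M"
          using elim(2) by (simp add: r_def)
        have fin: "K' (shear p) = ennreal c"
        proof -
          have "K' (shear p) \<noteq> top"
          proof
            assume "K' (shear p) = top"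
            then have "ennreal (r powr (real CARD('n) + \<beta>)) * K' (shear p) = top" using r0 by (simp add: ennreal_mult_top)
            then show False using m by (simp add: top_unique)
          qed
          then show ?thesis by (simp add: c_def ennreal_enn2real_if)
        qed
        have "r powr (real CARD('n) + \<beta>) * c \<le> M"
          using m c0 assms(7) unfolding fin by (simp add: ennreal_le_iff2 flip: ennreal_mult)
        then have "r powr (- real CARD('n) - \<beta>) * (r powr (real CARD('n) + \<beta>) * c) \<le> r powr (- real CARD('n) - \<beta>) * M"
          by (intro mult_left_mono) auto
        moreover have "r powr (- real CARD('n) - \<beta>) * r powr (real CARD('n) + \<beta>) = 1"
          using r0 by (simp flip: powr_add)
        ultimately have "c \<le> M * r powr (- real CARD('n) - \<beta>)" by (simp add: mult.assoc[symmetric] mult.commute[of M])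
        also have "\<dots> \<le> max M (L * d powr - e) * r powr (- real CARD('n) - \<beta>)" by (intro mult_right_mono) auto
        finally have "c \<le> far_bound \<beta> d (max M (L * d powr - e)) (fst p)"
          using False assms(6) by (simp add: r_def far_bound_def)
        moreover have nd: "\<not> norm (fst p) < d" using False assms(6) by (simp add: r_def)
        ultimately show ?thesis unfolding if_not_P[OF nd] c_def[symmetric] by (intro conjI fin)
      qed
    qed
  qed
  have "kernel_regular s d l L \<Gamma> (wkern s K')" using 1 2 by (simp add: kernel_regular_def)
  then show thesis by (rule that[OF mK KK _ 3[folded kernel_bounds_at_def, unfolded e_def]])
qed

section \<open>The form away from the diagonal\<close>

definition far_mass :: "'a::euclidean_space itself \<Rightarrow> real \<Rightarrow> real \<Rightarrow> real \<Rightarrow> real" where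
  "far_mass _ \<beta> d B = enn2real (\<integral>\<^sup>+k. ennreal (far_bound \<beta> d B k) \<partial>(lborel :: 'a measure))"

lemma far_mass_nonneg [simp]: "0 \<le> far_mass T \<beta> d B"
  by (simp add: far_mass_def)

lemma far_bound_nonneg: "0 \<le> B \<Longrightarrow> 0 \<le> far_bound \<beta> d B k"
  by (simp add: far_bound_def)

lemma far_mass_eq:
  assumes "0 < \<beta>" "0 < d" "0 \<le> B"
  shows "(\<integral>\<^sup>+k. ennreal (far_bound \<beta> d B k) \<partial>(lborel :: 'a::euclidean_space measure)) = ennreal (far_mass TYPE('a) \<beta> d B)"
proof -
  have "(\<integral>\<^sup>+k. ennreal (far_bound \<beta> d B k) \<partial>(lborel :: 'a measure))
    = ennreal B * (\<integral>\<^sup>+k. ennreal (indicator (- ball 0 d) k * norm k powr (- real DIM('a) - \<beta>)) \<partial>(lborel :: 'a measure))"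
    unfolding far_bound_def using assms(3) by (subst nn_integral_cmult[symmetric]) (auto simp: ennreal_mult)
  also have "\<dots> < \<infinity>"
    using radial_far[OF assms(1,2), where 'a = 'a] by (simp add: ennreal_mult_less_top)
  finally show ?thesis by (simp add: far_mass_def)
qed

text \<open>With p = n + \<beta>, |x| \<le> R and |k| \<ge> d one has 1 \<le> d^(-p) |k|^p and |x +
  k| \<le> (R / d + 1) |k|. Adding the p-th powers bounds 1 + |x + k|^p by a multiple of |k|^p, so
  the tail is dominated by the weight of the norm in \<open>weighted_L1\<close>, centred at the
  origin instead of at \<open>x\<close>.\<close>

definition decay_const :: "'a::euclidean_space itself \<Rightarrow> real \<Rightarrow> real \<Rightarrow> real \<Rightarrow> real \<Rightarrow> real" where
  "decay_const _ \<beta> d B R = B * (d powr (- (real DIM('a) + \<beta>)) + (R / d + 1) powr (real DIM('a) + \<beta>))"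

lemma decay_const_nonneg: "0 \<le> B \<Longrightarrow> 0 \<le> decay_const T \<beta> d B R"
  by (simp add: decay_const_def)

lemma far_bound_le_decay:
  fixes x k :: "'a::euclidean_space"
  assumes "0 < \<beta>" "0 < d" "0 \<le> B" "norm x \<le> R" "0 \<le> R"
  shows "far_bound \<beta> d B k \<le> decay_const TYPE('a) \<beta> d B R / (1 + norm (x + k) powr (real DIM('a) + \<beta>))"
proof (cases "norm k < d")
  case True
  then show ?thesis using assms decay_const_nonneg[OF assms(3)]
    by (auto simp: far_bound_def intro!: divide_nonneg_nonneg add_nonneg_nonneg)
next
  case False
  define p where "p = real DIM('a) + \<beta>"
  have p: "0 < p" using assms by (simp add: p_def add_pos_pos)
  have k: "d \<le> norm k" "0 < norm k" using False assms by auto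
  have 1: "1 \<le> d powr (- p) * norm k powr p"
    using powr_mono2[of p d "norm k"] k assms p by (simp add: powr_minus field_simps)
  have "R \<le> R / d * norm k"
    using mult_left_mono[OF k(1), of "R / d"] assms by simp
  then have "norm (x + k) \<le> (R / d + 1) * norm k"
    using norm_triangle_ineq[of x k] assms(4) by (simp add: distrib_right)
  then have "norm (x + k) powr p \<le> ((R / d + 1) * norm k) powr p"
    using p by (intro powr_mono2) auto
  also have "\<dots> = (R / d + 1) powr p * norm k powr p"
    using assms by (simp add: powr_mult)
  finally have "1 + norm (x + k) powr p \<le> (d powr (- p) + (R / d + 1) powr p) * norm k powr p"
    using 1 by (simp add: distrib_right)
  then have "norm k powr (- p) * (1 + norm (x + k) powr p) \<le> norm k powr (- p) * ((d powr (- p) + (R / d + 1) powr p) * norm k powr p)"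
    by (rule mult_left_mono) simp
  also have "\<dots> = d powr (- p) + (R / d + 1) powr p"
    using k by (simp add: powr_minus)
  finally have "B * norm k powr (- p) * (1 + norm (x + k) powr p) \<le> B * (d powr (- p) + (R / d + 1) powr p)"
    using assms(3) by (simp add: mult.assoc mult_left_mono)
  moreover have "far_bound \<beta> d B k = B * norm k powr (- p)"
    using k by (simp add: far_bound_def p_def)
  moreover have "0 < 1 + norm (x + k) powr p" by (simp add: add_pos_nonneg)
  ultimately show ?thesis by (simp add: decay_const_def p_def[symmetric] pos_le_divide_eq)
qed

lemma nn_integral_abs_mult_le:
  assumes "sqint M f" "sqint M g"
  shows "(\<integral>\<^sup>+x. ennreal \<bar>f x * g x\<bar> \<partial>M) \<le> ennreal (l2 M f * l2 M g)"
  using sqint_mult_integrable[OF assms] Cauchy_Schwarz_l2(1)[OF assms]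
  by (subst nn_integral_eq_integral) (auto simp: ennreal_leI)

text \<open>Expanding the product of increments gives four terms. In the two where \<open>u\<close>
  and \<open>\<phi>\<close> sit at the same point, the tail integrates to \<open>far_mass\<close>
  and Cauchy-Schwarz on \<open>W\<close> remains. In the two mixed ones, one point lies in the
  bounded set \<open>W\<close>, so the tail is absorbed into the weight at the other point; this
  leaves the weighted norm of \<open>u\<close> times the L1 norm of \<open>\<phi>\<close>, the
  latter bounded through the measure of \<open>W\<close>.\<close>

lemma far_interaction:
  fixes u \<phi> :: "'a::euclidean_space \<Rightarrow> real"
  assumes "0 < \<beta>" "0 < d" "0 \<le> B" "0 \<le> R" and [measurable]: "u \<in> borel_measurable borel"
    and \<phi>: "sqint lborel \<phi>" "\<And>x. x \<notin> W \<Longrightarrow> \<phi> x = 0"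
    and W: "W \<in> sets borel" "W \<subseteq> cball 0 R" and uW: "sqint lborel (\<lambda>x. indicator W x * u x)"
    and g: "integrable lborel (\<lambda>x. \<bar>u x\<bar> / (1 + norm x powr (real DIM('a) + \<beta>)))"
  shows "(\<integral>\<^sup>+p. ennreal (far_bound \<beta> d B (fst p) * \<bar>difs u p * difs \<phi> p\<bar>) \<partial>(lborel \<Otimes>\<^sub>M lborel))
    \<le> ennreal ((2 * far_mass TYPE('a) \<beta> d B * l2 lborel (\<lambda>x. indicator W x * u x)
        + 2 * decay_const TYPE('a) \<beta> d B R * sqrt (measure lborel W) * (\<integral>x. \<bar>u x\<bar> / (1 + norm x powr (real DIM('a) + \<beta>)) \<partial>lborel)) * l2 lborel \<phi>)"
proof -
  have [measurable]: "\<phi> \<in> borel_measurable borel" using \<phi>(1) by (simp add: sqint_def)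
  define D where "D = decay_const TYPE('a) \<beta> d B R"
  have D0: "0 \<le> D" unfolding D_def by (rule decay_const_nonneg[OF assms(3)])
  define I where "I = far_mass TYPE('a) \<beta> d B"
  have I0: "0 \<le> I" by (simp add: I_def)
  define g where "g = (\<lambda>x::'a. \<bar>u x\<bar> / (1 + norm x powr (real DIM('a) + \<beta>)))"
  have g0: "0 \<le> g x" for x by (simp add: g_def)
  have [measurable]: "g \<in> borel_measurable borel" unfolding g_def by measurable
  define J where "J = (\<integral>x. g x \<partial>lborel)"
  have J: "(\<integral>\<^sup>+x. ennreal (g x) \<partial>lborel) = ennreal J"
    unfolding J_def using assms(11) g0 by (intro nn_integral_eq_integral) (auto simp: g_def)
  have J0: "0 \<le> J" unfolding J_def using g0 by (rule Bochner_Integration.integral_nonneg)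
  define U where "U = l2 lborel (\<lambda>x. indicator W x * u x)"
  have fb: "far_bound \<beta> d B k * \<bar>u (x + k)\<bar> \<le> D * g (x + k)" if "norm x \<le> R" for k x
    using mult_right_mono[OF far_bound_le_decay[OF assms(1,2,3) that assms(4), of k], of "\<bar>u (x + k)\<bar>"]
    by (simp add: g_def D_def)
  \<comment> \<open>Evenness lets the same decay bound be used with the roles of the two points
    exchanged.\<close>
  have fbe: "far_bound \<beta> d B (- k) = far_bound \<beta> d B k" for k :: 'a
    by (simp add: far_bound_def indicator_def)
  have inW: "norm x \<le> R" if "\<phi> x \<noteq> 0" for x using that \<phi>(2)[of x] W(2) by (auto simp: subset_iff)
  have pt: "far_bound \<beta> d B k * \<bar>dif k u x * dif k \<phi> x\<bar>
     \<le> far_bound \<beta> d B k * \<bar>u (x + k) * \<phi> (x + k)\<bar> + far_bound \<beta> d B k * \<bar>u x * \<phi> x\<bar>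
       + D * (g (x + k) * \<bar>\<phi> x\<bar>) + D * (g x * \<bar>\<phi> (x + k)\<bar>)" for k x
  proof -
    have a: "far_bound \<beta> d B k * \<bar>u (x + k)\<bar> * \<bar>\<phi> x\<bar> \<le> D * g (x + k) * \<bar>\<phi> x\<bar>"
    proof (cases "\<phi> x = 0")
      case False
      then show ?thesis by (intro mult_right_mono fb inW) auto
    qed simp
    have b: "far_bound \<beta> d B k * \<bar>u x\<bar> * \<bar>\<phi> (x + k)\<bar> \<le> D * g x * \<bar>\<phi> (x + k)\<bar>"
    proof (cases "\<phi> (x + k) = 0")
      case False
      then show ?thesis using fb[OF inW[OF False], of "- k"] by (intro mult_right_mono) (auto simp: fbe)
    qed simp
    have "\<bar>dif k u x * dif k \<phi> x\<bar> \<le> (\<bar>u (x + k)\<bar> + \<bar>u x\<bar>) * (\<bar>\<phi> (x + k)\<bar> + \<bar>\<phi> x\<bar>)"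
      unfolding abs_mult dif_def by (intro mult_mono) auto
    then have "far_bound \<beta> d B k * \<bar>dif k u x * dif k \<phi> x\<bar> \<le> far_bound \<beta> d B k * ((\<bar>u (x + k)\<bar> + \<bar>u x\<bar>) * (\<bar>\<phi> (x + k)\<bar> + \<bar>\<phi> x\<bar>))"
      by (intro mult_left_mono far_bound_nonneg assms(3))
    then show ?thesis using a b by (simp add: algebra_simps abs_mult)
  qed
  have nnb [simp]: "0 \<le> far_bound \<beta> d B k" for k :: 'a by (rule far_bound_nonneg[OF assms(3)])
  have sW: "sqint lborel (indicator W :: 'a \<Rightarrow> real)" "l2 lborel (indicator W :: 'a \<Rightarrow> real) = sqrt (measure lborel W)"
  proof -
    have fin: "emeasure lborel W < \<infinity>"
      using W emeasure_mono[OF W(2), of lborel] emeasure_lborel_cball_finite[of "0::'a" R] by (simp add: order_le_less_trans)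
    have [simp]: "(\<lambda>x. (indicator W x)\<^sup>2) = (indicator W :: 'a \<Rightarrow> real)" by (auto simp: indicator_def fun_eq_iff)
    show "sqint lborel (indicator W :: 'a \<Rightarrow> real)"
      using W(1) fin by (simp add: sqint_def integrable_indicator_iff)
    show "l2 lborel (indicator W :: 'a \<Rightarrow> real) = sqrt (measure lborel W)"
      using W(1) by (simp add: l2_def)
  qed
  have P: "(\<integral>\<^sup>+x. ennreal \<bar>\<phi> x\<bar> \<partial>lborel) \<le> ennreal (sqrt (measure lborel W) * l2 lborel \<phi>)"
  proof -
    have "(\<integral>\<^sup>+x. ennreal \<bar>\<phi> x\<bar> \<partial>lborel) = (\<integral>\<^sup>+x. ennreal \<bar>indicator W x * \<phi> x\<bar> \<partial>lborel)"
      using \<phi>(2) by (intro nn_integral_cong) (auto simp: indicator_def)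
    then show ?thesis using nn_integral_abs_mult_le[OF sW(1) \<phi>(1)] sW(2) by simp
  qed
  have Q: "(\<integral>\<^sup>+x. ennreal \<bar>u x * \<phi> x\<bar> \<partial>lborel) \<le> ennreal (U * l2 lborel \<phi>)"
  proof -
    have "(\<integral>\<^sup>+x. ennreal \<bar>u x * \<phi> x\<bar> \<partial>lborel) = (\<integral>\<^sup>+x. ennreal \<bar>(indicator W x * u x) * \<phi> x\<bar> \<partial>lborel)"
      using \<phi>(2) by (intro nn_integral_cong) (auto simp: indicator_def)
    then show ?thesis using nn_integral_abs_mult_le[OF uW \<phi>(1)] by (simp add: U_def)
  qed
  have T1: "(\<integral>\<^sup>+k. \<integral>\<^sup>+x. ennreal (far_bound \<beta> d B k * \<bar>u x * \<phi> x\<bar>) \<partial>lborel \<partial>(lborel :: 'a measure)) \<le> ennreal (I * (U * l2 lborel \<phi>))"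
  proof -
    have "(\<integral>\<^sup>+k. \<integral>\<^sup>+x. ennreal (far_bound \<beta> d B k * \<bar>u x * \<phi> x\<bar>) \<partial>lborel \<partial>(lborel :: 'a measure))
      = (\<integral>\<^sup>+k. ennreal (far_bound \<beta> d B k) * (\<integral>\<^sup>+x. ennreal \<bar>u x * \<phi> x\<bar> \<partial>lborel) \<partial>(lborel :: 'a measure))"
      by (intro nn_integral_cong) (simp add: ennreal_mult nn_integral_cmult)
    also have "\<dots> = ennreal I * (\<integral>\<^sup>+x. ennreal \<bar>u x * \<phi> x\<bar> \<partial>lborel)"
      by (simp add: nn_integral_multc far_mass_eq[OF assms(1-3)] I_def)
    also have "\<dots> \<le> ennreal I * ennreal (U * l2 lborel \<phi>)" by (intro mult_left_mono Q) simp
    finally show ?thesis using I0 by (simp add: ennreal_mult U_def)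
  qed
  have T2: "(\<integral>\<^sup>+x. \<integral>\<^sup>+k. ennreal (D * (g x * \<bar>\<phi> (x + k)\<bar>)) \<partial>lborel \<partial>lborel) \<le> ennreal (D * (J * (sqrt (measure lborel W) * l2 lborel \<phi>)))"
    and T3: "(\<integral>\<^sup>+x. \<integral>\<^sup>+k. ennreal (D * (g (x + k) * \<bar>\<phi> x\<bar>)) \<partial>lborel \<partial>lborel) \<le> ennreal (D * (J * (sqrt (measure lborel W) * l2 lborel \<phi>)))"
  proof -
    let ?P = "\<integral>\<^sup>+x. ennreal \<bar>\<phi> x\<bar> \<partial>lborel"
    have tr: "(\<integral>\<^sup>+k. f (x + k) \<partial>lborel) = (\<integral>\<^sup>+k. f k \<partial>lborel)" if "f \<in> borel_measurable borel" for f :: "'a \<Rightarrow> ennreal" and x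
      using nn_integral_lborel_translate[OF that, of x] by (simp add: add.commute)
    have e: "ennreal D * (ennreal J * ?P) \<le> ennreal (D * (J * (sqrt (measure lborel W) * l2 lborel \<phi>)))"
    proof -
      have "ennreal D * (ennreal J * ?P) \<le> ennreal D * (ennreal J * ennreal (sqrt (measure lborel W) * l2 lborel \<phi>))"
        by (intro mult_left_mono P) auto
      then show ?thesis using D0 J0 by (simp add: ennreal_mult)
    qed
    have "(\<integral>\<^sup>+x. \<integral>\<^sup>+k. ennreal (D * (g x * \<bar>\<phi> (x + k)\<bar>)) \<partial>lborel \<partial>lborel) = (\<integral>\<^sup>+x. ennreal D * (ennreal (g x) * ?P) \<partial>lborel)"
      using D0 g0 tr[of "\<lambda>x. ennreal \<bar>\<phi> x\<bar>"] by (intro nn_integral_cong) (simp add: ennreal_mult nn_integral_cmult)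
    also have "\<dots> = ennreal D * (ennreal J * ?P)"
      by (simp add: nn_integral_cmult nn_integral_multc J)
    finally show "(\<integral>\<^sup>+x. \<integral>\<^sup>+k. ennreal (D * (g x * \<bar>\<phi> (x + k)\<bar>)) \<partial>lborel \<partial>lborel) \<le> ennreal (D * (J * (sqrt (measure lborel W) * l2 lborel \<phi>)))"
      using e by simp
    have "(\<integral>\<^sup>+x. \<integral>\<^sup>+k. ennreal (D * (g (x + k) * \<bar>\<phi> x\<bar>)) \<partial>lborel \<partial>lborel) = (\<integral>\<^sup>+x. ennreal D * (ennreal J * ennreal \<bar>\<phi> x\<bar>) \<partial>lborel)"
      using D0 g0 tr[of "\<lambda>x. ennreal (g x)"] by (intro nn_integral_cong) (simp add: ennreal_mult nn_integral_cmult nn_integral_multc J)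
    also have "\<dots> = ennreal D * (ennreal J * ?P)"
      by (simp add: nn_integral_cmult)
    finally show "(\<integral>\<^sup>+x. \<integral>\<^sup>+k. ennreal (D * (g (x + k) * \<bar>\<phi> x\<bar>)) \<partial>lborel \<partial>lborel) \<le> ennreal (D * (J * (sqrt (measure lborel W) * l2 lborel \<phi>)))"
      using e by simp
  qed
  let ?M = "lborel \<Otimes>\<^sub>M (lborel :: 'a measure)"
  let ?f1 = "\<lambda>p :: 'a \<times> 'a. ennreal (far_bound \<beta> d B (fst p) * \<bar>u (snd p + fst p) * \<phi> (snd p + fst p)\<bar>)"
    and ?f2 = "\<lambda>p :: 'a \<times> 'a. ennreal (far_bound \<beta> d B (fst p) * \<bar>u (snd p) * \<phi> (snd p)\<bar>)"
    and ?f3 = "\<lambda>p :: 'a \<times> 'a. ennreal (D * (g (snd p + fst p) * \<bar>\<phi> (snd p)\<bar>))"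
    and ?f4 = "\<lambda>p :: 'a \<times> 'a. ennreal (D * (g (snd p) * \<bar>\<phi> (snd p + fst p)\<bar>))"
  have "(\<integral>\<^sup>+p. ennreal (far_bound \<beta> d B (fst p) * \<bar>difs u p * difs \<phi> p\<bar>) \<partial>?M) \<le> (\<integral>\<^sup>+p. ?f1 p + ?f2 p + ?f3 p + ?f4 p \<partial>?M)"
  proof (rule nn_integral_mono)
    fix p :: "'a \<times> 'a"
    have "ennreal (far_bound \<beta> d B (fst p) * \<bar>difs u p * difs \<phi> p\<bar>) \<le> ennreal (far_bound \<beta> d B (fst p) * \<bar>u (snd p + fst p) * \<phi> (snd p + fst p)\<bar>
      + far_bound \<beta> d B (fst p) * \<bar>u (snd p) * \<phi> (snd p)\<bar> + D * (g (snd p + fst p) * \<bar>\<phi> (snd p)\<bar>) + D * (g (snd p) * \<bar>\<phi> (snd p + fst p)\<bar>))"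
      using pt[of "fst p" "snd p"] by (intro ennreal_leI) (simp add: difs_def case_prod_beta)
    then show "ennreal (far_bound \<beta> d B (fst p) * \<bar>difs u p * difs \<phi> p\<bar>) \<le> ?f1 p + ?f2 p + ?f3 p + ?f4 p"
      using D0 g0 by simp
  qed
  also have "\<dots> = (\<integral>\<^sup>+p. ?f1 p \<partial>?M) + (\<integral>\<^sup>+p. ?f2 p \<partial>?M) + (\<integral>\<^sup>+p. ?f3 p \<partial>?M) + (\<integral>\<^sup>+p. ?f4 p \<partial>?M)"
  proof -
    have "?f1 \<in> borel_measurable ?M" "?f2 \<in> borel_measurable ?M" "?f3 \<in> borel_measurable ?M" "?f4 \<in> borel_measurable ?M"
      by measurable
    then show ?thesis by (simp add: nn_integral_add)
  qed
  also have "(\<integral>\<^sup>+p. ?f1 p \<partial>?M) = (\<integral>\<^sup>+k. \<integral>\<^sup>+x. ennreal (far_bound \<beta> d B k * \<bar>u (x + k) * \<phi> (x + k)\<bar>) \<partial>lborel \<partial>lborel)"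
    by (subst lborel.nn_integral_fst[symmetric]) auto
  also have "\<dots> = (\<integral>\<^sup>+k. \<integral>\<^sup>+x. ennreal (far_bound \<beta> d B k * \<bar>u x * \<phi> x\<bar>) \<partial>lborel \<partial>(lborel :: 'a measure))"
  proof (rule nn_integral_cong)
    fix k :: 'a
    show "(\<integral>\<^sup>+x. ennreal (far_bound \<beta> d B k * \<bar>u (x + k) * \<phi> (x + k)\<bar>) \<partial>lborel) = (\<integral>\<^sup>+x. ennreal (far_bound \<beta> d B k * \<bar>u x * \<phi> x\<bar>) \<partial>lborel)"
      by (rule nn_integral_lborel_translate[of "\<lambda>x. ennreal (far_bound \<beta> d B k * \<bar>u x * \<phi> x\<bar>)"]) measurable
  qed
  also have "(\<integral>\<^sup>+p. ?f2 p \<partial>?M) = (\<integral>\<^sup>+k. \<integral>\<^sup>+x. ennreal (far_bound \<beta> d B k * \<bar>u x * \<phi> x\<bar>) \<partial>lborel \<partial>(lborel :: 'a measure))"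
    by (subst lborel.nn_integral_fst[symmetric]) auto
  also have "(\<integral>\<^sup>+p. ?f3 p \<partial>?M) = (\<integral>\<^sup>+x. \<integral>\<^sup>+k. ennreal (D * (g (x + k) * \<bar>\<phi> x\<bar>)) \<partial>lborel \<partial>lborel)"
    by (subst lborel_pair.nn_integral_snd[symmetric]) auto
  also have "(\<integral>\<^sup>+p. ?f4 p \<partial>?M) = (\<integral>\<^sup>+x. \<integral>\<^sup>+k. ennreal (D * (g x * \<bar>\<phi> (x + k)\<bar>)) \<partial>lborel \<partial>lborel)"
    by (subst lborel_pair.nn_integral_snd[symmetric]) auto
  finally have "(\<integral>\<^sup>+p. ennreal (far_bound \<beta> d B (fst p) * \<bar>difs u p * difs \<phi> p\<bar>) \<partial>?M)
    \<le> ennreal (I * (U * l2 lborel \<phi>)) + ennreal (I * (U * l2 lborel \<phi>)) + ennreal (D * (J * (sqrt (measure lborel W) * l2 lborel \<phi>)))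
      + ennreal (D * (J * (sqrt (measure lborel W) * l2 lborel \<phi>)))"
    by (rule order_trans) (intro add_mono T1 T2 T3)
  also have "\<dots> = ennreal (I * (U * l2 lborel \<phi>) + I * (U * l2 lborel \<phi>) + D * (J * (sqrt (measure lborel W) * l2 lborel \<phi>))
      + D * (J * (sqrt (measure lborel W) * l2 lborel \<phi>)))"
  proof -
    have "ennreal a + ennreal a + ennreal b + ennreal b = ennreal (a + a + b + b)" if "0 \<le> a" "0 \<le> b" for a b
      using that by (metis add_nonneg_nonneg ennreal_plus)
    then show ?thesis using I0 D0 J0 by (simp only: U_def mult_nonneg_nonneg l2_nonneg measure_nonneg real_sqrt_ge_zero)
  qed
  also have "I * (U * l2 lborel \<phi>) + I * (U * l2 lborel \<phi>) + D * (J * (sqrt (measure lborel W) * l2 lborel \<phi>))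
      + D * (J * (sqrt (measure lborel W) * l2 lborel \<phi>)) = (2 * I * U + 2 * D * sqrt (measure lborel W) * J) * l2 lborel \<phi>"
    by (simp add: algebra_simps)
  finally show ?thesis by (simp add: I_def D_def U_def J_def g_def)
qed

text \<open>The integral is split at |k| = d. On the near part \<open>U\<close> and
  \<open>u'\<close> agree wherever the increment of \<open>\<phi>\<close> can be nonzero, which
  gives \<open>bil\<close>; the far part is at most \<open>c\<close>. The split needs both parts
  integrable: the near one by the bounds on \<open>wkern\<close>, the far one by the assumed
  majorant.\<close>

lemma energy_localize:
  fixes K K' :: "(real^'n) \<times> (real^'n) \<Rightarrow> ennreal" and u u' U \<phi> :: "real^'n \<Rightarrow> real"
  assumes "0 \<le> B" "0 < d" and [measurable]: "K' \<in> borel_measurable (borel \<Otimes>\<^sub>M borel)" and KK: "AE p in lebesgue. K p = K' p"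
    and a: "AE p in kmeas s d. l \<le> wkern s K' p \<and> wkern s K' p \<le> L" "0 < l" "l \<le> L"
    and KB: "AE p in lborel \<Otimes>\<^sub>M lborel. fst p \<noteq> 0 \<longrightarrow> kernel_bounds_at s \<beta> d l L B K' p"
    and u: "u' \<in> borel_measurable borel" "AE x in lborel. u x = u' x"
    and U: "frac_sobolev s d U" and \<phi>: "frac_sobolev s d \<phi>"
    and Uu: "\<And>k x. norm k < d \<Longrightarrow> \<phi> x \<noteq> 0 \<or> \<phi> (x + k) \<noteq> 0 \<Longrightarrow> U x = u' x \<and> U (x + k) = u' (x + k)"
    and far: "(\<integral>\<^sup>+p. ennreal (far_bound \<beta> d B (fst p) * \<bar>difs u' p * difs \<phi> p\<bar>) \<partial>(lborel \<Otimes>\<^sub>M lborel)) \<le> ennreal c" "0 \<le> c"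
    and K: "K \<in> borel_measurable lebesgue" and um: "u \<in> borel_measurable lebesgue"
  shows "\<bar>energy K u \<phi> - bil s d (wkern s K') U \<phi>\<bar> \<le> c"
proof -
  let ?M = "lborel \<Otimes>\<^sub>M (lborel :: (real^'n) measure)"
  note [measurable] = u(1) frac_sobolevD(1)[OF U] frac_sobolevD(1)[OF \<phi>]
  define F where "F p = (u' (fst p) - u' (snd p)) * (\<phi> (fst p) - \<phi> (snd p)) * enn2real (K' p)" for p
  have Fm [measurable]: "F \<in> borel_measurable (borel \<Otimes>\<^sub>M borel)" unfolding F_def by measurable
  have Fl: "F \<in> borel_measurable lebesgue"
    using Fm by (intro measurable_completion) (simp add: borel_prod)
  let ?E = "\<lambda>p. (u (fst p) - u (snd p)) * (\<phi> (fst p) - \<phi> (snd p)) * enn2real (K p)"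
  have AEE: "AE p in lebesgue. F p = ?E p"
  proof -
    have "AE p in ?M. u (fst p) = u' (fst p)" by (rule AE_lborel_pair_fst[OF u(2)])
    moreover have "AE p in ?M. u (snd p) = u' (snd p)" by (rule AE_lborel_pair_snd[OF u(2)])
    moreover have "AE p in ?M. K p = K' p" using KK unfolding AE_completion_iff lborel_prod .
    ultimately have "AE p in ?M. F p = ?E p" by eventually_elim (simp add: F_def)
    then show ?thesis unfolding AE_completion_iff lborel_prod .
  qed
  have Em: "?E \<in> borel_measurable lebesgue" by (rule borel_measurable_AE[OF Fl AEE])
  have "energy K u \<phi> = (\<integral>p. ?E p \<partial>lebesgue)"
    unfolding energy_def by (intro Bochner_Integration.integral_cong) auto
  also have "\<dots> = (\<integral>p. F p \<partial>lebesgue)" by (rule integral_cong_AE[OF Em Fl]) (use AEE in eventually_elim, simp)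
  also have "\<dots> = (\<integral>p. F p \<partial>lborel)" using Fm by (intro integral_completion) (simp add: borel_prod)
  also have "\<dots> = (\<integral>p. F (shear p) \<partial>?M)" by (rule integral_shear) measurable
  finally have E: "energy K u \<phi> = (\<integral>p. F (shear p) \<partial>?M)" .
  have Fs: "F (shear p) = difs u' p * difs \<phi> p * enn2real (K' (shear p))" for p
    by (simp add: F_def shear_def difs_def dif_def case_prod_beta)
  have nz: "AE p in ?M. fst p \<noteq> 0" by (rule AE_lborel_pair_fst[OF AE_lborel_singleton])
  define N where "N p = indicator (ball 0 d) (fst p) * F (shear p)" for p
  define H where "H p = indicator (- ball 0 d) (fst p) * F (shear p)" for p
  have [measurable]: "N \<in> borel_measurable (borel \<Otimes>\<^sub>M borel)" "H \<in> borel_measurable (borel \<Otimes>\<^sub>M borel)"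
    unfolding N_def H_def by measurable
  have NH: "F (shear p) = N p + H p" for p by (simp add: N_def H_def indicator_def)
  let ?G = "\<lambda>p. difs U p * difs \<phi> p * wkern s K' p"
  have [measurable]: "?G \<in> borel_measurable (borel \<Otimes>\<^sub>M borel)" by measurable
  have NG: "AE p in ?M. wgt s d (fst p) * ?G p = N p"
    using KB nz
  proof eventually_elim
    case (elim p)
    show ?case
    proof (cases "norm (fst p) < d")
      case True
      have e: "enn2real (K' (shear p)) = wgt s d (fst p) * wkern s K' p"
        using elim True by (simp add: kernel_bounds_at_def)
      have "difs U p * difs \<phi> p = difs u' p * difs \<phi> p"
        using Uu[OF True, of "snd p"] by (cases "\<phi> (snd p) \<noteq> 0 \<or> \<phi> (snd p + fst p) \<noteq> 0") (auto simp: difs_def dif_def case_prod_beta)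
      then show ?thesis using True by (auto simp: N_def Fs e)
    next
      case False
      then show ?thesis by (simp add: N_def wgt_def)
    qed
  qed
  have km: "kmeas s d = density ?M (\<lambda>p. ennreal (wgt s d (fst p)))"
    by (simp add: kmeas_def case_prod_unfold)
  have aL: "AE p in kmeas s d. \<bar>wkern s K' p\<bar> \<le> L" using a(1) by eventually_elim (use a(2) in auto)
  have L0: "0 \<le> L" using a(2,3) by simp
  have wm: "wkern s K' \<in> borel_measurable (kmeas s d)" by measurable
  have iG: "integrable (kmeas s d) ?G"
    by (rule triple_integral_bound(1)[OF frac_sobolevD(3)[OF U] frac_sobolevD(3)[OF \<phi>] wm aL L0])
  have "integrable ?M (\<lambda>p. wgt s d (fst p) * ?G p)"
    using iG unfolding km by (subst (asm) integrable_density) auto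
  then have iN: "integrable ?M N"
    using NG by (subst integrable_cong_AE[where g = "\<lambda>p. wgt s d (fst p) * ?G p"]) (auto elim: AE_mp)
  have "bil s d (wkern s K') U \<phi> = (\<integral>p. wgt s d (fst p) * ?G p \<partial>?M)"
    unfolding bil_def km by (subst integral_density) auto
  also have "\<dots> = (\<integral>p. N p \<partial>?M)" using NG by (intro integral_cong_AE) auto
  finally have bN: "bil s d (wkern s K') U \<phi> = (\<integral>p. N p \<partial>?M)" .
  have Hb: "(\<integral>\<^sup>+p. ennreal (norm (H p)) \<partial>?M) \<le> ennreal c"
  proof -
    have "AE p in ?M. ennreal (norm (H p)) \<le> ennreal (far_bound \<beta> d B (fst p) * \<bar>difs u' p * difs \<phi> p\<bar>)"
      using KB nz
    proof eventually_elim
      case (elim p)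
      show ?case
      proof (cases "norm (fst p) < d")
        case True
        then show ?thesis by (simp add: H_def)
      next
        case False
        then have "enn2real (K' (shear p)) \<le> far_bound \<beta> d B (fst p)" using elim by (simp add: kernel_bounds_at_def)
        then have "\<bar>difs u' p * difs \<phi> p\<bar> * enn2real (K' (shear p)) \<le> \<bar>difs u' p * difs \<phi> p\<bar> * far_bound \<beta> d B (fst p)"
          by (rule mult_left_mono) simp
        then show ?thesis using False by (intro ennreal_leI) (simp add: H_def Fs abs_mult mult.commute)
      qed
    qed
    then have "(\<integral>\<^sup>+p. ennreal (norm (H p)) \<partial>?M) \<le> (\<integral>\<^sup>+p. ennreal (far_bound \<beta> d B (fst p) * \<bar>difs u' p * difs \<phi> p\<bar>) \<partial>?M)"
      by (rule nn_integral_mono_AE)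
    then show ?thesis using far(1) by (rule order_trans)
  qed
  have iH: "integrable ?M H"
    unfolding integrable_iff_bounded using Hb by (simp add: order_le_less_trans)
  have "ennreal \<bar>\<integral>p. H p \<partial>?M\<bar> \<le> (\<integral>\<^sup>+p. ennreal (norm (H p)) \<partial>?M)"
    using integral_norm_bound_ennreal[OF iH] by simp
  then have "ennreal \<bar>\<integral>p. H p \<partial>?M\<bar> \<le> ennreal c" using Hb by (rule order_trans)
  then have Hc: "\<bar>\<integral>p. H p \<partial>?M\<bar> \<le> c" using far(2) by (simp add: ennreal_le_iff)
  have "energy K u \<phi> = bil s d (wkern s K') U \<phi> + (\<integral>p. H p \<partial>?M)"
    unfolding E bN using iN iH by (simp add: NH)
  then show ?thesis using Hc by simp
qed

section \<open>Membership in the energy spaces\<close>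

lemma cross_region_measurable:
  assumes "\<Omega> \<in> sets (borel :: (real^'n) measure)"
  shows "cross_region \<Omega> \<in> sets (borel \<Otimes>\<^sub>M borel)"
proof -
  have c: "UNIV - \<Omega> \<in> sets (borel :: (real^'n) measure)" using assms by auto
  have "UNIV \<times> UNIV - (UNIV - \<Omega>) \<times> (UNIV - \<Omega>) \<in> sets ((borel :: (real^'n) measure) \<Otimes>\<^sub>M borel)"
    by (intro sets.Diff pair_measureI c) auto
  then show ?thesis by (simp add: cross_region_def)
qed

text \<open>This makes the cutoff test functions legitimate in the equation. The kernel is at most
  \<open>L\<close> times the weight plus the tail: the first part is paid by the fractional energy,
  the second by the L2 norm, since the tail has finite mass.\<close>

lemma X0_space_frac_sobolev:
  fixes K K' :: "(real^'n) \<times> (real^'n) \<Rightarrow> ennreal" and \<phi> :: "real^'n \<Rightarrow> real"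
  assumes "0 \<le> B" "0 < d" "0 < \<beta>" "0 \<le> L" and [measurable]: "K' \<in> borel_measurable (borel \<Otimes>\<^sub>M borel)" and KK: "AE p in lebesgue. K p = K' p"
    and KB: "AE p in lborel \<Otimes>\<^sub>M lborel. fst p \<noteq> 0 \<longrightarrow> kernel_bounds_at s \<beta> d l L B K' p"
    and \<phi>: "frac_sobolev s d \<phi>" "\<And>x. x \<notin> W \<Longrightarrow> \<phi> x = 0" and W: "W \<subseteq> \<Omega>" and \<Omega>: "\<Omega> \<in> sets borel"
  shows "\<phi> \<in> X0_space K \<Omega>"
proof -
  let ?M = "lborel \<Otimes>\<^sub>M (lborel :: (real^'n) measure)"
  note [measurable] = frac_sobolevD(1)[OF \<phi>(1)]
  have m: "\<phi> \<in> borel_measurable lebesgue" by (intro measurable_completion) simp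
  have "sqint lborel (\<lambda>x. indicator \<Omega> x * \<phi> x)"
    using l2_restrict_mono(1)[OF frac_sobolevD(2)[OF \<phi>(1)]] \<Omega> by simp
  then have L2: "\<phi> \<in> L2 \<Omega>"
    by (simp add: L2_iff_sqint sqint_lebesgue_on_iff(1)[OF \<Omega> frac_sobolevD(1)[OF \<phi>(1)]])
  define F where "F p = ennreal ((\<phi> (fst p) - \<phi> (snd p))\<^sup>2) * K' p" for p
  have Fm [measurable]: "F \<in> borel_measurable (borel \<Otimes>\<^sub>M borel)" unfolding F_def by measurable
  have "(\<integral>\<^sup>+(x, y)\<in>cross_region \<Omega>. ennreal ((\<phi> x - \<phi> y)\<^sup>2) * K (x, y) \<partial>lebesgue) \<le> (\<integral>\<^sup>+p. F p \<partial>lebesgue)"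
  proof (rule nn_integral_mono_AE, use KK in eventually_elim)
    case (elim p)
    then show ?case by (cases p) (auto simp: F_def indicator_def)
  qed
  also have "\<dots> = (\<integral>\<^sup>+p. F p \<partial>?M)" by (simp add: nn_integral_completion lborel_prod)
  also have "\<dots> = (\<integral>\<^sup>+p. F (shear p) \<partial>?M)" by (rule nn_integral_shear[symmetric]) measurable
  also have "\<dots> \<le> (\<integral>\<^sup>+p. ennreal L * (ennreal (wgt s d (fst p)) * ennreal ((difs \<phi> p)\<^sup>2)) + ennreal (far_bound \<beta> d B (fst p)) * ennreal ((difs \<phi> p)\<^sup>2) \<partial>?M)"
  proof (rule nn_integral_mono_AE, use KB AE_lborel_pair_fst[OF AE_lborel_singleton[of 0]] in eventually_elim)
    case (elim p)
    define c where "c = enn2real (K' (shear p))"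
    have K': "K' (shear p) = ennreal c" and b: "c \<le> L * wgt s d (fst p) + far_bound \<beta> d B (fst p)"
    proof -
      have kb: "kernel_bounds_at s \<beta> d l L B K' p" using elim by simp
      show "K' (shear p) = ennreal c" using kb by (simp only: kernel_bounds_at_def c_def)
      show "c \<le> L * wgt s d (fst p) + far_bound \<beta> d B (fst p)"
      proof (cases "norm (fst p) < d")
        case True
        then have "c = wgt s d (fst p) * wkern s K' p" "wkern s K' p \<le> L" using kb by (simp_all add: kernel_bounds_at_def c_def)
        then have "c \<le> L * wgt s d (fst p)" by (simp add: mult.commute mult_right_mono)
        then show ?thesis using far_bound_nonneg[OF assms(1), of \<beta> d "fst p"] by simp
      next
        case False
        then show ?thesis using kb assms(4) by (simp add: kernel_bounds_at_def c_def add_increasing)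
      qed
    qed
    have "F (shear p) = ennreal ((difs \<phi> p)\<^sup>2) * ennreal c"
      by (simp add: F_def K') (simp add: shear_def difs_def dif_def case_prod_beta)
    also have "\<dots> \<le> ennreal ((difs \<phi> p)\<^sup>2) * ennreal (L * wgt s d (fst p) + far_bound \<beta> d B (fst p))"
      by (intro mult_left_mono ennreal_leI b) auto
    also have "\<dots> = ennreal L * (ennreal (wgt s d (fst p)) * ennreal ((difs \<phi> p)\<^sup>2)) + ennreal (far_bound \<beta> d B (fst p)) * ennreal ((difs \<phi> p)\<^sup>2)"
    proof -
      have "ennreal (L * wgt s d (fst p) + far_bound \<beta> d B (fst p)) = ennreal L * ennreal (wgt s d (fst p)) + ennreal (far_bound \<beta> d B (fst p))"
        using assms(4) far_bound_nonneg[OF assms(1), of \<beta> d "fst p"] by (simp add: ennreal_mult)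
      moreover have "X * (x * y + z) = x * (y * X) + z * X" for X x y z :: ennreal
        by (simp add: distrib_left mult_ac)
      ultimately show ?thesis by simp
    qed
    finally show ?case .
  qed
  also have "\<dots> = ennreal L * (\<integral>\<^sup>+p. ennreal (wgt s d (fst p)) * ennreal ((difs \<phi> p)\<^sup>2) \<partial>?M)
     + (\<integral>\<^sup>+p. ennreal (far_bound \<beta> d B (fst p)) * ennreal ((difs \<phi> p)\<^sup>2) \<partial>?M)"
    by (subst nn_integral_add) (auto simp: nn_integral_cmult)
  also have "(\<integral>\<^sup>+p. ennreal (wgt s d (fst p)) * ennreal ((difs \<phi> p)\<^sup>2) \<partial>?M) = ennreal ((l2 (kmeas s d) (difs \<phi>))\<^sup>2)"
  proof -
    have "(\<integral>\<^sup>+p. ennreal ((difs \<phi> p)\<^sup>2) \<partial>kmeas s d) = (\<integral>\<^sup>+p. ennreal (wgt s d (fst p)) * ennreal ((difs \<phi> p)\<^sup>2) \<partial>?M)"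
      unfolding kmeas_def by (subst nn_integral_density) (auto simp: case_prod_beta)
    then show ?thesis using nn_integral_square[OF frac_sobolevD(3)[OF \<phi>(1)]] by simp
  qed
  also have "(\<integral>\<^sup>+p. ennreal (far_bound \<beta> d B (fst p)) * ennreal ((difs \<phi> p)\<^sup>2) \<partial>?M)
    \<le> ennreal (far_mass TYPE(real^'n) \<beta> d B) * ennreal ((2 * l2 lborel \<phi>)\<^sup>2)"
  proof -
    have "(\<integral>\<^sup>+p. ennreal (far_bound \<beta> d B (fst p)) * ennreal ((difs \<phi> p)\<^sup>2) \<partial>?M)
      = (\<integral>\<^sup>+k. \<integral>\<^sup>+x. ennreal (far_bound \<beta> d B k) * ennreal ((dif k \<phi> x)\<^sup>2) \<partial>lborel \<partial>(lborel :: (real^'n) measure))"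
      by (subst lborel.nn_integral_fst[symmetric]) (auto simp: difs_def)
    also have "\<dots> = (\<integral>\<^sup>+k. ennreal (far_bound \<beta> d B k) * ennreal ((l2 lborel (dif k \<phi>))\<^sup>2) \<partial>(lborel :: (real^'n) measure))"
      using nn_integral_square[OF l2_dif(1)[OF frac_sobolevD(2)[OF \<phi>(1)]]] by (intro nn_integral_cong) (simp add: nn_integral_cmult)
    also have "\<dots> \<le> (\<integral>\<^sup>+k. ennreal (far_bound \<beta> d B k) * ennreal ((2 * l2 lborel \<phi>)\<^sup>2) \<partial>(lborel :: (real^'n) measure))"
      by (intro nn_integral_mono mult_left_mono ennreal_leI power_mono l2_dif(2) frac_sobolevD(2)[OF \<phi>(1)]) auto
    also have "\<dots> = ennreal (far_mass TYPE(real^'n) \<beta> d B) * ennreal ((2 * l2 lborel \<phi>)\<^sup>2)"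
      by (simp add: nn_integral_multc far_mass_eq[OF assms(3,2,1)])
    finally show ?thesis .
  qed
  finally have "(\<integral>\<^sup>+(x, y)\<in>cross_region \<Omega>. ennreal ((\<phi> x - \<phi> y)\<^sup>2) * K (x, y) \<partial>lebesgue)
    \<le> ennreal L * ennreal ((l2 (kmeas s d) (difs \<phi>))\<^sup>2) + ennreal (far_mass TYPE(real^'n) \<beta> d B) * ennreal ((2 * l2 lborel \<phi>)\<^sup>2)"
    by (simp add: add_left_mono)
  also have "\<dots> < \<infinity>" by (simp add: ennreal_mult_less_top)
  finally show ?thesis using m L2 \<phi>(2) W by (auto simp: X0_space_def X_space_def)
qed

text \<open>The energy of \<open>u\<close> is known only on pairs with a point in
  \<open>\<Omega>\<close>. If \<open>x\<close> lies in \<open>\<Omega>\<close>, the pair is of this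
  kind, and the Leibniz rule with the lower bound on the kernel applies. If not, the spare layer
  between \<open>(a + 1) * d\<close> and \<open>(a + 2) * d\<close> puts \<open>x\<close> and all
  points closer to it than \<open>d\<close> outside the support of the cutoff, so the increment
  vanishes.\<close>

lemma cutoff_frac_sobolev:
  fixes K K' :: "(real^'n) \<times> (real^'n) \<Rightarrow> ennreal" and u u' :: "real^'n \<Rightarrow> real"
  assumes "s < 1" "0 < d" "0 < l" and [measurable]: "K' \<in> borel_measurable (borel \<Otimes>\<^sub>M borel)" and KK: "AE p in lebesgue. K p = K' p"
    and KB: "AE p in lborel \<Otimes>\<^sub>M lborel. fst p \<noteq> 0 \<longrightarrow> kernel_bounds_at s \<beta> d l L B K' p"
    and u: "u \<in> X_space K \<Omega>" and u': "u' \<in> borel_measurable borel" "AE x in lborel. u x = u' x"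
    and \<Omega>: "\<Omega> \<in> sets borel" "nbh S ((a + 2) * d) \<subseteq> \<Omega>"
  shows "frac_sobolev s d (\<lambda>x. cutoff S d a x * u' x)" "l2 lborel (\<lambda>x. cutoff S d a x * u' x) \<le> L2_norm \<Omega> u"
    "sqint lborel (\<lambda>x. indicator \<Omega> x * u' x)" "l2 lborel (\<lambda>x. indicator \<Omega> x * u' x) = L2_norm \<Omega> u"
proof -
  let ?M = "lborel \<Otimes>\<^sub>M (lborel :: (real^'n) measure)"
  note [measurable] = u'(1) \<Omega>(1)
  have cr[measurable]: "cross_region \<Omega> \<in> sets (borel \<Otimes>\<^sub>M borel)" by (rule cross_region_measurable[OF \<Omega>(1)])
  have uL: "sqint (lebesgue_on \<Omega>) u" using u by (simp add: X_space_def L2_iff_sqint)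
  have "AE x in lebesgue_on \<Omega>. u x = u' x"
    using u'(2) by (subst AE_lebesgue_on_iff[OF \<Omega>(1)]) (auto elim: AE_mp)
  moreover have "u' \<in> borel_measurable (lebesgue_on \<Omega>)"
    by (rule measurable_restrict_space1) (rule measurable_completion, simp)
  ultimately have "l2 (lebesgue_on \<Omega>) u = l2 (lebesgue_on \<Omega>) u'" "sqint (lebesgue_on \<Omega>) u'"
    using l2_cong_AE[of u u' "lebesgue_on \<Omega>"] uL by (auto simp: sqint_def)
  then show sq: "sqint lborel (\<lambda>x. indicator \<Omega> x * u' x)" and eq: "l2 lborel (\<lambda>x. indicator \<Omega> x * u' x) = L2_norm \<Omega> u"
    by (auto simp: L2_norm_eq_l2 sqint_lebesgue_on_iff[OF \<Omega>(1) u'(1)])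
  define U where "U = (\<lambda>x. cutoff S d a x * u' x)"
  have Um [measurable]: "U \<in> borel_measurable borel" unfolding U_def by measurable
  have off: "cutoff S d a x = 0" if "x \<notin> nbh S ((a + 1) * d)" for x
    by (rule cutoff_eq_0[OF assms(2) that])
  have sub: "nbh S ((a + 1) * d) \<subseteq> \<Omega>"
    using \<Omega>(2) nbh_mono[of _ S "(a + 1) * d" "(a + 2) * d"] assms(2) by (auto simp: algebra_simps)
  have "\<bar>U x\<bar> \<le> 1 * \<bar>indicator \<Omega> x * u' x\<bar>" for x
  proof (cases "x \<in> \<Omega>")
    case True
    then show ?thesis using cutoff_bounds(3)[of S d a x] by (simp add: U_def abs_mult mult_left_le_one_le)
  next
    case False
    then show ?thesis using off[of x] sub by (auto simp: U_def)
  qed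
  then have Uq: "sqint lborel U" "l2 lborel U \<le> 1 * l2 lborel (\<lambda>x. indicator \<Omega> x * u' x)"
    using l2_mono[OF sq, of U 1] by simp_all
  then show "l2 lborel (\<lambda>x. cutoff S d a x * u' x) \<le> L2_norm \<Omega> u" using eq by (simp add: U_def)
  define G where "G p = indicator (cross_region \<Omega>) p * (ennreal ((u' (fst p) - u' (snd p))\<^sup>2) * K' p)" for p
  have Gm [measurable]: "G \<in> borel_measurable (borel \<Otimes>\<^sub>M borel)" unfolding G_def by measurable
  have "(\<integral>\<^sup>+p. G (shear p) \<partial>?M) = (\<integral>\<^sup>+p. G p \<partial>?M)" by (rule nn_integral_shear) measurable
  also have "\<dots> = (\<integral>\<^sup>+p. G p \<partial>lebesgue)" by (simp add: nn_integral_completion lborel_prod)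
  also have "\<dots> = (\<integral>\<^sup>+(x, y)\<in>cross_region \<Omega>. ennreal ((u x - u y)\<^sup>2) * K (x, y) \<partial>lebesgue)"
  proof (rule nn_integral_cong_AE)
    have "AE p in ?M. u (fst p) = u' (fst p)" by (rule AE_lborel_pair_fst[OF u'(2)])
    moreover have "AE p in ?M. u (snd p) = u' (snd p)" by (rule AE_lborel_pair_snd[OF u'(2)])
    ultimately have "AE p in ?M. u (fst p) = u' (fst p) \<and> u (snd p) = u' (snd p)" by eventually_elim simp
    then have "AE p in lebesgue. u (fst p) = u' (fst p) \<and> u (snd p) = u' (snd p)"
      unfolding AE_completion_iff lborel_prod .
    then show "AE p in lebesgue. G p = (case p of (x, y) \<Rightarrow> ennreal ((u x - u y)\<^sup>2) * K (x, y)) * indicator (cross_region \<Omega>) p"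
      using KK by eventually_elim (auto simp: G_def mult.commute split: prod.splits)
  qed
  also have "\<dots> < \<infinity>" using u by (simp add: X_space_def)
  finally have Gfin: "(\<integral>\<^sup>+p. G (shear p) \<partial>?M) < \<infinity>" .
  let ?m = "\<lambda>p :: (real^'n) \<times> (real^'n). norm (fst p) * (indicator \<Omega> (snd p) * u' (snd p))"
  have mm: "sqint (kmeas s d) ?m" by (rule l2_moment_slice(1)[OF assms(1,2) sq])
  have dens: "(\<integral>\<^sup>+p. ennreal ((f p)\<^sup>2) \<partial>kmeas s d) = (\<integral>\<^sup>+p. ennreal (wgt s d (fst p)) * ennreal ((f p)\<^sup>2) \<partial>?M)"
    if "f \<in> borel_measurable (borel \<Otimes>\<^sub>M borel)" for f :: "(real^'n) \<times> (real^'n) \<Rightarrow> real"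
    unfolding kmeas_def using that by (subst nn_integral_density) (auto simp: case_prod_beta)
  have "(\<integral>\<^sup>+p. ennreal ((difs U p)\<^sup>2) \<partial>kmeas s d) = (\<integral>\<^sup>+p. ennreal (wgt s d (fst p)) * ennreal ((difs U p)\<^sup>2) \<partial>?M)"
    by (rule dens) measurable
  \<comment> \<open>The factors 2 come from squaring a sum, 1 / l from trading the weight for
    \<open>K\<close>, and the square of 1 / d from the Lipschitz constant of the cutoff.\<close>
  also have "\<dots> \<le> (\<integral>\<^sup>+p. ennreal (2 / l) * G (shear p) + ennreal (2 / d\<^sup>2) * (ennreal (wgt s d (fst p)) * ennreal ((?m p)\<^sup>2)) \<partial>?M)"
  proof (rule nn_integral_mono_AE, use KB AE_lborel_pair_fst[OF AE_lborel_singleton[of 0]] in eventually_elim)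
    case (elim p)
    obtain k x where p: "p = (k, x)" by force
    define c where "c = enn2real (K' (shear p))"
    have kb: "kernel_bounds_at s \<beta> d l L B K' p" using elim by simp
    have K': "K' (shear p) = ennreal c" using kb by (simp only: kernel_bounds_at_def c_def)
    show ?case
    proof (cases "norm k < d \<and> x \<in> \<Omega>")
      case True
      have c: "l * wgt s d k \<le> c" using kb True by (simp add: kernel_bounds_at_def p c_def)
      have "dif k U x = cutoff S d a (x + k) * dif k u' x + u' x * dif k (cutoff S d a) x"
        by (simp add: U_def dif_def algebra_simps)
      moreover have "\<bar>cutoff S d a (x + k) * dif k u' x\<bar> \<le> \<bar>dif k u' x\<bar>"
        using cutoff_bounds(3)[of S d a "x + k"] by (simp add: abs_mult mult_left_le_one_le)
      moreover have "\<bar>u' x * dif k (cutoff S d a) x\<bar> \<le> \<bar>u' x\<bar> * (norm k / d)"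
        using cutoff_lipschitz[OF assms(2), of S a "x + k" x] unfolding abs_mult by (intro mult_left_mono) (auto simp: dif_def)
      ultimately have "\<bar>dif k U x\<bar> \<le> \<bar>dif k u' x\<bar> + \<bar>u' x\<bar> * (norm k / d)" by linarith
      then have "(dif k U x)\<^sup>2 \<le> (\<bar>dif k u' x\<bar> + \<bar>u' x\<bar> * (norm k / d))\<^sup>2"
        by (metis abs_ge_zero power2_abs power_mono)
      also have "\<dots> \<le> 2 * (dif k u' x)\<^sup>2 + 2 * (\<bar>u' x\<bar> * (norm k / d))\<^sup>2"
        using sum_squares_bound[of "\<bar>dif k u' x\<bar>" "\<bar>u' x\<bar> * (norm k / d)"] by (simp add: power2_sum)
      also have "(\<bar>u' x\<bar> * (norm k / d))\<^sup>2 = (1 / d\<^sup>2) * (norm k * u' x)\<^sup>2" by (simp add: power_mult_distrib power_divide)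
      finally have "wgt s d k * (dif k U x)\<^sup>2 \<le> wgt s d k * (2 * (dif k u' x)\<^sup>2 + 2 * ((1 / d\<^sup>2) * (norm k * u' x)\<^sup>2))"
        by (rule mult_left_mono) simp
      moreover have "wgt s d k * (2 * (dif k u' x)\<^sup>2) \<le> (2 / l) * ((dif k u' x)\<^sup>2 * c)"
      proof -
        have "wgt s d k \<le> c / l" using c assms(3) by (simp add: pos_le_divide_eq mult.commute)
        then have "wgt s d k * (2 * (dif k u' x)\<^sup>2) \<le> c / l * (2 * (dif k u' x)\<^sup>2)" by (rule mult_right_mono) simp
        then show ?thesis by (simp add: field_simps)
      qed
      ultimately have "wgt s d k * (dif k U x)\<^sup>2 \<le> (2 / l) * ((dif k u' x)\<^sup>2 * c) + (2 / d\<^sup>2) * (wgt s d k * (norm k * u' x)\<^sup>2)"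
        by (simp add: algebra_simps)
      then have "ennreal (wgt s d k * (dif k U x)\<^sup>2) \<le> ennreal ((2 / l) * ((dif k u' x)\<^sup>2 * c) + (2 / d\<^sup>2) * (wgt s d k * (norm k * u' x)\<^sup>2))"
        by (rule ennreal_leI)
      also have "\<dots> = ennreal (2 / l) * (ennreal ((dif k u' x)\<^sup>2) * ennreal c) + ennreal (2 / d\<^sup>2) * (ennreal (wgt s d k) * ennreal ((norm k * u' x)\<^sup>2))"
      proof -
        have mult3: "ennreal (x * (y * z)) = ennreal x * (ennreal y * ennreal z)" if "0 \<le> x" "0 \<le> y" "0 \<le> z" for x y z
          using that by (simp add: ennreal_mult)
        have "0 \<le> 2 / l" "0 \<le> 2 / d\<^sup>2" "0 \<le> c" using assms(2,3) by (auto simp: c_def)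
        then show ?thesis
          by (subst ennreal_plus) (simp_all only: mult3 wgt_nonneg zero_le_power2 mult_nonneg_nonneg)
      qed
      also have "ennreal ((dif k u' x)\<^sup>2) * ennreal c = G (shear p)"
        using True K' by (simp add: G_def p) (simp add: shear_def cross_region_def dif_def)
      finally show ?thesis using True by (simp add: p difs_def ennreal_mult)
    next
      case False
      have "wgt s d k * (dif k U x)\<^sup>2 = 0"
      proof (cases "norm k < d")
        case True
        then have x: "x \<notin> \<Omega>" using False by simp
        then have x1: "x \<notin> nbh S ((a + 1) * d)" using sub by auto
        have x2: "x + k \<notin> nbh S ((a + 1) * d)"
        proof
          assume "x + k \<in> nbh S ((a + 1) * d)"
          from nbh_add[OF this, of "- k" d] True have "x \<in> nbh S ((a + 2) * d)" by (simp add: algebra_simps)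
          then show False using x \<Omega>(2) by auto
        qed
        show ?thesis using off[OF x1] off[OF x2] by (simp add: dif_def U_def)
      qed (simp add: wgt_def)
      then have "ennreal (wgt s d k) * ennreal ((dif k U x)\<^sup>2) = 0" by (metis ennreal_0 ennreal_mult wgt_nonneg zero_le_power2)
      then show ?thesis by (auto simp: p difs_def)
    qed
  qed
  also have "\<dots> = ennreal (2 / l) * (\<integral>\<^sup>+p. G (shear p) \<partial>?M) + ennreal (2 / d\<^sup>2) * (\<integral>\<^sup>+p. ennreal (wgt s d (fst p)) * ennreal ((?m p)\<^sup>2) \<partial>?M)"
    by (subst nn_integral_add) (auto simp: nn_integral_cmult)
  also have "(\<integral>\<^sup>+p. ennreal (wgt s d (fst p)) * ennreal ((?m p)\<^sup>2) \<partial>?M) = ennreal ((l2 (kmeas s d) ?m)\<^sup>2)"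
    using dens[of ?m] nn_integral_square[OF mm] by simp
  also have "ennreal (2 / l) * (\<integral>\<^sup>+p. G (shear p) \<partial>?M) + ennreal (2 / d\<^sup>2) * ennreal ((l2 (kmeas s d) ?m)\<^sup>2) < \<infinity>"
    using Gfin by (simp add: ennreal_mult_less_top)
  finally have "sqint (kmeas s d) (difs U)" by (intro sqintI) auto
  then show "frac_sobolev s d (\<lambda>x. cutoff S d a x * u' x)"
    using Uq(1) Um unfolding frac_sobolev_def U_def by simp
qed

section \<open>Scales inside the domain and application to solutions\<close>

lemma nbh_near_closure:
  fixes S :: "'a::euclidean_space set"
  assumes "S \<noteq> {}" "x \<in> nbh S t"
  obtains y where "y \<in> closure S" "dist x y \<le> t"
proof -
  obtain y where y: "y \<in> closure S" "infdist x (closure S) = dist x y"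
    using infdist_attains_inf[of "closure S" x] assms(1) by auto
  have "infdist x (closure S) \<le> infdist x S"
    by (rule infdist_mono[OF closure_subset assms(1)])
  then show thesis using that[OF y(1)] y(2) assms(2) by (simp add: nbh_def)
qed

lemma nbh_measurable [measurable]: "nbh S t \<in> sets (borel :: 'a::euclidean_space measure)"
  unfolding nbh_def by (intro borel_closed closed_Collect_le continuous_intros)

lemma weighted_L1_borel:
  fixes u u' :: "real^'n \<Rightarrow> real"
  assumes "u \<in> weighted_L1 \<beta>" and [measurable]: "u' \<in> borel_measurable borel" and "AE x in lborel. u x = u' x"
  shows "integrable lborel (\<lambda>x. \<bar>u' x\<bar> / (1 + norm x powr (real DIM(real^'n) + \<beta>)))"
    "(\<integral>x. \<bar>u' x\<bar> / (1 + norm x powr (real DIM(real^'n) + \<beta>)) \<partial>lborel) = weighted_L1_norm \<beta> u"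
proof -
  let ?g = "\<lambda>u x. \<bar>u x :: real\<bar> / (1 + norm (x :: real^'n) powr (real CARD('n) + \<beta>))"
  have int: "integrable lebesgue (?g u)" using assms(1) by (simp add: weighted_L1_def)
  have gm: "?g u' \<in> borel_measurable lborel" by measurable
  then have gl: "?g u' \<in> borel_measurable lebesgue" by (rule measurable_completion)
  have ae: "AE x in lebesgue. ?g u x = ?g u' x"
    unfolding AE_completion_iff using assms(3) by eventually_elim simp
  have "integrable lebesgue (?g u')"
    using integrable_cong_AE_imp[OF int gl] ae by (auto elim: AE_mp)
  then show "integrable lborel (\<lambda>x. \<bar>u' x\<bar> / (1 + norm x powr (real DIM(real^'n) + \<beta>)))"
    using integrable_completion[OF gm] by simp
  have "weighted_L1_norm \<beta> u = (\<integral>x. ?g u' x \<partial>lebesgue)"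
    unfolding weighted_L1_norm_def using ae int gl by (intro integral_cong_AE) auto
  also have "\<dots> = (\<integral>x. ?g u' x \<partial>lborel)" by (rule integral_completion[OF gm])
  finally show "(\<integral>x. \<bar>u' x\<bar> / (1 + norm x powr (real DIM(real^'n) + \<beta>)) \<partial>lborel) = weighted_L1_norm \<beta> u" by simp
qed

text \<open>The equation is used only to establish \<open>form_bounded\<close> for \<open>U\<close>:
  for \<open>\<phi>\<close> supported in \<open>W\<close>, the energy of \<open>u\<close> is an
  inner product with \<open>f\<close>, and the truncated form of \<open>U\<close> differs from it by
  the far part, which is again controlled by the L2 norm of \<open>\<phi>\<close>.\<close>

theorem solution_difference_estimate:
  fixes \<Omega> S :: "(real^'n) set"
  assumes "0 < s" "s < 1" "0 < \<beta>" "0 < l" "l \<le> L" "0 < M" "0 < \<Gamma>" and \<Omega>: "open \<Omega>" and S: "subdomain S \<Omega>"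
  obtains C d where "0 < C" "0 < d" "\<And>K f u. admissible_kernel s \<beta> l L M \<Gamma> K \<Longrightarrow> f \<in> L2 \<Omega> \<Longrightarrow> u \<in> weighted_L1 \<beta> \<Longrightarrow>
      is_solution K \<Omega> f u \<Longrightarrow>
      \<exists>w. difference_regular s d S (C * (L2_norm \<Omega> u + weighted_L1_norm \<beta> u + L2_norm \<Omega> f)) w \<and>
        (AE x in lborel. x \<in> S \<longrightarrow> u x = w x)"
proof -
  have S0: "S \<noteq> {}" and So: "open S" and Sc: "compact (closure S)" "closure S \<subseteq> \<Omega>"
    using S by (auto simp: subdomain_def)
  have Sb [measurable]: "S \<in> sets borel" using So by simp
  have \<Omega>b: "\<Omega> \<in> sets borel" using \<Omega> by simp
  obtain e where e: "0 < e" "(\<Union>x\<in>closure S. ball x e) \<subseteq> \<Omega>"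
    using compact_subset_open_imp_ball_epsilon_subset[OF Sc(1) \<Omega> Sc(2)] by blast
  \<comment> \<open>Below 1, since ellipticity is assumed only for pairs closer than 1; at most a
    tenth of \<open>e\<close>, so that nine layers stay inside \<open>\<Omega>\<close>.\<close>
  define d where "d = min (e / 10) (1 / 2)"
  have d: "0 < d" "d < 1" "9 * d < e" using e(1) by (auto simp: d_def min_def)
  have n9: "nbh S (9 * d) \<subseteq> \<Omega>"
  proof
    fix x assume "x \<in> nbh S (9 * d)"
    then obtain y where "y \<in> closure S" "dist x y \<le> 9 * d" using nbh_near_closure[OF S0] by blast
    then have "x \<in> (\<Union>x\<in>closure S. ball x e)" using d(3) by (auto simp: dist_commute intro!: bexI[of _ y])
    then show "x \<in> \<Omega>" using e(2) by blast
  qed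
  obtain R0 where R0: "0 < R0" "\<And>y. y \<in> closure S \<Longrightarrow> norm y \<le> R0"
    using compact_imp_bounded[OF Sc(1)] by (auto simp: bounded_pos)
  define W where "W = nbh S (6 * d)"
  define R where "R = R0 + 6 * d"
  have Wb: "W \<in> sets borel" unfolding W_def by measurable
  have WR: "W \<subseteq> cball 0 R"
  proof
    fix x assume "x \<in> W"
    then obtain y where y: "y \<in> closure S" "dist x y \<le> 6 * d" using nbh_near_closure[OF S0] unfolding W_def by blast
    have "norm x \<le> norm y + dist x y" by (metis dist_norm norm_triangle_sub)
    then show "x \<in> cball 0 R" using R0(2)[OF y(1)] y(2) by (simp add: R_def)
  qed
  have Rpos: "0 \<le> R" using R0(1) d by (simp add: R_def)
  have W\<Omega>: "W \<subseteq> \<Omega>" using n9 nbh_mono[of _ S "6 * d" "9 * d"] d by (auto simp: W_def)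
  define B where "B = max M (L * d powr (- (real CARD('n) + 2 * s)))"
  have B: "0 \<le> B" using assms(6) by (simp add: B_def)
  define I where "I = far_mass TYPE(real^'n) \<beta> d B"
  define D where "D = decay_const TYPE(real^'n) \<beta> d B R"
  have I0: "0 \<le> I" by (simp add: I_def)
  have D0: "0 \<le> D" unfolding D_def by (rule decay_const_nonneg[OF B])
  \<comment> \<open>The three summands absorb the norm of \<open>f\<close>, the L2 norm of
    \<open>u\<close> and the weighted norm of \<open>u\<close>, the last two with the factors of the
    far interaction.\<close>
  define c1 where "c1 = 1 + 2 * I + 2 * D * sqrt (measure lborel W)"
  have c1: "1 \<le> c1" using I0 D0 by (simp add: c1_def)
  obtain C0 where C0: "0 < C0" "\<And>u a A. frac_sobolev s d u \<Longrightarrow> l2 lborel u \<le> A \<Longrightarrow> kernel_regular s d l L \<Gamma> a \<Longrightarrow>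
    form_bounded s d a (nbh S (6 * d)) A u \<Longrightarrow> \<exists>w. difference_regular s d S (C0 * A) w \<and> (\<forall>x\<in>nbh S (5 * d). w x = u x)"
    using mixed_difference_estimate[OF assms(1,2) d(1) assms(4,5) less_imp_le[OF assms(7)] Sb] by blast
  show thesis
  proof (rule that[of "C0 * c1" d])
    show "0 < C0 * c1" using c1 C0(1) by simp
    show "0 < d" by fact
  next
    fix K :: "(real^'n) \<times> (real^'n) \<Rightarrow> ennreal" and f u
    assume K: "admissible_kernel s \<beta> l L M \<Gamma> K" and f: "f \<in> L2 \<Omega>" and uw: "u \<in> weighted_L1 \<beta>" and sol: "is_solution K \<Omega> f u"
    have uX: "u \<in> X_space K \<Omega>" using sol by (simp add: is_solution_def)
    define N where "N = L2_norm \<Omega> u + weighted_L1_norm \<beta> u + L2_norm \<Omega> f"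
    have Nf: "0 \<le> L2_norm \<Omega> f" "0 \<le> L2_norm \<Omega> u" by (simp_all add: L2_norm_eq_l2)
    have Nw: "0 \<le> weighted_L1_norm \<beta> u" unfolding weighted_L1_norm_def by (intro Bochner_Integration.integral_nonneg) (simp add: add_nonneg_nonneg)
    have N0: "0 \<le> N" using Nf Nw by (simp add: N_def)
    obtain K' where K'm [measurable]: "K' \<in> borel_measurable (borel \<Otimes>\<^sub>M borel)" and KK: "AE p in lebesgue. K p = K' p"
      and Kr: "kernel_regular s d l L \<Gamma> (wkern s K')"
      and KB: "AE p in lborel \<Otimes>\<^sub>M lborel. fst p \<noteq> 0 \<longrightarrow> kernel_bounds_at s \<beta> d l L B K' p"
      using admissible_kernel_reduce[OF K assms(1,3,4) d(1,2) assms(6) less_imp_le[OF assms(7)]] unfolding B_def by blast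
    have Kl: "AE p in kmeas s d. l \<le> wkern s K' p \<and> wkern s K' p \<le> L" using Kr by (simp add: kernel_regular_def)
    have um: "u \<in> borel_measurable lebesgue" using uX by (simp add: X_space_def)
    then obtain u' where "u' \<in> borel_measurable lborel" and u': "AE x in lborel. u x = u' x"
      using completion_ex_borel_measurable_real[of u lborel] by auto
    then have u'm [measurable]: "u' \<in> borel_measurable borel" by simp
    \<comment> \<open>Test functions live in \<open>nbh S (6 * d)\<close> and interact up to 7 d,
      where \<open>U\<close> must equal \<open>u'\<close>; its support then reaches 8 d, and the
      ninth layer is the spare one of \<open>cutoff_frac_sobolev\<close>.\<close>
    define U where "U = (\<lambda>x. cutoff S d 7 x * u' x)"
    note cf = cutoff_frac_sobolev[OF assms(2) d(1) assms(4) K'm KK KB uX u'm u' \<Omega>b, of S 7]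
    have n9': "nbh S ((7 + 2) * d) \<subseteq> \<Omega>" using n9 by simp
    have Uf: "frac_sobolev s d U" and UN: "l2 lborel U \<le> L2_norm \<Omega> u"
      and u\<Omega>: "sqint lborel (\<lambda>x. indicator \<Omega> x * u' x)" "l2 lborel (\<lambda>x. indicator \<Omega> x * u' x) = L2_norm \<Omega> u"
      using cf[OF n9'] unfolding U_def by auto
    have Ueq: "U x = u' x" if "x \<in> nbh S (7 * d)" for x
      using cutoff_eq_1[OF d(1) that] by (simp add: U_def)
    have uWq: "sqint lborel (\<lambda>x. indicator W x * u' x)" and uWN: "l2 lborel (\<lambda>x. indicator W x * u' x) \<le> L2_norm \<Omega> u"
    proof -
      have eq: "(\<lambda>x. indicator W x * u' x) = (\<lambda>x. indicator W x * (indicator \<Omega> x * u' x))"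
        using W\<Omega> by (auto simp: indicator_def fun_eq_iff)
      show "sqint lborel (\<lambda>x. indicator W x * u' x)" "l2 lborel (\<lambda>x. indicator W x * u' x) \<le> L2_norm \<Omega> u"
        using l2_restrict_mono[OF u\<Omega>(1), of W] Wb u\<Omega>(2) unfolding eq by auto
    qed
    note g = weighted_L1_borel[OF uw u'm u']
    have H: "form_bounded s d (wkern s K') W (c1 * N) U"
      unfolding form_bounded_def
    proof (intro allI impI)
      fix \<phi> assume \<phi>: "frac_sobolev s d \<phi>" and "\<forall>x. x \<notin> W \<longrightarrow> \<phi> x = 0"
      then have \<phi>W: "\<And>x. x \<notin> W \<Longrightarrow> \<phi> x = 0" by blast
      define c where "c = (2 * I * L2_norm \<Omega> u + 2 * D * sqrt (measure lborel W) * weighted_L1_norm \<beta> u) * l2 lborel \<phi>"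
      have c0: "0 \<le> c" unfolding c_def using I0 D0 Nf Nw by (intro mult_nonneg_nonneg add_nonneg_nonneg) auto
      have far: "(\<integral>\<^sup>+p. ennreal (far_bound \<beta> d B (fst p) * \<bar>difs u' p * difs \<phi> p\<bar>) \<partial>(lborel \<Otimes>\<^sub>M lborel)) \<le> ennreal c"
      proof -
        have "(2 * I * l2 lborel (\<lambda>x. indicator W x * u' x) + 2 * D * sqrt (measure lborel W) * weighted_L1_norm \<beta> u) * l2 lborel \<phi> \<le> c"
          unfolding c_def using I0 D0 Nw uWN by (intro mult_right_mono add_mono mult_left_mono) auto
        then show ?thesis
          using far_interaction[OF assms(3) d(1) B Rpos u'm frac_sobolevD(2)[OF \<phi>] \<phi>W Wb WR uWq g(1)]
          unfolding g(2) I_def[symmetric] D_def[symmetric] by (meson ennreal_leI order_trans)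
      qed
      have loc: "\<bar>energy K u \<phi> - bil s d (wkern s K') U \<phi>\<bar> \<le> c"
      proof (rule energy_localize[OF B d(1) K'm KK Kl assms(4,5) KB u'm u' Uf \<phi> _ far c0 _ um])
        show "K \<in> borel_measurable lebesgue" using K by (simp add: admissible_kernel_def)
        fix k x assume k: "norm k < d" and nz: "\<phi> x \<noteq> 0 \<or> \<phi> (x + k) \<noteq> 0"
        have "x \<in> nbh S (7 * d) \<and> x + k \<in> nbh S (7 * d)"
        proof (cases "x \<in> nbh S (6 * d)")
          case True
          then show ?thesis using nbh_add[OF True, of k d] nbh_mono[OF True, of "7 * d"] k d by (simp add: algebra_simps)
        next
          case False
          then have *: "x + k \<in> nbh S (6 * d)" using nz \<phi>W by (auto simp: W_def)
          then show ?thesis using nbh_add[OF *, of "- k" d] nbh_mono[OF *, of "7 * d"] k d by (simp add: algebra_simps)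
        qed
        then show "U x = u' x \<and> U (x + k) = u' (x + k)" by (simp add: Ueq)
      qed
      have "\<phi> \<in> X0_space K \<Omega>"
        using assms(4,5) by (intro X0_space_frac_sobolev[OF B d(1) assms(3) _ K'm KK KB \<phi> \<phi>W W\<Omega> \<Omega>b]) auto
      then have "energy K u \<phi> = L2_inner \<Omega> f \<phi>" using sol by (simp add: is_solution_def)
      moreover have "\<bar>L2_inner \<Omega> f \<phi>\<bar> \<le> L2_norm \<Omega> f * l2 lborel \<phi>"
      proof -
        have "sqint lborel (\<lambda>x. indicator \<Omega> x * \<phi> x)" "l2 lborel (\<lambda>x. indicator \<Omega> x * \<phi> x) \<le> l2 lborel \<phi>"
          using l2_restrict_mono[OF frac_sobolevD(2)[OF \<phi>], of \<Omega>] \<Omega>b by auto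
        then have *: "sqint (lebesgue_on \<Omega>) \<phi>" "l2 (lebesgue_on \<Omega>) \<phi> \<le> l2 lborel \<phi>"
          by (auto simp: sqint_lebesgue_on_iff[OF \<Omega>b frac_sobolevD(1)[OF \<phi>]])
        have "\<bar>L2_inner \<Omega> f \<phi>\<bar> \<le> l2 (lebesgue_on \<Omega>) f * l2 (lebesgue_on \<Omega>) \<phi>"
          unfolding L2_inner_def using f *(1) by (intro Cauchy_Schwarz_l2(2)) (auto simp: L2_iff_sqint)
        also have "\<dots> \<le> l2 (lebesgue_on \<Omega>) f * l2 lborel \<phi>" by (intro mult_left_mono *(2)) simp
        finally show ?thesis by (simp add: L2_norm_eq_l2)
      qed
      ultimately have "\<bar>bil s d (wkern s K') U \<phi>\<bar> \<le> L2_norm \<Omega> f * l2 lborel \<phi> + c" using loc by linarith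
      also have "\<dots> = (L2_norm \<Omega> f + 2 * I * L2_norm \<Omega> u + 2 * D * sqrt (measure lborel W) * weighted_L1_norm \<beta> u) * l2 lborel \<phi>"
        by (simp add: c_def algebra_simps)
      also have "\<dots> \<le> (c1 * N) * l2 lborel \<phi>"
      proof (rule mult_right_mono)
        define q where "q = 2 * D * sqrt (measure lborel W)"
        have q0: "0 \<le> q" using D0 by (simp add: q_def)
        have "L2_norm \<Omega> f \<le> N" "2 * I * L2_norm \<Omega> u \<le> 2 * I * N" "q * weighted_L1_norm \<beta> u \<le> q * N"
          using Nf Nw I0 q0 by (auto simp: N_def intro!: mult_left_mono)
        then show "L2_norm \<Omega> f + 2 * I * L2_norm \<Omega> u + 2 * D * sqrt (measure lborel W) * weighted_L1_norm \<beta> u \<le> c1 * N"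
          unfolding c1_def q_def[symmetric] by (simp add: algebra_simps)
      qed simp
      finally show "\<bar>bil s d (wkern s K') U \<phi>\<bar> \<le> (c1 * N) * l2 lborel \<phi>" .
    qed
    have "N \<le> c1 * N" using c1 N0 mult_right_mono[of 1 c1 N] by simp
    moreover have "l2 lborel U \<le> N" using UN Nf Nw by (simp add: N_def)
    ultimately have UA: "l2 lborel U \<le> c1 * N" by linarith
    obtain w where w: "difference_regular s d S (C0 * (c1 * N)) w" "\<forall>x\<in>nbh S (5 * d). w x = U x"
      using C0(2)[OF Uf UA Kr H[unfolded W_def]] by blast
    show "\<exists>w. difference_regular s d S (C0 * c1 * (L2_norm \<Omega> u + weighted_L1_norm \<beta> u + L2_norm \<Omega> f)) w \<and>
        (AE x in lborel. x \<in> S \<longrightarrow> u x = w x)"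
      unfolding N_def[symmetric]
    proof (intro exI[of _ w] conjI)
      show "difference_regular s d S (C0 * c1 * N) w" using w(1) by (simp add: mult.assoc)
      show "AE x in lborel. x \<in> S \<longrightarrow> u x = w x"
        using u'
      proof eventually_elim
        case (elim x)
        show ?case
        proof
          assume "x \<in> S"
          then have "x \<in> nbh S (5 * d)" "x \<in> nbh S (7 * d)" using d by (auto intro: nbh_self)
          then show "u x = w x" using elim w(2) Ueq by simp
        qed
      qed
    qed
  qed
qed

subsection \<open>Weak derivatives\<close>

primrec diff_times :: "nat \<Rightarrow> (real \<Rightarrow> real) \<Rightarrow> bool" where
  "diff_times 0 f \<longleftrightarrow> True"
| "diff_times (Suc n) f \<longleftrightarrow> (\<exists>f'. (\<forall>t. (f has_real_derivative f' t) (at t)) \<and> diff_times n f')"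

lemma diff_times_SucD: "diff_times (Suc n) f \<Longrightarrow> diff_times n f"
proof (induction n arbitrary: f)
  case (Suc n)
  then obtain f' where f': "\<forall>t. (f has_real_derivative f' t) (at t)" "diff_times (Suc n) f'"
    by (auto simp only: diff_times.simps(2)[of "Suc n"])
  then show ?case using Suc.IH[OF f'(2)] by auto
qed simp

lemma diff_times_add: "diff_times n f \<Longrightarrow> diff_times n g \<Longrightarrow> diff_times n (\<lambda>t. f t + g t)"
proof (induction n arbitrary: f g)
  case (Suc n)
  then obtain f' g' where "\<forall>t. (f has_real_derivative f' t) (at t)" "diff_times n f'"
    "\<forall>t. (g has_real_derivative g' t) (at t)" "diff_times n g'" by auto
  then show ?case using Suc.IH[of f' g'] by (auto intro!: exI[of _ "\<lambda>t. f' t + g' t"] derivative_intros)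
qed simp

lemma diff_times_mult: "diff_times n f \<Longrightarrow> diff_times n g \<Longrightarrow> diff_times n (\<lambda>t. f t * g t)"
proof (induction n arbitrary: f g)
  case (Suc n)
  then obtain f' g' where f: "\<forall>t. (f has_real_derivative f' t) (at t)" "diff_times n f'"
    and g: "\<forall>t. (g has_real_derivative g' t) (at t)" "diff_times n g'" by auto
  have "diff_times n (\<lambda>t. f' t * g t + f t * g' t)"
    by (intro diff_times_add Suc.IH f(2) g(2) diff_times_SucD[OF Suc.prems(1)] diff_times_SucD[OF Suc.prems(2)])
  moreover have "((\<lambda>t. f t * g t) has_real_derivative f' t * g t + f t * g' t) (at t)" for t
    using DERIV_mult[of f "f' t" t UNIV g "g' t"] f(1) g(1) by (simp add: mult.commute)
  ultimately show ?case by (auto intro!: exI[of _ "\<lambda>t. f' t * g t + f t * g' t"])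
qed simp

lemma diff_times_cmult: "diff_times n f \<Longrightarrow> diff_times n (\<lambda>t. c * f t)"
proof (induction n arbitrary: f)
  case (Suc n)
  then obtain f' where "\<forall>t. (f has_real_derivative f' t) (at t)" "diff_times n f'" by auto
  then show ?case using Suc.IH[of f'] by (auto intro!: exI[of _ "\<lambda>t. c * f' t"] DERIV_cmult)
qed simp

lemma diff_times_affine: "diff_times n f \<Longrightarrow> diff_times n (\<lambda>t. f (c * t + b))"
proof (induction n arbitrary: f)
  case (Suc n)
  then obtain f' where f': "\<forall>t. (f has_real_derivative f' t) (at t)" "diff_times n f'" by auto
  have "((\<lambda>t. f (c * t + b)) has_real_derivative c * f' (c * t + b)) (at t)" for t
  proof -
    have "((\<lambda>t. c * t + b) has_real_derivative c) (at t)" by (auto intro!: derivative_eq_intros)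
    from DERIV_chain2[OF f'(1)[rule_format, of "c * t + b"] this] show ?thesis by (simp add: mult.commute)
  qed
  then show ?case using diff_times_cmult[OF Suc.IH[OF f'(2)], of c]
    by (auto intro!: exI[of _ "\<lambda>t. c * f' (c * t + b)"])
qed simp

definition smooth_real :: "(real \<Rightarrow> real) \<Rightarrow> bool" where
  "smooth_real f \<longleftrightarrow> (\<forall>n. diff_times n f)"

text \<open>A derivative is unique, so the derivatives supplied for the different orders
  \<open>n\<close> are one function, and that function inherits every order.\<close>

lemma smooth_realE:
  assumes "smooth_real f"
  obtains f' where "\<And>t. (f has_real_derivative f' t) (at t)" "smooth_real f'"
proof -
  have ex: "\<exists>f'. (\<forall>t. (f has_real_derivative f' t) (at t)) \<and> diff_times n f'" for n
    using assms unfolding smooth_real_def by (metis diff_times.simps(2))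
  obtain f' where f': "\<And>t. (f has_real_derivative f' t) (at t)" using ex by blast
  have "diff_times n f'" for n
  proof -
    obtain g where g: "\<forall>t. (f has_real_derivative g t) (at t)" "diff_times n g" using ex by blast
    then have "g = f'" using f' by (intro ext) (metis DERIV_unique)
    then show ?thesis using g by simp
  qed
  then show thesis by (intro that[OF f']) (simp add: smooth_real_def)
qed

lemma tendsto_poly_mult_exp_minus: "((\<lambda>y. poly p y * exp (- y)) \<longlongrightarrow> (0::real)) at_top"
proof -
  have "((\<lambda>y. \<Sum>i\<le>degree p. coeff p i * (y ^ i / exp y)) \<longlongrightarrow> (\<Sum>i\<le>degree p. coeff p i * 0)) at_top"
    by (intro tendsto_sum tendsto_mult tendsto_const tendsto_power_div_exp_0)
  then show ?thesis by (simp add: poly_altdef exp_minus sum_distrib_right divide_inverse mult.assoc)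
qed

text \<open>Carrying a polynomial in 1 / t in front of exp (- 1 / t) makes the class closed under
  differentiation: p is replaced by y^2 (p - p') in the variable y = 1 / t. Smoothness is then a
  plain induction over all \<open>p\<close>.\<close>

definition flat_exp :: "real poly \<Rightarrow> real \<Rightarrow> real" where
  "flat_exp p t = (if 0 < t then poly p (inverse t) * exp (- inverse t) else 0)"

lemma flat_exp_at_right: "(flat_exp p \<longlongrightarrow> 0) (at_right 0)"
proof -
  have "((\<lambda>t. poly p (inverse t) * exp (- inverse t)) \<longlongrightarrow> 0) (at_right 0)"
    by (rule filterlim_compose[OF tendsto_poly_mult_exp_minus filterlim_inverse_at_top_right])
  then show ?thesis
    by (rule Lim_transform_eventually) (auto simp: flat_exp_def eventually_at_filter)
qed

lemma flat_exp_deriv: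
  "(flat_exp p has_real_derivative flat_exp (monom 1 2 * (p - pderiv p)) t) (at t)"
proof -
  consider "0 < t" | "t < 0" | "t = 0" by linarith
  then show ?thesis
  proof cases
    case 1
    have i: "(inverse has_real_derivative - (inverse t ^ 2)) (at t)"
      using DERIV_inverse[of t] 1 by (simp add: numeral_2_eq_2)
    have p: "((\<lambda>t. poly p (inverse t)) has_real_derivative poly (pderiv p) (inverse t) * - (inverse t ^ 2)) (at t)"
      by (rule DERIV_chain2[OF poly_DERIV i])
    have e: "((\<lambda>t. exp (- inverse t)) has_real_derivative exp (- inverse t) * - (- (inverse t ^ 2))) (at t)"
      by (rule DERIV_chain2[OF DERIV_exp DERIV_minus[OF i]])
    have "((\<lambda>t. poly p (inverse t) * exp (- inverse t)) has_real_derivative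
        poly (pderiv p) (inverse t) * - (inverse t ^ 2) * exp (- inverse t) + exp (- inverse t) * - (- (inverse t ^ 2)) * poly p (inverse t)) (at t)"
      by (rule DERIV_mult[OF p e])
    also have "poly (pderiv p) (inverse t) * - (inverse t ^ 2) * exp (- inverse t) + exp (- inverse t) * - (- (inverse t ^ 2)) * poly p (inverse t)
      = flat_exp (monom 1 2 * (p - pderiv p)) t"
      using 1 by (simp add: flat_exp_def poly_monom algebra_simps)
    finally show ?thesis
      by (rule has_field_derivative_transform_within_open[of _ _ _ "{0<..}"]) (use 1 in \<open>auto simp: flat_exp_def\<close>)
  next
    case 2
    have "((\<lambda>t. 0) has_real_derivative 0) (at t)" by simp
    then have "(flat_exp p has_real_derivative 0) (at t)"
      by (rule has_field_derivative_transform_within_open[of _ _ _ "{..<0}"]) (use 2 in \<open>auto simp: flat_exp_def\<close>)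
    then show ?thesis using 2 by (simp add: flat_exp_def)
  next
    case 3
    have "((\<lambda>h. (flat_exp p (0 + h) - flat_exp p 0) / h) \<longlongrightarrow> 0) (at 0)"
    proof (rule filterlim_split_at)
      have "eventually (\<lambda>h::real. 0 = (flat_exp p (0 + h) - flat_exp p 0) / h) (at_left 0)"
        by (auto simp: flat_exp_def eventually_at_filter)
      then show "((\<lambda>h. (flat_exp p (0 + h) - flat_exp p 0) / h) \<longlongrightarrow> 0) (at_left 0)"
        by (rule Lim_transform_eventually[rotated]) simp
      \<comment> \<open>Dividing by \<open>h\<close> multiplies the polynomial by its variable, so
        the quotient is again of the form \<open>flat_exp\<close> and tends to 0 from the
        right.\<close>
      have "eventually (\<lambda>h::real. flat_exp ([:0, 1:] * p) h = (flat_exp p (0 + h) - flat_exp p 0) / h) (at_right 0)"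
        by (auto simp: flat_exp_def eventually_at_filter divide_inverse mult_ac)
      then show "((\<lambda>h. (flat_exp p (0 + h) - flat_exp p 0) / h) \<longlongrightarrow> 0) (at_right 0)"
        by (rule Lim_transform_eventually[OF flat_exp_at_right])
    qed
    then have "(flat_exp p has_real_derivative 0) (at 0)" by (simp add: DERIV_def)
    then show ?thesis using 3 by (simp add: flat_exp_def)
  qed
qed

lemma smooth_flat_exp: "smooth_real (flat_exp p)"
proof -
  have "diff_times n (flat_exp p)" for n
  proof (induction n arbitrary: p)
    case (Suc n)
    then show ?case using flat_exp_deriv by auto
  qed simp
  then show ?thesis by (simp add: smooth_real_def)
qed

text \<open>A product of the flat exponential at m (t - a) and at m (b - t): supported in the
  interval for every \<open>m\<close>, and tending to 1 inside as \<open>m\<close> grows. The smooth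
  functions thus increase in sharpness towards an indicator without convolution.\<close>

definition bump :: "real \<Rightarrow> real \<Rightarrow> nat \<Rightarrow> real \<Rightarrow> real" where
  "bump a b m t = flat_exp 1 (real m * t + - (real m * a)) * flat_exp 1 (- real m * t + real m * b)"

lemma smooth_bump: "smooth_real (bump a b m)"
  using smooth_flat_exp unfolding smooth_real_def bump_def[abs_def]
  by (intro allI diff_times_mult diff_times_affine) auto

lemma flat_exp_1_bounds: "0 \<le> flat_exp 1 t" "flat_exp 1 t \<le> 1"
  by (auto simp: flat_exp_def)

lemma bump_bounds: "0 \<le> bump a b m t" "bump a b m t \<le> 1"
  unfolding bump_def using flat_exp_1_bounds by (auto intro: mult_le_one)

lemma bump_eq_0: "t \<le> a \<or> b \<le> t \<Longrightarrow> bump a b m t = 0"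
proof -
  assume "t \<le> a \<or> b \<le> t"
  then have "real m * t \<le> real m * a \<or> real m * b \<le> real m * t" by (auto intro: mult_left_mono)
  then show ?thesis by (auto simp: bump_def flat_exp_def)
qed

lemma flat_exp_scale_tendsto:
  assumes "0 < t"
  shows "(\<lambda>m. flat_exp 1 (real m * t)) \<longlonglongrightarrow> 1"
proof -
  have "(\<lambda>m. exp (- (inverse (real m) * inverse t))) \<longlonglongrightarrow> exp (- (0 * inverse t))"
    by (intro tendsto_intros lim_inverse_n)
  then have *: "(\<lambda>m. exp (- (inverse (real m) * inverse t))) \<longlonglongrightarrow> 1" by simp
  show ?thesis
    by (rule Lim_transform_eventually[OF *]) (use assms in \<open>auto simp: flat_exp_def inverse_mult_distrib eventually_sequentially intro!: exI[of _ 1]\<close>)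
qed

lemma bump_tendsto: "(\<lambda>m. bump a b m t) \<longlonglongrightarrow> indicator {a<..<b} t"
proof (cases "a < t \<and> t < b")
  case True
  have "(\<lambda>m. flat_exp 1 (real m * (t - a)) * flat_exp 1 (real m * (b - t))) \<longlonglongrightarrow> 1 * 1"
    by (intro tendsto_mult flat_exp_scale_tendsto) (use True in auto)
  then show ?thesis using True by (simp add: bump_def algebra_simps)
next
  case False
  then have "bump a b m t = 0" for m by (intro bump_eq_0) auto
  then show ?thesis using False by (auto simp: indicator_def)
qed

section \<open>Smooth approximations of boxes\<close>

lemma partial_deriv_prod:
  fixes h :: "'n::finite \<Rightarrow> real \<Rightarrow> real"
  assumes "\<And>i t. (h i has_real_derivative h' i t) (at t)"
  shows "(\<lambda>x. \<Prod>i\<in>UNIV. h i (x $ i)) differentiable (at x)"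
    "partial_deriv j (\<lambda>x. \<Prod>i\<in>UNIV. h i (x $ i)) = (\<lambda>x. \<Prod>i\<in>UNIV. (h(j := h' j)) i (x $ i))"
proof -
  have c: "((\<lambda>x. h i (x $ i)) has_derivative (\<lambda>y. h' i (x $ i) * y $ i)) (at x)" for i and x :: "real^'n"
  proof -
    have "(h i has_derivative (\<lambda>y. h' i (x $ i) * y)) (at (x $ i))"
      using assms[of i "x $ i"] by (simp add: has_field_derivative_def)
    from has_derivative_compose[OF bounded_linear_imp_has_derivative[OF bounded_linear_vec_nth] this]
    show ?thesis by simp
  qed
  have d: "((\<lambda>x. \<Prod>i\<in>UNIV. h i (x $ i)) has_derivative (\<lambda>y. \<Sum>i\<in>UNIV. (h' i (x $ i) * y $ i) * (\<Prod>j\<in>UNIV - {i}. h j (x $ j)))) (at x)" for x :: "real^'n"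
    by (rule has_derivative_prod) (rule c)
  then show "(\<lambda>x. \<Prod>i\<in>UNIV. h i (x $ i)) differentiable (at x)" unfolding differentiable_def by blast
  show "partial_deriv j (\<lambda>x. \<Prod>i\<in>UNIV. h i (x $ i)) = (\<lambda>x. \<Prod>i\<in>UNIV. (h(j := h' j)) i (x $ i))"
  proof
    fix x :: "real^'n"
    have "partial_deriv j (\<lambda>x. \<Prod>i\<in>UNIV. h i (x $ i)) x
      = (\<Sum>i\<in>UNIV. (h' i (x $ i) * (axis j 1 :: real^'n) $ i) * (\<Prod>j\<in>UNIV - {i}. h j (x $ j)))"
      unfolding partial_deriv_def frechet_derivative_at[OF d, symmetric] ..
    also have "\<dots> = (\<Sum>i\<in>UNIV. if i = j then h' j (x $ j) * (\<Prod>i\<in>UNIV - {j}. h i (x $ i)) else 0)"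
      by (intro sum.cong) (auto simp: axis_def)
    also have "\<dots> = h' j (x $ j) * (\<Prod>i\<in>UNIV - {j}. h i (x $ i))" by simp
    also have "\<dots> = (\<Prod>i\<in>UNIV. (h(j := h' j)) i (x $ i))"
      by (subst prod.remove[of UNIV j]) (auto intro!: prod.cong)
    finally show "partial_deriv j (\<lambda>x. \<Prod>i\<in>UNIV. h i (x $ i)) x = (\<Prod>i\<in>UNIV. (h(j := h' j)) i (x $ i))" .
  qed
qed

text \<open>A partial derivative replaces a single factor by its derivative, so products of smooth
  functions of one coordinate stay in their class under any sequence of partial derivatives.\<close>

lemma fold_partial_deriv_prod:
  fixes h :: "'n::finite \<Rightarrow> real \<Rightarrow> real"
  assumes "\<And>i. smooth_real (h i)"
  shows "\<exists>g. (\<forall>i. smooth_real (g i)) \<and> fold partial_deriv is (\<lambda>x. \<Prod>i\<in>UNIV. h i (x $ i)) = (\<lambda>x. \<Prod>i\<in>UNIV. g i (x $ i))"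
  using assms
proof (induction "is" arbitrary: h)
  case Nil
  then show ?case by auto
next
  case (Cons j js)
  have "\<forall>i. \<exists>f'. (\<forall>t. (h i has_real_derivative f' t) (at t)) \<and> smooth_real f'"
    using smooth_realE[OF Cons.prems] by metis
  then obtain h' where h': "\<And>i t. (h i has_real_derivative h' i t) (at t)" "\<And>i. smooth_real (h' i)" by metis
  have "smooth_real ((h(j := h' j)) i)" for i using Cons.prems h'(2) by simp
  from Cons.IH[OF this] show ?case
    using partial_deriv_prod(2)[of h h' j, OF h'(1)] by simp
qed

definition box_bump :: "real^'n \<Rightarrow> real^'n \<Rightarrow> nat \<Rightarrow> real^'n \<Rightarrow> real" where
  "box_bump a b m x = (\<Prod>i\<in>UNIV. bump (a $ i) (b $ i) m (x $ i))"

lemma box_bump_bounds: "0 \<le> box_bump a b m x" "box_bump a b m x \<le> 1"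
  unfolding box_bump_def using bump_bounds by (auto intro!: prod_nonneg prod_le_1)

lemma box_bump_eq_0: "x \<notin> box a b \<Longrightarrow> box_bump a b m x = 0"
  unfolding box_bump_def mem_box_cart by (auto simp: not_less intro!: bump_eq_0)

lemma box_bump_tendsto: "(\<lambda>m. box_bump a b m x) \<longlonglongrightarrow> indicator (box a b) x"
proof -
  have "(\<lambda>m. box_bump a b m x) \<longlonglongrightarrow> (\<Prod>i\<in>UNIV. indicator {a $ i<..<b $ i} (x $ i))"
    unfolding box_bump_def by (intro tendsto_prod bump_tendsto)
  also have "(\<Prod>i\<in>UNIV. indicator {a $ i<..<b $ i} (x $ i)) = (indicator (box a b) x :: real)"
    by (auto simp: indicator_def mem_box_cart prod_zero_iff)
  finally show ?thesis .
qed

lemma box_bump_test_function: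
  assumes "cbox a b \<subseteq> U"
  shows "box_bump a b m \<in> test_functions U"
proof -
  have eq: "box_bump a b m = (\<lambda>x. \<Prod>i\<in>UNIV. bump (a $ i) (b $ i) m (x $ i))"
    by (simp add: box_bump_def fun_eq_iff)
  have "fold partial_deriv is (box_bump a b m) differentiable (at x)" for "is" x
  proof -
    obtain g where g: "\<And>i. smooth_real (g i)" "fold partial_deriv is (box_bump a b m) = (\<lambda>x. \<Prod>i\<in>UNIV. g i (x $ i))"
      using fold_partial_deriv_prod[of "\<lambda>i. bump (a $ i) (b $ i) m" "is"] smooth_bump unfolding eq by blast
    have "\<forall>i. \<exists>f'. \<forall>t. (g i has_real_derivative f' t) (at t)" using smooth_realE[OF g(1)] by metis
    then obtain g' where "\<And>i t. (g i has_real_derivative g' i t) (at t)" by metis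
    then show ?thesis unfolding g(2) by (rule partial_deriv_prod(1))
  qed
  moreover have sub: "closure {x. box_bump a b m x \<noteq> 0} \<subseteq> cbox a b"
    using box_bump_eq_0[of _ a b m] box_subset_cbox[of a b] by (intro closure_minimal) auto
  moreover have "compact (closure {x. box_bump a b m x \<noteq> 0})"
    using bounded_subset[OF bounded_cbox sub] by (simp add: compact_eq_bounded_closed)
  ultimately show ?thesis using assms by (auto simp: test_functions_def)
qed

section \<open>Test functions and the fundamental lemma of variations\<close>

lemma test_function_continuous:
  assumes "\<phi> \<in> test_functions U"
  shows "\<phi> differentiable (at x)" "continuous_on UNIV \<phi>" "partial_deriv i \<phi> differentiable (at x)" "continuous_on UNIV (partial_deriv i \<phi>)"
proof -
  have d: "fold partial_deriv is \<phi> differentiable (at x)" for "is" x using assms by (simp add: test_functions_def)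
  show 1: "\<phi> differentiable (at x)" for x using d[of "[]"] by simp
  show 2: "partial_deriv i \<phi> differentiable (at x)" for x using d[of "[i]"] by simp
  show "continuous_on UNIV \<phi>" using 1 by (simp add: continuous_on_eq_continuous_at differentiable_imp_continuous_within)
  show "continuous_on UNIV (partial_deriv i \<phi>)" using 2 by (simp add: continuous_on_eq_continuous_at differentiable_imp_continuous_within)
qed

text \<open>The positive and the negative part of \<open>w\<close> are densities of two measures
  that agree on open boxes, a generator stable under intersection, hence everywhere. Densities are
  unique almost everywhere, and \<open>ennreal\<close> cuts negative numbers to 0, so equal values
  at \<open>w x\<close> and \<open>- w x\<close> force \<open>w x = 0\<close>.\<close>

lemma AE_zero_of_box_integrals:
  fixes w :: "'a::euclidean_space \<Rightarrow> real"
  assumes w: "integrable lborel w" and z: "\<And>a b. (\<integral>x. indicator (box a b) x * w x \<partial>lborel) = 0"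
  shows "AE x in lborel. w x = 0"
proof -
  have [measurable]: "w \<in> borel_measurable lborel" using w by simp
  define P where "P = density lborel (\<lambda>x. ennreal (w x))"
  define Q where "Q = density lborel (\<lambda>x. ennreal (- w x))"
  have wf: "(\<integral>\<^sup>+x. ennreal (norm (w x)) \<partial>lborel) < \<infinity>" using w by (simp add: integrable_iff_bounded)
  have eq: "emeasure P (box a b) = emeasure Q (box a b)" and fin: "emeasure P (box a b) \<noteq> \<infinity>" for a b
  proof -
    let ?f = "\<lambda>x. indicator (box a b) x * w x"
    have int: "integrable lborel ?f" using w integrable_real_mult_indicator[of "box a b" lborel w] by (simp add: mult.commute)
    have p: "emeasure P (box a b) = (\<integral>\<^sup>+x. ennreal (?f x) \<partial>lborel)"
      unfolding P_def by (subst emeasure_density) (auto intro!: nn_integral_cong simp: indicator_def)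
    have q: "emeasure Q (box a b) = (\<integral>\<^sup>+x. ennreal (- ?f x) \<partial>lborel)"
      unfolding Q_def by (subst emeasure_density) (auto intro!: nn_integral_cong simp: indicator_def)
    have pf: "(\<integral>\<^sup>+x. ennreal (?f x) \<partial>lborel) < \<infinity>"
      by (rule le_less_trans[OF nn_integral_mono wf]) (auto simp: indicator_def intro!: ennreal_leI)
    have qf: "(\<integral>\<^sup>+x. ennreal (- ?f x) \<partial>lborel) < \<infinity>"
      by (rule le_less_trans[OF nn_integral_mono wf]) (auto simp: indicator_def intro!: ennreal_leI)
    have "enn2real (\<integral>\<^sup>+x. ennreal (?f x) \<partial>lborel) - enn2real (\<integral>\<^sup>+x. ennreal (- ?f x) \<partial>lborel) = 0"
      using real_lebesgue_integral_def[OF int] z[of a b] by simp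
    then have "enn2real (\<integral>\<^sup>+x. ennreal (?f x) \<partial>lborel) = enn2real (\<integral>\<^sup>+x. ennreal (- ?f x) \<partial>lborel)" by simp
    then have "ennreal (enn2real (\<integral>\<^sup>+x. ennreal (?f x) \<partial>lborel)) = ennreal (enn2real (\<integral>\<^sup>+x. ennreal (- ?f x) \<partial>lborel))"
      by (rule arg_cong)
    then show "emeasure P (box a b) = emeasure Q (box a b)"
      unfolding p q ennreal_enn2real[OF pf[unfolded infinity_ennreal_def]] ennreal_enn2real[OF qf[unfolded infinity_ennreal_def]] .
    show "emeasure P (box a b) \<noteq> \<infinity>" using pf unfolding p by simp
  qed
  have "P = Q"
  proof (rule measure_eqI_generator_eq)
    let ?E = "range (\<lambda>(a, b). box a b :: 'a set)"
    show "Int_stable ?E" by (auto simp: Int_stable_def box_Int_box)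
    show "?E \<subseteq> Pow UNIV" "sets P = sigma_sets UNIV ?E" "sets Q = sigma_sets UNIV ?E"
      by (simp_all add: P_def Q_def borel_eq_box)
    let ?A = "\<lambda>n::nat. box (- (real n *\<^sub>R One)) (real n *\<^sub>R One) :: 'a set"
    show "range ?A \<subseteq> ?E" "(\<Union>i. ?A i) = UNIV" unfolding UN_box_eq_UNIV by auto
    show "emeasure P (?A i) \<noteq> \<infinity>" for i by (rule fin)
    show "emeasure P X = emeasure Q X" if "X \<in> ?E" for X using that eq by auto
  qed
  then have "AE x in lborel. ennreal (w x) = ennreal (- w x)"
    unfolding P_def Q_def by (intro sigma_finite_measure.density_unique[OF lborel.sigma_finite_measure_axioms]) auto
  then show ?thesis
  proof eventually_elim
    case (elim x)
    then show ?case by (cases "0 \<le> w x") (auto simp: ennreal_neg ennreal_eq_0_iff)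
  qed
qed

text \<open>Local integrability is available on compact sets, so the argument runs inside one closed
  box: bumps tend to the indicator of a smaller box, dominated convergence makes all box integrals
  vanish, and the boundary of the box is a null set. Countably many closed boxes then cover
  \<open>U\<close>.\<close>

lemma fundamental_lemma_variations:
  fixes v :: "real^'n \<Rightarrow> real"
  assumes U: "open U" and v: "\<And>C. compact C \<Longrightarrow> C \<subseteq> U \<Longrightarrow> set_integrable lebesgue C v"
    and z: "\<And>\<phi>. \<phi> \<in> test_functions U \<Longrightarrow> (\<integral>x. v x * \<phi> x \<partial>lebesgue_on U) = 0"
  shows "AE x in lebesgue_on U. v x = 0"
proof -
  have Ub: "U \<in> sets borel" using U by simp
  have box0: "AE x in lborel. x \<in> cbox c d \<longrightarrow> v x = 0" if cd: "cbox c d \<subseteq> U" for c d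
  proof -
    have int: "integrable lebesgue (\<lambda>x. indicator (cbox c d) x *\<^sub>R v x)"
      using v[OF compact_cbox cd] by (simp add: set_integrable_def)
    then have "(\<lambda>x. indicator (cbox c d) x *\<^sub>R v x) \<in> borel_measurable lebesgue" by simp
    then obtain w where wm [measurable]: "w \<in> borel_measurable lborel" and w: "AE x in lborel. indicator (cbox c d) x *\<^sub>R v x = w x"
      using completion_ex_borel_measurable_real[of "\<lambda>x. indicator (cbox c d) x *\<^sub>R v x" lborel] by auto
    have wl: "AE x in lebesgue. indicator (cbox c d) x *\<^sub>R v x = w x" using w by (simp add: AE_completion_iff)
    have "integrable lebesgue w"
      by (rule integrable_cong_AE_imp[OF int]) (use wl measurable_completion[OF wm] in \<open>auto elim: AE_mp\<close>)
    then have wi: "integrable lborel w" using integrable_completion[OF wm] by simp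
    have sub0: "(\<integral>x. indicator (box a b) x * w x \<partial>lborel) = 0" if ab: "cbox a b \<subseteq> cbox c d" for a b
    proof -
      have bm [measurable]: "box_bump a b m \<in> borel_measurable borel" for m
        using test_function_continuous(2)[OF box_bump_test_function[OF order_refl, of a b m]]
        by (rule borel_measurable_continuous_onI)
      have zm: "(\<integral>x. w x * box_bump a b m x \<partial>lborel) = 0" for m
      proof -
        have "box_bump a b m \<in> test_functions U"
          using ab cd by (intro box_bump_test_function) auto
        then have "0 = (\<integral>x. v x * box_bump a b m x \<partial>lebesgue_on U)" using z by simp
        also have "\<dots> = (\<integral>x. indicator U x *\<^sub>R (v x * box_bump a b m x) \<partial>lebesgue)"
          using Ub by (intro integral_restrict_space) simp
        also have "\<dots> = (\<integral>x. (indicator (cbox c d) x *\<^sub>R v x) * box_bump a b m x \<partial>lebesgue)"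
        proof (rule Bochner_Integration.integral_cong)
          fix x
          show "indicator U x *\<^sub>R (v x * box_bump a b m x) = (indicator (cbox c d) x *\<^sub>R v x) * box_bump a b m x"
            using box_bump_eq_0[of x a b m] ab cd box_subset_cbox[of a b] by (cases "x \<in> cbox c d") (auto simp: indicator_def)
        qed simp
        also have "\<dots> = (\<integral>x. w x * box_bump a b m x \<partial>lebesgue)"
        proof (rule integral_cong_AE)
          have b: "box_bump a b m \<in> borel_measurable lebesgue" by (rule measurable_completion) simp
          show "(\<lambda>x. (indicator (cbox c d) x *\<^sub>R v x) * box_bump a b m x) \<in> borel_measurable lebesgue"
            using b int by (intro borel_measurable_times) auto
          show "(\<lambda>x. w x * box_bump a b m x) \<in> borel_measurable lebesgue"
            by (rule measurable_completion) measurable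
          show "AE x in lebesgue. (indicator (cbox c d) x *\<^sub>R v x) * box_bump a b m x = w x * box_bump a b m x"
            using wl by eventually_elim simp
        qed
        also have "\<dots> = (\<integral>x. w x * box_bump a b m x \<partial>lborel)" by (rule integral_completion) measurable
        finally show ?thesis by simp
      qed
      have "(\<lambda>m. \<integral>x. w x * box_bump a b m x \<partial>lborel) \<longlonglongrightarrow> (\<integral>x. w x * indicator (box a b) x \<partial>lborel)"
      proof (rule integral_dominated_convergence[where w = "\<lambda>x. \<bar>w x\<bar>"])
        show "AE x in lborel. (\<lambda>m. w x * box_bump a b m x) \<longlonglongrightarrow> w x * indicator (box a b) x"
          by (intro AE_I2 tendsto_mult tendsto_const box_bump_tendsto)
        show "AE x in lborel. norm (w x * box_bump a b m x) \<le> \<bar>w x\<bar>" for m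
          using box_bump_bounds[of a b m] by (intro AE_I2) (simp add: abs_mult mult_left_le)
      qed (use wi in auto)
      then have "(\<integral>x. w x * indicator (box a b) x \<partial>lborel) = 0" by (simp add: zm LIMSEQ_const_iff)
      then show ?thesis by (simp add: mult.commute)
    qed
    let ?w = "\<lambda>x. indicator (box c d) x * w x"
    have "integrable lborel ?w" using wi integrable_real_mult_indicator[of "box c d" lborel w] by (simp add: mult.commute)
    moreover have "(\<integral>x. indicator (box a b) x * ?w x \<partial>lborel) = 0" for a b
    proof -
      obtain a' b' where e: "box a b \<inter> box c d = box a' b'" using box_Int_box[of a b c d] by blast
      have "(\<integral>x. indicator (box a b) x * ?w x \<partial>lborel) = (\<integral>x. indicator (box a' b') x * w x \<partial>lborel)"
        unfolding e[symmetric] by (intro Bochner_Integration.integral_cong) (auto simp: indicator_def)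
      also have "\<dots> = 0"
      proof (cases "box a' b' = {}")
        case False
        then have "cbox a' b' = closure (box a' b')" by (simp add: closure_box)
        also have "\<dots> \<subseteq> cbox c d" using e box_subset_cbox[of c d] by (intro closure_minimal) auto
        finally show ?thesis by (rule sub0)
      qed simp
      finally show ?thesis .
    qed
    ultimately have "AE x in lborel. ?w x = 0" by (rule AE_zero_of_box_integrals)
    moreover have "AE x in lborel. x \<notin> cbox c d - box c d"
    proof -
      have "cbox c d - box c d \<in> null_sets lborel"
        by (simp add: null_sets_def emeasure_Diff box_subset_cbox emeasure_lborel_box_eq emeasure_lborel_cbox_eq)
      then show ?thesis by (rule AE_not_in)
    qed
    ultimately show ?thesis using w
    proof eventually_elim
      case (elim x)
      then show ?case by (auto simp: indicator_def split: if_splits)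
    qed
  qed
  obtain \<D> where D: "countable \<D>" "\<D> \<subseteq> Pow U" "\<And>X. X \<in> \<D> \<Longrightarrow> \<exists>a b. X = cbox a b" "\<Union>\<D> = U"
    using open_countable_Union_open_cbox[OF U] by blast
  have "AE x in lborel. \<forall>X\<in>\<D>. x \<in> X \<longrightarrow> v x = 0"
  proof (subst AE_ball_countable[OF D(1)], intro ballI)
    fix X assume X: "X \<in> \<D>"
    then obtain a b where "X = cbox a b" using D(3) by blast
    then show "AE x in lborel. x \<in> X \<longrightarrow> v x = 0" using box0[of a b] X D(2) by auto
  qed
  then have "AE x in lborel. x \<in> U \<longrightarrow> v x = 0"
    by eventually_elim (use D(4) in blast)
  then show ?thesis by (simp add: AE_lebesgue_on_iff[OF Ub])
qed

lemma test_function_props: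
  assumes "\<phi> \<in> test_functions U"
  obtains Q where "compact Q" "Q \<subseteq> U" "\<And>x. x \<notin> Q \<Longrightarrow> \<phi> x = 0" "\<And>i x. x \<notin> Q \<Longrightarrow> partial_deriv i \<phi> x = 0"
proof (rule that[of "closure {x. \<phi> x \<noteq> 0}"])
  let ?Q = "closure {x. \<phi> x \<noteq> 0}"
  show "compact ?Q" "?Q \<subseteq> U" using assms by (auto simp: test_functions_def)
  show 0: "\<phi> x = 0" if "x \<notin> ?Q" for x using that closure_subset[of "{x. \<phi> x \<noteq> 0}"] by auto
  show "partial_deriv i \<phi> x = 0" if x: "x \<notin> ?Q" for i x
  proof -
    have "((\<lambda>x. 0 :: real) has_derivative (\<lambda>_. 0)) (at x)" by simp
    then have "(\<phi> has_derivative (\<lambda>_. 0)) (at x)"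
    proof (rule has_derivative_transform_within_open)
      show "open (- ?Q)" by (rule open_Compl[OF closed_closure])
      show "x \<in> - ?Q" using x by simp
      show "0 = \<phi> y" if "y \<in> - ?Q" for y using 0[of y] that by simp
    qed
    then have "frechet_derivative \<phi> (at x) = (\<lambda>_. 0)" by (rule frechet_derivative_at[symmetric])
    then show ?thesis by (simp add: partial_deriv_def)
  qed
qed

lemma continuous_compact_support_bounded:
  fixes f :: "'a::euclidean_space \<Rightarrow> real"
  assumes "continuous_on UNIV f" "compact Q" "\<And>x. x \<notin> Q \<Longrightarrow> f x = 0"
  obtains B where "0 \<le> B" "\<And>x. \<bar>f x\<bar> \<le> B"
proof -
  have "bounded (f ` Q)"
    using assms(1,2) by (intro compact_imp_bounded compact_continuous_image) (auto intro: continuous_on_subset)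
  then obtain B where B: "0 < B" "\<And>y. y \<in> f ` Q \<Longrightarrow> norm y \<le> B" by (auto simp: bounded_pos)
  have "\<bar>f x\<bar> \<le> B" for x using B assms(3)[of x] by (cases "x \<in> Q") auto
  then show thesis using that B(1) by (metis less_imp_le)
qed

lemma integrable_mult_test:
  fixes v :: "real^'n \<Rightarrow> real"
  assumes U: "open U" and \<phi>: "\<phi> \<in> test_functions U" and v: "\<And>C. compact C \<Longrightarrow> C \<subseteq> U \<Longrightarrow> set_integrable lebesgue C v"
  shows "integrable (lebesgue_on U) (\<lambda>x. v x * \<phi> x)"
proof -
  obtain Q where Q: "compact Q" "Q \<subseteq> U" "\<And>x. x \<notin> Q \<Longrightarrow> \<phi> x = 0" using test_function_props[OF \<phi>] by metis
  obtain B where B: "0 \<le> B" "\<And>x. \<bar>\<phi> x\<bar> \<le> B"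
    using continuous_compact_support_bounded[OF test_function_continuous(2)[OF \<phi>] Q(1,3)] by metis
  have pm: "\<phi> \<in> borel_measurable lebesgue"
    using test_function_continuous(2)[OF \<phi>] by (intro measurable_completion) (simp add: borel_measurable_continuous_onI)
  have i: "integrable lebesgue (\<lambda>x. indicator Q x *\<^sub>R v x)" using v[OF Q(1,2)] by (simp add: set_integrable_def)
  have "integrable lebesgue (\<lambda>x. (indicator Q x *\<^sub>R v x) * \<phi> x)"
  proof (rule Bochner_Integration.integrable_bound[of _ "\<lambda>x. B * (indicator Q x *\<^sub>R v x)"])
    show "integrable lebesgue (\<lambda>x. B * (indicator Q x *\<^sub>R v x))" using i by simp
    show "(\<lambda>x. (indicator Q x *\<^sub>R v x) * \<phi> x) \<in> borel_measurable lebesgue"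
      using i pm by (intro borel_measurable_times) auto
    show "AE x in lebesgue. norm ((indicator Q x *\<^sub>R v x) * \<phi> x) \<le> norm (B * (indicator Q x *\<^sub>R v x))"
      using B by (intro AE_I2) (auto simp: abs_mult indicator_def mult.commute intro: mult_right_mono)
  qed
  also have "(\<lambda>x. (indicator Q x *\<^sub>R v x) * \<phi> x) = (\<lambda>x. indicator U x *\<^sub>R (v x * \<phi> x))"
    using Q(2,3) by (auto simp: indicator_def fun_eq_iff)
  finally show ?thesis using U by (subst integrable_restrict_space) auto
qed

text \<open>\<open>weak_deriv\<close> is an arbitrary choice among weak derivatives, so estimates
  proved for an explicit candidate reach it only through uniqueness, obtained by applying the
  fundamental lemma to the difference.\<close>

lemma weak_deriv_AE_eq:
  fixes u g :: "real^'n \<Rightarrow> real"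
  assumes U: "open U" and g: "has_weak_deriv U \<alpha> u g"
  shows "AE x in lebesgue_on U. weak_deriv U \<alpha> u x = g x"
proof -
  let ?v = "weak_deriv U \<alpha> u"
  have v: "has_weak_deriv U \<alpha> u ?v" using someI[of "has_weak_deriv U \<alpha> u", OF g] by (simp add: weak_deriv_def)
  have li: "\<And>C. compact C \<Longrightarrow> C \<subseteq> U \<Longrightarrow> set_integrable lebesgue C g" "\<And>C. compact C \<Longrightarrow> C \<subseteq> U \<Longrightarrow> set_integrable lebesgue C ?v"
    using g v by (auto simp: has_weak_deriv_def)
  have "AE x in lebesgue_on U. ?v x - g x = 0"
  proof (rule fundamental_lemma_variations[OF U])
    show "set_integrable lebesgue C (\<lambda>x. ?v x - g x)" if "compact C" "C \<subseteq> U" for C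
      using li[OF that] by (rule set_integral_diff(1)[rotated])
    fix \<phi> assume \<phi>: "\<phi> \<in> test_functions U"
    have "(-1) ^ multi_order \<alpha> * (\<integral>x. ?v x * \<phi> x \<partial>lebesgue_on U) = (-1) ^ multi_order \<alpha> * (\<integral>x. g x * \<phi> x \<partial>lebesgue_on U)"
    proof -
      have "(\<integral>x. u x * multi_deriv \<alpha> \<phi> x \<partial>lebesgue_on U) = (-1) ^ multi_order \<alpha> * (\<integral>x. h x * \<phi> x \<partial>lebesgue_on U)"
        if "has_weak_deriv U \<alpha> u h" for h
        using that \<phi> unfolding has_weak_deriv_def by blast
      from this[OF v] this[OF g] show ?thesis by (rule trans[OF sym])
    qed
    then have "(\<integral>x. ?v x * \<phi> x \<partial>lebesgue_on U) = (\<integral>x. g x * \<phi> x \<partial>lebesgue_on U)" by simp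
    moreover have "(\<integral>x. (?v x - g x) * \<phi> x \<partial>lebesgue_on U) = (\<integral>x. ?v x * \<phi> x \<partial>lebesgue_on U) - (\<integral>x. g x * \<phi> x \<partial>lebesgue_on U)"
      unfolding left_diff_distrib
      by (rule Bochner_Integration.integral_diff[OF integrable_mult_test[OF U \<phi> li(2)] integrable_mult_test[OF U \<phi> li(1)]])
    ultimately show "(\<integral>x. (?v x - g x) * \<phi> x \<partial>lebesgue_on U) = 0" by simp
  qed
  then show ?thesis by eventually_elim simp
qed

section \<open>Multi-indices of order at most one\<close>

lemma fold_funpow_single:
  "distinct xs \<Longrightarrow> fold (\<lambda>j. f j ^^ (if j = i then 1 else 0)) xs \<phi> = (if i \<in> set xs then f i \<phi> else \<phi>)"
  by (induction xs arbitrary: \<phi>) auto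

lemma multi_deriv_zero: "multi_deriv (\<lambda>_. 0) \<phi> = \<phi>"
proof -
  have "fold (\<lambda>i. partial_deriv i ^^ 0) xs \<phi> = \<phi>" for xs by (induction xs) auto
  then show ?thesis by (simp add: multi_deriv_def)
qed

text \<open>The enumeration of the coordinates is unspecified, but all powers except one are zero,
  so its order is invisible.\<close>

lemma multi_deriv_single: "multi_deriv (\<lambda>j. if j = i then 1 else 0) \<phi> = partial_deriv i \<phi>"
proof -
  let ?xs = "SOME xs. distinct xs \<and> set xs = (UNIV :: 'a set)"
  have "\<exists>xs. distinct xs \<and> set xs = (UNIV :: 'a set)" using finite_distinct_list[of "UNIV :: 'a set"] by auto
  then have "distinct ?xs \<and> set ?xs = UNIV" by (rule someI_ex)
  then show ?thesis by (simp add: multi_deriv_def fold_funpow_single)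
qed

lemma multi_order_0_iff: "multi_order \<alpha> = 0 \<longleftrightarrow> \<alpha> = (\<lambda>_. 0)"
  by (auto simp: multi_order_def fun_eq_iff)

lemma multi_order_single: "multi_order (\<lambda>j. if j = i then 1 else 0) = 1"
  by (simp add: multi_order_def)

lemma multi_order_1_cases:
  assumes "multi_order \<alpha> = 1"
  obtains i where "\<alpha> = (\<lambda>j. if j = i then 1 else 0)"
proof -
  obtain i where i: "\<alpha> i \<noteq> 0" using assms multi_order_0_iff[of \<alpha>] by fastforce
  have s: "multi_order \<alpha> = \<alpha> i + (\<Sum>j\<in>UNIV - {i}. \<alpha> j)"
    unfolding multi_order_def by (rule sum.remove) auto
  then have "\<alpha> i = 1" "(\<Sum>j\<in>UNIV - {i}. \<alpha> j) = 0" using assms i by linarith+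
  then have "\<alpha> = (\<lambda>j. if j = i then 1 else 0)" by (auto simp: fun_eq_iff)
  then show thesis by (rule that)
qed

subsection \<open>From differences to Sobolev regularity\<close>

text \<open>The identity \<open>\<Delta>\<^sub>2\<^sub>h = 2 \<Delta>\<^sub>h + \<Delta>\<^sub>h\<^sup>2\<close> controls first differences by second differences, at the
  price of staying below order one.\<close>

lemma first_difference_bound:
  fixes S :: "'a::euclidean_space set"
  assumes "0 < d" "0 < r" "r < 1" "r \<le> 2 * s" and [measurable]: "S \<in> sets borel"
  obtains B where "0 < B" "\<And>(w :: 'a \<Rightarrow> real) A h. w \<in> borel_measurable borel \<Longrightarrow> sqint lborel w \<Longrightarrow> l2 lborel w \<le> A \<Longrightarrow>
      (\<And>h. norm h \<le> d \<Longrightarrow> l2 lborel (\<lambda>x. indicator S x * dif h (dif h w) x) \<le> norm h powr (2 * s) * A) \<Longrightarrow>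
      norm h \<le> d \<Longrightarrow> l2 lborel (\<lambda>x. indicator S x * dif h w x) \<le> B * norm h powr r * A"
proof -
  define B1 where "B1 = 2 / (d / 2) powr r"
  \<comment> \<open>\<open>B1\<close> covers |h| \<ge> d / 2 by the trivial bound 2 A.
    \<open>B2\<close> is the fixed point of the doubling recursion, which sends B to 2^(r - 1) B +
    d^(2 s - r) / 2; it is a contraction because r < 1.\<close>
  define B2 where "B2 = (d powr (2 * s - r) / 2) / (1 - 2 powr r / 2)"
  define B where "B = max B1 B2"
  have r2: "2 powr r < 2" using powr_less_mono[of r 1 2] assms(3) by simp
  have B1: "0 < B1" using assms by (simp add: B1_def)
  have B0: "0 < B" using B1 by (simp add: B_def)
  have rec: "2 powr r / 2 * B + d powr (2 * s - r) / 2 \<le> B"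
  proof -
    have "1 - 2 powr r / 2 \<noteq> 0" using r2 by simp
    then have "d powr (2 * s - r) / 2 = B2 * (1 - 2 powr r / 2)" unfolding B2_def by (metis nonzero_eq_divide_eq)
    also have "\<dots> \<le> B * (1 - 2 powr r / 2)" using r2 by (intro mult_right_mono) (auto simp: B_def)
    finally show ?thesis by (simp add: algebra_simps)
  qed
  show thesis
  proof (rule that[OF B0])
    fix w :: "'a \<Rightarrow> real" and A and h :: 'a
    assume w: "w \<in> borel_measurable borel" "sqint lborel w" "l2 lborel w \<le> A"
      and sec: "\<And>h. norm h \<le> d \<Longrightarrow> l2 lborel (\<lambda>x. indicator S x * dif h (dif h w) x) \<le> norm h powr (2 * s) * A"
      and hd: "norm h \<le> d"
    have A0: "0 \<le> A" using w(3) l2_nonneg order_trans by blast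
    define N where "N h = l2 lborel (\<lambda>x. indicator S x * dif h w x)" for h
    have sq: "sqint lborel (\<lambda>x. indicator S x * dif h w x)" for h
      using l2_restrict_mono(1)[OF l2_dif(1)[OF w(2)]] by simp
    have sq2: "sqint lborel (\<lambda>x. indicator S x * dif h (dif h w) x)" for h
      using l2_restrict_mono(1)[OF l2_dif(1)[OF l2_dif(1)[OF w(2)]]] by simp
    have N2: "N h \<le> 2 * A" for h
      using l2_restrict_mono(2)[OF l2_dif(1)[OF w(2), of h], of S] l2_dif(2)[OF w(2), of h] w(3) by (simp add: N_def)
    have dbl: "N h \<le> N (2 *\<^sub>R h) / 2 + norm h powr (2 * s) * A / 2" if "norm h \<le> d" for h
    proof -
      have eq: "indicator S x * dif h w x = (1/2) * (indicator S x * dif (2 *\<^sub>R h) w x) - (1/2) * (indicator S x * dif h (dif h w) x)" for x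
        by (simp add: dif_def scaleR_2 algebra_simps add.assoc)
      have "N h = l2 lborel (\<lambda>x. (1/2) * (indicator S x * dif (2 *\<^sub>R h) w x) - (1/2) * (indicator S x * dif h (dif h w) x))"
        unfolding N_def eq[symmetric] ..
      also have "\<dots> \<le> l2 lborel (\<lambda>x. (1/2) * (indicator S x * dif (2 *\<^sub>R h) w x)) + l2 lborel (\<lambda>x. (1/2) * (indicator S x * dif h (dif h w) x))"
        by (rule sqint_diff(2)[OF sqint_cmult[OF sq] sqint_cmult[OF sq2]])
      also have "\<dots> \<le> N (2 *\<^sub>R h) / 2 + norm h powr (2 * s) * A / 2"
        unfolding l2_cmult using sec[OF that] by (simp add: N_def)
      finally show ?thesis .
    qed
    \<comment> \<open>Induction on the number of doublings that bring \<open>h\<close> to length at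
      least d / 2, where the trivial bound takes over.\<close>
    have main: "d / 2 ^ j \<le> norm h \<Longrightarrow> norm h \<le> d \<Longrightarrow> N h \<le> B * norm h powr r * A" for j and h :: 'a
    proof (induction j arbitrary: h)
      case 0
      then have big: "d / 2 \<le> norm h" using assms(1) by simp
      have "2 = B1 * (d / 2) powr r" using assms by (simp add: B1_def)
      also have "\<dots> \<le> B * norm h powr r" using assms big B1 by (intro mult_mono powr_mono2) (auto simp: B_def)
      finally have "2 * A \<le> B * norm h powr r * A" using A0 by (intro mult_right_mono)
      then show ?case using N2[of h] by linarith
    next
      case (Suc j)
      have hpos: "0 < norm h" using Suc.prems(1) assms(1) by (smt (verit) divide_pos_pos zero_less_power)
      show ?case
      proof (cases "d / 2 \<le> norm h")
        case True
        have "2 = B1 * (d / 2) powr r" using assms by (simp add: B1_def)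
        also have "\<dots> \<le> B * norm h powr r" using assms True B1 by (intro mult_mono powr_mono2) (auto simp: B_def)
        finally have "2 * A \<le> B * norm h powr r * A" using A0 by (intro mult_right_mono)
        then show ?thesis using N2[of h] by linarith
      next
        case False
        have IH: "N (2 *\<^sub>R h) \<le> B * norm (2 *\<^sub>R h) powr r * A"
          using Suc.prems False by (intro Suc.IH) (auto simp: field_simps)
        have p: "norm (2 *\<^sub>R h) powr r = 2 powr r * norm h powr r" by (simp add: powr_mult)
        have q: "norm h powr (2 * s) \<le> norm h powr r * d powr (2 * s - r)"
        proof -
          have "norm h powr (2 * s) = norm h powr r * norm h powr (2 * s - r)" using hpos by (simp flip: powr_add)
          also have "\<dots> \<le> norm h powr r * d powr (2 * s - r)"
            using Suc.prems assms by (intro mult_left_mono powr_mono2) auto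
          finally show ?thesis .
        qed
        have "N h \<le> N (2 *\<^sub>R h) / 2 + norm h powr (2 * s) * A / 2" by (rule dbl[OF Suc.prems(2)])
        also have "\<dots> \<le> (B * (2 powr r * norm h powr r) * A) / 2 + (norm h powr r * d powr (2 * s - r)) * A / 2"
          using IH p q A0 by (intro add_mono divide_right_mono mult_right_mono) auto
        also have "\<dots> = (2 powr r / 2 * B + d powr (2 * s - r) / 2) * (norm h powr r * A)"
          by (simp add: algebra_simps)
        also have "\<dots> \<le> B * (norm h powr r * A)" using rec A0 by (intro mult_right_mono) auto
        finally show ?thesis by (simp add: mult.assoc)
      qed
    qed
    show "l2 lborel (\<lambda>x. indicator S x * dif h w x) \<le> B * norm h powr r * A"
    proof (cases "h = 0")
      case True
      then show ?thesis by (simp add: dif_def[abs_def])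
    next
      case False
      obtain j where "d / norm h < 2 ^ j" using real_arch_pow[of 2 "d / norm h"] by auto
      then have "d / 2 ^ j \<le> norm h" using False by (simp add: field_simps)
      from main[OF this hd] show ?thesis by (simp add: N_def)
    qed
  qed
qed

section \<open>Geometric limits in L2 and Gagliardo integrals\<close>

lemma l2_Fatou:
  assumes f: "\<And>m. f m \<in> borel_measurable M" and g: "g \<in> borel_measurable M"
    and lim: "AE x in M. (\<lambda>m. f m x) \<longlonglongrightarrow> g x"
    and sq: "\<And>m. sqint M (f m)" and b: "\<And>m. m \<ge> m0 \<Longrightarrow> l2 M (f m) \<le> c" and c: "0 \<le> c"
  shows "sqint M g" "l2 M g \<le> c"
proof -
  note [measurable] = f g
  have "(\<integral>\<^sup>+x. ennreal ((g x)\<^sup>2) \<partial>M) = (\<integral>\<^sup>+x. liminf (\<lambda>m. ennreal ((f m x)\<^sup>2)) \<partial>M)"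
  proof (rule nn_integral_cong_AE, use lim in eventually_elim)
    case (elim x)
    have "(\<lambda>m. ennreal ((f m x)\<^sup>2)) \<longlonglongrightarrow> ennreal ((g x)\<^sup>2)" using elim by (intro tendsto_intros) auto
    then show ?case by (metis lim_imp_Liminf sequentially_bot)
  qed
  also have "\<dots> \<le> liminf (\<lambda>m. \<integral>\<^sup>+x. ennreal ((f m x)\<^sup>2) \<partial>M)" by (rule nn_integral_liminf) measurable
  also have "\<dots> \<le> ennreal (c\<^sup>2)"
  proof -
    have "eventually (\<lambda>m. (\<integral>\<^sup>+x. ennreal ((f m x)\<^sup>2) \<partial>M) \<le> ennreal (c\<^sup>2)) sequentially"
      unfolding eventually_sequentially
    proof (intro exI allI impI)
      fix m assume "m0 \<le> m"
      then have "(l2 M (f m))\<^sup>2 \<le> c\<^sup>2" using b by (intro power_mono) auto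
      then show "(\<integral>\<^sup>+x. ennreal ((f m x)\<^sup>2) \<partial>M) \<le> ennreal (c\<^sup>2)"
        by (simp add: nn_integral_square[OF sq] ennreal_leI)
    qed
    then have "limsup (\<lambda>m. \<integral>\<^sup>+x. ennreal ((f m x)\<^sup>2) \<partial>M) \<le> ennreal (c\<^sup>2)" by (rule Limsup_bounded)
    then show ?thesis using Liminf_le_Limsup[of sequentially "\<lambda>m. \<integral>\<^sup>+x. ennreal ((f m x)\<^sup>2) \<partial>M"] by (simp add: order_trans)
  qed
  finally have *: "(\<integral>\<^sup>+x. ennreal ((g x)\<^sup>2) \<partial>M) \<le> ennreal (c\<^sup>2)" .
  show "sqint M g" "l2 M g \<le> c" using l2_leI[OF g * c] by auto
qed

text \<open>Completeness of L2 with an explicit rate. Weighting the squared steps by \<theta>^(-j)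
  still leaves a summable series of integrals, so almost everywhere the j-th step is at most a
  constant times the square root of \<theta>^j, and the functions converge pointwise. Telescoping
  bounds the tails, and Fatou passes them to the limit.\<close>

lemma geometric_l2_limit:
  fixes f :: "nat \<Rightarrow> 'a \<Rightarrow> real"
  assumes sq: "\<And>j. sqint M (f j)" and step: "\<And>j. l2 M (\<lambda>x. f (Suc j) x - f j x) \<le> c * \<theta> ^ j"
    and "0 \<le> c" "0 < \<theta>" "\<theta> < 1"
  obtains g where "g \<in> borel_measurable M" "\<And>j. sqint M (\<lambda>x. g x - f j x)" "\<And>j. l2 M (\<lambda>x. g x - f j x) \<le> c * \<theta> ^ j / (1 - \<theta>)"
proof -
  have m [measurable]: "f j \<in> borel_measurable M" for j using sq[of j] by (simp add: sqint_def)
  define D where "D j = (\<lambda>x. f (Suc j) x - f j x)" for j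
  have Dm [measurable]: "D j \<in> borel_measurable M" for j unfolding D_def by measurable
  have Dq: "sqint M (D j)" for j unfolding D_def by (rule sqint_diff(1)[OF sq sq])
  define T where "T x = (\<Sum>j. ennreal (inverse \<theta> ^ j * (D j x)\<^sup>2))" for x
  have [measurable]: "T \<in> borel_measurable M" unfolding T_def by measurable
  have "(\<integral>\<^sup>+x. T x \<partial>M) = (\<Sum>j. \<integral>\<^sup>+x. ennreal (inverse \<theta> ^ j * (D j x)\<^sup>2) \<partial>M)"
    unfolding T_def by (rule nn_integral_suminf) measurable
  also have "\<dots> \<le> (\<Sum>j. ennreal (c\<^sup>2 * \<theta> ^ j))"
  proof (rule suminf_le[OF _ summableI summableI])
    fix j
    have "(\<integral>\<^sup>+x. ennreal (inverse \<theta> ^ j * (D j x)\<^sup>2) \<partial>M) = ennreal (inverse \<theta> ^ j) * (\<integral>\<^sup>+x. ennreal ((D j x)\<^sup>2) \<partial>M)"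
      using assms(4) by (subst nn_integral_cmult[symmetric]) (auto simp: ennreal_mult)
    also have "\<dots> = ennreal (inverse \<theta> ^ j * (l2 M (D j))\<^sup>2)"
      using assms(4) by (simp add: nn_integral_square[OF Dq] ennreal_mult)
    also have "\<dots> \<le> ennreal (c\<^sup>2 * \<theta> ^ j)"
    proof (rule ennreal_leI)
      have "(l2 M (D j))\<^sup>2 \<le> (c * \<theta> ^ j)\<^sup>2" using step[of j] by (intro power_mono) (auto simp: D_def)
      then have "inverse \<theta> ^ j * (l2 M (D j))\<^sup>2 \<le> inverse \<theta> ^ j * (c * \<theta> ^ j)\<^sup>2" using assms(4) by (intro mult_left_mono) auto
      also have "\<dots> = c\<^sup>2 * \<theta> ^ j" using assms(4) by (simp add: power_mult_distrib power2_eq_square power_inverse field_simps)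
      finally show "inverse \<theta> ^ j * (l2 M (D j))\<^sup>2 \<le> c\<^sup>2 * \<theta> ^ j" .
    qed
    finally show "(\<integral>\<^sup>+x. ennreal (inverse \<theta> ^ j * (D j x)\<^sup>2) \<partial>M) \<le> ennreal (c\<^sup>2 * \<theta> ^ j)" .
  qed
  also have "\<dots> < top"
    unfolding top.not_eq_extremum[symmetric]
    using assms(4,5) by (intro ennreal_suminf_neq_top summable_mult summable_geometric) auto
  finally have "AE x in M. T x \<noteq> \<infinity>"
    by (intro nn_integral_PInf_AE) auto
  then have conv: "AE x in M. convergent (\<lambda>j. f j x)"
  proof eventually_elim
    case (elim x)
    obtain t where t: "0 \<le> t" "T x = ennreal t" using elim by (cases "T x") auto
    have "\<bar>D j x\<bar> \<le> sqrt t * sqrt \<theta> ^ j" for j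
    proof -
      have "ennreal (inverse \<theta> ^ j * (D j x)\<^sup>2) = (\<Sum>i\<in>{j}. ennreal (inverse \<theta> ^ i * (D i x)\<^sup>2))"
        by (simp only: sum.insert sum.empty finite.emptyI empty_iff not_False_eq_True add_0_right)
      also have "\<dots> \<le> T x" unfolding T_def by (rule sum_le_suminf) auto
      finally have "inverse \<theta> ^ j * (D j x)\<^sup>2 \<le> t" using t by (simp add: ennreal_le_iff)
      then have "\<theta> ^ j * (inverse \<theta> ^ j * (D j x)\<^sup>2) \<le> \<theta> ^ j * t" using assms(4) by (intro mult_left_mono) auto
      moreover have "\<theta> ^ j * (inverse \<theta> ^ j * (D j x)\<^sup>2) = (D j x)\<^sup>2"
        using assms(4) by (simp add: power_inverse)
      ultimately have "(D j x)\<^sup>2 \<le> t * \<theta> ^ j" by (simp add: mult.commute)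
      then have "sqrt ((D j x)\<^sup>2) \<le> sqrt (t * \<theta> ^ j)" by (rule real_sqrt_le_mono)
      then have "\<bar>D j x\<bar> \<le> sqrt (t * \<theta> ^ j)" by simp
      then show ?thesis by (simp add: real_sqrt_mult real_sqrt_power)
    qed
    moreover have "summable (\<lambda>j. sqrt t * sqrt \<theta> ^ j)"
      using assms(4,5) by (intro summable_mult summable_geometric) auto
    ultimately have "summable (\<lambda>j. D j x)" by (intro summable_comparison_test'[of "\<lambda>j. sqrt t * sqrt \<theta> ^ j" 0 "\<lambda>j. D j x"]) auto
    then have "(\<lambda>n. \<Sum>j<n. D j x) \<longlonglongrightarrow> suminf (\<lambda>j. D j x)" by (rule summable_LIMSEQ)
    moreover have "(\<Sum>j<n. D j x) = f n x - f 0 x" for n unfolding D_def by (rule sum_lessThan_telescope)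
    ultimately have "(\<lambda>n. (f n x - f 0 x) + f 0 x) \<longlonglongrightarrow> suminf (\<lambda>j. D j x) + f 0 x" by (intro tendsto_add) auto
    then show ?case by (auto simp: convergent_def)
  qed
  define g where "g x = lim (\<lambda>j. f j x)" for x
  have gm [measurable]: "g \<in> borel_measurable M" unfolding g_def by (rule borel_measurable_lim_metric) measurable
  have lim: "AE x in M. (\<lambda>j. f j x) \<longlonglongrightarrow> g x"
    using conv by eventually_elim (simp add: convergent_LIMSEQ_iff g_def)
  \<comment> \<open>The factor \<open>1 - \<theta> ^ n\<close> is the exact partial geometric sum,
    which lets the induction close.\<close>
  have tele: "l2 M (\<lambda>x. f (j + n) x - f j x) \<le> c * \<theta> ^ j * (1 - \<theta> ^ n) / (1 - \<theta>)" for j n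
  proof (induction n)
    case (Suc n)
    have "l2 M (\<lambda>x. f (j + Suc n) x - f j x) = l2 M (\<lambda>x. (f (Suc (j + n)) x - f (j + n) x) + (f (j + n) x - f j x))" by simp
    also have "\<dots> \<le> c * \<theta> ^ (j + n) + c * \<theta> ^ j * (1 - \<theta> ^ n) / (1 - \<theta>)"
      using sqint_add(2)[OF sqint_diff(1)[OF sq sq] sqint_diff(1)[OF sq sq], of "Suc (j + n)" "j + n" "j + n" j] step[of "j + n"] Suc by linarith
    also have "\<dots> = c * \<theta> ^ j * (1 - \<theta> ^ Suc n) / (1 - \<theta>)"
      using assms(5) by (simp add: power_add field_simps)
    finally show ?case .
  qed (use assms in simp)
  show thesis
  proof (rule that[OF gm])
    fix j
    have b: "l2 M (\<lambda>x. f m x - f j x) \<le> c * \<theta> ^ j / (1 - \<theta>)" if "m \<ge> j" for m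
    proof -
      have "c * \<theta> ^ j * (1 - \<theta> ^ (m - j)) \<le> c * \<theta> ^ j * 1"
        using assms(3,4) by (intro mult_left_mono) auto
      then have "c * \<theta> ^ j * (1 - \<theta> ^ (m - j)) / (1 - \<theta>) \<le> c * \<theta> ^ j / (1 - \<theta>)"
        using assms(5) by (intro divide_right_mono) auto
      then show ?thesis using tele[of j "m - j"] that by simp
    qed
    have "AE x in M. (\<lambda>m. f m x - f j x) \<longlonglongrightarrow> g x - f j x"
      using lim by eventually_elim (intro tendsto_diff tendsto_const)
    then have "sqint M (\<lambda>x. g x - f j x) \<and> l2 M (\<lambda>x. g x - f j x) \<le> c * \<theta> ^ j / (1 - \<theta>)"
      using l2_Fatou[of "\<lambda>m x. f m x - f j x" M "\<lambda>x. g x - f j x" j "c * \<theta> ^ j / (1 - \<theta>)"]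
        sqint_diff(1)[OF sq sq] b assms(3-5) by auto
    then show "sqint M (\<lambda>x. g x - f j x)" "l2 M (\<lambda>x. g x - f j x) \<le> c * \<theta> ^ j / (1 - \<theta>)" by auto
  qed
qed

text \<open>The squared seminorm with values in [0, \<infinity>], so that finiteness can be the
  outcome of an estimate and need not be known before it.\<close>

definition gagliardo_energy :: "real \<Rightarrow> 'a::euclidean_space set \<Rightarrow> ('a \<Rightarrow> real) \<Rightarrow> ennreal" where
  "gagliardo_energy \<sigma> S v = (\<integral>\<^sup>+p. ennreal (indicator (S \<times> S) p *
    ((v (fst p) - v (snd p))\<^sup>2 / norm (fst p - snd p) powr (real DIM('a) + 2 * \<sigma>))) \<partial>(lborel \<Otimes>\<^sub>M lborel))"

text \<open>For |k| < \<delta> the increment bound leaves |k|^(2 (\<tau> - \<sigma>) - n),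
  integrable at 0 because \<sigma> < \<tau>; for larger |k| the trivial bound 2 A leaves |k|^(-n - 2
  \<sigma>), integrable at infinity because \<sigma> > 0. Both indicators of \<open>S\<close> are
  kept in the increment, since \<open>v\<close> is controlled on \<open>S\<close> only.\<close>

lemma gagliardo_bound:
  fixes S :: "'a::euclidean_space set"
  assumes "0 < \<sigma>" "\<sigma> < \<tau>" "0 < \<delta>" and [measurable]: "S \<in> sets borel"
  obtains c where "0 < c" "\<And>(v :: 'a \<Rightarrow> real) A. v \<in> borel_measurable borel \<Longrightarrow> sqint lborel (\<lambda>x. indicator S x * v x) \<Longrightarrow>
     l2 lborel (\<lambda>x. indicator S x * v x) \<le> A \<Longrightarrow>
     (\<And>k. k \<noteq> 0 \<Longrightarrow> norm k < \<delta> \<Longrightarrow> l2 lborel (\<lambda>x. indicator S x * indicator S (x + k) * dif k v x) \<le> norm k powr \<tau> * A) \<Longrightarrow>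
     gagliardo_energy \<sigma> S v \<le> ennreal ((c * A)\<^sup>2)"
proof -
  let ?n = "real DIM('a)"
  define c1 where "c1 = enn2real (\<integral>\<^sup>+k. ennreal (indicator (ball 0 \<delta>) k * norm k powr (2 * (\<tau> - \<sigma>) - ?n)) \<partial>(lborel :: 'a measure))"
  define c2 where "c2 = enn2real (\<integral>\<^sup>+k. ennreal (indicator (- ball 0 \<delta>) k * norm k powr (- ?n - 2 * \<sigma>)) \<partial>(lborel :: 'a measure))"
  have e1: "(\<integral>\<^sup>+k. ennreal (indicator (ball 0 \<delta>) k * norm k powr (2 * (\<tau> - \<sigma>) - ?n)) \<partial>(lborel :: 'a measure)) = ennreal c1"
    using radial_near[of "2 * (\<tau> - \<sigma>)" \<delta>, where 'a = 'a] assms by (simp add: c1_def)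
  have e2: "(\<integral>\<^sup>+k. ennreal (indicator (- ball 0 \<delta>) k * norm k powr (- ?n - 2 * \<sigma>)) \<partial>(lborel :: 'a measure)) = ennreal c2"
    using radial_far[of "2 * \<sigma>" \<delta>, where 'a = 'a] assms by (simp add: c2_def)
  have c12: "0 \<le> c1" "0 \<le> c2" by (simp_all add: c1_def c2_def)
  show thesis
  \<comment> \<open>The 4 is the square of the factor in the trivial bound 2 A; the 1 keeps the
    constant positive.\<close>
  proof (rule that[of "sqrt (c1 + 4 * c2 + 1)"])
    show "0 < sqrt (c1 + 4 * c2 + 1)" using c12 by simp
    fix v :: "'a \<Rightarrow> real" and A
    assume vm [measurable]: "v \<in> borel_measurable borel" and vq: "sqint lborel (\<lambda>x. indicator S x * v x)"
      and vA: "l2 lborel (\<lambda>x. indicator S x * v x) \<le> A"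
      and dA: "\<And>k. k \<noteq> 0 \<Longrightarrow> norm k < \<delta> \<Longrightarrow> l2 lborel (\<lambda>x. indicator S x * indicator S (x + k) * dif k v x) \<le> norm k powr \<tau> * A"
    have A0: "0 \<le> A" using vA l2_nonneg order_trans by blast
    let ?F = "\<lambda>p. ennreal (indicator (S \<times> S) p * ((v (fst p) - v (snd p))\<^sup>2 / norm (fst p - snd p) powr (?n + 2 * \<sigma>)))"
    define G where "G k = (\<lambda>x. indicator S x * indicator S (x + k) * dif k v x)" for k
    have Gq: "sqint lborel (G k)" and G2: "l2 lborel (G k) \<le> 2 * A" for k
    proof -
      note tr = l2_translate[OF vq, of k]
      note df = sqint_diff[OF tr(1) vq]
      have [measurable]: "G k \<in> borel_measurable borel" unfolding G_def dif_def by measurable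
      have *: "\<bar>G k x\<bar> \<le> 1 * \<bar>indicator S (x + k) * v (x + k) - indicator S x * v x\<bar>" for x
        by (cases "x \<in> S"; cases "x + k \<in> S") (simp_all add: G_def dif_def)
      have "sqint lborel (G k) \<and> l2 lborel (G k) \<le> 1 * l2 lborel (\<lambda>x. indicator S (x + k) * v (x + k) - indicator S x * v x)"
        using l2_mono[OF df(1), of "G k" 1] * by simp
      then show "sqint lborel (G k)" "l2 lborel (G k) \<le> 2 * A" using df(2) tr(2) vA by auto
    qed
    have [measurable]: "S \<times> S \<in> sets (borel \<Otimes>\<^sub>M borel)" by (rule pair_measureI) measurable
    have Fm: "?F \<in> borel_measurable (borel \<Otimes>\<^sub>M borel)" by measurable
    have "(\<integral>\<^sup>+p. ?F p \<partial>(lborel \<Otimes>\<^sub>M lborel)) = (\<integral>\<^sup>+p. ?F (shear p) \<partial>(lborel \<Otimes>\<^sub>M lborel))"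
      by (rule nn_integral_shear[OF Fm, symmetric])
    also have "\<dots> = (\<integral>\<^sup>+k. \<integral>\<^sup>+x. ?F (shear (k, x)) \<partial>lborel \<partial>lborel)"
      by (rule lborel.nn_integral_fst[symmetric]) (use measurable_compose[OF shear_measurable Fm] in simp)
    also have "\<dots> = (\<integral>\<^sup>+k. ennreal (norm k powr (- ?n - 2 * \<sigma>)) * ennreal ((l2 lborel (G k))\<^sup>2) \<partial>(lborel :: 'a measure))"
    proof (rule nn_integral_cong)
      fix k :: 'a
      have "?F (shear (k, x)) = ennreal (norm k powr (- ?n - 2 * \<sigma>)) * ennreal ((G k x)\<^sup>2)" for x
      proof -
        have p: "norm k powr (- ?n - 2 * \<sigma>) = inverse (norm k powr (?n + 2 * \<sigma>))"
          by (simp flip: powr_minus)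
        show ?thesis unfolding p
          by (cases "x \<in> S"; cases "x + k \<in> S")
            (simp_all add: shear_def G_def dif_def divide_inverse mult.commute flip: ennreal_mult)
      qed
      then show "(\<integral>\<^sup>+x. ?F (shear (k, x)) \<partial>lborel) = ennreal (norm k powr (- ?n - 2 * \<sigma>)) * ennreal ((l2 lborel (G k))\<^sup>2)"
        using sqint_measurable[OF Gq[of k]] by (simp add: nn_integral_cmult nn_integral_square[OF Gq])
    qed
    also have "\<dots> \<le> (\<integral>\<^sup>+k. ennreal (A\<^sup>2) * ennreal (indicator (ball 0 \<delta>) k * norm k powr (2 * (\<tau> - \<sigma>) - ?n))
        + ennreal (4 * A\<^sup>2) * ennreal (indicator (- ball 0 \<delta>) k * norm k powr (- ?n - 2 * \<sigma>)) \<partial>(lborel :: 'a measure))"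
    proof (rule nn_integral_mono)
      fix k :: 'a
      consider "k = 0" | "k \<noteq> 0" "norm k < \<delta>" | "\<not> norm k < \<delta>" by blast
      then show "ennreal (norm k powr (- ?n - 2 * \<sigma>)) * ennreal ((l2 lborel (G k))\<^sup>2) \<le> ennreal (A\<^sup>2) * ennreal (indicator (ball 0 \<delta>) k * norm k powr (2 * (\<tau> - \<sigma>) - ?n))
        + ennreal (4 * A\<^sup>2) * ennreal (indicator (- ball 0 \<delta>) k * norm k powr (- ?n - 2 * \<sigma>))"
      proof cases
        case 1
        then show ?thesis by simp
      next
        case 2
        have "(l2 lborel (G k))\<^sup>2 \<le> (norm k powr \<tau> * A)\<^sup>2" using dA[OF 2] unfolding G_def by (intro power_mono) auto
        then have "norm k powr (- ?n - 2 * \<sigma>) * (l2 lborel (G k))\<^sup>2 \<le> norm k powr (- ?n - 2 * \<sigma>) * (norm k powr \<tau> * A)\<^sup>2"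
          by (rule mult_left_mono) simp
        also have "\<dots> = A\<^sup>2 * norm k powr (2 * (\<tau> - \<sigma>) - ?n)"
        proof -
          have "norm k powr (- ?n - 2 * \<sigma>) * (norm k powr \<tau> * norm k powr \<tau>) = norm k powr (2 * (\<tau> - \<sigma>) - ?n)"
            by (simp add: algebra_simps flip: powr_add)
          then show ?thesis by (simp add: power2_eq_square mult_ac)
        qed
        finally show ?thesis using 2 by (simp add: ennreal_leI flip: ennreal_mult)
      next
        case 3
        have "(l2 lborel (G k))\<^sup>2 \<le> (2 * A)\<^sup>2" using G2 by (intro power_mono) auto
        then have "norm k powr (- ?n - 2 * \<sigma>) * (l2 lborel (G k))\<^sup>2 \<le> norm k powr (- ?n - 2 * \<sigma>) * (2 * A)\<^sup>2"
          by (rule mult_left_mono) simp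
        then show ?thesis using 3 by (simp add: ennreal_leI power_mult_distrib mult_ac flip: ennreal_mult)
      qed
    qed
    also have "\<dots> = ennreal (A\<^sup>2) * ennreal c1 + ennreal (4 * A\<^sup>2) * ennreal c2"
      by (subst nn_integral_add, measurable, subst nn_integral_cmult, measurable, subst nn_integral_cmult, measurable)
        (simp only: e1 e2)
    also have "\<dots> = ennreal (A\<^sup>2 * c1 + 4 * A\<^sup>2 * c2)" using c12 by (simp add: ennreal_mult)
    also have "\<dots> \<le> ennreal ((sqrt (c1 + 4 * c2 + 1) * A)\<^sup>2)"
      using c12 by (intro ennreal_leI) (simp add: power_mult_distrib algebra_simps)
    finally show "gagliardo_energy \<sigma> S v \<le> ennreal ((sqrt (c1 + 4 * c2 + 1) * A)\<^sup>2)" by (simp only: gagliardo_energy_def)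
  qed
qed

section \<open>Weak derivatives as limits of difference quotients\<close>

lemma integral_lborel_translate:
  fixes f :: "'a::euclidean_space \<Rightarrow> real"
  assumes [measurable]: "f \<in> borel_measurable borel"
  shows "(\<integral>x. f (x + h) \<partial>lborel) = (\<integral>x. f x \<partial>lborel)"
proof -
  have "(\<integral>x. f x \<partial>lborel) = (\<integral>x. f x \<partial>distr lborel borel ((+) h))" by (simp add: lborel_distr_plus)
  also have "\<dots> = (\<integral>x. f (h + x) \<partial>lborel)" by (subst integral_distr) auto
  finally show ?thesis by (simp add: add.commute)
qed

lemma test_function_line_deriv:
  assumes \<phi>: "\<phi> \<in> test_functions U"
  shows "((\<lambda>\<sigma>. \<phi> (x + \<sigma> *\<^sub>R axis i 1)) has_real_derivative partial_deriv i \<phi> (x + \<sigma> *\<^sub>R axis i 1)) (at \<sigma>)"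
proof -
  let ?e = "axis i 1 :: real^'a"
  let ?F = "frechet_derivative \<phi> (at (x + \<sigma> *\<^sub>R ?e))"
  have d: "\<phi> differentiable (at (x + \<sigma> *\<^sub>R ?e))" by (rule test_function_continuous(1)[OF \<phi>])
  then have F: "(\<phi> has_derivative ?F) (at (x + \<sigma> *\<^sub>R ?e))" by (simp add: frechet_derivative_works)
  have "((\<lambda>\<sigma>. x + \<sigma> *\<^sub>R ?e) has_derivative (\<lambda>t. t *\<^sub>R ?e)) (at \<sigma>)" by (auto intro!: derivative_eq_intros)
  from has_derivative_compose[OF this F]
  have "((\<lambda>\<sigma>. \<phi> (x + \<sigma> *\<^sub>R ?e)) has_derivative (\<lambda>t. ?F (t *\<^sub>R ?e))) (at \<sigma>)" .
  moreover have "(\<lambda>t. ?F (t *\<^sub>R ?e)) = (*) (partial_deriv i \<phi> (x + \<sigma> *\<^sub>R ?e))"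
    using linear_scale[OF linear_frechet_derivative[OF d]] by (auto simp: partial_deriv_def fun_eq_iff mult.commute)
  ultimately show ?thesis by (simp add: has_field_derivative_def)
qed

lemma test_function_lipschitz:
  assumes \<phi>: "\<phi> \<in> test_functions U" and B: "\<And>x. \<bar>partial_deriv i \<phi> x\<bar> \<le> B"
  shows "\<bar>\<phi> (x + \<sigma> *\<^sub>R axis i 1) - \<phi> x\<bar> \<le> B * \<bar>\<sigma>\<bar>"
proof -
  have "norm (\<phi> (x + \<sigma> *\<^sub>R axis i 1) - \<phi> (x + 0 *\<^sub>R axis i 1)) \<le> B * norm (\<sigma> - 0)"
    using test_function_line_deriv[OF \<phi>] B
    by (intro field_differentiable_bound[of UNIV "\<lambda>\<sigma>. \<phi> (x + \<sigma> *\<^sub>R axis i 1)" "\<lambda>\<sigma>. partial_deriv i \<phi> (x + \<sigma> *\<^sub>R axis i 1)" B]) auto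
  then show ?thesis by simp
qed

lemma test_function_quotient_tendsto:
  assumes \<phi>: "\<phi> \<in> test_functions U" and \<tau>: "\<tau> \<longlonglongrightarrow> 0" "\<And>j. \<tau> j \<noteq> 0"
  shows "(\<lambda>j. (\<phi> (x + \<tau> j *\<^sub>R axis i 1) - \<phi> x) / \<tau> j) \<longlonglongrightarrow> partial_deriv i \<phi> x"
proof -
  have "((\<lambda>h. (\<phi> (x + (0 + h) *\<^sub>R axis i 1) - \<phi> (x + 0 *\<^sub>R axis i 1)) / h) \<longlongrightarrow> partial_deriv i \<phi> (x + 0 *\<^sub>R axis i 1)) (at 0)"
    using test_function_line_deriv[OF \<phi>, of x i 0] unfolding DERIV_def .
  then have "((\<lambda>h. (\<phi> (x + h *\<^sub>R axis i 1) - \<phi> x) / h) \<longlongrightarrow> partial_deriv i \<phi> x) (at 0)" by simp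
  moreover have "filterlim \<tau> (at 0) sequentially" using \<tau> by (simp add: filterlim_at)
  ultimately show ?thesis by (rule filterlim_compose)
qed

lemma sqint_indicator:
  assumes "C \<in> sets borel" "bounded (C :: 'a::euclidean_space set)"
  shows "sqint lborel (indicator C :: 'a \<Rightarrow> real)"
proof -
  have "emeasure lborel C < \<infinity>" using emeasure_bounded_finite[OF assms(2)] by simp
  moreover have "(\<lambda>x. (indicator C x)\<^sup>2) = (indicator C :: 'a \<Rightarrow> real)" by (auto simp: indicator_def)
  ultimately show ?thesis using assms(1) by (simp add: sqint_def integrable_indicator_iff)
qed

lemma set_integrable_of_sqint:
  fixes v v' :: "real^'n \<Rightarrow> real"
  assumes "open S" "compact C" "C \<subseteq> S" and [measurable]: "v \<in> borel_measurable borel"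
    and v: "sqint lborel (\<lambda>x. indicator S x * v x)" and ae: "AE x in lborel. x \<in> S \<longrightarrow> v' x = v x"
  shows "set_integrable lebesgue C v'"
proof -
  have C [measurable]: "C \<in> sets borel" using assms(2) by (simp add: compact_imp_closed)
  have "integrable lborel (\<lambda>x. indicator C x * (indicator S x * v x))"
    by (rule sqint_mult_integrable[OF sqint_indicator[OF C compact_imp_bounded[OF assms(2)]] v])
  also have "(\<lambda>x. indicator C x * (indicator S x * v x)) = (\<lambda>x. indicator C x * v x)"
    using assms(3) by (auto simp: indicator_def fun_eq_iff)
  finally have i: "integrable lborel (\<lambda>x. indicator C x * v x)" .
  have m: "(\<lambda>x. indicator C x * v x) \<in> borel_measurable lborel" by measurable
  have il: "integrable lebesgue (\<lambda>x. indicator C x * v x)" using i integrable_completion[OF m] by simp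
  have ae': "AE x in lebesgue. indicator C x * v x = indicator C x * v' x"
    unfolding AE_completion_iff using ae by eventually_elim (use assms(3) in \<open>auto simp: indicator_def\<close>)
  have "integrable lebesgue (\<lambda>x. indicator C x * v' x)"
    by (rule integrable_cong_AE_imp[OF il borel_measurable_AE[OF borel_measurable_integrable[OF il] ae'] ae'])
  then show ?thesis by (simp add: set_integrable_def)
qed

lemma integral_lebesgue_on_test:
  fixes v v' \<phi> :: "real^'n \<Rightarrow> real"
  assumes "open S" and [measurable]: "v \<in> borel_measurable borel" "\<phi> \<in> borel_measurable borel"
    and ae: "AE x in lborel. x \<in> S \<longrightarrow> v' x = v x" and z: "\<And>x. x \<notin> S \<Longrightarrow> \<phi> x = 0"
  shows "(\<integral>x. v' x * \<phi> x \<partial>lebesgue_on S) = (\<integral>x. v x * \<phi> x \<partial>lborel)"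
proof -
  have m: "(\<lambda>x. v x * \<phi> x) \<in> borel_measurable lborel" by measurable
  have ae': "AE x in lebesgue. v x * \<phi> x = indicator S x *\<^sub>R (v' x * \<phi> x)"
    unfolding AE_completion_iff using ae by eventually_elim (use z in \<open>auto simp: indicator_def\<close>)
  have "(\<integral>x. v' x * \<phi> x \<partial>lebesgue_on S) = (\<integral>x. indicator S x *\<^sub>R (v' x * \<phi> x) \<partial>lebesgue)"
    using assms(1) by (intro integral_restrict_space) simp
  also have "\<dots> = (\<integral>x. v x * \<phi> x \<partial>lebesgue)"
    using ae' by (intro integral_cong_AE borel_measurable_AE[OF measurable_completion[OF m] ae'] measurable_completion[OF m]) (auto elim: AE_mp)
  also have "\<dots> = (\<integral>x. v x * \<phi> x \<partial>lborel)" by (rule integral_completion[OF m])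
  finally show ?thesis .
qed

lemma has_weak_deriv_zero:
  fixes u w :: "real^'n \<Rightarrow> real"
  assumes "open S" "w \<in> borel_measurable borel" "sqint lborel (\<lambda>x. indicator S x * w x)" "AE x in lborel. x \<in> S \<longrightarrow> u x = w x"
  shows "has_weak_deriv S (\<lambda>_. 0) u w"
  unfolding has_weak_deriv_def
proof (intro conjI allI impI ballI)
  fix C assume C: "compact C \<and> C \<subseteq> S"
  show "set_integrable lebesgue C u" using C assms by (intro set_integrable_of_sqint[of S C w]) auto
  show "set_integrable lebesgue C w" using C assms by (intro set_integrable_of_sqint[of S C w]) auto
next
  fix \<phi> assume \<phi>: "\<phi> \<in> test_functions S"
  obtain Q where "Q \<subseteq> S" "\<And>x. x \<notin> Q \<Longrightarrow> \<phi> x = 0" using test_function_props[OF \<phi>] by metis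
  then have z: "\<And>x. x \<notin> S \<Longrightarrow> \<phi> x = 0" by auto
  have pm: "\<phi> \<in> borel_measurable borel" using test_function_continuous(2)[OF \<phi>] by (rule borel_measurable_continuous_onI)
  show "(\<integral>x. u x * multi_deriv (\<lambda>_. 0) \<phi> x \<partial>lebesgue_on S) = (-1) ^ multi_order (\<lambda>_. 0) * (\<integral>x. w x * \<phi> x \<partial>lebesgue_on S)"
    using integral_lebesgue_on_test[OF assms(1,2) pm assms(4) z] integral_lebesgue_on_test[OF assms(1,2) pm _ z, of w]
    by (simp add: multi_deriv_zero multi_order_def)
qed

text \<open>Discrete integration by parts moves the difference quotient from \<open>w\<close> to
  \<open>\<phi>\<close>. On one side the quotients of \<open>w\<close> converge to \<open>g\<close>
  in L2 on \<open>S\<close>; on the other those of \<open>\<phi>\<close> converge pointwise and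
  boundedly. Translates of \<open>\<phi>\<close> may leave \<open>S\<close>, which is harmless
  because \<open>w\<close> is square integrable on the whole space.\<close>

lemma has_weak_deriv_of_quotients:
  fixes u w g :: "real^'n \<Rightarrow> real" and \<tau> :: "nat \<Rightarrow> real"
  assumes S: "open S" and w: "w \<in> borel_measurable borel" "sqint lborel w" and u: "AE x in lborel. x \<in> S \<longrightarrow> u x = w x"
    and g: "g \<in> borel_measurable borel" "sqint lborel (\<lambda>x. indicator S x * g x)"
    and \<tau>: "\<And>j. 0 < \<tau> j" "\<tau> \<longlonglongrightarrow> 0"
    and lim: "(\<lambda>j. l2 lborel (\<lambda>x. indicator S x * (g x - dif (\<tau> j *\<^sub>R axis i 1) w x / \<tau> j))) \<longlonglongrightarrow> 0"
  shows "has_weak_deriv S (\<lambda>j. if j = i then 1 else 0) u g"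
  unfolding has_weak_deriv_def
proof (intro conjI allI impI ballI)
  have Sb: "S \<in> sets borel" using S by simp
  have wS: "sqint lborel (\<lambda>x. indicator S x * w x)" using l2_restrict_mono(1)[OF w(2)] Sb by simp
  fix C assume C: "compact C \<and> C \<subseteq> S"
  show "set_integrable lebesgue C u" using C by (intro set_integrable_of_sqint[OF S _ _ w(1) wS u]) auto
  show "set_integrable lebesgue C g" using C by (intro set_integrable_of_sqint[OF S _ _ g]) auto
next
  have Sb [measurable]: "S \<in> sets borel" using S by simp
  note [measurable] = w(1) g(1)
  fix \<phi> assume \<phi>: "\<phi> \<in> test_functions S"
  obtain Q where Q: "compact Q" "Q \<subseteq> S" "\<And>x. x \<notin> Q \<Longrightarrow> \<phi> x = 0" "\<And>i x. x \<notin> Q \<Longrightarrow> partial_deriv i \<phi> x = 0" using test_function_props[OF \<phi>] by metis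
  note c = test_function_continuous[OF \<phi>]
  have pm [measurable]: "\<phi> \<in> borel_measurable borel" using c(2) by (rule borel_measurable_continuous_onI)
  have dm [measurable]: "partial_deriv i \<phi> \<in> borel_measurable borel" using c(4) by (rule borel_measurable_continuous_onI)
  obtain B0 where B0: "0 \<le> B0" "\<And>x. \<bar>\<phi> x\<bar> \<le> B0" using continuous_compact_support_bounded[OF c(2) Q(1,3)] by metis
  obtain B where B: "0 \<le> B" "\<And>x. \<bar>partial_deriv i \<phi> x\<bar> \<le> B" using continuous_compact_support_bounded[OF c(4) Q(1,4)] by metis
  obtain R0 where R0: "\<And>x. x \<in> Q \<Longrightarrow> norm x \<le> R0" using compact_imp_bounded[OF Q(1)] by (auto simp: bounded_iff)
  obtain t where t: "\<And>j. \<tau> j \<le> t"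
    using convergent_imp_Bseq[of \<tau>] \<tau>(2) unfolding Bseq_def convergent_def by (metis abs_le_iff real_norm_def)
  have \<phi>q: "sqint lborel \<phi>"
  proof -
    have "\<bar>\<phi> x\<bar> \<le> B0 * \<bar>indicator Q x :: real\<bar>" for x using B0 Q(3) by (cases "x \<in> Q") auto
    then show ?thesis
      using Q(1) B0(1) by (intro l2_mono(1)[of lborel "indicator Q" \<phi> B0] sqint_indicator) (auto simp: compact_imp_closed compact_imp_bounded)
  qed
  let ?e = "axis i 1 :: real^'n"
  define q where "q j x = dif (\<tau> j *\<^sub>R ?e) w x / \<tau> j" for j x
  have qm [measurable]: "q j \<in> borel_measurable borel" for j unfolding q_def by measurable
  have qq: "sqint lborel (q j)" for j
    using sqint_cmult[OF l2_dif(1)[OF w(2)], of "1 / \<tau> j" "\<tau> j *\<^sub>R ?e"] by (simp add: q_def[abs_def])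
  \<comment> \<open>The translation is by minus the step while the denominator is the positive step,
    hence the limit is minus the partial derivative: the sign of integration by parts.\<close>
  define \<psi> where "\<psi> j x = (\<phi> (x + (- \<tau> j) *\<^sub>R ?e) - \<phi> x) / \<tau> j" for j x
  have \<psi>m [measurable]: "\<psi> j \<in> borel_measurable borel" for j unfolding \<psi>_def by measurable
  have parts: "(\<integral>x. q j x * \<phi> x \<partial>lborel) = (\<integral>x. w x * \<psi> j x \<partial>lborel)" for j
  proof -
    note wt = l2_translate(1)[OF w(2), of "\<tau> j *\<^sub>R ?e"] and pt = l2_translate(1)[OF \<phi>q, of "(- \<tau> j) *\<^sub>R ?e"]
    have "(\<integral>x. q j x * \<phi> x \<partial>lborel) = (\<integral>x. (1 / \<tau> j) * (w (x + \<tau> j *\<^sub>R ?e) * \<phi> x) - (1 / \<tau> j) * (w x * \<phi> x) \<partial>lborel)"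
      by (intro Bochner_Integration.integral_cong) (auto simp: q_def dif_def algebra_simps diff_divide_distrib)
    also have "\<dots> = (1 / \<tau> j) * (\<integral>x. w (x + \<tau> j *\<^sub>R ?e) * \<phi> x \<partial>lborel) - (1 / \<tau> j) * (\<integral>x. w x * \<phi> x \<partial>lborel)"
      using sqint_mult_integrable[OF wt \<phi>q] sqint_mult_integrable[OF w(2) \<phi>q] by (subst Bochner_Integration.integral_diff) auto
    also have "(\<integral>x. w (x + \<tau> j *\<^sub>R ?e) * \<phi> x \<partial>lborel) = (\<integral>x. w x * \<phi> (x + (- \<tau> j) *\<^sub>R ?e) \<partial>lborel)"
      using integral_lborel_translate[of "\<lambda>x. w x * \<phi> (x + (- \<tau> j) *\<^sub>R ?e)" "\<tau> j *\<^sub>R ?e"] by (simp add: add.assoc)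
    also have "(1 / \<tau> j) * (\<integral>x. w x * \<phi> (x + (- \<tau> j) *\<^sub>R ?e) \<partial>lborel) - (1 / \<tau> j) * (\<integral>x. w x * \<phi> x \<partial>lborel)
       = (\<integral>x. (1 / \<tau> j) * (w x * \<phi> (x + (- \<tau> j) *\<^sub>R ?e)) - (1 / \<tau> j) * (w x * \<phi> x) \<partial>lborel)"
      using sqint_mult_integrable[OF w(2) pt] sqint_mult_integrable[OF w(2) \<phi>q] by (subst Bochner_Integration.integral_diff) auto
    also have "\<dots> = (\<integral>x. w x * \<psi> j x \<partial>lborel)"
      by (intro Bochner_Integration.integral_cong) (auto simp: \<psi>_def algebra_simps diff_divide_distrib)
    finally show ?thesis .
  qed
  have "(\<lambda>j. \<integral>x. w x * \<psi> j x \<partial>lborel) \<longlonglongrightarrow> (\<integral>x. w x * (- partial_deriv i \<phi> x) \<partial>lborel)"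
  \<comment> \<open>\<open>B\<close> bounds the quotients through the Lipschitz estimate, and the
    ball contains the support \<open>Q\<close> of \<open>\<phi>\<close> enlarged by the largest
    step, hence all translated supports.\<close>
  proof (rule integral_dominated_convergence[where w = "\<lambda>x. B * \<bar>indicator (cball 0 (R0 + t)) x * w x\<bar>"])
    show "integrable lborel (\<lambda>x. B * \<bar>indicator (cball 0 (R0 + t)) x * w x\<bar>)"
      using sqint_mult_integrable[OF sqint_indicator w(2), of "cball 0 (R0 + t)"] by auto
    show "AE x in lborel. (\<lambda>j. w x * \<psi> j x) \<longlonglongrightarrow> w x * (- partial_deriv i \<phi> x)"
    proof (intro AE_I2 tendsto_mult tendsto_const)
      fix x
      have "(\<lambda>j. - ((\<phi> (x + (- \<tau> j) *\<^sub>R ?e) - \<phi> x) / (- \<tau> j))) \<longlonglongrightarrow> - partial_deriv i \<phi> x"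
        using tendsto_minus[OF \<tau>(2)] \<tau>(1) by (intro tendsto_minus test_function_quotient_tendsto[OF \<phi>]) (auto simp: less_imp_neq[symmetric])
      then show "(\<lambda>j. \<psi> j x) \<longlonglongrightarrow> - partial_deriv i \<phi> x" by (simp add: \<psi>_def)
    qed
    show "AE x in lborel. norm (w x * \<psi> j x) \<le> B * \<bar>indicator (cball 0 (R0 + t)) x * w x\<bar>" for j
    proof (intro AE_I2)
      fix x
      have "\<bar>\<phi> (x + (- \<tau> j) *\<^sub>R ?e) - \<phi> x\<bar> \<le> B * \<bar>- \<tau> j\<bar>" by (rule test_function_lipschitz[OF \<phi> B(2)])
      then have b: "\<bar>\<psi> j x\<bar> \<le> B" using \<tau>(1)[of j] by (simp add: \<psi>_def abs_divide pos_divide_le_eq)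
      show "norm (w x * \<psi> j x) \<le> B * \<bar>indicator (cball 0 (R0 + t)) x * w x\<bar>"
      proof (cases "x \<in> cball 0 (R0 + t)")
        case True
        then show ?thesis using mult_left_mono[OF b, of "\<bar>w x\<bar>"] by (simp add: abs_mult mult.commute)
      next
        case False
        have t0: "0 < t" using t[of j] \<tau>(1)[of j] by simp
        have x1: "x \<notin> Q" using False R0[of x] t0 by auto
        have x2: "x + (- \<tau> j) *\<^sub>R ?e \<notin> Q"
        proof
          assume "x + (- \<tau> j) *\<^sub>R ?e \<in> Q"
          then have "norm (x + (- \<tau> j) *\<^sub>R ?e) \<le> R0" by (rule R0)
          moreover have "norm ((- \<tau> j) *\<^sub>R ?e) \<le> t" using t[of j] \<tau>(1)[of j] by (simp add: norm_axis_1)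
          moreover have "norm x \<le> norm (x + (- \<tau> j) *\<^sub>R ?e) + norm ((- \<tau> j) *\<^sub>R ?e)"
            by (metis add_diff_cancel norm_triangle_ineq4)
          ultimately show False using False by simp
        qed
        show ?thesis using False Q(3)[OF x1] Q(3)[OF x2] by (simp add: \<psi>_def)
      qed
    qed
  qed measurable
  then have l1: "(\<lambda>j. \<integral>x. q j x * \<phi> x \<partial>lborel) \<longlonglongrightarrow> - (\<integral>x. w x * partial_deriv i \<phi> x \<partial>lborel)" by (simp add: parts)
  have l2': "(\<lambda>j. \<integral>x. q j x * \<phi> x \<partial>lborel) \<longlonglongrightarrow> (\<integral>x. g x * \<phi> x \<partial>lborel)"
  proof -
    have dq: "sqint lborel (\<lambda>x. indicator S x * (g x - q j x))" for j
      using sqint_diff(1)[OF g(2) l2_restrict_mono(1)[OF qq[of j], of S]] by (simp add: right_diff_distrib)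
    have ig: "integrable lborel (\<lambda>x. g x * \<phi> x)"
    proof -
      have "integrable lborel (\<lambda>x. (indicator S x * g x) * \<phi> x)" by (rule sqint_mult_integrable[OF g(2) \<phi>q])
      also have "(\<lambda>x. (indicator S x * g x) * \<phi> x) = (\<lambda>x. g x * \<phi> x)" using Q(2,3) by (auto simp: indicator_def fun_eq_iff)
      finally show ?thesis .
    qed
    have "\<bar>(\<integral>x. q j x * \<phi> x \<partial>lborel) - (\<integral>x. g x * \<phi> x \<partial>lborel)\<bar> \<le> l2 lborel (\<lambda>x. indicator S x * (g x - q j x)) * l2 lborel \<phi>" for j
    proof -
      have "(\<integral>x. g x * \<phi> x \<partial>lborel) - (\<integral>x. q j x * \<phi> x \<partial>lborel) = (\<integral>x. g x * \<phi> x - q j x * \<phi> x \<partial>lborel)"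
        by (rule Bochner_Integration.integral_diff[symmetric, OF ig sqint_mult_integrable[OF qq \<phi>q]])
      also have "\<dots> = (\<integral>x. (indicator S x * (g x - q j x)) * \<phi> x \<partial>lborel)"
        using Q(2,3) by (intro Bochner_Integration.integral_cong) (auto simp: indicator_def algebra_simps)
      finally show ?thesis using Cauchy_Schwarz_l2(2)[OF dq \<phi>q, of j] by (simp add: abs_minus_commute)
    qed
    then have b: "\<forall>\<^sub>F j in sequentially. norm ((\<integral>x. q j x * \<phi> x \<partial>lborel) - (\<integral>x. g x * \<phi> x \<partial>lborel))
        \<le> l2 lborel (\<lambda>x. indicator S x * (g x - q j x)) * l2 lborel \<phi>"
      unfolding real_norm_def by (intro always_eventually allI)
    have "(\<lambda>j. l2 lborel (\<lambda>x. indicator S x * (g x - q j x)) * l2 lborel \<phi>) \<longlonglongrightarrow> 0 * l2 lborel \<phi>"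
      unfolding q_def by (intro tendsto_mult tendsto_const lim)
    then have l0: "(\<lambda>j. l2 lborel (\<lambda>x. indicator S x * (g x - q j x)) * l2 lborel \<phi>) \<longlonglongrightarrow> 0" by simp
    from b l0 have "(\<lambda>j. (\<integral>x. q j x * \<phi> x \<partial>lborel) - (\<integral>x. g x * \<phi> x \<partial>lborel)) \<longlonglongrightarrow> 0"
      by (rule Lim_null_comparison)
    then show ?thesis by (simp add: LIM_zero_iff)
  qed
  have eq: "(\<integral>x. w x * partial_deriv i \<phi> x \<partial>lborel) = - (\<integral>x. g x * \<phi> x \<partial>lborel)"
    using LIMSEQ_unique[OF l1 l2'] by simp
  have z: "\<And>x. x \<notin> S \<Longrightarrow> \<phi> x = 0" "\<And>x. x \<notin> S \<Longrightarrow> partial_deriv i \<phi> x = 0" using Q by auto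
  show "(\<integral>x. u x * multi_deriv (\<lambda>j. if j = i then 1 else 0) \<phi> x \<partial>lebesgue_on S)
     = (-1) ^ multi_order (\<lambda>j. if j = i then 1 else 0) * (\<integral>x. g x * \<phi> x \<partial>lebesgue_on S)"
    using integral_lebesgue_on_test[OF S w(1) dm u z(2)] integral_lebesgue_on_test[OF S g(1) pm _ z(1), of g] eq
    unfolding multi_deriv_single multi_order_single by simp
qed

text \<open>Consecutive dyadic quotients differ by a second difference with equal steps divided by
  the step, of size step^(2 s - 1); as \<open>s > 1 / 2\<close> this decays geometrically. For the
  increments of the limit \<open>g\<close>, a quotient whose step is comparable to |k| is compared
  with \<open>g\<close>: the distance to it has the size of the tail, |k|^(2 s - 1), and its own
  increment is at most step^(s - 1) |k|^s by the mixed bound, which is of the same size.\<close>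

lemma first_weak_derivative:
  fixes S :: "(real^'n) set"
  assumes "1 / 2 < s" "s < 1" "0 < d" and S: "open S"
  obtains c where "0 < c" "\<And>(w :: real^'n \<Rightarrow> real) u A i. difference_regular s d S A w \<Longrightarrow> AE x in lborel. x \<in> S \<longrightarrow> u x = w x \<Longrightarrow>
      \<exists>g. g \<in> borel_measurable borel \<and> sqint lborel (\<lambda>x. indicator S x * g x) \<and> l2 lborel (\<lambda>x. indicator S x * g x) \<le> c * A \<and>
        has_weak_deriv S (\<lambda>j. if j = i then 1 else 0) u g \<and>
        (\<forall>k. k \<noteq> 0 \<longrightarrow> norm k < d \<longrightarrow> l2 lborel (\<lambda>x. indicator S x * indicator S (x + k) * dif k g x) \<le> norm k powr (2 * s - 1) * (c * A))"
proof -
  have Sb [measurable]: "S \<in> sets borel" using S by simp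
  define \<theta> where "\<theta> = 2 powr (1 - 2 * s)"
  have \<theta>: "0 < \<theta>" "\<theta> < 1" using assms(1) powr_less_mono[of "1 - 2 * s" 0 2] by (auto simp: \<theta>_def)
  \<comment> \<open>With \<theta> = 2^(1 - 2 s), the number step(j + 1)^(2 s) / step(j) equals
    \<open>c0\<close> times \<theta>^j for the steps d / 2^j.\<close>
  define c0 where "c0 = (d / 2) powr (2 * s) / d"
  have c0: "0 < c0" using assms by (simp add: c0_def)
  define ca where "ca = c0 / (1 - \<theta>)"
  have ca: "0 < ca" using c0 \<theta> by (simp add: ca_def)
  \<comment> \<open>Two copies of the tail, at \<open>x\<close> and at \<open>x + k\<close>, with (2
    / d)^(2 s - 1) from the comparison of the step with 2 |k|; the summand 1 is the increment of the
    quotient itself.\<close>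
  define cb where "cb = 2 * ca * (2 / d) powr (2 * s - 1) + 1"
  have cb: "0 < cb" using ca by (simp add: cb_def add_nonneg_pos)
  define c where "c = max (ca + 2 / d) cb"
  have c: "0 < c" "ca + 2 / d \<le> c" "cb \<le> c" using cb by (auto simp: c_def)
  show thesis
  proof (rule that[OF c(1)])
    fix w :: "real^'n \<Rightarrow> real" and u and A and i :: 'n
    assume w: "difference_regular s d S A w" and u: "AE x in lborel. x \<in> S \<longrightarrow> u x = w x"
    note wm [measurable] = difference_regularD(1)[OF w] and wq = difference_regularD(2)[OF w]
      and wA = difference_regularD(3)[OF w] and A0 = difference_regularD(4)[OF w] and mix = difference_regularD(5)[OF w]
    let ?e = "axis i 1 :: real^'n"
    define \<tau> where "\<tau> j = d / 2 ^ j" for j :: nat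
    have \<tau>: "0 < \<tau> j" "\<tau> j \<le> d" "\<tau> (Suc j) = \<tau> j / 2" for j
      using assms(3) by (auto simp: \<tau>_def field_simps)
    have \<tau>0: "\<tau> \<longlonglongrightarrow> 0"
    proof -
      have "(\<lambda>j. d * (1 / 2) ^ j) \<longlonglongrightarrow> d * 0" by (intro tendsto_intros LIMSEQ_power_zero) auto
      then show ?thesis by (simp add: \<tau>_def[abs_def] power_divide)
    qed
    have ne: "norm (\<tau> j *\<^sub>R ?e) = \<tau> j" for j using \<tau>(1)[of j] by (simp add: norm_axis_1)
    have \<tau>\<theta>: "\<theta> ^ j = (\<tau> j / d) powr (2 * s - 1)" for j
    proof -
      have "\<theta> ^ j = 2 powr (real j * (1 - 2 * s))" by (simp add: \<theta>_def powr_power mult.commute)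
      also have "\<dots> = (2 ^ j) powr (1 - 2 * s)" by (simp add: powr_powr[symmetric] powr_realpow)
      also have "\<dots> = (\<tau> j / d) powr (2 * s - 1)" using assms(3) by (simp add: \<tau>_def powr_divide powr_minus_divide[symmetric])
      finally show ?thesis .
    qed
    define q where "q j x = dif (\<tau> j *\<^sub>R ?e) w x / \<tau> j" for j x
    have qm [measurable]: "q j \<in> borel_measurable borel" for j unfolding q_def by measurable
    have qq: "sqint lborel (q j)" for j
      using sqint_cmult[OF l2_dif(1)[OF wq], of "1 / \<tau> j" "\<tau> j *\<^sub>R ?e"] by (simp add: q_def[abs_def])
    define f where "f j x = indicator S x * q j x" for j x
    have fq: "sqint lborel (f j)" for j unfolding f_def by (rule l2_restrict_mono(1)[OF qq]) simp
    have step: "l2 lborel (\<lambda>x. f (Suc j) x - f j x) \<le> (c0 * A) * \<theta> ^ j" for j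
    proof -
      let ?h = "\<tau> (Suc j) *\<^sub>R ?e"
      have h2: "\<tau> j *\<^sub>R ?e = ?h + ?h" using \<tau>(3)[of j] by (simp flip: scaleR_left_distrib)
      have eq: "f (Suc j) x - f j x = (- 1 / \<tau> j) * (indicator S x * dif ?h (dif ?h w) x)" for x
      proof -
        have tj: "\<tau> j = 2 * \<tau> (Suc j)" using \<tau>(3)[of j] by simp
        have "q (Suc j) x = 2 * dif ?h w x / \<tau> j" unfolding q_def tj by simp
        moreover have "q j x = dif (?h + ?h) w x / \<tau> j" by (simp only: q_def h2)
        ultimately have "q (Suc j) x - q j x = (2 * dif ?h w x - dif (?h + ?h) w x) / \<tau> j"
          by (simp only: diff_divide_distrib)
        also have "2 * dif ?h w x - dif (?h + ?h) w x = - dif ?h (dif ?h w) x"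
          by (simp add: dif_def add.assoc)
        finally have "q (Suc j) x - q j x = - dif ?h (dif ?h w) x / \<tau> j" .
        then have "indicator S x * (q (Suc j) x - q j x) = indicator S x * (- dif ?h (dif ?h w) x / \<tau> j)" by simp
        then show ?thesis by (simp add: f_def right_diff_distrib)
      qed
      have "l2 lborel (\<lambda>x. f (Suc j) x - f j x) = 1 / \<tau> j * l2 lborel (\<lambda>x. indicator S x * dif ?h (dif ?h w) x)"
        unfolding eq l2_cmult using \<tau>(1)[of j] by simp
      also have "\<dots> \<le> 1 / \<tau> j * (\<tau> (Suc j) powr s * \<tau> (Suc j) powr s * A)"
        using mix[of ?h ?h] ne[of "Suc j"] \<tau>[of "Suc j"] \<tau>(1)[of j] by (intro mult_left_mono) auto
      also have "\<dots> = (c0 * A) * \<theta> ^ j"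
      proof -
        have "\<tau> (Suc j) powr s * \<tau> (Suc j) powr s = \<tau> (Suc j) powr (2 * s)" by (simp flip: powr_add)
        also have "\<dots> = (d / 2) powr (2 * s) * (\<tau> j / d) powr (2 * s)"
        proof -
          have t: "\<tau> (Suc j) = (d / 2) * (\<tau> j / d)" using assms(3) \<tau>(3) by simp
          show ?thesis unfolding t using assms(3) \<tau>(1)[of j] by (intro powr_mult)
        qed
        also have "(\<tau> j / d) powr (2 * s) = (\<tau> j / d) powr (2 * s - 1) * (\<tau> j / d)"
          using assms(3) \<tau>(1)[of j] powr_add[of "\<tau> j / d" "2 * s - 1" 1] by simp
        also have "(\<tau> j / d) powr (2 * s - 1) = \<theta> ^ j" by (rule \<tau>\<theta>[symmetric])
        finally have e: "\<tau> (Suc j) powr s * \<tau> (Suc j) powr s = (d / 2) powr (2 * s) * (\<theta> ^ j * (\<tau> j / d))" .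
        show ?thesis unfolding e using \<tau>(1)[of j] assms(3) by (simp add: c0_def)
      qed
      finally show ?thesis .
    qed
    have cA: "0 \<le> c0 * A" using c0 A0 by simp
    obtain g where gm: "g \<in> borel_measurable lborel" and gq: "\<And>j. sqint lborel (\<lambda>x. g x - f j x)"
      and gl: "\<And>j. l2 lborel (\<lambda>x. g x - f j x) \<le> (c0 * A) * \<theta> ^ j / (1 - \<theta>)"
      using geometric_l2_limit[OF fq step cA \<theta>] by blast
    have gm' [measurable]: "g \<in> borel_measurable borel" using gm by simp
    define a where "a j x = indicator S x * (g x - q j x)" for j x
    have aeq: "a j x = indicator S x * (g x - f j x)" for j x by (simp add: a_def f_def indicator_def)
    have aq: "sqint lborel (a j)" and al: "l2 lborel (a j) \<le> ca * A * \<theta> ^ j" for j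
    proof -
      show "sqint lborel (a j)" unfolding aeq[abs_def] by (rule l2_restrict_mono(1)[OF gq]) simp
      have "l2 lborel (a j) \<le> l2 lborel (\<lambda>x. g x - f j x)" unfolding aeq[abs_def] by (rule l2_restrict_mono(2)[OF gq]) simp
      then show "l2 lborel (a j) \<le> ca * A * \<theta> ^ j" using gl[of j] by (simp add: ca_def)
    qed
    have geq: "indicator S x * g x = a 0 x + f 0 x" for x by (simp add: a_def f_def right_diff_distrib)
    have Sgq: "sqint lborel (\<lambda>x. indicator S x * g x)" unfolding geq by (rule sqint_add(1)[OF aq fq])
    have Sgl: "l2 lborel (\<lambda>x. indicator S x * g x) \<le> c * A"
    proof -
      have "l2 lborel (f 0) \<le> l2 lborel (q 0)" unfolding f_def[abs_def] by (rule l2_restrict_mono(2)[OF qq]) simp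
      also have "l2 lborel (q 0) = 1 / d * l2 lborel (dif (d *\<^sub>R ?e) w)"
        using l2_cmult[of lborel "1 / d" "dif (d *\<^sub>R ?e) w"] assms(3) by (simp add: q_def[abs_def] \<tau>_def)
      also have "\<dots> \<le> 1 / d * (2 * A)" using l2_dif(2)[OF wq, of "d *\<^sub>R ?e"] wA assms(3) by (intro mult_left_mono) auto
      finally have "l2 lborel (f 0) \<le> 2 / d * A" by simp
      then have "l2 lborel (\<lambda>x. indicator S x * g x) \<le> (ca + 2 / d) * A"
        using sqint_add(2)[OF aq[of 0] fq[of 0]] al[of 0] unfolding geq by (simp add: distrib_right)
      also have "\<dots> \<le> c * A" using c(2) A0 by (rule mult_right_mono)
      finally show ?thesis .
    qed
    have wd: "has_weak_deriv S (\<lambda>j. if j = i then 1 else 0) u g"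
    proof (rule has_weak_deriv_of_quotients[OF S wm wq u gm' Sgq \<tau>(1) \<tau>0])
      have "(\<lambda>j. l2 lborel (a j)) \<longlonglongrightarrow> 0"
      proof (rule Lim_null_comparison)
        show "\<forall>\<^sub>F j in sequentially. norm (l2 lborel (a j)) \<le> ca * A * \<theta> ^ j" using al by simp
        have "(\<lambda>j. ca * A * \<theta> ^ j) \<longlonglongrightarrow> ca * A * 0" using \<theta> by (intro tendsto_intros LIMSEQ_power_zero) auto
        then show "(\<lambda>j. ca * A * \<theta> ^ j) \<longlonglongrightarrow> 0" by simp
      qed
      then show "(\<lambda>j. l2 lborel (\<lambda>x. indicator S x * (g x - dif (\<tau> j *\<^sub>R axis i 1) w x / \<tau> j))) \<longlonglongrightarrow> 0"
        by (simp add: a_def[abs_def] q_def)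
    qed
    have "l2 lborel (\<lambda>x. indicator S x * indicator S (x + k) * dif k g x) \<le> norm k powr (2 * s - 1) * (c * A)"
      if k: "k \<noteq> 0" "norm k < d" for k
    proof -
      \<comment> \<open>Both sides of the comparison are used: step \<le> 2 |k| for the tail, whose
        exponent 2 s - 1 is positive, and |k| \<le> step for the mixed bound, where s - 1 is
        negative.\<close>
      obtain j where j: "d / 2 ^ j / 2 \<le> norm k" "norm k < d / 2 ^ j"
        using dyadic_scale[of "norm k" d] k by auto
      then have j': "\<tau> j \<le> 2 * norm k" "norm k \<le> \<tau> j" by (auto simp: \<tau>_def)
      define b where "b x = indicator S x * dif k (q j) x" for x
      have dk: "dif k (q j) x = 1 / \<tau> j * dif k (dif (\<tau> j *\<^sub>R ?e) w) x" for x
        by (simp add: dif_def q_def diff_divide_distrib)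
      have beq: "b x = (1 / \<tau> j) * (indicator S x * dif k (dif (\<tau> j *\<^sub>R ?e) w) x)" for x by (simp add: b_def dk)
      have bq: "sqint lborel b" unfolding beq[abs_def]
        by (intro sqint_cmult l2_restrict_mono(1) l2_dif(1) wq) simp
      have bl: "l2 lborel b \<le> norm k powr (2 * s - 1) * A"
      proof -
        have "l2 lborel b \<le> 1 / \<tau> j * (\<tau> j powr s * norm k powr s * A)"
          unfolding beq[abs_def] l2_cmult using mix[of "\<tau> j *\<^sub>R ?e" k] ne \<tau>[of j] k by (simp add: divide_right_mono)
        also have "\<dots> = \<tau> j powr (s - 1) * norm k powr s * A"
          using \<tau>(1)[of j] by (simp add: powr_diff)
        also have "\<dots> \<le> norm k powr (s - 1) * norm k powr s * A"
          using j' k assms A0 by (intro mult_right_mono powr_mono2') auto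
        also have "norm k powr (s - 1) * norm k powr s = norm k powr (2 * s - 1)" by (simp flip: powr_add)
        finally show ?thesis .
      qed
      have al': "l2 lborel (a j) \<le> ca * A * ((2 / d) powr (2 * s - 1) * norm k powr (2 * s - 1))"
      proof -
        have "\<theta> ^ j \<le> (2 / d * norm k) powr (2 * s - 1)"
          unfolding \<tau>\<theta> using j' assms \<tau>(1)[of j] by (intro powr_mono2) (auto simp: divide_right_mono)
        also have "\<dots> = (2 / d) powr (2 * s - 1) * norm k powr (2 * s - 1)" using assms(3) by (intro powr_mult)
        finally show ?thesis using al[of j] ca A0 by (meson less_imp_le mult_left_mono mult_nonneg_nonneg order_trans)
      qed
      note tr = l2_translate[OF aq[of j], of k]
      note s1 = sqint_diff[OF tr(1) aq[of j]]
      note s2 = sqint_add[OF s1(1) bq]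
      let ?G = "\<lambda>x. indicator S x * indicator S (x + k) * dif k g x"
      have "?G x = indicator S x * indicator S (x + k) * (a j (x + k) - a j x + b x)" for x
        by (simp add: a_def b_def dif_def indicator_def)
      then have *: "\<bar>?G x\<bar> \<le> 1 * \<bar>a j (x + k) - a j x + b x\<bar>" for x by (simp add: indicator_def)
      have Gm: "?G \<in> borel_measurable lborel" unfolding dif_def by measurable
      have "l2 lborel ?G \<le> 1 * l2 lborel (\<lambda>x. a j (x + k) - a j x + b x)"
        using l2_mono(2)[OF s2(1) Gm, of 1] * by simp
      also have "\<dots> \<le> l2 lborel (a j) + l2 lborel (a j) + l2 lborel b" using s1(2) s2(2) tr(2) by simp
      also have "\<dots> \<le> 2 * (ca * A * ((2 / d) powr (2 * s - 1) * norm k powr (2 * s - 1))) + norm k powr (2 * s - 1) * A"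
        using al' bl by simp
      also have "\<dots> = norm k powr (2 * s - 1) * (cb * A)" by (simp add: cb_def algebra_simps)
      also have "\<dots> \<le> norm k powr (2 * s - 1) * (c * A)" using c(3) A0 by (intro mult_left_mono mult_right_mono) auto
      finally show ?thesis .
    qed
    then show "\<exists>g. g \<in> borel_measurable borel \<and> sqint lborel (\<lambda>x. indicator S x * g x) \<and> l2 lborel (\<lambda>x. indicator S x * g x) \<le> c * A \<and>
        has_weak_deriv S (\<lambda>j. if j = i then 1 else 0) u g \<and>
        (\<forall>k. k \<noteq> 0 \<longrightarrow> norm k < d \<longrightarrow> l2 lborel (\<lambda>x. indicator S x * indicator S (x + k) * dif k g x) \<le> norm k powr (2 * s - 1) * (c * A))"
      using gm' Sgq Sgl wd by blast
  qed
qed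

section \<open>Transfer from Borel representatives\<close>

lemma lebesgue_on_AE_transfer:
  fixes v g :: "'a::euclidean_space \<Rightarrow> real"
  assumes S [measurable]: "S \<in> sets borel" and gm [measurable]: "g \<in> borel_measurable borel" and ae: "AE x in lborel. x \<in> S \<longrightarrow> v x = g x"
    and g: "sqint lborel (\<lambda>x. indicator S x * g x)"
  shows "v \<in> L2 S" "L2_norm S v = l2 lborel (\<lambda>x. indicator S x * g x)"
proof -
  have m: "(\<lambda>x. indicator S x *\<^sub>R g x) \<in> borel_measurable lebesgue"
    by (rule measurable_completion) simp
  have "AE x in lebesgue. indicator S x *\<^sub>R g x = indicator S x *\<^sub>R v x"
    unfolding AE_completion_iff using ae by eventually_elim (auto simp: indicator_def)
  then have "(\<lambda>x. indicator S x *\<^sub>R v x) \<in> borel_measurable lebesgue" by (rule borel_measurable_AE[OF m])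
  then have vm: "v \<in> borel_measurable (lebesgue_on S)"
    by (subst borel_measurable_restrict_space_iff) (auto simp: mult.commute)
  have gl: "g \<in> borel_measurable (lebesgue_on S)"
    by (rule measurable_restrict_space1) (rule measurable_completion, simp)
  have "AE x in lebesgue_on S. v x = g x" using ae by (simp add: AE_lebesgue_on_iff[OF S])
  note l2_cong_AE[OF this vm gl]
  then show "v \<in> L2 S" "L2_norm S v = l2 lborel (\<lambda>x. indicator S x * g x)"
    using g by (auto simp: L2_iff_sqint L2_norm_eq_l2 sqint_lebesgue_on_iff[OF S gm])
qed

text \<open>A null set in one variable gives a null set of pairs for the Borel product measure; only
  then is the completion taken, because Lebesgue measure on pairs is not itself the product of
  completed measures.\<close>

lemma gagliardo_transfer:
  fixes v g :: "real^'n \<Rightarrow> real"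
  assumes S [measurable]: "S \<in> sets borel" and [measurable]: "g \<in> borel_measurable borel" and ae: "AE x in lborel. x \<in> S \<longrightarrow> v x = g x"
    and b: "gagliardo_energy \<sigma> S g \<le> ennreal (c\<^sup>2)"
    and "0 \<le> c"
  shows "gagliardo_finite \<sigma> S v" "gagliardo_seminorm \<sigma> S v \<le> c"
proof -
  let ?M = "lborel \<Otimes>\<^sub>M (lborel :: (real^'n) measure)"
  define F where "F p = indicator (S \<times> S) p * ((g (fst p) - g (snd p))\<^sup>2 / norm (fst p - snd p) powr (real DIM(real^'n) + 2 * \<sigma>))" for p
  have SS [measurable]: "S \<times> S \<in> sets (borel \<Otimes>\<^sub>M borel)" by (rule pair_measureI) measurable
  have Fb [measurable]: "F \<in> borel_measurable (borel \<Otimes>\<^sub>M borel)" unfolding F_def by measurable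
  then have Fm: "F \<in> borel_measurable lborel" by (simp add: borel_prod)
  have F0: "0 \<le> F p" for p by (simp add: F_def)
  have fin: "(\<integral>\<^sup>+p. ennreal (F p) \<partial>lborel) \<le> ennreal (c\<^sup>2)" using b unfolding F_def gagliardo_energy_def by (simp add: lborel_prod)
  have Fi: "integrable lborel F"
    unfolding integrable_iff_bounded using Fm F0 fin by (simp add: order_le_less_trans)
  have Fl: "integrable lebesgue F" using Fi integrable_completion[OF Fm] by simp
  have "S \<times> S \<in> sets (borel :: ((real^'n) \<times> (real^'n)) measure)" using SS unfolding borel_prod .
  then have SSl: "(S \<times> S) \<inter> space lebesgue \<in> sets lebesgue" by simp
  have aeM: "AE p in ?M. F p = indicator (S \<times> S) p *\<^sub>R gagliardo_integrand \<sigma> v p"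
    using AE_lborel_pair_fst[OF ae] AE_lborel_pair_snd[OF ae]
  proof eventually_elim
    case (elim p)
    then show ?case by (cases p) (auto simp: F_def gagliardo_integrand_def indicator_def)
  qed
  then have aeL: "AE p in lebesgue. F p = indicator (S \<times> S) p *\<^sub>R gagliardo_integrand \<sigma> v p"
    unfolding AE_completion_iff lborel_prod .
  note vm = borel_measurable_AE[OF borel_measurable_integrable[OF Fl] aeL]
  show "gagliardo_finite \<sigma> S v"
    unfolding gagliardo_finite_def integrable_restrict_space[OF SSl] by (rule integrable_cong_AE_imp[OF Fl vm aeL])
  have "(\<integral>p. gagliardo_integrand \<sigma> v p \<partial>lebesgue_on (S \<times> S)) = (\<integral>p. F p \<partial>lebesgue)"
    unfolding integral_restrict_space[OF SSl] using aeL by (intro integral_cong_AE vm borel_measurable_integrable[OF Fl]) (auto elim: AE_mp)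
  also have "\<dots> = (\<integral>p. F p \<partial>lborel)" by (rule integral_completion[OF Fm])
  also have "\<dots> \<le> c\<^sup>2"
  proof -
    have "ennreal (\<integral>p. F p \<partial>lborel) \<le> ennreal (c\<^sup>2)" using fin nn_integral_eq_integral[OF Fi] F0 by simp
    then show ?thesis by (simp add: ennreal_le_iff)
  qed
  finally show "gagliardo_seminorm \<sigma> S v \<le> c"
    unfolding gagliardo_seminorm_def using assms(5) by (simp add: real_le_lsqrt)
qed

section \<open>Sobolev norms of every order below 2s\<close>

lemma H_space_criterion:
  fixes S :: "(real^'n) set"
  assumes S: "open S" and u: "u \<in> L2 S" and "0 \<le> c"
    and ex: "\<And>\<alpha> :: 'n \<Rightarrow> nat. multi_order \<alpha> \<le> nat \<lfloor>r\<rfloor> \<Longrightarrow> \<exists>g. g \<in> borel_measurable borel \<and> has_weak_deriv S \<alpha> u g \<and>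
       sqint lborel (\<lambda>x. indicator S x * g x) \<and> l2 lborel (\<lambda>x. indicator S x * g x) \<le> c \<and>
       (multi_order \<alpha> = nat \<lfloor>r\<rfloor> \<longrightarrow> frac r \<noteq> 0 \<longrightarrow>
         gagliardo_energy (frac r) S g \<le> ennreal (c\<^sup>2))"
  shows "u \<in> H_space r S"
    "H_norm r S u \<le> (sqrt (real (card {\<alpha> :: 'n \<Rightarrow> nat. multi_order \<alpha> \<le> nat \<lfloor>r\<rfloor>})) + real (card {\<alpha> :: 'n \<Rightarrow> nat. multi_order \<alpha> = nat \<lfloor>r\<rfloor>})) * c"
proof -
  let ?k = "nat \<lfloor>r\<rfloor>"
  have Sb: "S \<in> sets borel" using S by simp
  have low: "(\<exists>v. has_weak_deriv S \<alpha> u v) \<and> weak_deriv S \<alpha> u \<in> L2 S \<and> L2_norm S (weak_deriv S \<alpha> u) \<le> c \<and>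
     (multi_order \<alpha> = ?k \<longrightarrow> frac r \<noteq> 0 \<longrightarrow> gagliardo_finite (frac r) S (weak_deriv S \<alpha> u) \<and> gagliardo_seminorm (frac r) S (weak_deriv S \<alpha> u) \<le> c)"
    if \<alpha>: "multi_order \<alpha> \<le> ?k" for \<alpha> :: "'n \<Rightarrow> nat"
  proof -
    obtain g where g: "g \<in> borel_measurable borel" "has_weak_deriv S \<alpha> u g" "sqint lborel (\<lambda>x. indicator S x * g x)"
       "l2 lborel (\<lambda>x. indicator S x * g x) \<le> c"
       "multi_order \<alpha> = ?k \<Longrightarrow> frac r \<noteq> 0 \<Longrightarrow>
         gagliardo_energy (frac r) S g \<le> ennreal (c\<^sup>2)"
      using ex[OF \<alpha>] by blast
    have "AE x in lebesgue_on S. weak_deriv S \<alpha> u x = g x" by (rule weak_deriv_AE_eq[OF S g(2)])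
    then have ae: "AE x in lborel. x \<in> S \<longrightarrow> weak_deriv S \<alpha> u x = g x" by (simp add: AE_lebesgue_on_iff[OF Sb])
    show ?thesis
      using lebesgue_on_AE_transfer[OF Sb g(1) ae g(3)] g(2,4) gagliardo_transfer[OF Sb g(1) ae g(5) assms(3)] by auto
  qed
  have W: "u \<in> W2 ?k S" using u low by (simp add: W2_def)
  show "u \<in> H_space r S" using W low by (simp add: H_space_def Let_def)
  have fin: "finite {\<alpha> :: 'n \<Rightarrow> nat. multi_order \<alpha> \<le> ?k}" by (rule finite_multi_order_le)
  \<comment> \<open>\<open>W2_norm\<close> adds squares, so its bound carries the square root of the
    number of multi-indices; the seminorms are added as they are and carry the number
    itself.\<close>
  have W2: "W2_norm ?k S u \<le> sqrt (real (card {\<alpha> :: 'n \<Rightarrow> nat. multi_order \<alpha> \<le> ?k})) * c"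
  proof -
    have "(\<Sum>\<alpha> | multi_order \<alpha> \<le> ?k. (L2_norm S (weak_deriv S \<alpha> u))\<^sup>2) \<le> (\<Sum>\<alpha> :: 'n \<Rightarrow> nat | multi_order \<alpha> \<le> ?k. c\<^sup>2)"
      using low by (intro sum_mono power_mono) (auto simp: L2_norm_eq_l2)
    also have "\<dots> = real (card {\<alpha> :: 'n \<Rightarrow> nat. multi_order \<alpha> \<le> ?k}) * c\<^sup>2" by simp
    finally have "W2_norm ?k S u \<le> sqrt (real (card {\<alpha> :: 'n \<Rightarrow> nat. multi_order \<alpha> \<le> ?k}) * c\<^sup>2)"
      unfolding W2_norm_def by (rule real_sqrt_le_mono)
    then show ?thesis using assms(3) by (simp add: real_sqrt_mult)
  qed
  have G: "(\<Sum>\<alpha> | multi_order \<alpha> = ?k. gagliardo_seminorm (frac r) S (weak_deriv S \<alpha> u)) \<le> real (card {\<alpha> :: 'n \<Rightarrow> nat. multi_order \<alpha> = ?k}) * c"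
    if "frac r \<noteq> 0"
  proof -
    have "(\<Sum>\<alpha> | multi_order \<alpha> = ?k. gagliardo_seminorm (frac r) S (weak_deriv S \<alpha> u)) \<le> (\<Sum>\<alpha> :: 'n \<Rightarrow> nat | multi_order \<alpha> = ?k. c)"
      using low that by (intro sum_mono) auto
    then show ?thesis by simp
  qed
  show "H_norm r S u \<le> (sqrt (real (card {\<alpha> :: 'n \<Rightarrow> nat. multi_order \<alpha> \<le> ?k})) + real (card {\<alpha> :: 'n \<Rightarrow> nat. multi_order \<alpha> = ?k})) * c"
  proof (cases "frac r = 0")
    case True
    have "0 \<le> real (card {\<alpha> :: 'n \<Rightarrow> nat. multi_order \<alpha> = ?k}) * c" using assms(3) by simp
    then show ?thesis using W2 True by (simp add: H_norm_def Let_def distrib_right)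
  next
    case False
    then show ?thesis using W2 G by (simp add: H_norm_def Let_def distrib_right)
  qed
qed

text \<open>Because 2 s < 2, only derivatives of order 0 and 1 occur. For r < 1 the first
  differences of \<open>w\<close> suffice. For r \<ge> 1 necessarily s > 1 / 2, and the increments
  of the first derivatives, of order 2 s - 1, exceed the fractional part r - 1.\<close>

theorem H_space_of_mixed_differences:
  fixes S :: "(real^'n) set"
  assumes "0 < s" "s < 1" "0 < r" "r < 2 * s" "0 < d" and S: "open S"
  obtains C where "0 < C" "\<And>(w :: real^'n \<Rightarrow> real) u A. difference_regular s d S A w \<Longrightarrow> AE x in lborel. x \<in> S \<longrightarrow> u x = w x \<Longrightarrow>
      u \<in> H_space r S \<and> H_norm r S u \<le> C * A"
proof -
  have Sb: "S \<in> sets borel" using S by simp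
  define N where "N = sqrt (real (card {\<alpha> :: 'n \<Rightarrow> nat. multi_order \<alpha> \<le> nat \<lfloor>r\<rfloor>})) + real (card {\<alpha> :: 'n \<Rightarrow> nat. multi_order \<alpha> = nat \<lfloor>r\<rfloor>})"
  have N0: "0 \<le> N" by (simp add: N_def)
  show thesis
  proof (cases "r < 1")
    case True
    \<comment> \<open>Room on both sides: below 1 and at most 2 s for the doubling argument, above
      \<open>r\<close> for the Gagliardo integral to converge.\<close>
    define r' where "r' = (r + min 1 (2 * s)) / 2"
    have r': "0 < r'" "r' < 1" "r' \<le> 2 * s" "r < r'" using True assms by (auto simp: r'_def min_def)
    obtain B where B: "0 < B" "\<And>(w :: real^'n \<Rightarrow> real) A h. w \<in> borel_measurable borel \<Longrightarrow> sqint lborel w \<Longrightarrow> l2 lborel w \<le> A \<Longrightarrow>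
      (\<And>h. norm h \<le> d \<Longrightarrow> l2 lborel (\<lambda>x. indicator S x * dif h (dif h w) x) \<le> norm h powr (2 * s) * A) \<Longrightarrow>
      norm h \<le> d \<Longrightarrow> l2 lborel (\<lambda>x. indicator S x * dif h w x) \<le> B * norm h powr r' * A"
      using first_difference_bound[OF assms(5) r'(1,2,3) Sb] by blast
    obtain c where c: "0 < c" "\<And>(v :: real^'n \<Rightarrow> real) A. v \<in> borel_measurable borel \<Longrightarrow> sqint lborel (\<lambda>x. indicator S x * v x) \<Longrightarrow>
     l2 lborel (\<lambda>x. indicator S x * v x) \<le> A \<Longrightarrow>
     (\<And>k. k \<noteq> 0 \<Longrightarrow> norm k < d \<Longrightarrow> l2 lborel (\<lambda>x. indicator S x * indicator S (x + k) * dif k v x) \<le> norm k powr r' * A) \<Longrightarrow>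
     gagliardo_energy r S v \<le> ennreal ((c * A)\<^sup>2)"
      using gagliardo_bound[OF assms(3) r'(4) assms(5) Sb] by blast
    have fl: "nat \<lfloor>r\<rfloor> = 0" "frac r = r" using True assms(3) by (auto simp: frac_eq floor_eq_iff nat_eq_iff)
    define C where "C = (c + 1) * (B + 1)"
    have C: "0 < C" using c(1) B(1) by (simp add: C_def)
    show thesis
    proof (rule that[of "(N + 1) * C"])
      show "0 < (N + 1) * C" using N0 C by simp
      fix w :: "real^'n \<Rightarrow> real" and u A
      assume dr: "difference_regular s d S A w" and ae: "AE x in lborel. x \<in> S \<longrightarrow> u x = w x"
      note w = difference_regularD(1-3)[OF dr] ae and A0 = difference_regularD(4)[OF dr] and mix = difference_regularD(5)[OF dr]
      have CA: "(B + 1) * A \<le> C * A" "c * ((B + 1) * A) \<le> C * A" "A \<le> (B + 1) * A"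
        using A0 B(1) c(1) by (auto simp: C_def algebra_simps)
      have wS: "sqint lborel (\<lambda>x. indicator S x * w x)" "l2 lborel (\<lambda>x. indicator S x * w x) \<le> (B + 1) * A"
        using l2_restrict_mono[OF w(2), of S] Sb w(3) CA(3) by auto
      have sec: "l2 lborel (\<lambda>x. indicator S x * dif h (dif h w) x) \<le> norm h powr (2 * s) * A" if "norm h \<le> d" for h
        using mix[OF that that] by (simp flip: powr_add)
      have "l2 lborel (\<lambda>x. indicator S x * indicator S (x + k) * dif k w x) \<le> norm k powr r' * ((B + 1) * A)" if k: "norm k < d" for k
      proof -
        have sk: "sqint lborel (\<lambda>x. indicator S x * dif k w x)" using l2_restrict_mono(1)[OF l2_dif(1)[OF w(2)]] Sb by simp
        have m: "(\<lambda>x. indicator S x * indicator S (x + k) * dif k w x) \<in> borel_measurable lborel"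
          using w(1) Sb unfolding dif_def by measurable
        have "l2 lborel (\<lambda>x. indicator S x * indicator S (x + k) * dif k w x) \<le> 1 * l2 lborel (\<lambda>x. indicator S x * dif k w x)"
          by (rule l2_mono(2)[OF sk m]) (auto simp: indicator_def)
        also have "\<dots> \<le> B * norm k powr r' * A" using B(2)[OF w(1-3) sec, of k] k by simp
        also have "\<dots> \<le> norm k powr r' * ((B + 1) * A)" using A0 by (simp add: algebra_simps)
        finally show ?thesis .
      qed
      then have gg: "gagliardo_energy r S w \<le> ennreal ((c * ((B + 1) * A))\<^sup>2)" by (intro c(2)[OF w(1) wS])
      have gC: "gagliardo_energy r S w \<le> ennreal ((C * A)\<^sup>2)"
        by (rule order_trans[OF gg]) (use CA A0 B(1) c(1) in \<open>intro ennreal_leI power_mono, auto\<close>)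
      have w0: "has_weak_deriv S (\<lambda>_. 0) u w" by (rule has_weak_deriv_zero[OF S w(1) wS(1) w(4)])
      have uL: "u \<in> L2 S" by (rule lebesgue_on_AE_transfer(1)[OF Sb w(1,4) wS(1)])
      have wC: "l2 lborel (\<lambda>x. indicator S x * w x) \<le> C * A" using wS(2) CA(1) by linarith
      have CA0: "0 \<le> C * A" using C A0 by auto
      have ex: "\<exists>g. g \<in> borel_measurable borel \<and> has_weak_deriv S \<alpha> u g \<and>
          sqint lborel (\<lambda>x. indicator S x * g x) \<and> l2 lborel (\<lambda>x. indicator S x * g x) \<le> C * A \<and>
          (multi_order \<alpha> = nat \<lfloor>r\<rfloor> \<longrightarrow> frac r \<noteq> 0 \<longrightarrow> gagliardo_energy (frac r) S g \<le> ennreal ((C * A)\<^sup>2))"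
        if \<alpha>': "multi_order \<alpha> \<le> nat \<lfloor>r\<rfloor>" for \<alpha> :: "'n \<Rightarrow> nat"
      proof -
        have \<alpha>: "\<alpha> = (\<lambda>_. 0)" using \<alpha>' by (simp add: fl multi_order_0_iff)
        show ?thesis
          unfolding fl(2) \<alpha> by (intro exI[of _ w] conjI impI w(1) w0 wS(1) wC gC)
      qed
      have "u \<in> H_space r S \<and> H_norm r S u \<le> N * (C * A)"
        unfolding N_def using H_space_criterion[OF S uL CA0 ex] by blast
      moreover have "N * (C * A) \<le> (N + 1) * C * A" using C A0 by (simp add: algebra_simps)
      ultimately show "u \<in> H_space r S \<and> H_norm r S u \<le> (N + 1) * C * A" by linarith
    qed
  next
    case False
    then have s: "1 / 2 < s" using assms(4) by simp
    have r2: "r < 2" using assms by simp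
    obtain c where c: "0 < c" "\<And>(w :: real^'n \<Rightarrow> real) u A i. difference_regular s d S A w \<Longrightarrow> AE x in lborel. x \<in> S \<longrightarrow> u x = w x \<Longrightarrow>
      \<exists>g. g \<in> borel_measurable borel \<and> sqint lborel (\<lambda>x. indicator S x * g x) \<and> l2 lborel (\<lambda>x. indicator S x * g x) \<le> c * A \<and>
        has_weak_deriv S (\<lambda>j. if j = i then 1 else 0) u g \<and>
        (\<forall>k. k \<noteq> 0 \<longrightarrow> norm k < d \<longrightarrow> l2 lborel (\<lambda>x. indicator S x * indicator S (x + k) * dif k g x) \<le> norm k powr (2 * s - 1) * (c * A))"
      using first_weak_derivative[OF s assms(2,5) S] by blast
    have fl: "nat \<lfloor>r\<rfloor> = 1" using False r2 by (simp add: floor_eq_iff nat_eq_iff)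
    have fr: "frac r = r - 1"
    proof -
      have "\<lfloor>r\<rfloor> = 1" using False r2 by (simp add: floor_eq_iff)
      then show ?thesis by (simp add: frac_def)
    qed
    \<comment> \<open>For r = 1 there is no seminorm to bound; a constant is supplied all the same,
      so that \<open>C\<close> has one definition for both cases.\<close>
    have "\<exists>c'>0. frac r \<noteq> 0 \<longrightarrow> (\<forall>(v :: real^'n \<Rightarrow> real) A. v \<in> borel_measurable borel \<longrightarrow> sqint lborel (\<lambda>x. indicator S x * v x) \<longrightarrow>
     l2 lborel (\<lambda>x. indicator S x * v x) \<le> A \<longrightarrow>
     (\<forall>k. k \<noteq> 0 \<longrightarrow> norm k < d \<longrightarrow> l2 lborel (\<lambda>x. indicator S x * indicator S (x + k) * dif k v x) \<le> norm k powr (2 * s - 1) * A) \<longrightarrow>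
     gagliardo_energy (frac r) S v \<le> ennreal ((c' * A)\<^sup>2))"
    proof (cases "frac r = 0")
      case True
      then show ?thesis by (intro exI[of _ 1]) simp
    next
      case False
      then have "0 < frac r" "frac r < 2 * s - 1" using frac_ge_0[of r] assms(4) by (auto simp: fr)
      then obtain c' where "0 < c'" and c': "\<And>(v :: real^'n \<Rightarrow> real) A. v \<in> borel_measurable borel \<Longrightarrow> sqint lborel (\<lambda>x. indicator S x * v x) \<Longrightarrow>
        l2 lborel (\<lambda>x. indicator S x * v x) \<le> A \<Longrightarrow>
        (\<And>k. k \<noteq> 0 \<Longrightarrow> norm k < d \<Longrightarrow> l2 lborel (\<lambda>x. indicator S x * indicator S (x + k) * dif k v x) \<le> norm k powr (2 * s - 1) * A) \<Longrightarrow>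
        gagliardo_energy (frac r) S v \<le> ennreal ((c' * A)\<^sup>2)"
        using gagliardo_bound[OF _ _ assms(5) Sb] by blast
      show ?thesis
        by (intro exI[of _ c'] conjI impI allI \<open>0 < c'\<close> c') simp_all
    qed
    then obtain c' where c': "0 < c'" "\<And>(v :: real^'n \<Rightarrow> real) A. frac r \<noteq> 0 \<Longrightarrow> v \<in> borel_measurable borel \<Longrightarrow> sqint lborel (\<lambda>x. indicator S x * v x) \<Longrightarrow>
     l2 lborel (\<lambda>x. indicator S x * v x) \<le> A \<Longrightarrow>
     (\<forall>k. k \<noteq> 0 \<longrightarrow> norm k < d \<longrightarrow> l2 lborel (\<lambda>x. indicator S x * indicator S (x + k) * dif k v x) \<le> norm k powr (2 * s - 1) * A) \<Longrightarrow>
     gagliardo_energy (frac r) S v \<le> ennreal ((c' * A)\<^sup>2)"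
      by blast
    \<comment> \<open>The summands bound the function, its first derivatives and the Gagliardo
      energy of these.\<close>
    define C where "C = 1 + c + c' * c"
    have C: "0 < C" using c(1) c'(1) by (simp add: C_def add_pos_pos)
    show thesis
    proof (rule that[of "(N + 1) * C"])
      show "0 < (N + 1) * C" using N0 C by simp
      fix w :: "real^'n \<Rightarrow> real" and u A
      assume dr: "difference_regular s d S A w" and ae: "AE x in lborel. x \<in> S \<longrightarrow> u x = w x"
      note w = difference_regularD(1-3)[OF dr] ae and A0 = difference_regularD(4)[OF dr] and mix = difference_regularD(5)[OF dr]
      have CA: "A \<le> C * A" "c * A \<le> C * A" "c' * (c * A) \<le> C * A"
        using A0 c(1) c'(1) by (auto simp: C_def algebra_simps)
      have wS: "sqint lborel (\<lambda>x. indicator S x * w x)" "l2 lborel (\<lambda>x. indicator S x * w x) \<le> A"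
        using l2_restrict_mono[OF w(2), of S] Sb w(3) by auto
      have uL: "u \<in> L2 S" by (rule lebesgue_on_AE_transfer(1)[OF Sb w(1,4) wS(1)])
      have CA0: "0 \<le> C * A" using C A0 by auto
      have ex: "\<exists>g. g \<in> borel_measurable borel \<and> has_weak_deriv S \<alpha> u g \<and>
          sqint lborel (\<lambda>x. indicator S x * g x) \<and> l2 lborel (\<lambda>x. indicator S x * g x) \<le> C * A \<and>
          (multi_order \<alpha> = nat \<lfloor>r\<rfloor> \<longrightarrow> frac r \<noteq> 0 \<longrightarrow> gagliardo_energy (frac r) S g \<le> ennreal ((C * A)\<^sup>2))"
        if \<alpha>: "multi_order \<alpha> \<le> nat \<lfloor>r\<rfloor>" for \<alpha> :: "'n \<Rightarrow> nat"
      proof (cases "multi_order \<alpha> = 0")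
        case True
        then have "\<alpha> = (\<lambda>_. 0)" by (simp add: multi_order_0_iff)
        then have "has_weak_deriv S \<alpha> u w" using has_weak_deriv_zero[OF S w(1) wS(1) w(4)] by simp
        then show ?thesis using w(1) wS CA(1) True fl by (intro exI[of _ w]) auto
      next
        case False
        then have "multi_order \<alpha> = 1" using \<alpha> fl by simp
        then obtain i where i: "\<alpha> = (\<lambda>j. if j = i then 1 else 0)" by (rule multi_order_1_cases)
        obtain g where g: "g \<in> borel_measurable borel" "sqint lborel (\<lambda>x. indicator S x * g x)" "l2 lborel (\<lambda>x. indicator S x * g x) \<le> c * A"
          "has_weak_deriv S (\<lambda>j. if j = i then 1 else 0) u g"
          "\<forall>k. k \<noteq> 0 \<longrightarrow> norm k < d \<longrightarrow> l2 lborel (\<lambda>x. indicator S x * indicator S (x + k) * dif k g x) \<le> norm k powr (2 * s - 1) * (c * A)"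
          using c(2)[OF dr ae, of i] by blast
        have "gagliardo_energy (frac r) S g \<le> ennreal ((C * A)\<^sup>2)" if "frac r \<noteq> 0"
        proof -
          have "gagliardo_energy (frac r) S g \<le> ennreal ((c' * (c * A))\<^sup>2)" by (rule c'(2)[OF that g(1,2,3,5)])
          also have "\<dots> \<le> ennreal ((C * A)\<^sup>2)" using CA A0 c(1) c'(1) by (intro ennreal_leI power_mono) auto
          finally show ?thesis .
        qed
        then show ?thesis using g CA(2) i by (intro exI[of _ g]) auto
      qed
      have "u \<in> H_space r S \<and> H_norm r S u \<le> N * (C * A)"
        unfolding N_def using H_space_criterion[OF S uL CA0 ex] by blast
      moreover have "N * (C * A) \<le> (N + 1) * C * A" using C A0 by (simp add: algebra_simps)
      ultimately show "u \<in> H_space r S \<and> H_norm r S u \<le> (N + 1) * C * A" by linarith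
    qed
  qed
qed

theorem theorem2p1:
  fixes s \<beta> l L M \<Gamma> :: real and \<Omega> :: "(real^'n) set"
  assumes "0 < s" "s < 1" and "\<beta> > 0" and "open \<Omega>"
    and "l > 0" "L \<ge> l" and "M > 0" and "\<Gamma> > 0"
  shows "\<forall>\<epsilon>\<in>{0<..<2 * s}.
    (\<forall>K f u. admissible_kernel s \<beta> l L M \<Gamma> K \<and> f \<in> L2 \<Omega> \<and>
        u \<in> X_space K \<Omega> \<inter> weighted_L1 \<beta> \<and> is_solution K \<Omega> f u
      \<longrightarrow> u \<in> H_loc (2 * s - \<epsilon>) \<Omega>) \<and>
    (\<forall>\<Omega>'. subdomain \<Omega>' \<Omega> \<longrightarrow>
      (\<exists>C>0. \<forall>K f u. admissible_kernel s \<beta> l L M \<Gamma> K \<and> f \<in> L2 \<Omega> \<and>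
          u \<in> X_space K \<Omega> \<inter> weighted_L1 \<beta> \<and> is_solution K \<Omega> f u
        \<longrightarrow> H_norm (2 * s - \<epsilon>) \<Omega>' u
              \<le> C * (L2_norm \<Omega> u + weighted_L1_norm \<beta> u + L2_norm \<Omega> f)))"
proof
  fix \<epsilon> assume \<epsilon>: "\<epsilon> \<in> {0<..<2 * s}"
  \<comment> \<open>Membership and estimate are proved together on an arbitrary subdomain, with the
    constant fixed before \<open>K\<close>, \<open>f\<close> and \<open>u\<close>; local membership
    is then the first half over all subdomains, the estimate the second half on the given
    one.\<close>
  have main: "\<exists>C>0. \<forall>K f u. admissible_kernel s \<beta> l L M \<Gamma> K \<and> f \<in> L2 \<Omega> \<and>
          u \<in> X_space K \<Omega> \<inter> weighted_L1 \<beta> \<and> is_solution K \<Omega> f u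
        \<longrightarrow> u \<in> H_space (2 * s - \<epsilon>) S \<and> H_norm (2 * s - \<epsilon>) S u
              \<le> C * (L2_norm \<Omega> u + weighted_L1_norm \<beta> u + L2_norm \<Omega> f)" if S: "subdomain S \<Omega>" for S
  proof -
    have So: "open S" using S by (simp add: subdomain_def)
    obtain C d where C: "0 < C" "0 < d" "\<And>K f u. admissible_kernel s \<beta> l L M \<Gamma> K \<Longrightarrow> f \<in> L2 \<Omega> \<Longrightarrow> u \<in> weighted_L1 \<beta> \<Longrightarrow>
      is_solution K \<Omega> f u \<Longrightarrow>
      \<exists>w. difference_regular s d S (C * (L2_norm \<Omega> u + weighted_L1_norm \<beta> u + L2_norm \<Omega> f)) w \<and>
        (AE x in lborel. x \<in> S \<longrightarrow> u x = w x)"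
      using solution_difference_estimate[OF assms(1-3,5-8,4) S] by blast
    have r: "0 < 2 * s - \<epsilon>" "2 * s - \<epsilon> < 2 * s" using \<epsilon> by auto
    obtain C' where C': "0 < C'" "\<And>(w :: real^'n \<Rightarrow> real) u A. difference_regular s d S A w \<Longrightarrow> AE x in lborel. x \<in> S \<longrightarrow> u x = w x \<Longrightarrow>
      u \<in> H_space (2 * s - \<epsilon>) S \<and> H_norm (2 * s - \<epsilon>) S u \<le> C' * A"
      using H_space_of_mixed_differences[OF assms(1,2) r C(2) So] by blast
    show ?thesis
    proof (intro exI[of _ "C' * C"] conjI allI impI)
      show "0 < C' * C" using C(1) C'(1) by simp
    next
      fix K f u
      assume a: "admissible_kernel s \<beta> l L M \<Gamma> K \<and> f \<in> L2 \<Omega> \<and> u \<in> X_space K \<Omega> \<inter> weighted_L1 \<beta> \<and> is_solution K \<Omega> f u"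
      obtain w where w: "difference_regular s d S (C * (L2_norm \<Omega> u + weighted_L1_norm \<beta> u + L2_norm \<Omega> f)) w"
        "AE x in lborel. x \<in> S \<longrightarrow> u x = w x"
        using C(3)[of K f u] a by blast
      show "u \<in> H_space (2 * s - \<epsilon>) S"
        "H_norm (2 * s - \<epsilon>) S u \<le> C' * C * (L2_norm \<Omega> u + weighted_L1_norm \<beta> u + L2_norm \<Omega> f)"
        using C'(2)[OF w] by (auto simp: mult.assoc)
    qed
  qed
  show "(\<forall>K f u. admissible_kernel s \<beta> l L M \<Gamma> K \<and> f \<in> L2 \<Omega> \<and>
        u \<in> X_space K \<Omega> \<inter> weighted_L1 \<beta> \<and> is_solution K \<Omega> f u
      \<longrightarrow> u \<in> H_loc (2 * s - \<epsilon>) \<Omega>) \<and>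
    (\<forall>\<Omega>'. subdomain \<Omega>' \<Omega> \<longrightarrow>
      (\<exists>C>0. \<forall>K f u. admissible_kernel s \<beta> l L M \<Gamma> K \<and> f \<in> L2 \<Omega> \<and>
          u \<in> X_space K \<Omega> \<inter> weighted_L1 \<beta> \<and> is_solution K \<Omega> f u
        \<longrightarrow> H_norm (2 * s - \<epsilon>) \<Omega>' u
              \<le> C * (L2_norm \<Omega> u + weighted_L1_norm \<beta> u + L2_norm \<Omega> f)))"
  proof (intro conjI allI impI)
    fix K f u
    assume a: "admissible_kernel s \<beta> l L M \<Gamma> K \<and> f \<in> L2 \<Omega> \<and> u \<in> X_space K \<Omega> \<inter> weighted_L1 \<beta> \<and> is_solution K \<Omega> f u"
    show "u \<in> H_loc (2 * s - \<epsilon>) \<Omega>"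
      unfolding H_loc_def
    proof (intro CollectI allI impI)
      fix V assume "subdomain V \<Omega>"
      from main[OF this] a show "u \<in> H_space (2 * s - \<epsilon>) V" by blast
    qed
  next
    fix \<Omega>' assume "subdomain \<Omega>' \<Omega>"
    from main[OF this] show "\<exists>C>0. \<forall>K f u. admissible_kernel s \<beta> l L M \<Gamma> K \<and> f \<in> L2 \<Omega> \<and>
          u \<in> X_space K \<Omega> \<inter> weighted_L1 \<beta> \<and> is_solution K \<Omega> f u
        \<longrightarrow> H_norm (2 * s - \<epsilon>) \<Omega>' u
              \<le> C * (L2_norm \<Omega> u + weighted_L1_norm \<beta> u + L2_norm \<Omega> f)" by blast
  qed
qed

end
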